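(* Let $w\in A_s$ and $p_s=\frac{ps}{s+1}\in[1,p)$. Then there are continuous inclusions $$W^{1,p}(\Omega,w)\hookrightarrow W^{1,p_s}(\Omega)\hookrightarrow\begin{cases}L^q(\Omega),&\text{for }p_s\le q\le p_s^*,\ \text{if }1\le p_s<N,\\ L^q(\Omega),&\text{for }1\le q<\infty,\ \text{if }p_s=N,\\ C(\overline\Omega),&\text{if }p_s>N.\end{cases}$$ Moreover, the embedding $W^{1,p}(\Omega,w)\hookrightarrow L^q(\Omega)$ is compact for $p_s\le q<p_s^*$ if $1\le p_s<N$ (the case $q=p_s^*$ being excepted), the embedding $W^{1,p}(\Omega,w)\hookrightarrow L^q(\Omega)$ is compact for $1\le q<\infty$ if $p_s=N$, and the embedding $W^{1,p}(\Omega,w)\hookrightarrow C(\overline\Omega)$ is compact if $p_s>N$. The same result holds for the space $W^{1,p}_0(\Omega,w)$ in place of $W^{1,p}(\Omega,w)$.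
   Context: $N\ge2$, $\Omega\subset\mathbb R^N$ is a bounded smooth domain, $1<p<\infty$. A locally integrable $w:\mathbb R^N\to(0,\infty)$ (with $0<w<\infty$ a.e.) belongs to the Muckenhoupt class $A_p$ if there is $c_{p,w}>0$ such that $\left(\frac1{|B|}\int_B w\,dx\right)\left(\frac1{|B|}\int_B w^{-\frac1{p-1}}dx\right)^{p-1}\le c_{p,w}$ for all balls $B\subset\mathbb R^N$. Fix $s\in[\frac1{p-1},\infty)\cap(\frac Np,\infty)$; $w\in A_s$ means $w\in A_p$ and $w^{-s}\in L^1(\Omega)$. If $p_s<N$, $p_s^*=\frac{Np_s}{N-p_s}$. $W^{1,p}(\Omega,w)$ is the space of (weakly differentiable) measurable $u:\Omega\to\mathbb R$ with $\|u\|_{1,p,w}=(\int_\Omega|u|^pw\,dx)^{1/p}+(\int_\Omega|\nabla u|^pw\,dx)^{1/p}<\infty$; $W^{1,p}_0(\Omega,w)$ is the closure of $C_c^\infty(\Omega)$ in it. *)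

theory Defs
  imports "HOL-Analysis.Analysis"
begin

section \<open>Smooth functions and smooth domains\<close>

definition partial_deriv :: "'n \<Rightarrow> (real^'n \<Rightarrow> real) \<Rightarrow> real^'n \<Rightarrow> real" where
  "partial_deriv i f x = frechet_derivative f (at x) (axis i 1)"

primrec Ck :: "nat \<Rightarrow> (real^'n \<Rightarrow> real) \<Rightarrow> bool" where
  "Ck 0 f \<longleftrightarrow> continuous_on UNIV f"
| "Ck (Suc k) f \<longleftrightarrow> (\<forall>x. f differentiable at x) \<and> (\<forall>i. Ck k (partial_deriv i f))"

definition smooth :: "(real^'n \<Rightarrow> real) \<Rightarrow> bool" where
  "smooth f \<longleftrightarrow> (\<forall>k. Ck k f)"

text \<open>
  The space \<open>C\<^sub>c\<^sup>\<infinity>(\<Omega>)\<close>; its elements are extended by zero to the whole space.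
\<close>

definition test_functions :: "(real^'n) set \<Rightarrow> (real^'n \<Rightarrow> real) set" where
  "test_functions \<Omega> =
     {\<phi>. smooth \<phi> \<and> compact (closure {x. \<phi> x \<noteq> 0}) \<and> closure {x. \<phi> x \<noteq> 0} \<subseteq> \<Omega>}"

text \<open>
  Near each boundary point, \<open>\<Omega>\<close> is the region above the graph of a smooth function, in Cartesian
  coordinates whose last axis points in the direction of the unit vector \<open>e\<close>. The function \<open>\<gamma>\<close> of
  \<open>N - 1\<close> variables is only evaluated at \<open>x - (x \<bullet> e) e\<close>, the orthogonal projection of \<open>x\<close> to
  the hyperplane perpendicular to \<open>e\<close>; that it is defined on the whole space is no restriction.
\<close>

definition smooth_boundary :: "(real^'n) set \<Rightarrow> bool" where
  "smooth_boundary \<Omega> \<longleftrightarrow>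
     (\<forall>x0 \<in> frontier \<Omega>. \<exists>r>0. \<exists>e \<gamma>. norm e = 1 \<and> smooth \<gamma> \<and>
        \<Omega> \<inter> ball x0 r = {x \<in> ball x0 r. \<gamma> (x - (x \<bullet> e) *\<^sub>R e) < x \<bullet> e})"

definition bounded_smooth_domain :: "(real^'n) set \<Rightarrow> bool" where
  "bounded_smooth_domain \<Omega> \<longleftrightarrow>
     open \<Omega> \<and> connected \<Omega> \<and> \<Omega> \<noteq> {} \<and> bounded \<Omega> \<and> smooth_boundary \<Omega>"


section \<open>Muckenhoupt weights\<close>

definition locally_integrable_on ::
    "(real^'n \<Rightarrow> 'b::{banach, second_countable_topology}) \<Rightarrow> (real^'n) set \<Rightarrow> bool"
    (infix \<open>locally'_integrable'_on\<close> 50) where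
  "f locally_integrable_on \<Omega> \<longleftrightarrow> (\<forall>K. compact K \<and> K \<subseteq> \<Omega> \<longrightarrow> integrable (lebesgue_on K) f)"

text \<open>
  The integrability of \<open>w\<^bsup>-1/(p-1)\<^esup>\<close> on balls is the finiteness implicit in the \<open>A\<^sub>p\<close>
  inequality; it has to be required because the Bochner integral of a non-integrable function is 0.
\<close>

definition muckenhoupt :: "real \<Rightarrow> (real^'n \<Rightarrow> real) set" where
  "muckenhoupt p =
     {w. w locally_integrable_on UNIV \<and> (AE x in lebesgue. 0 < w x) \<and>
         (\<exists>c>0. \<forall>x r. 0 < r \<longrightarrow>
            integrable (lebesgue_on (ball x r)) (\<lambda>y. w y powr (- 1 / (p - 1))) \<and>
            (1 / measure lebesgue (ball x r) * (LINT y|lebesgue_on (ball x r). w y)) *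
            (1 / measure lebesgue (ball x r) *
               (LINT y|lebesgue_on (ball x r). w y powr (- 1 / (p - 1)))) powr (p - 1) \<le> c)}"

definition muckenhoupt_sub :: "(real^'n) set \<Rightarrow> real \<Rightarrow> real \<Rightarrow> (real^'n \<Rightarrow> real) set" where
  "muckenhoupt_sub \<Omega> p s =
     {w \<in> muckenhoupt p. integrable (lebesgue_on \<Omega>) (\<lambda>x. w x powr (- s))}"


section \<open>Function spaces\<close>

text \<open>
  A normed function space is a set of functions together with its norm. Functions on \<open>\<Omega>\<close> are
  represented by total functions whose values outside \<open>\<Omega>\<close> play no role, and functions that agree
  almost everywhere in \<open>\<Omega>\<close> are not identified, so the norms are seminorms on representatives.
\<close>

type_synonym 'a fun_space = "('a \<Rightarrow> real) set \<times> (('a \<Rightarrow> real) \<Rightarrow> real)"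

definition Lp_space :: "(real^'n) set \<Rightarrow> real \<Rightarrow> (real^'n) fun_space" where
  "Lp_space \<Omega> q =
     ({u. u \<in> borel_measurable (lebesgue_on \<Omega>) \<and>
          integrable (lebesgue_on \<Omega>) (\<lambda>x. \<bar>u x\<bar> powr q)},
      \<lambda>u. (LINT x|lebesgue_on \<Omega>. \<bar>u x\<bar> powr q) powr (1 / q))"

definition is_weak_gradient ::
    "(real^'n) set \<Rightarrow> (real^'n \<Rightarrow> real) \<Rightarrow> (real^'n \<Rightarrow> real^'n) \<Rightarrow> bool" where
  "is_weak_gradient \<Omega> u g \<longleftrightarrow>
     u locally_integrable_on \<Omega> \<and> g locally_integrable_on \<Omega> \<and>
     (\<forall>\<phi> \<in> test_functions \<Omega>. \<forall>i.
        (LINT x|lebesgue_on \<Omega>. u x * partial_deriv i \<phi> x) =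
        - (LINT x|lebesgue_on \<Omega>. g x $ i * \<phi> x))"

definition weakly_differentiable :: "(real^'n) set \<Rightarrow> (real^'n \<Rightarrow> real) \<Rightarrow> bool" where
  "weakly_differentiable \<Omega> u \<longleftrightarrow> (\<exists>g. is_weak_gradient \<Omega> u g)"

text \<open>The weak gradient is unique up to null sets, so the choice of \<open>g\<close> is immaterial.\<close>

definition weak_gradient :: "(real^'n) set \<Rightarrow> (real^'n \<Rightarrow> real) \<Rightarrow> real^'n \<Rightarrow> real^'n" where
  "weak_gradient \<Omega> u = (SOME g. is_weak_gradient \<Omega> u g)"

definition sobolev_norm ::
    "(real^'n) set \<Rightarrow> real \<Rightarrow> (real^'n \<Rightarrow> real) \<Rightarrow> (real^'n \<Rightarrow> real) \<Rightarrow> real" where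
  "sobolev_norm \<Omega> p w u =
     (LINT x|lebesgue_on \<Omega>. \<bar>u x\<bar> powr p * w x) powr (1 / p) +
     (LINT x|lebesgue_on \<Omega>. norm (weak_gradient \<Omega> u x) powr p * w x) powr (1 / p)"

definition sobolev_space ::
    "(real^'n) set \<Rightarrow> real \<Rightarrow> (real^'n \<Rightarrow> real) \<Rightarrow> (real^'n) fun_space" where
  "sobolev_space \<Omega> p w =
     ({u. u \<in> borel_measurable (lebesgue_on \<Omega>) \<and> weakly_differentiable \<Omega> u \<and>
          integrable (lebesgue_on \<Omega>) (\<lambda>x. \<bar>u x\<bar> powr p * w x) \<and>
          integrable (lebesgue_on \<Omega>) (\<lambda>x. norm (weak_gradient \<Omega> u x) powr p * w x)},
      sobolev_norm \<Omega> p w)"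

text \<open>For locally integrable \<open>w\<close>, test functions belong to the weighted Sobolev space.\<close>

definition sobolev_space0 ::
    "(real^'n) set \<Rightarrow> real \<Rightarrow> (real^'n \<Rightarrow> real) \<Rightarrow> (real^'n) fun_space" where
  "sobolev_space0 \<Omega> p w =
     ({u \<in> fst (sobolev_space \<Omega> p w).
         \<forall>\<epsilon>>0. \<exists>\<phi> \<in> test_functions \<Omega>. sobolev_norm \<Omega> p w (\<lambda>x. u x - \<phi> x) < \<epsilon>},
      sobolev_norm \<Omega> p w)"

text \<open>
  \<open>C(closure \<Omega>)\<close> as a space of functions modulo null sets: a function belongs to it if it agrees
  almost everywhere in \<open>\<Omega>\<close> with a continuous function on the closure. For open \<open>\<Omega>\<close> that function
  is unique on the closure, and its maximum norm is the norm of the space.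
\<close>

definition is_cont_version ::
    "(real^'n) set \<Rightarrow> (real^'n \<Rightarrow> real) \<Rightarrow> (real^'n \<Rightarrow> real) \<Rightarrow> bool" where
  "is_cont_version \<Omega> u v \<longleftrightarrow>
     continuous_on (closure \<Omega>) v \<and> (AE x in lebesgue_on \<Omega>. u x = v x)"

definition C_closure_space :: "(real^'n) set \<Rightarrow> (real^'n) fun_space" where
  "C_closure_space \<Omega> =
     ({u. \<exists>v. is_cont_version \<Omega> u v},
      \<lambda>u. SUP x\<in>closure \<Omega>. \<bar>(SOME v. is_cont_version \<Omega> u v) x\<bar>)"


section \<open>Embeddings\<close>

definition continuously_embedded :: "'a fun_space \<Rightarrow> 'a fun_space \<Rightarrow> bool"
    (infix \<open>\<hookrightarrow>\<close> 50) where
  "X \<hookrightarrow> Y \<longleftrightarrow>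
     fst X \<subseteq> fst Y \<and> (\<exists>C. \<forall>u \<in> fst X. snd Y u \<le> C * snd X u)"

definition compactly_embedded :: "'a fun_space \<Rightarrow> 'a fun_space \<Rightarrow> bool" where
  "compactly_embedded X Y \<longleftrightarrow>
     X \<hookrightarrow> Y \<and>
     (\<forall>u :: nat \<Rightarrow> 'a \<Rightarrow> real.
        (\<forall>n. u n \<in> fst X) \<and> (\<exists>M. \<forall>n. snd X (u n) \<le> M) \<longrightarrow>
        (\<exists>r v. strict_mono r \<and> v \<in> fst Y \<and>
               (\<lambda>n. snd Y (\<lambda>x. u (r n) x - v x)) \<longlonglongrightarrow> 0))"

definition critical_exponent :: "real \<Rightarrow> real \<Rightarrow> real" where
  "critical_exponent N p = N * p / (N - p)"

end

theory Submission
  imports Defs "HOL-Complex_Analysis.Great_Picard" "HOL-Computational_Algebra.Polynomial"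
begin

text \<open>
  By the Hoelder inequality, integrability of \<open>w\<^bsup>-s\<^esup>\<close> turns the weighted \<open>p\<close>-norms into
  unweighted \<open>p\<^sub>s\<close>-norms, so it remains to prove the Sobolev and Rellich theorems on \<open>\<Omega>\<close> without weight;
  the space with zero boundary values is a subset with the same norm.

  No extension operator is used. A smooth boundary gives a uniform interior cone condition: locally,
  \<open>\<Omega>\<close> is stable under translations in a cone. Mollifying with kernels supported in that cone
  approximates a Sobolev function by smooth functions whose gradients are controlled up to the boundary.
  For such functions \<open>\<bar>u(x)\<bar>\<close>, cut off near a boundary point, is bounded by the integrals of the
  gradient along \<open>N\<close> linearly independent directions of the cone, and the Loomis--Whitney inequality
  yields the Gagliardo--Nirenberg--Sobolev inequality. If \<open>p\<^sub>s = N\<close>, one lowers the exponent. If \<open>p\<^sub>s > N\<close>,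
  averaging \<open>u\<close> over small balls in the cone gives Hoelder continuity. Translations in the cone
  move \<open>u\<close> by little in mean, uniformly on bounded sets, so a sequence whose mollifications converge
  is Cauchy in mean; interpolation with the Sobolev bound gives compactness in \<open>L\<^sup>q\<close>, and the
  Arzela--Ascoli theorem gives it in the space of continuous functions.
\<close>

section \<open>Hoelder and Loomis--Whitney inequalities\<close>

text \<open>The obstacle is the boundary. Test functions have compact support in \<Omega>, so the
  weak gradient identity says nothing about kernels that reach the boundary, and a function extended
  by zero may jump there. Both difficulties disappear if every construction looks in one direction
  only. A kernel supported in a box of the cone attached to \<open>x\<close> is still a test
  function, even for \<open>x\<close> close to the boundary. Gagliardo's bound asks, for each of N
  independent directions, for a single segment from \<open>x\<close> to a point where the function
  vanishes: inside the cone the segment stays in \<Omega>, and the end point is supplied by the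
  cutoff. Morrey's argument compares two points through the overlap of their cones. All constants
  depend on the patch and the exponents and never on the approximating functions, so that the
  estimates survive almost everywhere limits and can be added over a finite cover.\<close>

lemma young_powr:
  fixes a b \<theta> :: real
  assumes "0 < \<theta>" "\<theta> < 1" "0 \<le> a" "0 \<le> b"
  shows "a powr \<theta> * b powr (1 - \<theta>) \<le> \<theta> * a + (1 - \<theta>) * b"
proof (cases "a = 0 \<or> b = 0")
  case True
  then show ?thesis using assms by auto
next
  case False
  then show ?thesis using Youngs_inequality_0[of \<theta> "1 - \<theta>" a b] assms by auto
qed

text \<open>Young's inequality for \<open>f\<close> and \<open>g\<close>, normalised by their
  integrals, is integrated. The exponents sit on integrable functions and add up to 1, so that one
  form serves Jensen's inequality for kernels, the comparison of exponents on a bounded set and the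
  removal of the weight.\<close>

lemma Holder_powr:
  fixes f g :: "'a \<Rightarrow> real"
  assumes f: "integrable M f" "\<And>x. 0 \<le> f x" and g: "integrable M g" "\<And>x. 0 \<le> g x"
    and \<theta>: "0 < \<theta>" "\<theta> < 1"
  shows "integrable M (\<lambda>x. f x powr \<theta> * g x powr (1 - \<theta>))"
    and "(LINT x|M. f x powr \<theta> * g x powr (1 - \<theta>))
           \<le> (LINT x|M. f x) powr \<theta> * (LINT x|M. g x) powr (1 - \<theta>)"
proof -
  have [measurable]: "f \<in> borel_measurable M" "g \<in> borel_measurable M"
    using f g by auto
  show int: "integrable M (\<lambda>x. f x powr \<theta> * g x powr (1 - \<theta>))"
    by (rule Bochner_Integration.integrable_bound[of _ "\<lambda>x. \<theta> * f x + (1 - \<theta>) * g x"])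
      (use f g young_powr[OF \<theta>] \<theta> in \<open>auto intro!: AE_I2 simp: abs_mult\<close>)
  let ?F = "LINT x|M. f x" and ?G = "LINT x|M. g x"
  have F0: "?F \<ge> 0" and G0: "?G \<ge> 0" using f g by auto
  show "(LINT x|M. f x powr \<theta> * g x powr (1 - \<theta>)) \<le> ?F powr \<theta> * ?G powr (1 - \<theta>)"
  \<comment> \<open>Normalisation is impossible if an integral vanishes; then that function, hence
    the product, vanishes almost everywhere.\<close>
  proof (cases "?F = 0 \<or> ?G = 0")
    case True
    then have "(AE x in M. f x = 0) \<or> (AE x in M. g x = 0)"
      using integral_nonneg_eq_0_iff_AE[OF f(1)] integral_nonneg_eq_0_iff_AE[OF g(1)] f g by auto
    then have "AE x in M. f x powr \<theta> * g x powr (1 - \<theta>) = 0"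
      by (elim disjE) (auto elim!: eventually_mono)
    then have "(LINT x|M. f x powr \<theta> * g x powr (1 - \<theta>)) = 0"
      by (rule integral_eq_zero_AE)
    then show ?thesis by simp
  next
    case False
    then have pos: "?F > 0" "?G > 0" using F0 G0 by auto
    let ?c = "?F powr \<theta> * ?G powr (1 - \<theta>)"
    have "(LINT x|M. f x powr \<theta> * g x powr (1 - \<theta>))
        \<le> (LINT x|M. ?c * (\<theta> * (f x / ?F) + (1 - \<theta>) * (g x / ?G)))"
    proof (rule integral_mono[OF int])
      show "integrable M (\<lambda>x. ?c * (\<theta> * (f x / ?F) + (1 - \<theta>) * (g x / ?G)))"
        using f g by auto
      fix x
      have "f x powr \<theta> * g x powr (1 - \<theta>)
          = ?c * ((f x / ?F) powr \<theta> * (g x / ?G) powr (1 - \<theta>))"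
        using pos f g by (simp add: powr_divide)
      also have "\<dots> \<le> ?c * (\<theta> * (f x / ?F) + (1 - \<theta>) * (g x / ?G))"
        using young_powr[OF \<theta>, of "f x / ?F" "g x / ?G"] pos f g
        by (intro mult_left_mono) auto
      finally show "f x powr \<theta> * g x powr (1 - \<theta>) \<le> ?c * (\<theta> * (f x / ?F) + (1 - \<theta>) * (g x / ?G))" .
    qed
    also have "\<dots> = ?c * (\<theta> * (?F / ?F) + (1 - \<theta>) * (?G / ?G))"
      using f g by simp
    also have "\<dots> = ?c" using pos by simp
    finally show ?thesis .
  qed
qed

section \<open>Real powers of extended nonnegative reals\<close>

text \<open>Line integrals may be infinite before anything is known to be integrable, so the
  Loomis-Whitney argument runs in \<open>ennreal\<close>. Infinity stays infinite for every
  exponent, and \<open>0 powr a = 0\<close> for every \<open>a\<close>, so that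
  \<open>epowr_eq_0\<close> holds without a condition on \<open>a\<close>.\<close>

definition epowr :: "ennreal \<Rightarrow> real \<Rightarrow> ennreal" where
  "epowr x a = (if x = top then top else ennreal (enn2real x powr a))"

lemma epowr_ennreal: "0 \<le> x \<Longrightarrow> epowr (ennreal x) a = ennreal (x powr a)"
  by (simp add: epowr_def)

lemma epowr_top [simp]: "epowr top a = top"
  by (simp add: epowr_def)

lemma epowr_eq_0 [simp]: "epowr x a = 0 \<longleftrightarrow> x = 0"
  by (cases x) (auto simp: epowr_ennreal ennreal_eq_0_iff)

lemma epowr_mono: "x \<le> y \<Longrightarrow> 0 < a \<Longrightarrow> epowr x a \<le> epowr y a"
  by (cases x; cases y) (auto simp: epowr_ennreal powr_mono2 top_unique)

lemma epowr_power:
  assumes "0 < n"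
  shows "epowr x a ^ n = epowr x (a * n)"
proof (cases x)
  case (real r)
  have "(r powr a) ^ n = r powr (a * n)"
    using powr_power[of r a n] assms by (cases "r = 0") (auto simp: mult.commute)
  then show ?thesis
    using real by (simp add: epowr_ennreal ennreal_power)
next
  case top
  then show ?thesis using assms by (simp add: power_eq_top_ennreal)
qed

lemma measurable_epowr [measurable]:
  assumes [measurable]: "f \<in> borel_measurable M"
  shows "(\<lambda>x. epowr (f x) a) \<in> borel_measurable M"
proof -
  have "f -` {top} \<inter> space M \<in> sets M" by (rule measurable_sets[OF assms]) simp
  then have [measurable]: "Measurable.pred M (\<lambda>x. f x = top)"
    by (simp add: pred_def vimage_def Int_def conj_commute)
  show ?thesis unfolding epowr_def by measurable
qed

text \<open>In \<open>ennreal\<close> the product of 0 and \<open>top\<close> is 0, so an infinite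
  factor decides the product only among nonzero factors.\<close>

lemma prod_top_ennreal:
  fixes f :: "'i \<Rightarrow> ennreal"
  assumes "finite A" "i \<in> A" "f i = top" "\<And>j. j \<in> A \<Longrightarrow> f j \<noteq> 0"
  shows "(\<Prod>j\<in>A. f j) = top"
proof -
  have "(\<Prod>j\<in>A - {i}. f j) \<noteq> 0" using assms by (simp add: prod_zero_iff)
  then show ?thesis using assms by (simp add: prod.remove[of A i] ennreal_top_mult)
qed

text \<open>The arithmetic-geometric mean inequality is applied pointwise to the functions
  \<open>f i\<close> divided by their integrals; after integration the means add up to 1.\<close>

lemma generalized_Holder:
  fixes f :: "'i \<Rightarrow> 'a \<Rightarrow> ennreal"
  assumes A: "finite A" "A \<noteq> {}" and f [measurable]: "\<And>i. i \<in> A \<Longrightarrow> f i \<in> borel_measurable M"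
  shows "(\<integral>\<^sup>+x. (\<Prod>i\<in>A. epowr (f i x) (1 / card A)) \<partial>M) \<le> (\<Prod>i\<in>A. epowr (\<integral>\<^sup>+x. f i x \<partial>M) (1 / card A))"
proof -
  define c where "c i = (\<integral>\<^sup>+x. f i x \<partial>M)" for i
  define m where "m = real (card A)"
  have m: "m > 0" using A by (auto simp: m_def card_gt_0_iff)
  \<comment> \<open>Vanishing integrals come first, because a zero factor wins over an infinite
    one.\<close>
  consider (z) i where "i \<in> A" "c i = 0" | (t) i where "i \<in> A" "c i = top" "\<And>j. j \<in> A \<Longrightarrow> c j \<noteq> 0"
    | (r) "\<And>i. i \<in> A \<Longrightarrow> c i \<noteq> 0 \<and> c i \<noteq> top" by blast
  then have "(\<integral>\<^sup>+x. (\<Prod>i\<in>A. epowr (f i x) (1 / m)) \<partial>M) \<le> (\<Prod>i\<in>A. epowr (c i) (1 / m))"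
  proof cases
    case z
    then have "AE x in M. f i x = 0" by (auto simp: c_def nn_integral_0_iff_AE)
    then have "AE x in M. (\<Prod>i\<in>A. epowr (f i x) (1 / m)) = 0"
      by eventually_elim (use z A in \<open>auto simp: prod_zero_iff\<close>)
    then have "(\<integral>\<^sup>+x. (\<Prod>i\<in>A. epowr (f i x) (1 / m)) \<partial>M) = (\<integral>\<^sup>+x. 0 \<partial>M)"
      by (rule nn_integral_cong_AE)
    then show ?thesis by simp
  next
    case t
    then have "(\<Prod>i\<in>A. epowr (c i) (1 / m)) = top"
      using A by (intro prod_top_ennreal[of A i]) auto
    then show ?thesis by simp
  next
    case r
    define r where "r i = enn2real (c i)" for i
    have c: "c i = ennreal (r i)" and rpos: "0 < r i" if "i \<in> A" for i
      using r[OF that] by (cases "c i"; auto simp: r_def ennreal_eq_0_iff less_le)+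
    define C where "C = (\<Prod>i\<in>A. epowr (c i) (1 / m))"
    have *: "(\<Prod>i\<in>A. epowr (f i x) (1 / m)) \<le> C * (\<Sum>i\<in>A. ennreal (1 / (m * r i)) * f i x)" for x
    proof (cases "\<exists>i\<in>A. f i x = top")
      case True
      then obtain i where i: "i \<in> A" "f i x = top" by auto
      have "(\<Sum>i\<in>A. ennreal (1 / (m * r i)) * f i x) = top"
        using i A mult_pos_pos[OF m rpos[of i]]
        by (simp add: ennreal_sum_eq_top) (auto simp: ennreal_mult_top ennreal_eq_0_iff not_le intro!: bexI[of _ i])
      moreover have "C \<noteq> 0" using A r by (auto simp: C_def prod_zero_iff)
      ultimately show ?thesis by (simp add: ennreal_mult_top)
    next
      case False
      define g where "g i = enn2real (f i x)" for i
      have g: "f i x = ennreal (g i)" "g i \<ge> 0" if "i \<in> A" for i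
        using False that by (auto simp: g_def ennreal_enn2real_if)
      have e1: "(\<Prod>i\<in>A. epowr (f i x) (1 / m)) = ennreal (\<Prod>i\<in>A. g i powr (1/m))"
        using g by (simp add: epowr_ennreal prod_ennreal cong: prod.cong)
      have e2: "C = ennreal (\<Prod>i\<in>A. r i powr (1/m))"
        using c rpos by (simp add: C_def epowr_ennreal prod_ennreal less_imp_le cong: prod.cong)
      have e3: "(\<Sum>i\<in>A. ennreal (1 / (m * r i)) * f i x) = ennreal (\<Sum>i\<in>A. g i / (m * r i))"
        using g rpos m by (subst sum_ennreal[symmetric])
          (auto intro!: sum.cong simp: less_imp_le simp flip: ennreal_mult'')
      have "(\<Prod>i\<in>A. g i powr (1/m)) = (\<Prod>i\<in>A. r i powr (1/m)) * (\<Prod>i\<in>A. g i / r i) powr (1/m)"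
        using g rpos by (simp add: prod_dividef powr_divide less_imp_le prod_nonneg prod_pos prod_powr_distrib)
          (simp add: prod_powr_distrib g(2) prod_nonneg less_imp_le prod_pos less_imp_neq [symmetric])
      also have "\<dots> \<le> (\<Prod>i\<in>A. r i powr (1/m)) * (\<Sum>i\<in>A. g i / r i / m)"
        using arith_geom_mean[OF A, of "\<lambda>i. g i / r i"] g rpos
        by (intro mult_left_mono prod_nonneg) (auto simp: m_def less_imp_le)
      finally show ?thesis
        unfolding e1 e2 e3 using g rpos m
        by (subst ennreal_mult[symmetric]) (auto intro!: prod_nonneg sum_nonneg ennreal_leI simp: less_imp_le field_simps)
    qed
    have "(\<integral>\<^sup>+x. (\<Prod>i\<in>A. epowr (f i x) (1 / m)) \<partial>M)
        \<le> (\<integral>\<^sup>+x. C * (\<Sum>i\<in>A. ennreal (1 / (m * r i)) * f i x) \<partial>M)"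
      by (intro nn_integral_mono *)
    also have "\<dots> = C * (\<Sum>i\<in>A. ennreal (1 / (m * r i)) * c i)"
      by (simp add: nn_integral_cmult nn_integral_sum c_def)
    also have "(\<Sum>i\<in>A. ennreal (1 / (m * r i)) * c i) = (\<Sum>i\<in>A. ennreal (1 / m))"
      using rpos m c by (intro sum.cong) (auto simp: less_imp_le less_imp_neq[symmetric] simp flip: ennreal_mult'')
    also have "\<dots> = ennreal (\<Sum>i\<in>A. 1 / m)" using m by (intro sum_ennreal) auto
    also have "\<dots> = 1" using m by (simp add: m_def)
    finally show ?thesis by (simp add: C_def)
  qed
  then show ?thesis by (simp add: m_def c_def)
qed

section \<open>Integration along directions and the Loomis-Whitney inequality\<close>

text \<open>The line integral is kept as a function on the whole space that is constant in direction
  \<open>e\<close>. Integrating out several coordinates is then a composition of operators on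
  functions of the same space.\<close>

definition dir_integral :: "'a::euclidean_space \<Rightarrow> ('a \<Rightarrow> ennreal) \<Rightarrow> 'a \<Rightarrow> ennreal" where
  "dir_integral e f x = (\<integral>\<^sup>+t. f (x + t *\<^sub>R e) \<partial>lborel)"

lemma measurable_dir_integral [measurable]:
  assumes [measurable]: "f \<in> borel_measurable borel"
  shows "dir_integral e f \<in> borel_measurable borel"
  unfolding dir_integral_def by measurable

lemma dir_integral_mono: "(\<And>x. f x \<le> g x) \<Longrightarrow> dir_integral e f x \<le> dir_integral e g x"
  unfolding dir_integral_def by (intro nn_integral_mono) auto

lemma dir_integral_translate:
  assumes [measurable]: "f \<in> borel_measurable borel"
  shows "dir_integral e f (x + s *\<^sub>R e) = dir_integral e f x"
proof -
  have "dir_integral e f x = (\<integral>\<^sup>+t. f (x + (s + 1 * t) *\<^sub>R e) \<partial>lborel)"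
    unfolding dir_integral_def by (subst nn_integral_real_affine[where c=1 and t=s]) auto
  then show ?thesis by (simp add: dir_integral_def algebra_simps)
qed

lemma dir_integral_commute:
  assumes [measurable]: "f \<in> borel_measurable borel"
  shows "dir_integral e (dir_integral e' f) x = dir_integral e' (dir_integral e f) x"
proof -
  have "dir_integral e (dir_integral e' f) x = (\<integral>\<^sup>+t. (\<integral>\<^sup>+s. f (x + t *\<^sub>R e + s *\<^sub>R e') \<partial>lborel) \<partial>lborel)"
    by (simp add: dir_integral_def)
  also have "\<dots> = (\<integral>\<^sup>+s. (\<integral>\<^sup>+t. f (x + t *\<^sub>R e + s *\<^sub>R e') \<partial>lborel) \<partial>lborel)"
    by (rule lborel_pair.Fubini') measurable
  also have "\<dots> = dir_integral e' (dir_integral e f) x"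
    by (simp add: dir_integral_def add_ac)
  finally show ?thesis .
qed

text \<open>Tonelli's theorem, one coordinate at a time: the list names distinct coordinates to be
  integrated out, while \<open>x\<close> fixes the others.\<close>

lemma dir_integral_list:
  fixes f :: "'a::euclidean_space \<Rightarrow> ennreal"
  assumes "set js \<subseteq> Basis" "distinct js" and [measurable]: "f \<in> borel_measurable borel"
  shows "foldr dir_integral js f x
           = (\<integral>\<^sup>+\<omega>. f (x + (\<Sum>b\<in>set js. \<omega> b *\<^sub>R b)) \<partial>(\<Pi>\<^sub>M b\<in>set js. lborel))"
  using assms(1,2)
proof (induction js arbitrary: x)
  case Nil
  show ?case by (simp add: PiM_empty nn_integral_count_space_finite)
next
  case (Cons j js)
  interpret P: product_sigma_finite "\<lambda>_::'a. lborel :: real measure"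
    by standard
  have *: "(\<Sum>b\<in>set js. (if b = j then t else \<omega> b) *\<^sub>R b) = (\<Sum>b\<in>set js. \<omega> b *\<^sub>R b)" for \<omega> t
    using Cons.prems by (intro sum.cong) auto
  have "foldr dir_integral (j # js) f x = (\<integral>\<^sup>+t. foldr dir_integral js f (x + t *\<^sub>R j) \<partial>lborel)"
    by (simp add: dir_integral_def)
  also have "\<dots> = (\<integral>\<^sup>+t. (\<integral>\<^sup>+\<omega>. f (x + t *\<^sub>R j + (\<Sum>b\<in>set js. \<omega> b *\<^sub>R b)) \<partial>(\<Pi>\<^sub>M b\<in>set js. lborel)) \<partial>lborel)"
    using Cons by simp
  also have "\<dots> = (\<integral>\<^sup>+\<omega>. f (x + (\<Sum>b\<in>set (j # js). \<omega> b *\<^sub>R b)) \<partial>(\<Pi>\<^sub>M b\<in>set (j # js). lborel))"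
    unfolding list.set using Cons.prems
    by (subst P.product_nn_integral_insert_rev) (auto simp: * add_ac fun_upd_def cong: if_cong)
  finally show ?case .
qed

lemma measurable_dir_integral_list [measurable]:
  assumes [measurable]: "f \<in> borel_measurable borel"
  shows "foldr dir_integral js f \<in> borel_measurable borel"
  by (induction js) auto

text \<open>If all coordinates are integrated out, the base point \<open>x\<close> is a mere
  translation and drops out.\<close>

lemma nn_integral_lborel_eq_dir_integral:
  fixes f :: "'a::euclidean_space \<Rightarrow> ennreal"
  assumes "set js = Basis" "distinct js" and [measurable]: "f \<in> borel_measurable borel"
  shows "foldr dir_integral js f x = (\<integral>\<^sup>+y. f y \<partial>lborel)"
proof -
  have "(\<integral>\<^sup>+y. f y \<partial>lborel) = (\<integral>\<^sup>+y. f (x + y) \<partial>lborel)"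
    by (subst lborel_distr_plus[of x, symmetric]) (simp add: nn_integral_distr)
  also have "\<dots> = (\<integral>\<^sup>+\<omega>. f (x + (\<Sum>b\<in>Basis. \<omega> b *\<^sub>R b)) \<partial>(\<Pi>\<^sub>M b\<in>Basis. lborel))"
    by (subst lborel_eq) (simp add: nn_integral_distr)
  finally show ?thesis using assms by (simp add: dir_integral_list)
qed

lemma prod_mono_ennreal:
  fixes f g :: "'i \<Rightarrow> ennreal"
  shows "(\<And>i. i \<in> A \<Longrightarrow> f i \<le> g i) \<Longrightarrow> prod f A \<le> prod g A"
  by (induction A rule: infinite_finite_induct) (auto intro: mult_mono)

text \<open>
  Integrating over one coordinate at a time, the factor of that coordinate is constant and the
  remaining \<open>DIM - 1\<close> factors are separated by the generalised Hoelder inequality.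
\<close>

lemma Loomis_Whitney_aux:
  fixes F :: "'a::euclidean_space \<Rightarrow> ennreal"
  assumes [measurable]: "F \<in> borel_measurable borel" and dim: "DIM('a) \<ge> 2"
    and "set js \<subseteq> Basis" "distinct js"
  defines "a \<equiv> 1 / (DIM('a) - 1 :: nat)"
  shows "foldr dir_integral js (\<lambda>x. \<Prod>b\<in>Basis. epowr (dir_integral b F x) a) x
    \<le> (\<Prod>b\<in>Basis. epowr ((if b \<in> set js then foldr dir_integral js F
                           else dir_integral b (foldr dir_integral js F)) x) a)"
  using assms(3,4)
proof (induction js arbitrary: x)
  case (Cons j js)
  define FJ where "FJ = foldr dir_integral js F"
  have [measurable]: "FJ \<in> borel_measurable borel" by (simp add: FJ_def)
  define H where "H b = (if b \<in> set js then FJ else dir_integral b FJ)" for b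
  have [measurable]: "H b \<in> borel_measurable borel" for b by (simp add: H_def)
  have j: "j \<in> Basis" "j \<notin> set js" using Cons.prems by auto
  let ?B = "Basis - {j} :: 'a set"
  have cB: "card ?B = DIM('a) - 1" using j by simp
  have "?B \<noteq> {}" 
  proof
    assume "?B = {}"
    then have "card ?B = 0" by (simp only: card.empty)
    with cB dim show False by simp
  qed
  have "foldr dir_integral (j # js) (\<lambda>x. \<Prod>b\<in>Basis. epowr (dir_integral b F x) a) x
      \<le> dir_integral j (\<lambda>x. \<Prod>b\<in>Basis. epowr (H b x) a) x"
  proof -
    have "foldr dir_integral js (\<lambda>x. \<Prod>b\<in>Basis. epowr (dir_integral b F x) a) y
        \<le> (\<Prod>b\<in>Basis. epowr (H b y) a)" for y
      using Cons.IH[of y] Cons.prems unfolding H_def FJ_def by simp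
    then show ?thesis by (auto intro!: dir_integral_mono)
  qed
  also have "\<dots> = (\<integral>\<^sup>+t. epowr (H j (x + t *\<^sub>R j)) a * (\<Prod>b\<in>?B. epowr (H b (x + t *\<^sub>R j)) a) \<partial>lborel)"
    unfolding dir_integral_def using j by (simp add: prod.remove)
  also have "\<dots> = (\<integral>\<^sup>+t. epowr (H j x) a * (\<Prod>b\<in>?B. epowr (H b (x + t *\<^sub>R j)) a) \<partial>lborel)"
    using j by (simp add: H_def dir_integral_translate)
  also have "\<dots> = epowr (H j x) a * (\<integral>\<^sup>+t. (\<Prod>b\<in>?B. epowr (H b (x + t *\<^sub>R j)) a) \<partial>lborel)"
    by (simp add: nn_integral_cmult)
  also have "\<dots> \<le> epowr (H j x) a * (\<Prod>b\<in>?B. epowr (\<integral>\<^sup>+t. H b (x + t *\<^sub>R j) \<partial>lborel) a)"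
    using generalized_Holder[of ?B "\<lambda>b t. H b (x + t *\<^sub>R j)" lborel] \<open>?B \<noteq> {}\<close>
    unfolding cB a_def by (intro mult_left_mono) auto
  also have "\<dots> = epowr (dir_integral j FJ x) a * (\<Prod>b\<in>?B. epowr (dir_integral j (H b) x) a)"
    using j by (simp add: dir_integral_def H_def)
  also have "(\<Prod>b\<in>?B. epowr (dir_integral j (H b) x) a)
    = (\<Prod>b\<in>?B. epowr ((if b \<in> set (j # js) then foldr dir_integral (j # js) F
                           else dir_integral b (foldr dir_integral (j # js) F)) x) a)"
    by (intro prod.cong) (auto simp: H_def FJ_def dir_integral_commute)
  finally show ?case using j
    by (subst prod.remove[of Basis j]) (auto simp: FJ_def)
qed simp

text \<open>The power \<open>DIM / (DIM - 1)\<close> is a product of \<open>DIM\<close> factors with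
  exponent \<open>1 / (DIM - 1)\<close>, one for each coordinate; the factor of a coordinate is
  estimated by the integral along that coordinate.\<close>

lemma Loomis_Whitney:
  fixes F f :: "'a::euclidean_space \<Rightarrow> ennreal"
  assumes [measurable]: "F \<in> borel_measurable borel" "f \<in> borel_measurable borel" and dim: "DIM('a) \<ge> 2"
    and le: "\<And>b x. b \<in> Basis \<Longrightarrow> f x \<le> dir_integral b F x"
  shows "(\<integral>\<^sup>+x. epowr (f x) (DIM('a) / (DIM('a) - 1 :: nat)) \<partial>lborel)
    \<le> epowr (\<integral>\<^sup>+x. F x \<partial>lborel) (DIM('a) / (DIM('a) - 1 :: nat))"
proof -
  define a where "a = 1 / (DIM('a) - 1 :: nat)"
  have a: "a > 0" using dim by (simp add: a_def)
  obtain js :: "'a list" where js: "set js = Basis" "distinct js"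
    using finite_distinct_list[OF finite_Basis] by blast
  have "(\<integral>\<^sup>+x. epowr (f x) (a * DIM('a)) \<partial>lborel) \<le> (\<integral>\<^sup>+x. (\<Prod>b\<in>(Basis::'a set). epowr (dir_integral b F x) a) \<partial>lborel)"
  proof (rule nn_integral_mono)
    fix x
    have "epowr (f x) (a * DIM('a)) = (\<Prod>b\<in>(Basis::'a set). epowr (f x) a)"
      by (simp add: epowr_power)
    also have "\<dots> \<le> (\<Prod>b\<in>Basis. epowr (dir_integral b F x) a)"
      using le a by (intro prod_mono_ennreal epowr_mono) auto
    finally show "epowr (f x) (a * DIM('a)) \<le> (\<Prod>b\<in>Basis. epowr (dir_integral b F x) a)" .
  qed
  also have "\<dots> = foldr dir_integral js (\<lambda>x. \<Prod>b\<in>Basis. epowr (dir_integral b F x) a) 0"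
    using js by (simp add: nn_integral_lborel_eq_dir_integral)
  also have "\<dots> \<le> (\<Prod>b\<in>(Basis::'a set). epowr (\<integral>\<^sup>+x. F x \<partial>lborel) a)"
    using Loomis_Whitney_aux[of F js 0] dim js by (simp add: nn_integral_lborel_eq_dir_integral a_def)
  also have "\<dots> = epowr (\<integral>\<^sup>+x. F x \<partial>lborel) (a * DIM('a))"
    by (simp add: epowr_power)
  finally show ?thesis by (simp add: a_def)
qed

section \<open>Gagliardo's inequality along linearly independent directions\<close>

lemma nn_integral_lborel_translate:
  fixes f :: "'a::euclidean_space \<Rightarrow> ennreal"
  assumes [measurable]: "f \<in> borel_measurable borel"
  shows "(\<integral>\<^sup>+y. f (c + y) \<partial>lborel) = (\<integral>\<^sup>+y. f y \<partial>lborel)"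
  by (subst lborel_distr_plus[of c, symmetric]) (simp add: nn_integral_distr)

lemma nn_integral_lborel_reflect:
  fixes f :: "'a::euclidean_space \<Rightarrow> ennreal"
  assumes [measurable]: "f \<in> borel_measurable borel"
  shows "(\<integral>\<^sup>+y. f (c - y) \<partial>lborel) = (\<integral>\<^sup>+y. f y \<partial>lborel)"
proof -
  have "lborel = distr lborel borel (\<lambda>y. c - y)"
    using lborel_affine[of "-1" c] by (simp add: density_1 flip: one_ennreal_def)
  then have "(\<integral>\<^sup>+y. f y \<partial>lborel) = (\<integral>\<^sup>+y. f y \<partial>distr lborel borel (\<lambda>y. c - y))"
    by simp
  also have "\<dots> = (\<integral>\<^sup>+y. f (c - y) \<partial>lborel)"
    by (simp add: nn_integral_distr)
  finally show ?thesis by simp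
qed

text \<open>The argument for the uniqueness of Haar measure.\<close>

lemma nn_integral_linear_change_mult:
  fixes T :: "'a::euclidean_space \<Rightarrow> 'a"
  assumes T: "linear T" "\<And>y. T (S y) = y"
    and [measurable]: "f \<in> borel_measurable borel" "g \<in> borel_measurable borel"
  shows "(\<integral>\<^sup>+x. f (T x) \<partial>lborel) * (\<integral>\<^sup>+x. g x \<partial>lborel) = (\<integral>\<^sup>+x. g (T x) \<partial>lborel) * (\<integral>\<^sup>+x. f x \<partial>lborel)"
proof -
  have [measurable]: "T \<in> borel_measurable borel"
    by (intro borel_measurable_continuous_onI linear_continuous_on linear_conv_bounded_linear[THEN iffD1] T)
  have "(\<integral>\<^sup>+x. f (T x) \<partial>lborel) * (\<integral>\<^sup>+x. g x \<partial>lborel) = (\<integral>\<^sup>+x. f (T x) * (\<integral>\<^sup>+y. g (T x + y) \<partial>lborel) \<partial>lborel)"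
    by (simp add: nn_integral_lborel_translate nn_integral_multc)
  also have "\<dots> = (\<integral>\<^sup>+x. (\<integral>\<^sup>+y. f (T x) * g (T x + y) \<partial>lborel) \<partial>lborel)"
    by (simp add: nn_integral_cmult)
  also have "\<dots> = (\<integral>\<^sup>+y. (\<integral>\<^sup>+x. f (T x) * g (T x + y) \<partial>lborel) \<partial>lborel)"
    by (rule lborel_pair.Fubini') measurable
  also have "\<dots> = (\<integral>\<^sup>+y. (\<integral>\<^sup>+x. f (T x - y) * g (T x) \<partial>lborel) \<partial>lborel)"
  proof (rule nn_integral_cong)
    fix y
    have "(\<integral>\<^sup>+x. f (T x) * g (T x + y) \<partial>lborel) = (\<integral>\<^sup>+x. f (T (- S y + x)) * g (T (- S y + x) + y) \<partial>lborel)"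
      by (rule nn_integral_lborel_translate[symmetric]) measurable
    then show "(\<integral>\<^sup>+x. f (T x) * g (T x + y) \<partial>lborel) = (\<integral>\<^sup>+x. f (T x - y) * g (T x) \<partial>lborel)"
      using T by (simp add: linear_add linear_diff)
  qed
  also have "\<dots> = (\<integral>\<^sup>+x. (\<integral>\<^sup>+y. f (T x - y) * g (T x) \<partial>lborel) \<partial>lborel)"
    by (rule lborel_pair.Fubini') measurable
  also have "\<dots> = (\<integral>\<^sup>+x. g (T x) \<partial>lborel) * (\<integral>\<^sup>+x. f x \<partial>lborel)"
    by (simp add: nn_integral_multc nn_integral_lborel_reflect nn_integral_cmult mult.commute)
  finally show ?thesis .
qed

text \<open>The constant is the reciprocal of the absolute value of the determinant. It is found by
  testing with the indicator of the unit ball \<open>B\<close>: both \<open>B\<close> and its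
  preimage are bounded open neighbourhoods of 0, so their measures are positive and finite, and
  \<open>c\<close> is their quotient.\<close>

lemma nn_integral_linear_change:
  fixes T :: "'a::euclidean_space \<Rightarrow> 'a"
  assumes T: "linear T" "inj T"
  obtains c :: real where "0 < c"
    "\<And>f. f \<in> borel_measurable borel \<Longrightarrow> (\<integral>\<^sup>+x. f (T x) \<partial>lborel) = ennreal c * (\<integral>\<^sup>+x. f x \<partial>lborel)"
proof -
  obtain S where S: "linear S" "\<And>x. S (T x) = x" "\<And>x. T (S x) = x"
    using linear_injective_isomorphism[OF T] by auto
  have contT: "continuous_on UNIV T" and contS: "bounded_linear S"
    using T S by (auto simp: linear_continuous_on linear_conv_bounded_linear)
  then have [measurable]: "T \<in> borel_measurable borel"
    by (intro borel_measurable_continuous_onI)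
  define B where "B = ball (0::'a) 1"
  have "T -` B = S ` B" using S by (auto simp: image_iff) (metis S(2))
  then have bT: "bounded (T -` B)" using bounded_linear_image[OF _ contS] by (auto simp: B_def)
  have oT: "open (T -` B)" using contT by (intro open_vimage) (auto simp: B_def)
  have "T 0 = 0" using T(1) by (rule linear_0)
  then have "0 \<in> T -` B" by (simp add: B_def)
  define a where "a = measure lborel B"
  define b where "b = measure lborel (T -` B)"
  have pos: "0 < measure lborel U" "emeasure lborel U = ennreal (measure lborel U)"
    if "open U" "bounded U" "0 \<in> U" for U :: "'a set"
  proof -
    show *: "emeasure lborel U = ennreal (measure lborel U)"
      using emeasure_bounded_finite[OF that(2)] by (intro emeasure_eq_ennreal_measure) auto
    have "emeasure lborel U \<noteq> 0"
    proof
      assume "emeasure lborel U = 0"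
      then have "U \<in> null_sets lborel" using that(1) by auto
      then have "negligible U" by (simp add: negligible_iff_null_sets null_sets_completionI)
      then show False using that open_not_negligible by blast
    qed
    then show "0 < measure lborel U" using * by (metis ennreal_0 measure_nonneg less_eq_real_def)
  qed
  have ab: "a > 0" "b > 0" "emeasure lborel B = ennreal a" "emeasure lborel (T -` B) = ennreal b"
    using pos[of B] pos[OF oT bT \<open>0 \<in> T -` B\<close>] by (auto simp: a_def b_def B_def)
  show ?thesis
  proof
    show "0 < b / a" using ab by simp
    fix f :: "'a \<Rightarrow> ennreal" assume [measurable]: "f \<in> borel_measurable borel"
    have [measurable]: "B \<in> sets borel" by (simp add: B_def)
    have "(\<integral>\<^sup>+x. indicator B (T x) \<partial>lborel) = (\<integral>\<^sup>+x. indicator (T -` B) x \<partial>lborel)"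
      by (rule nn_integral_cong) (auto simp: indicator_def)
    then have "(\<integral>\<^sup>+x. f (T x) \<partial>lborel) * ennreal a = ennreal b * (\<integral>\<^sup>+x. f x \<partial>lborel)"
      using nn_integral_linear_change_mult[OF T(1) S(3), of f "indicator B"] ab oT by simp
    then have "(\<integral>\<^sup>+x. f (T x) \<partial>lborel) * ennreal a * ennreal (1 / a) = ennreal b * (\<integral>\<^sup>+x. f x \<partial>lborel) * ennreal (1 / a)"
      by simp
    also have "(\<integral>\<^sup>+x. f (T x) \<partial>lborel) * ennreal a * ennreal (1 / a) = (\<integral>\<^sup>+x. f (T x) \<partial>lborel)"
      using ab by (simp add: mult.assoc flip: ennreal_mult')
    also have "ennreal b * (\<integral>\<^sup>+x. f x \<partial>lborel) * ennreal (1 / a) = ennreal (b / a) * (\<integral>\<^sup>+x. f x \<partial>lborel)"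
      using ab ennreal_mult'[of b "1 / a"] by (simp add: mult_ac)
    finally show "(\<integral>\<^sup>+x. f (T x) \<partial>lborel) = ennreal (b / a) * (\<integral>\<^sup>+x. f x \<partial>lborel)" .
  qed
qed

text \<open>Loomis-Whitney transported by \<open>T\<close>, which carries the coordinate axes to the
  given independent directions. The Jacobian \<open>c\<close> appears once on the left and to the
  power \<open>m\<close> on the right, hence \<open>C = c powr m / c\<close>.\<close>

lemma Gagliardo_bound:
  fixes T :: "real^'n \<Rightarrow> real^'n"
  assumes T: "linear T" "inj T" and n: "CARD('n) \<ge> 2"
  defines "m \<equiv> real CARD('n) / (real CARD('n) - 1)"
  obtains C :: real where "0 \<le> C"
    "\<And>f F. f \<in> borel_measurable borel \<Longrightarrow> integrable lborel F \<Longrightarrow> F \<in> borel_measurable borel \<Longrightarrow>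
       (\<And>x. 0 \<le> f x) \<Longrightarrow> (\<And>x. 0 \<le> F x) \<Longrightarrow>
       (\<And>i x. ennreal (f x) \<le> dir_integral (T (axis i 1)) (\<lambda>x. ennreal (F x)) x) \<Longrightarrow>
       integrable lborel (\<lambda>x. f x powr m) \<and> (LINT x|lborel. f x powr m) \<le> C * (LINT x|lborel. F x) powr m"
proof -
  obtain c where c: "0 < c" and T': "\<And>f. f \<in> borel_measurable borel \<Longrightarrow>
      (\<integral>\<^sup>+x. f (T x) \<partial>lborel) = ennreal c * (\<integral>\<^sup>+x. f x \<partial>lborel)"
    using nn_integral_linear_change[OF T] by metis
  have [measurable]: "T \<in> borel_measurable borel"
    by (intro borel_measurable_continuous_onI linear_continuous_on linear_conv_bounded_linear[THEN iffD1] T)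
  define C where "C = c powr m / c"
  have m: "m = DIM(real^'n) / (DIM(real^'n) - 1 :: nat)"
    using n by (simp add: m_def of_nat_diff)
  have "m > 0" using n by (auto simp: m_def)
  show ?thesis
  proof
    show "0 \<le> C" using c by (simp add: C_def)
    fix f F :: "real^'n \<Rightarrow> real"
    assume [measurable]: "f \<in> borel_measurable borel" "F \<in> borel_measurable borel"
      and F: "integrable lborel F" and f0: "\<And>x. 0 \<le> f x" and F0: "\<And>x. 0 \<le> F x"
      and le: "\<And>i x. ennreal (f x) \<le> dir_integral (T (axis i 1)) (\<lambda>x. ennreal (F x)) x"
    have "ennreal (f (T x)) \<le> dir_integral b (\<lambda>x. ennreal (F (T x))) x" if b: "b \<in> Basis" for b x
    proof -
      obtain i where "b = axis i 1" using b by (auto simp: Basis_vec_def)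
      then show ?thesis using le[of "T x" i] T(1)
        by (simp add: dir_integral_def linear_add linear_scale)
    qed
    then have "(\<integral>\<^sup>+x. epowr (ennreal (f (T x))) m \<partial>lborel) \<le> epowr (\<integral>\<^sup>+x. ennreal (F (T x)) \<partial>lborel) m"
      unfolding m using n by (intro Loomis_Whitney) auto
    also have "(\<integral>\<^sup>+x. epowr (ennreal (f (T x))) m \<partial>lborel) = ennreal c * (\<integral>\<^sup>+x. ennreal (f x powr m) \<partial>lborel)"
      using f0 by (subst T') (auto simp: epowr_ennreal)
    also have "(\<integral>\<^sup>+x. ennreal (F (T x)) \<partial>lborel) = ennreal (c * (LINT x|lborel. F x))"
      using c F F0 by (subst T') (auto simp: nn_integral_eq_integral ennreal_mult')
    also have "epowr \<dots> m = ennreal (c powr m * (LINT x|lborel. F x) powr m)"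
      using c F0 by (simp add: epowr_ennreal powr_mult)
    finally have "ennreal (1 / c) * (ennreal c * (\<integral>\<^sup>+x. ennreal (f x powr m) \<partial>lborel))
        \<le> ennreal (1 / c) * ennreal (c powr m * (LINT x|lborel. F x) powr m)"
      by (rule mult_left_mono) simp
    also have "\<dots> = ennreal (C * (LINT x|lborel. F x) powr m)"
      using c by (simp add: C_def flip: ennreal_mult'')
    also have "ennreal (1 / c) * (ennreal c * (\<integral>\<^sup>+x. ennreal (f x powr m) \<partial>lborel)) = (\<integral>\<^sup>+x. ennreal (f x powr m) \<partial>lborel)"
      using c by (simp add: mult.assoc[symmetric] flip: ennreal_mult'')
    finally have *: "(\<integral>\<^sup>+x. ennreal (f x powr m) \<partial>lborel) \<le> ennreal (C * (LINT x|lborel. F x) powr m)" .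
    then have int: "integrable lborel (\<lambda>x. f x powr m)"
      by (intro integrableI_nonneg) (auto intro: le_less_trans[OF _ ennreal_less_top])
    moreover have "(LINT x|lborel. f x powr m) \<le> C * (LINT x|lborel. F x) powr m"
      using * int \<open>0 \<le> C\<close> by (subst (asm) nn_integral_eq_integral) auto
    ultimately show "integrable lborel (\<lambda>x. f x powr m) \<and> (LINT x|lborel. f x powr m) \<le> C * (LINT x|lborel. F x) powr m" ..
  qed
qed

text \<open>At 0 the difference quotient is
  \<open>\<bar>h\<bar> powr (\<gamma> - 1) * sgn h\<close>, which tends to 0 because
  \<open>\<gamma> > 1\<close>.\<close>

lemma has_real_derivative_abs_powr:
  fixes x \<gamma> :: real
  assumes "1 < \<gamma>"
  shows "((\<lambda>x. \<bar>x\<bar> powr \<gamma>) has_real_derivative \<gamma> * \<bar>x\<bar> powr (\<gamma> - 1) * sgn x) (at x)"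
proof -
  consider "x > 0" | "x < 0" | "x = 0" by linarith
  then show ?thesis
  proof cases
    case 1
    have "((\<lambda>x. x powr \<gamma>) has_real_derivative \<gamma> * x powr (\<gamma> - 1)) (at x)"
      using 1 by (auto intro!: derivative_eq_intros)
    then show ?thesis
      using 1 by (subst has_field_derivative_cong_eventually[of _ "\<lambda>x. x powr \<gamma>"])
        (auto intro: eventually_mono[OF eventually_gt_at_top] eventually_mono[OF order_tendstoD(1)[OF tendsto_ident_at 1]])
  next
    case 2
    have "((\<lambda>x. (- x) powr \<gamma>) has_real_derivative \<gamma> * (- x) powr (\<gamma> - 1) * (-1)) (at x)"
      using 2 by (auto intro!: derivative_eq_intros)
    then show ?thesis
      using 2 by (subst has_field_derivative_cong_eventually[of _ "\<lambda>x. (- x) powr \<gamma>"])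
        (auto intro: eventually_mono[OF order_tendstoD(2)[OF tendsto_ident_at 2]])
  next
    case 3
    have "((\<lambda>h. \<bar>h\<bar> powr (\<gamma> - 1) * sgn h) \<longlongrightarrow> 0) (at (0::real))"
    proof (rule tendsto_norm_zero_cancel, rule tendsto_sandwich[of "\<lambda>_. 0"])
      show "((\<lambda>h. \<bar>h\<bar> powr (\<gamma> - 1)) \<longlongrightarrow> 0) (at (0::real))"
        using assms by (auto intro!: tendsto_eq_intros)
    qed (auto simp: abs_mult sgn_if)
    moreover have "\<bar>h\<bar> powr (\<gamma> - 1) * sgn h = \<bar>h\<bar> powr \<gamma> / h" if "h \<noteq> 0" for h :: real
      using that by (auto simp: powr_diff sgn_if abs_if)
    ultimately have "((\<lambda>h. \<bar>h\<bar> powr \<gamma> / h) \<longlongrightarrow> 0) (at (0::real))"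
      by (subst (asm) tendsto_cong) (auto simp: eventually_at_filter)
    then show ?thesis using 3 assms by (simp add: DERIV_def)
  qed
qed

text \<open>The fundamental theorem of calculus as an inequality in \<open>ennreal\<close>, the form
  in which it meets Tonelli's theorem. It is applied along the segments of the Gagliardo, Morrey and
  translation estimates.\<close>

lemma abs_le_nn_integral_derivative:
  fixes \<phi> \<phi>' :: "real \<Rightarrow> real"
  assumes d: "\<And>t. t \<in> {0..1} \<Longrightarrow> (\<phi> has_real_derivative \<phi>' t) (at t within {0..1})"
    and c: "continuous_on {0..1} \<phi>'" and le: "\<And>t. t \<in> {0..1} \<Longrightarrow> \<bar>\<phi>' t\<bar> \<le> h t"
  shows "ennreal \<bar>\<phi> 1 - \<phi> 0\<bar> \<le> (\<integral>\<^sup>+t. ennreal (h t) * indicator {0..1} t \<partial>lborel)"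
proof -
  have i: "set_integrable lborel {0..1} \<phi>'"
    unfolding set_integrable_def by (rule borel_integrable_compact) (use c in auto)
  have "\<phi> 1 - \<phi> 0 = (LBINT t:{0..1}. \<phi>' t)"
    using integral_FTC_Icc[of 0 1 \<phi> \<phi>'] d c
    by (simp add: set_lebesgue_integral_def has_real_derivative_iff_has_vector_derivative)
  then have "\<bar>\<phi> 1 - \<phi> 0\<bar> \<le> (LBINT t:{0..1}. \<bar>\<phi>' t\<bar>)"
    using set_integral_norm_bound[OF i] by simp
  then have "ennreal \<bar>\<phi> 1 - \<phi> 0\<bar> \<le> ennreal (LBINT t:{0..1}. \<bar>\<phi>' t\<bar>)"
    by (rule ennreal_leI)
  also have "\<dots> = (\<integral>\<^sup>+t. ennreal (indicator {0..1} t * \<bar>\<phi>' t\<bar>) \<partial>lborel)"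
    using set_integrable_norm[OF i] unfolding set_lebesgue_integral_def set_integrable_def
    by (subst nn_integral_eq_integral) auto
  also have "\<dots> \<le> (\<integral>\<^sup>+t. ennreal (h t) * indicator {0..1} t \<partial>lborel)"
    using le by (intro nn_integral_mono) (auto simp: indicator_def intro!: ennreal_leI)
  finally show ?thesis .
qed

section \<open>Smooth kernels\<close>

lemma Ck_Suc_imp_Ck: "Ck (Suc k) f \<Longrightarrow> Ck k f"
proof (induction k arbitrary: f)
  case 0
  then show ?case
    by (auto intro!: continuous_at_imp_continuous_on differentiable_imp_continuous_within)
qed simp

lemma partial_deriv_eq:
  "(f has_derivative f') (at x) \<Longrightarrow> partial_deriv i f x = f' (axis i 1)"
  unfolding partial_deriv_def by (metis frechet_derivative_at)

lemma has_derivative_partial_deriv: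
  assumes "f differentiable at x"
  shows "(f has_derivative (\<lambda>h. \<Sum>i\<in>UNIV. h $ i * partial_deriv i f x)) (at x)"
proof -
  let ?f' = "frechet_derivative f (at x)"
  have d: "(f has_derivative ?f') (at x)" using assms by (simp add: frechet_derivative_works)
  then interpret linear ?f' by (rule has_derivative_linear)
  have "?f' h = (\<Sum>i\<in>UNIV. h $ i * partial_deriv i f x)" for h
  proof -
    have "?f' h = ?f' (\<Sum>i\<in>UNIV. h $ i *\<^sub>R axis i 1)"
      using basis_expansion[of h] by (simp add: scalar_mult_eq_scaleR)
    then show ?thesis by (simp add: sum scale partial_deriv_def)
  qed
  then show ?thesis using d by presburger
qed

lemma Ck_add: "Ck k f \<Longrightarrow> Ck k g \<Longrightarrow> Ck k (\<lambda>x. f x + g x)"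
proof (induction k arbitrary: f g)
  case (Suc k)
  have "partial_deriv i (\<lambda>x. f x + g x) = (\<lambda>x. partial_deriv i f x + partial_deriv i g x)" for i
  proof
    fix x
    have "f differentiable at x" "g differentiable at x" using Suc.prems by auto
    from has_derivative_add[OF this[unfolded frechet_derivative_works]]
    show "partial_deriv i (\<lambda>x. f x + g x) x = partial_deriv i f x + partial_deriv i g x"
      by (auto dest!: partial_deriv_eq simp: partial_deriv_def)
  qed
  then show ?case using Suc by auto
qed (auto intro: continuous_intros)

lemma Ck_mult: "Ck k f \<Longrightarrow> Ck k g \<Longrightarrow> Ck k (\<lambda>x. f x * g x)"
proof (induction k arbitrary: f g)
  case (Suc k)
  have "partial_deriv i (\<lambda>x. f x * g x) = (\<lambda>x. f x * partial_deriv i g x + partial_deriv i f x * g x)" for i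
  proof
    fix x
    have "f differentiable at x" "g differentiable at x" using Suc.prems by auto
    from has_derivative_mult[OF this[unfolded frechet_derivative_works]]
    show "partial_deriv i (\<lambda>x. f x * g x) x = f x * partial_deriv i g x + partial_deriv i f x * g x"
      by (auto dest!: partial_deriv_eq simp: partial_deriv_def)
  qed
  moreover have "Ck k f" "Ck k g" using Suc.prems by (auto intro: Ck_Suc_imp_Ck simp del: Ck.simps)
  ultimately show ?case using Suc by (auto intro!: Ck_add)
qed (auto intro: continuous_intros)

lemma Ck_const [simp]: "Ck k (\<lambda>x. c)"
proof (induction k arbitrary: c)
  case (Suc k)
  have "partial_deriv i (\<lambda>x. c) = (\<lambda>x. 0)" for i :: 'a
    using partial_deriv_eq[OF has_derivative_const] by auto
  then show ?case using Suc by auto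
qed auto

lemma Ck_prod: "(\<And>i. i \<in> A \<Longrightarrow> Ck k (f i)) \<Longrightarrow> Ck k (\<lambda>x. \<Prod>i\<in>A. f i x)"
  by (induction A rule: infinite_finite_induct) (auto intro: Ck_mult)

section \<open>Bump functions on boxes\<close>

text \<open>A class of functions that contains \<open>exp (- 1 / t)\<close>, extended by 0, and is
  closed under differentiation; smoothness is then an induction with \<open>P\<close>
  arbitrary.\<close>

definition poly_exp :: "real poly \<Rightarrow> real \<Rightarrow> real" where
  "poly_exp P t = (if t > 0 then poly P (1 / t) * exp (- 1 / t) else 0)"

lemma poly_div_exp_tendsto_0: "((\<lambda>x. poly P x * exp (- x)) \<longlongrightarrow> (0::real)) at_top"
proof -
  have "((\<lambda>x. \<Sum>i\<le>degree P. coeff P i * (x ^ i / exp x)) \<longlongrightarrow> (\<Sum>i\<le>degree P. coeff P i * 0)) at_top"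
    by (intro tendsto_intros tendsto_power_div_exp_0)
  then show ?thesis
    by (simp add: poly_altdef exp_minus divide_inverse sum_distrib_right mult.assoc)
qed

text \<open>For \<open>t > 0\<close> the chain rule produces \<open>P - pderiv P\<close> at
  \<open>1 / t\<close>, divided by the square of \<open>t\<close>; this divisor is the polynomial
  \<open>[:0, 0, 1:]\<close> in \<open>1 / t\<close>. At 0 exponential decay beats every
  polynomial.\<close>

lemma has_real_derivative_poly_exp:
  "(poly_exp P has_real_derivative poly_exp ([:0, 0, 1:] * (P - pderiv P)) t) (at t)"
proof -
  consider "t > 0" | "t < 0" | "t = 0" by linarith
  then show ?thesis
  proof cases
    case 1
    have "((\<lambda>t. poly P (1 / t) * exp (- 1 / t)) has_real_derivative
        poly_exp ([:0, 0, 1:] * (P - pderiv P)) t) (at t)"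
      using 1 by (auto intro!: derivative_eq_intros DERIV_chain'[OF _ poly_DERIV]
          simp: poly_exp_def field_simps power2_eq_square)
    then show ?thesis
      using 1 by (subst has_field_derivative_cong_eventually[of _ "\<lambda>t. poly P (1 / t) * exp (- 1 / t)"])
        (auto simp: poly_exp_def intro: eventually_mono[OF order_tendstoD(1)[OF tendsto_ident_at 1]])
  next
    case 2
    then show ?thesis
      by (subst has_field_derivative_cong_eventually[of _ "\<lambda>t. 0"])
        (auto simp: poly_exp_def intro: eventually_mono[OF order_tendstoD(2)[OF tendsto_ident_at 2]])
  next
    case 3
    have "((\<lambda>h. poly_exp P h / h) \<longlongrightarrow> 0) (at_right 0)"
    proof -
      have "((\<lambda>h. poly (pCons 0 P) (inverse h) * exp (- inverse h)) \<longlongrightarrow> 0) (at_right (0::real))"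
        by (rule filterlim_compose[OF poly_div_exp_tendsto_0 filterlim_inverse_at_top_right])
      then show ?thesis
        by (rule Lim_transform_eventually)
          (auto simp: poly_exp_def eventually_at_filter divide_inverse)
    qed
    moreover have "((\<lambda>h. poly_exp P h / h) \<longlongrightarrow> 0) (at_left 0)"
      by (rule Lim_transform_eventually[OF tendsto_const])
        (auto simp: poly_exp_def eventually_at_filter)
    ultimately show ?thesis
      using 3 by (simp add: DERIV_def poly_exp_def[of _ 0] filterlim_split_at)
  qed
qed

lemma Ck_poly_exp_component: "Ck k (\<lambda>x::real^'n. poly_exp P (\<sigma> * (x $ i - a)))"
proof (induction k arbitrary: P)
  case 0
  have "isCont (poly_exp P) t" for P t
    using has_real_derivative_poly_exp by (rule DERIV_isCont)
  then have c: "continuous_on UNIV (poly_exp P)" for P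
    by (simp add: continuous_at_imp_continuous_on)
  have "continuous_on UNIV (\<lambda>x::real^'n. poly_exp P (\<sigma> * (x $ i - a)))"
    by (rule continuous_on_compose2[OF c]) (auto intro!: continuous_intros)
  then show ?case by simp
next
  case (Suc k)
  define Q where "Q = [:0, 0, 1:] * (P - pderiv P)"
  have d: "((\<lambda>x::real^'n. poly_exp P (\<sigma> * (x $ i - a))) has_derivative
      (\<lambda>h. poly_exp Q (\<sigma> * (x $ i - a)) * (\<sigma> * h $ i))) (at x)" for x
  proof -
    have "((\<lambda>x::real^'n. \<sigma> * (x $ i - a)) has_derivative (\<lambda>h. \<sigma> * h $ i)) (at x)"
      by (auto intro!: derivative_eq_intros bounded_linear.has_derivative[OF bounded_linear_vec_nth])
    from has_derivative_compose[OF this has_real_derivative_poly_exp[unfolded has_field_derivative_def]]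
    show ?thesis by (simp add: Q_def)
  qed
  have p: "partial_deriv j (\<lambda>x::real^'n. poly_exp P (\<sigma> * (x $ i - a)))
      = (\<lambda>x. (\<sigma> * (if i = j then 1 else 0)) * poly_exp Q (\<sigma> * (x $ i - a)))" for j
    using partial_deriv_eq[OF d] by (auto simp: axis_def)
  show ?case
    unfolding Ck.simps(2)
  proof (intro conjI allI)
    show "(\<lambda>x::real^'n. poly_exp P (\<sigma> * (x $ i - a))) differentiable at x" for x
      using d[of x] unfolding differentiable_def by blast
    show "Ck k (partial_deriv j (\<lambda>x::real^'n. poly_exp P (\<sigma> * (x $ i - a))))" for j
      unfolding p by (rule Ck_mult[OF Ck_const Suc.IH])
  qed
qed

text \<open>Each coordinate contributes a factor flat at the lower end and one flat at the upper
  end, so the product is positive exactly on the open box. The signs \<open>1\<close> and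
  \<open>-1\<close> are the \<sigma> of \<open>Ck_poly_exp_component\<close>.\<close>

definition bump :: "real^'n \<Rightarrow> real^'n \<Rightarrow> real^'n \<Rightarrow> real" where
  "bump l u x = (\<Prod>i\<in>UNIV. poly_exp 1 (1 * (x $ i - l $ i)) * poly_exp 1 ((-1) * (x $ i - u $ i)))"

lemma smooth_bump: "smooth (bump l u)"
  unfolding smooth_def bump_def by (intro allI Ck_prod Ck_mult Ck_poly_exp_component)

lemma bump_nonneg: "0 \<le> bump l u x"
  unfolding bump_def by (intro prod_nonneg) (auto simp: poly_exp_def)

lemma bump_pos: "x \<in> box l u \<Longrightarrow> 0 < bump l u x"
  unfolding bump_def by (intro prod_pos) (auto simp: poly_exp_def mem_box_cart)

lemma bump_zero:
  assumes "x \<notin> box l u"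
  shows "bump l u x = 0"
proof -
  obtain i where "x $ i \<le> l $ i \<or> u $ i \<le> x $ i"
    using assms by (auto simp: mem_box_cart not_less)
  then have "poly_exp 1 (1 * (x $ i - l $ i)) * poly_exp 1 ((-1) * (x $ i - u $ i)) = 0"
    by (auto simp: poly_exp_def)
  then show ?thesis unfolding bump_def by (intro prod_zero) auto
qed

lemma bump_translate: "bump l u (y - x) = bump (l + x) (u + x) y"
  by (simp add: bump_def algebra_simps)

lemma continuous_on_bump: "continuous_on S (bump l u)"
  using smooth_bump[unfolded smooth_def, rule_format, of 0 l u] by (auto intro: continuous_on_subset)

lemma bump_integral:
  fixes l u :: "real^'n"
  assumes "box l u \<noteq> {}"
  shows "integrable lborel (bump l u)" "0 < (LINT x|lborel. bump l u x)"
proof -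
  have "integrable lborel (\<lambda>x. indicator (cbox l u) x *\<^sub>R bump l u x)"
    by (rule borel_integrable_compact) (auto intro: continuous_on_bump)
  also have "(\<lambda>x. indicator (cbox l u) x *\<^sub>R bump l u x) = bump l u"
    using bump_zero box_subset_cbox by (fastforce simp: indicator_def)
  finally show i: "integrable lborel (bump l u)" .
  show "0 < (LINT x|lborel. bump l u x)"
  proof (rule ccontr)
    assume "\<not> ?thesis"
    then have "(LINT x|lborel. bump l u x) = 0"
      using Bochner_Integration.integral_nonneg[of lborel "bump l u", OF bump_nonneg] by linarith
    then have "AE x in lborel. bump l u x = 0"
      using integral_nonneg_eq_0_iff_AE[OF i] bump_nonneg by auto
    then have "AE x in lborel. x \<notin> box l u"
      by eventually_elim (use bump_pos in force)
    then have "box l u \<in> null_sets lborel"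
      by (subst AE_iff_null_sets) auto
    then have "negligible (box l u)"
      by (simp add: negligible_iff_null_sets null_sets_completionI)
    then show False using assms open_not_negligible by blast
  qed
qed

text \<open>For an empty box the quotient is \<open>0 / 0 = 0\<close>, so nonnegativity and
  smoothness hold for all \<open>l\<close> and \<open>u\<close>.\<close>

definition kernel :: "real^'n \<Rightarrow> real^'n \<Rightarrow> real^'n \<Rightarrow> real" where
  "kernel l u x = bump l u x / (LINT y|lborel. bump l u y)"

lemma kernel_nonneg: "0 \<le> kernel l u x"
  by (simp add: kernel_def bump_nonneg Bochner_Integration.integral_nonneg)

lemma kernel_zero: "x \<notin> box l u \<Longrightarrow> kernel l u x = 0"
  by (simp add: kernel_def bump_zero)

lemma smooth_kernel: "smooth (kernel l u)"
proof -
  have "smooth (\<lambda>x. inverse (LINT y|lborel. bump l u y) * bump l u x)"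
    using smooth_bump[of l u] by (auto simp: smooth_def intro!: Ck_mult)
  then show ?thesis by (simp add: kernel_def[abs_def] field_simps)
qed

lemma kernel_integral:
  assumes "box l u \<noteq> {}"
  shows "integrable lborel (kernel l u)" "(LINT x|lborel. kernel l u x) = 1"
  using bump_integral[OF assms] by (simp_all add: kernel_def[abs_def])

text \<open>A translated kernel is the kernel of the translated box; this is how it is recognised as
  a test function.\<close>

lemma kernel_translate: "kernel l u (y - x) = kernel (l + x) (u + x) y"
proof -
  have "(LINT y|lborel. bump (l + x) (u + x) y) = (LINT y|lborel. bump l u (- x + y))"
    using bump_translate[of l u _ x] by simp
  also have "\<dots> = (LINT y|distr lborel borel ((+) (- x)). bump l u y)"
    by (subst integral_distr) (auto intro!: borel_measurable_continuous_onI continuous_on_bump)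
  finally show ?thesis
    by (simp add: kernel_def bump_translate lborel_distr_plus)
qed

lemma kernel_test_function:
  assumes "cbox l u \<subseteq> \<Omega>"
  shows "kernel l u \<in> test_functions \<Omega>"
proof -
  have "{x. kernel l u x \<noteq> 0} \<subseteq> cbox l u"
    using kernel_zero box_subset_cbox by blast
  then have *: "closure {x. kernel l u x \<noteq> 0} \<subseteq> cbox l u"
    by (intro closure_minimal) auto
  then have "compact (closure {x. kernel l u x \<noteq> 0})"
    using bounded_subset[OF bounded_cbox] by (simp add: compact_eq_bounded_closed)
  with * assms show ?thesis by (auto simp: test_functions_def smooth_kernel)
qed

section \<open>Mollification\<close>

lemma partial_deriv_translate:
  assumes "f differentiable at (y - x)"
  shows "partial_deriv i (\<lambda>y. f (y - x)) y = partial_deriv i f (y - x)"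
proof -
  have "((\<lambda>y. y - x) has_derivative (\<lambda>h. h)) (at y)" by (auto intro!: derivative_eq_intros)
  from has_derivative_compose[OF this assms[unfolded frechet_derivative_works]]
  have "partial_deriv i (\<lambda>y. f (y - x)) y = frechet_derivative f (at (y - x)) (axis i 1)"
    by (rule partial_deriv_eq)
  then show ?thesis by (simp only: partial_deriv_def[of i f])
qed

section \<open>Continuity of translations in mean\<close>

lemma integrable_lborel_translate:
  fixes f :: "'a::euclidean_space \<Rightarrow> 'b::{banach, second_countable_topology}"
  assumes "integrable lborel f"
  shows "integrable lborel (\<lambda>x. f (x + z))"
proof -
  have "integrable (distr lborel borel ((+) z)) f"
    using assms by (simp add: lborel_distr_plus)
  then show ?thesis by (subst (asm) integrable_distr_eq) (use assms in \<open>auto simp: add.commute\<close>)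
qed

lemma integral_lborel_translate:
  fixes f :: "'a::euclidean_space \<Rightarrow> 'b::{banach, second_countable_topology}"
  assumes [measurable]: "f \<in> borel_measurable borel"
  shows "(LINT x|lborel. f (x + z)) = (LINT x|lborel. f x)"
proof -
  have "(LINT x|lborel. f x) = (LINT x|distr lborel borel ((+) z). f x)"
    by (simp add: lborel_distr_plus)
  then show ?thesis by (simp add: integral_distr add.commute)
qed

text \<open>The closed inner approximation is made compact by cutting it with a large ball; as the
  measure of \<open>A\<close> is finite, the part outside is small. The three errors take
  \<open>e/3\<close> each.\<close>

lemma lborel_inner_compact_outer_open:
  fixes A :: "'a::euclidean_space set"
  assumes A: "A \<in> sets lborel" "emeasure lborel A < \<infinity>" and e: "(e::real) > 0"
  obtains K U where "compact K" "K \<subseteq> A" "A \<subseteq> U" "open U" "emeasure lborel (U - K) \<le> ennreal e"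
proof -
  have AL: "A \<in> sets lebesgue" using A by simp
  obtain U where U: "open U" "A \<subseteq> U" "U - A \<in> lmeasurable" "emeasure lebesgue (U - A) < ennreal (e/3)"
    using sets_lebesgue_outer_open[OF AL, of "e/3"] e by (metis divide_pos_pos zero_less_numeral)
  obtain T where T: "closed T" "T \<subseteq> A" "emeasure lebesgue (A - T) < ennreal (e/3)"
    using sets_lebesgue_inner_closed[OF AL, of "e/3"] e by (metis divide_pos_pos zero_less_numeral)
  have [measurable]: "U \<in> sets borel" "T \<in> sets borel" "A \<in> sets borel" using U T A by auto
  have "(\<lambda>n. emeasure lborel (A - cball 0 (real n))) \<longlonglongrightarrow> emeasure lborel (\<Inter>n. A - cball 0 (real n))"
  proof (rule Lim_emeasure_decseq)
    show "decseq (\<lambda>n. A - cball 0 (real n))" by (auto simp: decseq_def)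
    have "emeasure lborel (A - cball 0 (real i)) \<le> emeasure lborel A" for i
      using A by (intro emeasure_mono) auto
    then show "emeasure lborel (A - cball 0 (real i)) \<noteq> \<infinity>" for i
      using A by (metis infinity_ennreal_def leD top.not_eq_extremum)
  qed auto
  also have "(\<Inter>n. A - cball 0 (real n)) = {}"
    using real_arch_simple by fastforce
  finally have "(\<lambda>n. emeasure lborel (A - cball 0 (real n))) \<longlonglongrightarrow> 0" by simp
  then have "eventually (\<lambda>n. emeasure lborel (A - cball 0 (real n)) < ennreal (e/3)) sequentially"
    using e by (intro order_tendstoD(2)) auto
  then obtain n where n: "emeasure lborel (A - cball 0 (real n)) < ennreal (e/3)"
    by (auto simp: eventually_sequentially)
  let ?K = "T \<inter> cball 0 (real n)"
  show ?thesis
  proof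
    show "compact ?K" using T by (intro closed_Int_compact) auto
    show "?K \<subseteq> A" "A \<subseteq> U" "open U" using T U by auto
    have "emeasure lborel (U - ?K) \<le> emeasure lborel ((U - A) \<union> (A - T) \<union> (A - cball 0 (real n)))"
      by (intro emeasure_mono) auto
    also have "\<dots> \<le> emeasure lborel (U - A) + emeasure lborel (A - T) + emeasure lborel (A - cball 0 (real n))"
      by (intro order_trans[OF emeasure_subadditive] add_right_mono) auto
    also have "\<dots> \<le> ennreal (e/3) + ennreal (e/3) + ennreal (e/3)"
      using U T n by (intro add_mono) (auto simp: less_imp_le)
    also have "\<dots> = ennreal e" using e by (simp flip: ennreal_plus)
    finally show "emeasure lborel (U - ?K) \<le> ennreal e" .
  qed
qed

text \<open>Induction over integrable functions. For an indicator of a set between a compact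
  \<open>K\<close> and an open \<open>U\<close>, a shift shorter than the distance from
  \<open>K\<close> to the complement of \<open>U\<close> changes the value only where
  \<open>x\<close> or \<open>x + z\<close> lies in \<open>U - K\<close>.\<close>

lemma integrable_translate_tendsto:
  fixes f :: "'a::euclidean_space \<Rightarrow> real"
  assumes "integrable lborel f" "e > 0"
  shows "\<exists>\<delta>>0. \<forall>z. norm z < \<delta> \<longrightarrow> (LINT x|lborel. \<bar>f (x + z) - f x\<bar>) \<le> e"
  using assms
proof (induction f arbitrary: e rule: integrable_induct)
  case (base A c)
  \<comment> \<open>The 1 keeps the denominator positive for \<open>c = 0\<close>; the 2 accounts
    for \<open>U - K\<close> and its translate.\<close>
  define e' where "e' = e / (2 * (\<bar>c\<bar> + 1))"
  have e': "e' > 0" using base by (simp add: e'_def add_nonneg_pos)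
  obtain K U where KU: "compact K" "K \<subseteq> A" "A \<subseteq> U" "open U" "emeasure lborel (U - K) \<le> ennreal e'"
    using lborel_inner_compact_outer_open[OF base(1,2) e'] by metis
  have [measurable]: "K \<in> sets borel" "U \<in> sets borel" "A \<in> sets borel"
    using KU base by (auto intro: borel_closed compact_imp_closed)
  have fin: "emeasure lborel (U - K) < \<infinity>" using KU(5) by (simp add: le_less_trans)
  have int: "integrable lborel (indicator (U - K) :: 'a \<Rightarrow> real)" using fin by simp
  have intA: "integrable lborel (\<lambda>x. indicator A x *\<^sub>R c)" using base by auto
  have m: "measure lborel (U - K) \<le> e'" using KU(5) e' fin by (auto simp: emeasure_eq_ennreal_measure)
  have "\<exists>\<delta>>0. \<forall>x\<in>K. \<forall>y\<in>- U. \<delta> \<le> dist x y"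
    using KU by (intro separate_compact_closed) (auto simp: closed_Compl)
  then obtain \<delta> where \<delta>: "\<delta> > 0" "\<And>x y. x \<in> K \<Longrightarrow> y \<in> - U \<Longrightarrow> \<delta> \<le> dist x y"
    by metis
  show ?case
  proof (intro exI[of _ \<delta>] conjI allI impI)
    fix z :: 'a assume z: "norm z < \<delta>"
    have K1: "x + z \<in> U" if "x \<in> K" for x using \<delta>(2)[OF that, of "x + z"] z by (force simp: dist_norm)
    have K2: "x \<in> U" if "x + z \<in> K" for x using \<delta>(2)[OF that, of x] z by (force simp: dist_norm)
    have b: "\<bar>indicator A (x + z) *\<^sub>R c - indicator A x *\<^sub>R c\<bar> \<le> \<bar>c\<bar> * (indicator (U - K) x + indicator (U - K) (x + z))" for x
      using K1[of x] K2[of x] KU by (auto simp: indicator_def)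
    have "(LINT x|lborel. \<bar>indicator A (x + z) *\<^sub>R c - indicator A x *\<^sub>R c\<bar>)
        \<le> (LINT x|lborel. \<bar>c\<bar> * (indicator (U - K) x + indicator (U - K) (x + z)))"
      using b int integrable_lborel_translate[OF int, of z] intA integrable_lborel_translate[OF intA, of z]
      by (intro integral_mono) auto
    also have "\<dots> = \<bar>c\<bar> * (measure lborel (U - K) + measure lborel (U - K))"
      using int integrable_lborel_translate[OF int, of z]
      by (simp add: integral_lborel_translate[of "indicator (U - K) :: 'a \<Rightarrow> real"])
    also have "\<dots> \<le> \<bar>c\<bar> * (e' + e')" using m by (intro mult_left_mono) auto
    also have "\<dots> \<le> 2 * e' * (\<bar>c\<bar> + 1)" using e' by (simp add: algebra_simps)
    also have "\<dots> = e"
    proof -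
      have "0 < 2 * (\<bar>c\<bar> + 1)" by (simp add: add_nonneg_pos)
      then have "2 * (\<bar>c\<bar> + 1) \<noteq> 0" by (rule less_imp_neq[symmetric])
      then have "e' * (2 * (\<bar>c\<bar> + 1)) = e"
        using nonzero_eq_divide_eq[of "2 * (\<bar>c\<bar> + 1)" e' e] e'_def by blast
      then show ?thesis by (simp add: algebra_simps)
    qed
    finally show "(LINT x|lborel. \<bar>indicator A (x + z) *\<^sub>R c - indicator A x *\<^sub>R c\<bar>) \<le> e" .
  qed (use \<delta> in auto)
next
  case (add f g)
  obtain d1 where d1: "d1 > 0" "\<And>z. norm z < d1 \<Longrightarrow> (LINT x|lborel. \<bar>f (x + z) - f x\<bar>) \<le> e/2"
    using add(3)[of "e/2"] add.prems by auto
  obtain d2 where d2: "d2 > 0" "\<And>z. norm z < d2 \<Longrightarrow> (LINT x|lborel. \<bar>g (x + z) - g x\<bar>) \<le> e/2"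
    using add(4)[of "e/2"] add.prems by auto
  show ?case
  proof (intro exI[of _ "min d1 d2"] conjI allI impI)
    fix z :: 'a assume z: "norm z < min d1 d2"
    note i = add(1,2) add(1,2)[THEN integrable_lborel_translate, of z]
    have "(LINT x|lborel. \<bar>f (x + z) + g (x + z) - (f x + g x)\<bar>)
        \<le> (LINT x|lborel. \<bar>f (x + z) - f x\<bar> + \<bar>g (x + z) - g x\<bar>)"
      using i by (intro integral_mono) auto
    also have "\<dots> \<le> e" using i d1(2)[of z] d2(2)[of z] z by simp
    finally show "(LINT x|lborel. \<bar>f (x + z) + g (x + z) - (f x + g x)\<bar>) \<le> e" .
  qed (use d1 d2 in auto)
next
  case (lim f s)
  have "(\<lambda>i. LINT x|lborel. \<bar>s i x - f x\<bar>) \<longlonglongrightarrow> (LINT x::'a|lborel. 0)"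
  proof (rule integral_dominated_convergence[where w="\<lambda>x. 3 * \<bar>f x\<bar>"])
    show "AE x in lborel. (\<lambda>i. \<bar>s i x - f x\<bar>) \<longlonglongrightarrow> 0"
      using lim by (intro AE_I2 tendsto_rabs_zero) (auto simp: LIM_zero_iff)
    show "AE x in lborel. norm \<bar>s i x - f x\<bar> \<le> 3 * \<bar>f x\<bar>" for i
    proof (rule AE_I2)
      fix x show "norm \<bar>s i x - f x\<bar> \<le> 3 * \<bar>f x\<bar>" using lim(3)[of x i] by auto
    qed
  qed (use lim in auto)
  then have "eventually (\<lambda>i. (LINT x|lborel. \<bar>s i x - f x\<bar>) < e/3) sequentially"
    using lim.prems by (intro order_tendstoD(2)) auto
  then obtain i where i: "(LINT x|lborel. \<bar>s i x - f x\<bar>) < e/3" by (auto simp: eventually_sequentially)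
  obtain d where d: "d > 0" "\<And>z. norm z < d \<Longrightarrow> (LINT x|lborel. \<bar>s i (x + z) - s i x\<bar>) \<le> e/3"
    using lim(5)[of "e/3" i] lim.prems by auto
  show ?case
  proof (intro exI[of _ d] conjI allI impI)
    fix z :: 'a assume z: "norm z < d"
    note i' = lim(1)[of i] lim(4) integrable_lborel_translate[OF lim(1)[of i], of z] integrable_lborel_translate[OF lim(4), of z]
    have "(LINT x|lborel. \<bar>f (x + z) - f x\<bar>)
        \<le> (LINT x|lborel. \<bar>s i (x + z) - f (x + z)\<bar> + \<bar>s i (x + z) - s i x\<bar> + \<bar>s i x - f x\<bar>)"
      using i' by (intro integral_mono) auto
    also have "\<dots> = (LINT x|lborel. \<bar>s i (x + z) - f (x + z)\<bar>) + (LINT x|lborel. \<bar>s i (x + z) - s i x\<bar>) + (LINT x|lborel. \<bar>s i x - f x\<bar>)"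
      using i' by simp
    also have "(LINT x|lborel. \<bar>s i (x + z) - f (x + z)\<bar>) = (LINT x|lborel. \<bar>s i x - f x\<bar>)"
      using lim(1)[of i] lim(4) by (intro integral_lborel_translate[of "\<lambda>x. \<bar>s i x - f x\<bar>"]) auto
    finally show "(LINT x|lborel. \<bar>f (x + z) - f x\<bar>) \<le> e" using i d(2)[OF z] by simp
  qed (use d in auto)
qed

section \<open>Uniform bounds for smooth functions with compact support\<close>

lemma partial_deriv_zero_outside:
  assumes "\<And>x. x \<notin> cbox l u \<Longrightarrow> f x = 0" "x \<notin> cbox l u"
  shows "partial_deriv i f x = 0"
proof -
  have "((\<lambda>_. 0) has_derivative (\<lambda>_. 0)) (at x)" by simp
  then have "(f has_derivative (\<lambda>_. 0)) (at x)"
    by (rule has_derivative_transform_within_open[of _ _ _ _ "- cbox l u"]) (use assms in \<open>auto simp: closed_cbox open_Compl\<close>)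
  then show ?thesis by (simp add: partial_deriv_eq)
qed

lemma smooth_imp_Ck: "smooth f \<Longrightarrow> Ck k f"
  by (simp add: smooth_def)

lemma smooth_partial_deriv: "smooth f \<Longrightarrow> smooth (partial_deriv i f)"
  unfolding smooth_def[of "partial_deriv i f"] using smooth_imp_Ck[of f "Suc _"] by simp

lemma smooth_differentiable: "smooth f \<Longrightarrow> f differentiable at x"
  using smooth_imp_Ck[of f "Suc 0"] by simp

lemma smooth_continuous: "smooth f \<Longrightarrow> continuous_on S f"
  using smooth_imp_Ck[of f 0] by (auto intro: continuous_on_subset)

lemma compact_support_bounded:
  assumes "smooth f" "\<And>x. x \<notin> cbox l u \<Longrightarrow> f x = 0"
  obtains B where "0 \<le> B" "\<And>x. \<bar>f x\<bar> \<le> B"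
proof -
  have "bounded (f ` cbox l u)"
    by (intro compact_imp_bounded compact_continuous_image smooth_continuous assms) auto
  then obtain B where B: "\<And>x. x \<in> cbox l u \<Longrightarrow> \<bar>f x\<bar> \<le> B" by (auto simp: bounded_iff)
  show ?thesis
  proof (rule that[of "max B 0"])
    show "\<bar>f x\<bar> \<le> max B 0" for x using B[of x] assms(2)[of x] by (cases "x \<in> cbox l u") auto
  qed auto
qed

lemma smooth_Lipschitz_on_convex:
  fixes f :: "real^'n \<Rightarrow> real"
  assumes f: "smooth f" and S: "convex S" and B: "\<And>i x. x \<in> S \<Longrightarrow> \<bar>partial_deriv i f x\<bar> \<le> B i"
    and xy: "x \<in> S" "y \<in> S"
  shows "\<bar>f x - f y\<bar> \<le> (\<Sum>i\<in>UNIV. B i) * norm (x - y)"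
proof -
  have "norm (f x - f y) \<le> (\<Sum>i\<in>UNIV. B i) * norm (x - y)"
  proof (rule differentiable_bound[OF S _ _ xy])
    fix x assume x: "x \<in> S"
    show "(f has_derivative (\<lambda>h. \<Sum>i\<in>UNIV. h $ i * partial_deriv i f x)) (at x within S)"
      using has_derivative_partial_deriv[OF smooth_differentiable[OF f]] by (rule has_derivative_at_withinI)
    show "onorm (\<lambda>h. \<Sum>i\<in>UNIV. h $ i * partial_deriv i f x) \<le> (\<Sum>i\<in>UNIV. B i)"
    proof (rule onorm_le)
      fix h :: "real^'n"
      have "norm (\<Sum>i\<in>UNIV. h $ i * partial_deriv i f x) \<le> (\<Sum>i\<in>UNIV. norm (h $ i * partial_deriv i f x))"
        by (rule norm_sum)
      also have "\<dots> \<le> (\<Sum>i\<in>UNIV. B i * norm h)"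
      proof (rule sum_mono)
        fix i
        have "\<bar>h $ i\<bar> * \<bar>partial_deriv i f x\<bar> \<le> norm h * B i"
          by (intro mult_mono component_le_norm_cart B x norm_ge_zero abs_ge_zero)
        then show "norm (h $ i * partial_deriv i f x) \<le> B i * norm h"
          by (simp add: abs_mult mult.commute)
      qed
      finally show "norm (\<Sum>i\<in>UNIV. h $ i * partial_deriv i f x) \<le> (\<Sum>i\<in>UNIV. B i) * norm h"
        by (simp add: sum_distrib_right)
    qed
  qed
  then show ?thesis by simp
qed

lemma smooth_compact_support_Lipschitz:
  fixes f :: "real^'n \<Rightarrow> real"
  assumes f: "smooth f" "\<And>x. x \<notin> cbox l u \<Longrightarrow> f x = 0"
  obtains L where "0 \<le> L" "\<And>x y. \<bar>f x - f y\<bar> \<le> L * norm (x - y)"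
proof -
  have "\<exists>B. 0 \<le> B \<and> (\<forall>x. \<bar>partial_deriv i f x\<bar> \<le> B)" for i
  proof -
    have z: "x \<notin> cbox l u \<Longrightarrow> partial_deriv i f x = 0" for x
      by (rule partial_deriv_zero_outside[of l u]) (use f(2) in auto)
    show ?thesis by (rule compact_support_bounded[OF smooth_partial_deriv[OF f(1)] z]) blast+
  qed
  then obtain B where B: "\<And>i. 0 \<le> B i" "\<And>i x. \<bar>partial_deriv i f x\<bar> \<le> B i" by metis
  show ?thesis
  proof (rule that[of "\<Sum>i\<in>UNIV. B i"])
    show "0 \<le> (\<Sum>i\<in>UNIV. B i)" using B(1) by (intro sum_nonneg)
    show "\<bar>f x - f y\<bar> \<le> (\<Sum>i\<in>UNIV. B i) * norm (x - y)" for x y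
      by (rule smooth_Lipschitz_on_convex[OF f(1) convex_UNIV]) (use B(2) in auto)
  qed
qed

text \<open>The remainder is quadratic uniformly in \<open>x\<close>, so that integrating it against
  an integrable function differentiates a mollification at once. The constant is the sum of the
  Lipschitz constants of the partial derivatives.\<close>

lemma smooth_compact_support_Taylor:
  fixes f :: "real^'n \<Rightarrow> real"
  assumes f: "smooth f" "\<And>x. x \<notin> cbox l u \<Longrightarrow> f x = 0"
  obtains C where "0 \<le> C"
    "\<And>x h. \<bar>f (x + h) - f x - (\<Sum>i\<in>UNIV. h $ i * partial_deriv i f x)\<bar> \<le> C * norm h ^ 2"
proof -
  have "\<exists>L. 0 \<le> L \<and> (\<forall>x y. \<bar>partial_deriv i f x - partial_deriv i f y\<bar> \<le> L * norm (x - y))" for i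
  proof -
    have z: "x \<notin> cbox l u \<Longrightarrow> partial_deriv i f x = 0" for x
      by (rule partial_deriv_zero_outside[of l u]) (use f(2) in auto)
    show ?thesis by (rule smooth_compact_support_Lipschitz[OF smooth_partial_deriv[OF f(1)] z]) blast+
  qed
  then obtain B where B: "\<And>i. 0 \<le> B i"
      "\<And>i x y. \<bar>partial_deriv i f x - partial_deriv i f y\<bar> \<le> B i * norm (x - y)" by metis
  define C where "C = (\<Sum>i\<in>UNIV. B i)"
  have C: "C \<ge> 0" using B by (auto simp: C_def intro: sum_nonneg)
  have "\<bar>f (x + h) - f x - (\<Sum>i\<in>UNIV. h $ i * partial_deriv i f x)\<bar> \<le> norm h * (C * norm h)" for x h
  proof -
    let ?S = "closed_segment x (x + h)"
    have "norm (f (x + h) - f x - (\<Sum>i\<in>UNIV. (x + h - x) $ i * partial_deriv i f x)) \<le> norm (x + h - x) * (C * norm h)"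
    proof (rule differentiable_bound_linearization[of x "x + h" ?S f "\<lambda>y h. \<Sum>i\<in>UNIV. h $ i * partial_deriv i f y"])
      fix t :: real assume "t \<in> {0..1}"
      then show "x + t *\<^sub>R (x + h - x) \<in> ?S"
        by (auto simp: closed_segment_def algebra_simps intro!: exI[of _ t])
    next
      fix y
      show "(f has_derivative (\<lambda>h. \<Sum>i\<in>UNIV. h $ i * partial_deriv i f y)) (at y within ?S)"
        using has_derivative_partial_deriv[OF smooth_differentiable[OF f(1)]] by (rule has_derivative_at_withinI)
      assume y: "y \<in> ?S"
      have yx: "norm (y - x) \<le> norm h"
        using segment_bound(1)[OF y] by simp
      show "onorm ((\<lambda>h. \<Sum>i\<in>UNIV. h $ i * partial_deriv i f y) - (\<lambda>h. \<Sum>i\<in>UNIV. h $ i * partial_deriv i f x)) \<le> C * norm h"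
      proof (rule onorm_le)
        fix k :: "real^'n"
        have "norm (((\<lambda>h. \<Sum>i\<in>UNIV. h $ i * partial_deriv i f y) - (\<lambda>h. \<Sum>i\<in>UNIV. h $ i * partial_deriv i f x)) k)
          = norm (\<Sum>i\<in>UNIV. k $ i * (partial_deriv i f y - partial_deriv i f x))"
          by (simp add: right_diff_distrib sum_subtractf)
        also have "\<dots> \<le> (\<Sum>i\<in>UNIV. norm (k $ i * (partial_deriv i f y - partial_deriv i f x)))"
          by (rule norm_sum)
        also have "\<dots> \<le> (\<Sum>i\<in>UNIV. norm k * (B i * norm h))"
        proof (rule sum_mono)
          fix i
          have "\<bar>partial_deriv i f y - partial_deriv i f x\<bar> \<le> B i * norm h"
            by (rule order_trans[OF B(2) mult_left_mono[OF yx B(1)]])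
          then have "\<bar>k $ i\<bar> * \<bar>partial_deriv i f y - partial_deriv i f x\<bar> \<le> norm k * (B i * norm h)"
            by (intro mult_mono component_le_norm_cart norm_ge_zero abs_ge_zero)
          then show "norm (k $ i * (partial_deriv i f y - partial_deriv i f x)) \<le> norm k * (B i * norm h)"
            by (simp add: abs_mult)
        qed
        also have "\<dots> = C * norm h * norm k"
          by (simp add: C_def sum_distrib_right sum_distrib_left mult_ac)
        finally show "norm (((\<lambda>h. \<Sum>i\<in>UNIV. h $ i * partial_deriv i f y) - (\<lambda>h. \<Sum>i\<in>UNIV. h $ i * partial_deriv i f x)) k) \<le> C * norm h * norm k" .
      qed
    qed auto
    then show ?thesis by simp
  qed
  then show ?thesis using that[OF C] by (simp add: power2_eq_square mult_ac)
qed

section \<open>Mollifications and their derivatives\<close>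

text \<open>The argument is \<open>x + z\<close>, not \<open>x - z\<close>: the value at
  \<open>x\<close> is an average of \<open>f\<close> over the box attached to \<open>x\<close>, so a
  box inside the cone looks into the domain.\<close>

definition mollify :: "real^'n \<Rightarrow> real^'n \<Rightarrow> (real^'n \<Rightarrow> 'b) \<Rightarrow> real^'n \<Rightarrow> 'b::{banach, second_countable_topology}" where
  "mollify l u f x = (LINT z|lborel. kernel l u z *\<^sub>R f (x + z))"

lemma kernel_zero_cbox: "x \<notin> cbox l u \<Longrightarrow> kernel l u x = 0"
  using kernel_zero box_subset_cbox by blast

lemma measurable_kernel [measurable]: "kernel l u \<in> borel_measurable borel"
  by (intro borel_measurable_continuous_onI smooth_continuous smooth_kernel)

lemma integrable_kernel_scaleR:
  fixes f :: "real^'n \<Rightarrow> 'b::{banach, second_countable_topology}"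
  assumes f: "integrable lborel f"
  shows "integrable lborel (\<lambda>y. kernel l u (y - x) *\<^sub>R f y)"
    and "integrable lborel (\<lambda>z. kernel l u z *\<^sub>R f (x + z))"
proof -
  obtain B where B: "0 \<le> B" "\<And>x. \<bar>kernel l u x\<bar> \<le> B"
    by (rule compact_support_bounded[OF smooth_kernel, of l u l u]) (use kernel_zero_cbox in blast)+
  have [measurable]: "f \<in> borel_measurable borel" using f by auto
  show *: "integrable lborel (\<lambda>y. kernel l u (y - x) *\<^sub>R f y)" for x
    by (rule Bochner_Integration.integrable_bound[of _ "\<lambda>y. B * norm (f y)"])
      (use f B in \<open>auto intro!: AE_I2 mult_right_mono\<close>)
  show "integrable lborel (\<lambda>z. kernel l u z *\<^sub>R f (x + z))"
    using integrable_lborel_translate[OF *, of x x] by (simp add: add.commute)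
qed

lemma mollify_alt:
  fixes f :: "real^'n \<Rightarrow> 'b::{banach, second_countable_topology}"
  assumes [measurable]: "f \<in> borel_measurable borel"
  shows "mollify l u f x = (LINT y|lborel. kernel l u (y - x) *\<^sub>R f y)"
  using integral_lborel_translate[of "\<lambda>y. kernel l u (y - x) *\<^sub>R f y" x]
  by (simp add: mollify_def add.commute)

lemma mollify_bounded:
  obtains B where "0 \<le> B" "\<And>f x. integrable lborel (f :: real^'n \<Rightarrow> 'b::{banach, second_countable_topology})
    \<Longrightarrow> norm (mollify l u f x) \<le> B * (LINT y|lborel. norm (f y))"
proof -
  obtain B where B: "0 \<le> B" "\<And>x. \<bar>kernel l u x\<bar> \<le> B"
    by (rule compact_support_bounded[OF smooth_kernel, of l u l u]) (use kernel_zero_cbox in blast)+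
  have "norm (mollify l u f x) \<le> B * (LINT y|lborel. norm (f y))" if f: "integrable lborel f"
    for f :: "real^'n \<Rightarrow> 'b" and x
  proof -
    have "norm (mollify l u f x) \<le> (LINT y|lborel. norm (kernel l u (y - x) *\<^sub>R f y))"
      unfolding mollify_alt[OF borel_measurable_integrable[OF f, simplified]] by (rule integral_norm_bound)
    also have "\<dots> \<le> (LINT y|lborel. B * norm (f y))"
      using f B integrable_kernel_scaleR(1)[OF f, THEN integrable_norm]
      by (intro integral_mono) (auto intro!: mult_right_mono)
    finally show ?thesis by simp
  qed
  with B that show ?thesis by blast
qed

text \<open>The constant depends on the kernel alone. Mollifications of a sequence bounded in mean
  are therefore equi-Lipschitz, which later carries convergence from a dense set to every
  point.\<close>

lemma mollify_Lipschitz: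
  obtains L where "0 \<le> L" "\<And>f x y. integrable lborel (f :: real^'n \<Rightarrow> 'b::{banach, second_countable_topology})
    \<Longrightarrow> norm (mollify l u f x - mollify l u f y) \<le> L * norm (x - y) * (LINT y|lborel. norm (f y))"
proof -
  obtain L where L: "0 \<le> L" "\<And>x y. \<bar>kernel l u x - kernel l u y\<bar> \<le> L * norm (x - y)"
    by (rule smooth_compact_support_Lipschitz[OF smooth_kernel, of l u l u]) (use kernel_zero_cbox in blast)+
  have "norm (mollify l u f x - mollify l u f y) \<le> L * norm (x - y) * (LINT y|lborel. norm (f y))"
    if f: "integrable lborel f" for f :: "real^'n \<Rightarrow> 'b" and x y
  proof -
    note i = integrable_kernel_scaleR(1)[OF f, of l u]
    have "mollify l u f x - mollify l u f y = (LINT z|lborel. (kernel l u (z - x) - kernel l u (z - y)) *\<^sub>R f z)"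
      using f i[of x] i[of y] by (simp add: mollify_alt scaleR_diff_left)
    also have "norm \<dots> \<le> (LINT z|lborel. norm ((kernel l u (z - x) - kernel l u (z - y)) *\<^sub>R f z))"
      by (rule integral_norm_bound)
    also have "\<dots> \<le> (LINT z|lborel. L * norm (x - y) * norm (f z))"
    proof (rule integral_mono)
      show "integrable lborel (\<lambda>z. norm ((kernel l u (z - x) - kernel l u (z - y)) *\<^sub>R f z))"
        using i[of x] i[of y] by (intro integrable_norm) (simp add: scaleR_diff_left)
      show "norm ((kernel l u (z - x) - kernel l u (z - y)) *\<^sub>R f z) \<le> L * norm (x - y) * norm (f z)" for z
        using L(2)[of "z - x" "z - y"] by (auto intro!: mult_right_mono simp: norm_minus_commute)
    qed (use f in auto)
    finally show ?thesis by simp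
  qed
  with L that show ?thesis by blast
qed

lemma continuous_on_mollify:
  fixes f :: "real^'n \<Rightarrow> 'b::{banach, second_countable_topology}"
  assumes f: "integrable lborel f"
  shows "continuous_on S (mollify l u f)"
proof -
  obtain L where L: "0 \<le> L" "\<And>f x y. integrable lborel (f :: real^'n \<Rightarrow> 'b)
    \<Longrightarrow> norm (mollify l u f x - mollify l u f y) \<le> L * norm (x - y) * (LINT y|lborel. norm (f y))"
    using mollify_Lipschitz by metis
  have "(L * (LINT y|lborel. norm (f y)))-lipschitz_on S (mollify l u f)"
    using L(1) L(2)[OF f] by (intro lipschitz_onI) (auto simp: dist_norm mult_ac)
  then show ?thesis by (rule lipschitz_on_continuous_on)
qed

lemma measurable_mollify [measurable]:
  fixes f :: "real^'n \<Rightarrow> 'b::{banach, second_countable_topology}"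
  assumes f: "integrable lborel f"
  shows "mollify l u f \<in> borel_measurable borel"
  by (intro borel_measurable_continuous_onI continuous_on_mollify f)

lemma mollify_has_derivative:
  fixes f :: "real^'n \<Rightarrow> real"
  assumes f: "integrable lborel f"
  shows "(mollify l u f has_derivative
    (\<lambda>h. \<Sum>i\<in>UNIV. h $ i * - (LINT y|lborel. partial_deriv i (kernel l u) (y - x) * f y))) (at x)"
proof -
  obtain C where C: "0 \<le> C"
    "\<And>x h. \<bar>kernel l u (x + h) - kernel l u x - (\<Sum>i\<in>UNIV. h $ i * partial_deriv i (kernel l u) x)\<bar> \<le> C * norm h ^ 2"
    by (rule smooth_compact_support_Taylor[OF smooth_kernel, of l u l u]) (use kernel_zero_cbox in blast)+
  have [measurable]: "f \<in> borel_measurable borel" using f by auto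
  let ?D = "\<lambda>i. LINT y|lborel. partial_deriv i (kernel l u) (y - x) * f y"
  have iD: "integrable lborel (\<lambda>y. partial_deriv i (kernel l u) (y - x) * f y)" for i
  proof -
    obtain B where B: "0 \<le> B" "\<And>x. \<bar>partial_deriv i (kernel l u) x\<bar> \<le> B"
    proof (rule compact_support_bounded[OF smooth_partial_deriv[OF smooth_kernel], of l u i l u])
      show "partial_deriv i (kernel l u) x = 0" if "x \<notin> cbox l u" for x
        by (rule partial_deriv_zero_outside[of l u]) (use kernel_zero_cbox that in auto)
    qed blast
    have [measurable]: "partial_deriv i (kernel l u) \<in> borel_measurable borel"
      by (intro borel_measurable_continuous_onI smooth_continuous smooth_partial_deriv smooth_kernel)
    show ?thesis
      by (rule Bochner_Integration.integrable_bound[of _ "\<lambda>y. B * norm (f y)"])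
        (use f B in \<open>auto intro!: AE_I2 mult_right_mono simp: abs_mult\<close>)
  qed
  let ?M = "C * (LINT y|lborel. \<bar>f y\<bar>)"
  have bl: "bounded_linear (\<lambda>h. \<Sum>i\<in>UNIV. h $ i * - ?D i)"
    by (intro bounded_linear_sum bounded_linear_mult_const bounded_linear_vec_nth)
  have main: "\<bar>mollify l u f (x + h) - mollify l u f x - (\<Sum>i\<in>UNIV. h $ i * - ?D i)\<bar> \<le> ?M * norm h ^ 2" for h
  proof -
    note i = integrable_kernel_scaleR(1)[OF f, of l u]
    \<comment> \<open>The Taylor remainder of the kernel at \<open>y - x\<close> for the increment
      \<open>- h\<close>, since moving \<open>x\<close> by \<open>h\<close> moves
      \<open>y - x\<close> by \<open>- h\<close>; the same sign produces the minus in the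
      derivative.\<close>
    define R where "R y = kernel l u (y - x + - h) - kernel l u (y - x) - (\<Sum>i\<in>UNIV. (- h) $ i * partial_deriv i (kernel l u) (y - x))" for y
    have R: "R y * f y = kernel l u (y - (x + h)) * f y - kernel l u (y - x) * f y
        - (\<Sum>i\<in>UNIV. (- h $ i) * (partial_deriv i (kernel l u) (y - x) * f y))" for y
      by (simp add: R_def algebra_simps sum_distrib_left sum_distrib_right)
    have Rb: "\<bar>R y\<bar> \<le> C * norm h ^ 2" for y
      using C(2)[of "y - x" "- h"] unfolding R_def norm_minus_cancel .
    have iR: "integrable lborel (\<lambda>y. R y * f y)"
      unfolding R using i[of x] i[of "x + h"] iD by auto
    have "mollify l u f (x + h) - mollify l u f x - (\<Sum>i\<in>UNIV. h $ i * - ?D i) = (LINT y|lborel. R y * f y)"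
      unfolding R using i[of x] i[of "x + h"] iD
      by (simp add: mollify_alt Bochner_Integration.integral_sum sum_negf)
    also have "\<bar>\<dots>\<bar> \<le> (LINT y|lborel. \<bar>R y * f y\<bar>)" by (rule integral_abs_bound)
    also have "\<dots> \<le> (LINT y|lborel. C * norm h ^ 2 * \<bar>f y\<bar>)"
    proof (rule integral_mono)
      show "integrable lborel (\<lambda>y. \<bar>R y * f y\<bar>)" using iR by (rule integrable_abs)
      show "\<bar>R y * f y\<bar> \<le> C * norm h ^ 2 * \<bar>f y\<bar>" for y
        unfolding abs_mult by (rule mult_right_mono[OF Rb abs_ge_zero])
    qed (use f in auto)
    finally show ?thesis by (simp add: mult_ac)
  qed
  show ?thesis
  proof (rule has_derivativeI_sandwich[of 1 _ _ _ _ "\<lambda>y. ?M * norm (y - x)"])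
    fix y assume "y \<noteq> x"
    then show "norm (mollify l u f y - mollify l u f x - (\<Sum>i\<in>UNIV. (y - x) $ i * - ?D i)) / norm (y - x) \<le> ?M * norm (y - x)"
      using main[of "y - x"] by (simp add: divide_simps power2_eq_square mult_ac)
  next
    show "((\<lambda>y. ?M * norm (y - x)) \<longlongrightarrow> 0) (at x)"
      by (auto intro!: tendsto_eq_intros)
  qed (use bl in auto)
qed

text \<open>A Borel representative of an element of \<open>W\<^bsup>1,1\<^esup>(\<Omega>)\<close> together with its gradient, both extended by zero.\<close>

definition weak_pair :: "(real^'n) set \<Rightarrow> (real^'n \<Rightarrow> real) \<Rightarrow> (real^'n \<Rightarrow> real^'n) \<Rightarrow> bool" where
  "weak_pair \<Omega> f g \<longleftrightarrow> integrable lborel f \<and> integrable lborel g \<and> (\<forall>x. x \<notin> \<Omega> \<longrightarrow> f x = 0 \<and> g x = 0) \<and>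
     (\<forall>\<phi> \<in> test_functions \<Omega>. \<forall>i.
        (LINT x|lborel. f x * partial_deriv i \<phi> x) = - (LINT x|lborel. g x $ i * \<phi> x))"

text \<open>As a function of \<open>y\<close>, the kernel at \<open>y - x\<close> is a test function
  of \<Omega> as soon as the closed box attached to \<open>x\<close> lies in \<Omega>. The minus
  sign of the weak gradient identity cancels the one in
  \<open>mollify_has_derivative\<close>.\<close>

lemma mollify_has_derivative_weak:
  assumes w: "weak_pair \<Omega> f g" and sub: "\<And>z. z \<in> cbox l u \<Longrightarrow> x + z \<in> \<Omega>"
  shows "(mollify l u f has_derivative (\<lambda>h. h \<bullet> mollify l u g x)) (at x)"
proof -
  have f: "integrable lborel f" and g: "integrable lborel g" using w by (auto simp: weak_pair_def)
  have "cbox (l + x) (u + x) \<subseteq> \<Omega>"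
  proof
    fix y assume "y \<in> cbox (l + x) (u + x)"
    then have "y - x \<in> cbox l u" by (auto simp: mem_box_cart algebra_simps)
    then show "y \<in> \<Omega>" using sub[of "y - x"] by simp
  qed
  then have t: "kernel (l + x) (u + x) \<in> test_functions \<Omega>" by (rule kernel_test_function)
  have k: "kernel (l + x) (u + x) = (\<lambda>y. kernel l u (y - x))"
    by (auto simp: kernel_translate)
  have "- (LINT y|lborel. partial_deriv i (kernel l u) (y - x) * f y) = mollify l u g x $ i" for i
  proof -
    have "(LINT y|lborel. partial_deriv i (kernel l u) (y - x) * f y)
        = (LINT y|lborel. f y * partial_deriv i (kernel (l + x) (u + x)) y)"
      unfolding k by (simp add: partial_deriv_translate smooth_differentiable smooth_kernel mult.commute)
    also have "\<dots> = - (LINT y|lborel. g y $ i * kernel (l + x) (u + x) y)"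
      using w t by (auto simp: weak_pair_def)
    also have "(LINT y|lborel. g y $ i * kernel (l + x) (u + x) y) = (LINT y|lborel. (kernel l u (y - x) *\<^sub>R g y) $ i)"
      unfolding k by (simp add: mult.commute)
    also have "\<dots> = mollify l u g x $ i"
      using g by (subst integral_bounded_linear[OF bounded_linear_vec_nth integrable_kernel_scaleR(1)])
        (auto simp: mollify_alt)
    finally show ?thesis by simp
  qed
  then show ?thesis using mollify_has_derivative[OF f, of l u x] by (simp add: inner_vec_def)
qed

section \<open>Mollification in L^p\<close>

lemma integrable_mult_kernel:
  assumes "integrable lborel f"
  shows "integrable lborel (\<lambda>z. kernel l u z * f (x + z))"
  using integrable_kernel_scaleR(2)[of f l u x] assms by simp

text \<open>Jensen's inequality for the probability density \<open>kernel l u\<close>, obtained from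
  Hoelder by splitting the density into its powers with exponents \<open>1 / p\<close> and
  \<open>1 - 1 / p\<close>.\<close>

lemma norm_mollify_powr_le:
  fixes f :: "real^'n \<Rightarrow> 'b::{banach, second_countable_topology}"
  assumes p: "1 \<le> p" and f: "integrable lborel f" "integrable lborel (\<lambda>x. norm (f x) powr p)"
    and box: "box l u \<noteq> {}"
  shows "norm (mollify l u f x) powr p \<le> (LINT z|lborel. kernel l u z * norm (f (x + z)) powr p)"
proof -
  note k = kernel_integral[OF box]
  have *: "norm (mollify l u f x) \<le> (LINT z|lborel. kernel l u z * norm (f (x + z)))"
  proof -
    have "norm (mollify l u f x) \<le> (LINT z|lborel. norm (kernel l u z *\<^sub>R f (x + z)))"
      unfolding mollify_def by (rule integral_norm_bound)
    then show ?thesis by (simp add: kernel_nonneg)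
  qed
  show ?thesis
  proof (cases "p = 1")
    case True
    then show ?thesis using * by simp
  next
    case False
    then have p1: "p > 1" using p by simp
    let ?F = "\<lambda>z. kernel l u z * norm (f (x + z)) powr p"
    let ?I = "LINT z|lborel. ?F z"
    have iF: "integrable lborel ?F" using integrable_mult_kernel[OF f(2)] .
    have I0: "0 \<le> ?I" by (simp add: kernel_nonneg)
    have "kernel l u z * norm (f (x + z)) = ?F z powr (1 / p) * kernel l u z powr (1 - 1 / p)" for z
      using p1 kernel_nonneg[of l u z]
      by (cases "kernel l u z = 0") (simp_all add: powr_mult powr_powr powr_diff)
    then have "(LINT z|lborel. kernel l u z * norm (f (x + z))) = (LINT z|lborel. ?F z powr (1 / p) * kernel l u z powr (1 - 1 / p))"
      by simp
    also have "\<dots> \<le> ?I powr (1 / p) * (LINT z|lborel. kernel l u z) powr (1 - 1 / p)"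
      using iF k p1 by (intro Holder_powr) (auto simp: kernel_nonneg)
    finally have "norm (mollify l u f x) \<le> ?I powr (1 / p)" using * k by simp
    then have "norm (mollify l u f x) powr p \<le> (?I powr (1 / p)) powr p"
      using p1 by (intro powr_mono2) auto
    then show ?thesis using p1 I0 by (simp add: powr_powr)
  qed
qed

lemma nn_integral_kernel: "box l u \<noteq> {} \<Longrightarrow> (\<integral>\<^sup>+z. ennreal (kernel l u z) \<partial>lborel) = 1"
  using kernel_integral[of l u] by (subst nn_integral_eq_integral) (auto simp: kernel_nonneg)

text \<open>By Tonelli the pointwise bound is an average over translates of \<open>f\<close>; all
  translates have the same norm and the kernel has mass 1.\<close>

lemma mollify_Lp:
  fixes f :: "real^'n \<Rightarrow> 'b::{banach, second_countable_topology}"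
  assumes p: "1 \<le> p" and f: "integrable lborel f" "integrable lborel (\<lambda>x. norm (f x) powr p)"
    and box: "box l u \<noteq> {}"
  shows "integrable lborel (\<lambda>x. norm (mollify l u f x) powr p)"
    and "(LINT x|lborel. norm (mollify l u f x) powr p) \<le> (LINT x|lborel. norm (f x) powr p)"
proof -
  have [measurable]: "f \<in> borel_measurable borel" "mollify l u f \<in> borel_measurable borel" using f by auto
  have "(\<integral>\<^sup>+x. ennreal (norm (mollify l u f x) powr p) \<partial>lborel)
      \<le> (\<integral>\<^sup>+x. (\<integral>\<^sup>+z. ennreal (kernel l u z * norm (f (x + z)) powr p) \<partial>lborel) \<partial>lborel)"
  proof (rule nn_integral_mono)
    fix x
    have "ennreal (norm (mollify l u f x) powr p) \<le> ennreal (LINT z|lborel. kernel l u z * norm (f (x + z)) powr p)"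
      using norm_mollify_powr_le[OF p f box] by (rule ennreal_leI)
    then show "ennreal (norm (mollify l u f x) powr p) \<le> (\<integral>\<^sup>+z. ennreal (kernel l u z * norm (f (x + z)) powr p) \<partial>lborel)"
      using integrable_mult_kernel[OF f(2), of l u x]
      by (subst nn_integral_eq_integral) (auto simp: kernel_nonneg)
  qed
  also have "\<dots> = (\<integral>\<^sup>+z. (\<integral>\<^sup>+x. ennreal (kernel l u z * norm (f (x + z)) powr p) \<partial>lborel) \<partial>lborel)"
    by (rule lborel_pair.Fubini') measurable
  also have "\<dots> = (\<integral>\<^sup>+z. ennreal (kernel l u z) * (\<integral>\<^sup>+x. ennreal (norm (f (z + x)) powr p) \<partial>lborel) \<partial>lborel)"
    by (simp add: kernel_nonneg ennreal_mult' nn_integral_cmult add.commute)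
  also have "\<dots> = (\<integral>\<^sup>+x. ennreal (norm (f x) powr p) \<partial>lborel)"
    using box by (simp add: nn_integral_lborel_translate[of "\<lambda>x. ennreal (norm (f x) powr p)"] nn_integral_multc nn_integral_kernel)
  also have "\<dots> = ennreal (LINT x|lborel. norm (f x) powr p)"
    using f by (subst nn_integral_eq_integral) auto
  finally have *: "(\<integral>\<^sup>+x. ennreal (norm (mollify l u f x) powr p) \<partial>lborel) \<le> ennreal (LINT x|lborel. norm (f x) powr p)" .
  then show int: "integrable lborel (\<lambda>x. norm (mollify l u f x) powr p)"
    by (intro integrableI_nonneg) (auto intro: le_less_trans[OF _ ennreal_less_top])
  show "(LINT x|lborel. norm (mollify l u f x) powr p) \<le> (LINT x|lborel. norm (f x) powr p)"
    using * int by (subst (asm) nn_integral_eq_integral) auto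
qed

lemma integrable_mollify:
  fixes f :: "real^'n \<Rightarrow> 'b::{banach, second_countable_topology}"
  assumes f: "integrable lborel f" and box: "box l u \<noteq> {}"
  shows "integrable lborel (mollify l u f)"
proof -
  have "integrable lborel (\<lambda>x. norm (mollify l u f x))"
    using mollify_Lp(1)[of 1 f l u] f box by simp
  then show ?thesis
    using f by (subst (asm) integrable_norm_iff) auto
qed

text \<open>The error of a mollification is an average of translation errors. The set
  \<open>S\<close> confines the estimate to points whose translations into the cone are
  controlled.\<close>

lemma mollify_diff_L1_le:
  fixes f :: "real^'n \<Rightarrow> real"
  assumes f: "integrable lborel f" and box: "box l u \<noteq> {}" and S [measurable]: "S \<in> sets borel" and e: "0 \<le> e"
    and le: "\<And>z. z \<in> cbox l u \<Longrightarrow> (LINT x|lborel. indicator S x * \<bar>f (x + z) - f x\<bar>) \<le> e"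
  shows "(LINT x|lborel. indicator S x * \<bar>mollify l u f x - f x\<bar>) \<le> e"
proof -
  have [measurable]: "f \<in> borel_measurable borel" "mollify l u f \<in> borel_measurable borel" using f by auto
  note iM = integrable_mollify[OF f box]
  have int: "integrable lborel (\<lambda>x. indicator S x * \<bar>mollify l u f x - f x\<bar>)"
    by (rule Bochner_Integration.integrable_bound[of _ "\<lambda>x. \<bar>mollify l u f x - f x\<bar>"])
      (use iM f in \<open>auto simp: indicator_def\<close>)
  have int2: "integrable lborel (\<lambda>x. indicator S x * \<bar>f (x + z) - f x\<bar>)" for z
    by (rule Bochner_Integration.integrable_bound[of _ "\<lambda>x. \<bar>f (x + z) - f x\<bar>"])
      (use integrable_lborel_translate[OF f, of z] f in \<open>auto simp: indicator_def\<close>)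
  have "(\<integral>\<^sup>+x. ennreal (indicator S x * \<bar>mollify l u f x - f x\<bar>) \<partial>lborel)
      \<le> (\<integral>\<^sup>+x. (\<integral>\<^sup>+z. ennreal (kernel l u z * (indicator S x * \<bar>f (x + z) - f x\<bar>)) \<partial>lborel) \<partial>lborel)"
  proof (rule nn_integral_mono)
    fix x
    have i: "integrable lborel (\<lambda>z. kernel l u z * f (x + z) - kernel l u z * f x)"
      using integrable_mult_kernel[OF f, of l u x] kernel_integral[OF box] by auto
    have "mollify l u f x - f x = (LINT z|lborel. kernel l u z * f (x + z)) - (LINT z|lborel. kernel l u z * f x)"
      using kernel_integral[OF box] by (simp add: mollify_def)
    also have "\<dots> = (LINT z|lborel. kernel l u z * (f (x + z) - f x))"
      using integrable_mult_kernel[OF f, of l u x] kernel_integral[OF box]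
      by (simp add: right_diff_distrib)
    finally have "indicator S x * \<bar>mollify l u f x - f x\<bar> \<le> indicator S x * (LINT z|lborel. \<bar>kernel l u z * (f (x + z) - f x)\<bar>)"
      by (auto intro!: mult_left_mono integral_abs_bound)
    also have "\<dots> = (LINT z|lborel. kernel l u z * (indicator S x * \<bar>f (x + z) - f x\<bar>))"
      by (simp add: abs_mult kernel_nonneg mult_ac flip: Bochner_Integration.integral_mult_right_zero)
    finally have "ennreal (indicator S x * \<bar>mollify l u f x - f x\<bar>) \<le> ennreal (LINT z|lborel. kernel l u z * (indicator S x * \<bar>f (x + z) - f x\<bar>))"
      by (rule ennreal_leI)
    also have "\<dots> = (\<integral>\<^sup>+z. ennreal (kernel l u z * (indicator S x * \<bar>f (x + z) - f x\<bar>)) \<partial>lborel)"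
    proof (rule nn_integral_eq_integral[symmetric])
      have "integrable lborel (\<lambda>z. indicator S x * \<bar>kernel l u z * f (x + z) - kernel l u z * f x\<bar>)"
        using i by auto
      also have "(\<lambda>z. indicator S x * \<bar>kernel l u z * f (x + z) - kernel l u z * f x\<bar>)
          = (\<lambda>z. kernel l u z * (indicator S x * \<bar>f (x + z) - f x\<bar>))"
        by (simp only: right_diff_distrib[symmetric] abs_mult abs_of_nonneg[OF kernel_nonneg] mult.left_commute)
      finally show "integrable lborel (\<lambda>z. kernel l u z * (indicator S x * \<bar>f (x + z) - f x\<bar>))" .
    qed (auto simp: kernel_nonneg)
    finally show "ennreal (indicator S x * \<bar>mollify l u f x - f x\<bar>)
      \<le> (\<integral>\<^sup>+z. ennreal (kernel l u z * (indicator S x * \<bar>f (x + z) - f x\<bar>)) \<partial>lborel)" .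
  qed
  also have "\<dots> = (\<integral>\<^sup>+z. (\<integral>\<^sup>+x. ennreal (kernel l u z * (indicator S x * \<bar>f (x + z) - f x\<bar>)) \<partial>lborel) \<partial>lborel)"
    by (rule lborel_pair.Fubini') measurable
  also have "\<dots> = (\<integral>\<^sup>+z. ennreal (kernel l u z) * (\<integral>\<^sup>+x. ennreal (indicator S x * \<bar>f (x + z) - f x\<bar>) \<partial>lborel) \<partial>lborel)"
    by (simp add: kernel_nonneg ennreal_mult' nn_integral_cmult)
  also have "\<dots> \<le> (\<integral>\<^sup>+z. ennreal (kernel l u z) * ennreal e \<partial>lborel)"
  proof (rule nn_integral_mono)
    fix z
    show "ennreal (kernel l u z) * (\<integral>\<^sup>+x. ennreal (indicator S x * \<bar>f (x + z) - f x\<bar>) \<partial>lborel) \<le> ennreal (kernel l u z) * ennreal e"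
    proof (cases "z \<in> cbox l u")
      case True
      then show ?thesis using le[OF True] int2[of z]
        by (intro mult_left_mono) (auto simp: nn_integral_eq_integral intro!: ennreal_leI)
    qed (simp add: kernel_zero_cbox)
  qed
  also have "\<dots> = ennreal e" using box by (simp add: nn_integral_multc nn_integral_kernel)
  finally show ?thesis using int e by (subst (asm) nn_integral_eq_integral) auto
qed

lemma cbox_scaleR_subset:
  fixes l u :: "real^'n"
  assumes "0 < t" "z \<in> cbox (t *\<^sub>R l) (t *\<^sub>R u)"
  obtains z' where "z' \<in> cbox l u" "z = t *\<^sub>R z'"
proof (rule that[of "(1 / t) *\<^sub>R z"])
  show "(1 / t) *\<^sub>R z \<in> cbox l u"
    using assms by (auto simp: mem_box_cart field_simps)
qed (use assms in auto)

lemma box_scaleR_nonempty: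
  fixes l u :: "real^'n"
  shows "0 < t \<Longrightarrow> box l u \<noteq> {} \<Longrightarrow> box (t *\<^sub>R l) (t *\<^sub>R u) \<noteq> {}"
  by (simp add: box_ne_empty)

text \<open>Continuity of translations gives convergence in mean as the boxes shrink. Convergence
  almost everywhere, on which Fatou's lemma relies, costs a subsequence of scales, so
  \<open>t\<close> depends on \<open>f\<close>.\<close>

lemma mollify_AE_limit:
  fixes f :: "real^'n \<Rightarrow> real" and l u :: "real^'n"
  assumes f: "integrable lborel f" and box: "box l u \<noteq> {}"
  obtains t :: "nat \<Rightarrow> real" where "\<And>k. 0 < t k" "\<And>k. t k \<le> 1"
    "AE x in lborel. (\<lambda>k. mollify (t k *\<^sub>R l) (t k *\<^sub>R u) f x) \<longlonglongrightarrow> f x"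
proof -
  define T where "T k = 1 / real (Suc k)" for k
  have T: "0 < T k" "T k \<le> 1" for k by (auto simp: T_def divide_le_eq)
  let ?m = "\<lambda>k. mollify (T k *\<^sub>R l) (T k *\<^sub>R u) f"
  have box': "box (T k *\<^sub>R l) (T k *\<^sub>R u) \<noteq> {}" for k using T(1) box by (rule box_scaleR_nonempty)
  have i: "integrable lborel (\<lambda>x. ?m k x - f x)" for k using integrable_mollify[OF f box'] f by auto
  obtain R where R: "R > 0" "\<And>z. z \<in> cbox l u \<Longrightarrow> norm z \<le> R"
    using bounded_cbox[of l u] by (auto simp: bounded_pos)
  have "(\<lambda>k. LINT x|lborel. norm (?m k x - f x)) \<longlonglongrightarrow> 0"
  proof (rule LIMSEQ_I)
    fix e :: real assume "e > 0"
    then obtain \<delta> where \<delta>: "\<delta> > 0" "\<And>z. norm z < \<delta> \<Longrightarrow> (LINT x|lborel. \<bar>f (x + z) - f x\<bar>) \<le> e / 2"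
      using integrable_translate_tendsto[OF f, of "e / 2"] by auto
    have "(\<lambda>k. T k * R) \<longlonglongrightarrow> 0 * R" unfolding T_def
      by (intro tendsto_intros LIMSEQ_Suc[OF lim_1_over_n])
    then have "eventually (\<lambda>k. T k * R < \<delta>) sequentially" using \<delta> by (intro order_tendstoD(2)) auto
    then obtain k0 where k0: "\<And>k. k \<ge> k0 \<Longrightarrow> T k * R < \<delta>" by (auto simp: eventually_sequentially)
    have "norm ((LINT x|lborel. norm (?m k x - f x)) - 0) < e" if "k \<ge> k0" for k
    proof -
      have "(LINT x|lborel. indicator UNIV x * \<bar>?m k x - f x\<bar>) \<le> e / 2"
      proof (rule mollify_diff_L1_le[OF f box'])
        fix z assume "z \<in> cbox (T k *\<^sub>R l) (T k *\<^sub>R u)"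
        then obtain z' where z': "z' \<in> cbox l u" "z = T k *\<^sub>R z'" using T cbox_scaleR_subset by metis
        then have "norm z \<le> T k * R" using R(2)[of z'] T[of k] by (auto intro!: mult_left_mono)
        then show "(LINT x|lborel. indicator UNIV x * \<bar>f (x + z) - f x\<bar>) \<le> e / 2"
          using \<delta>(2)[of z] k0[OF that] by simp
      qed (use \<open>e > 0\<close> in auto)
      then show ?thesis using \<open>e > 0\<close> by simp
    qed
    then show "\<exists>k0. \<forall>k\<ge>k0. norm ((LINT x|lborel. norm (?m k x - f x)) - 0) < e" by blast
  qed
  from tendsto_L1_AE_subseq[OF i this] obtain r where r: "strict_mono r" "AE x in lborel. (\<lambda>k. ?m (r k) x - f x) \<longlonglongrightarrow> 0"
    by auto
  show ?thesis
    by (rule that[of "\<lambda>k. T (r k)"]) (use T r in \<open>auto simp: LIM_zero_iff\<close>)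
qed

section \<open>Approximation up to the boundary\<close>

text \<open>
  The boxes \<open>t *\<^sub>R cbox l u\<close> with \<open>0 < t \<le> 1\<close> fill a truncated cone, so this is an interior cone condition
  that is uniform on \<open>K \<inter> \<Omega>\<close>.
\<close>

definition cone_patch :: "(real^'n) set \<Rightarrow> (real^'n) set \<Rightarrow> real^'n \<Rightarrow> real^'n \<Rightarrow> bool" where
  "cone_patch \<Omega> K l u \<longleftrightarrow> open K \<and> box l u \<noteq> {} \<and>
     (\<forall>x\<in>K \<inter> \<Omega>. \<forall>z\<in>cbox l u. \<forall>t. 0 < t \<and> t \<le> 1 \<longrightarrow> x + t *\<^sub>R z \<in> \<Omega>)"

text \<open>Mollifying with kernels supported in the cone keeps the gradient identity up to the boundary.\<close>

lemma patch_approximation: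
  fixes f :: "real^'n \<Rightarrow> real"
  assumes w: "weak_pair \<Omega> f g" and K: "cone_patch \<Omega> K l u"
  obtains v :: "nat \<Rightarrow> real^'n \<Rightarrow> real" and G :: "nat \<Rightarrow> real^'n \<Rightarrow> real^'n" where
    "\<And>k x. x \<in> K \<inter> \<Omega> \<Longrightarrow> (v k has_derivative (\<lambda>h. h \<bullet> G k x)) (at x)"
    "\<And>k S. continuous_on S (v k)" "\<And>k S. continuous_on S (G k)"
    "\<And>k. \<exists>B. \<forall>x. \<bar>v k x\<bar> \<le> B \<and> norm (G k x) \<le> B"
    "\<And>k p. 1 \<le> p \<Longrightarrow> integrable lborel (\<lambda>x. \<bar>f x\<bar> powr p) \<Longrightarrow> integrable lborel (\<lambda>x. \<bar>v k x\<bar> powr p) \<and>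
       (LINT x|lborel. \<bar>v k x\<bar> powr p) \<le> (LINT x|lborel. \<bar>f x\<bar> powr p)"
    "\<And>k p. 1 \<le> p \<Longrightarrow> integrable lborel (\<lambda>x. norm (g x) powr p) \<Longrightarrow> integrable lborel (\<lambda>x. norm (G k x) powr p) \<and>
       (LINT x|lborel. norm (G k x) powr p) \<le> (LINT x|lborel. norm (g x) powr p)"
    "AE x in lborel. (\<lambda>k. v k x) \<longlonglongrightarrow> f x"
proof -
  have f: "integrable lborel f" and g: "integrable lborel g" using w by (auto simp: weak_pair_def)
  have box: "box l u \<noteq> {}" using K by (auto simp: cone_patch_def)
  obtain t where t: "\<And>k. 0 < t k" "\<And>k. t k \<le> 1"
    "AE x in lborel. (\<lambda>k. mollify (t k *\<^sub>R l) (t k *\<^sub>R u) f x) \<longlonglongrightarrow> f x"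
    by (rule mollify_AE_limit[OF f box]) blast
  let ?v = "\<lambda>k. mollify (t k *\<^sub>R l) (t k *\<^sub>R u) f" and ?G = "\<lambda>k. mollify (t k *\<^sub>R l) (t k *\<^sub>R u) g"
  have box': "box (t k *\<^sub>R l) (t k *\<^sub>R u) \<noteq> {}" for k using t(1) box by (rule box_scaleR_nonempty)
  show ?thesis
  proof (rule that[of ?v ?G])
    fix k x assume x: "x \<in> K \<inter> \<Omega>"
    show "(?v k has_derivative (\<lambda>h. h \<bullet> ?G k x)) (at x)"
    proof (rule mollify_has_derivative_weak[OF w])
      fix z assume "z \<in> cbox (t k *\<^sub>R l) (t k *\<^sub>R u)"
      then obtain z' where "z' \<in> cbox l u" "z = t k *\<^sub>R z'" using t cbox_scaleR_subset by metis
      then show "x + z \<in> \<Omega>" using x K t(1,2)[of k] by (auto simp: cone_patch_def)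
    qed
  next
    fix k S
    show "continuous_on S (?v k)" "continuous_on S (?G k)"
      by (intro continuous_on_mollify f g)+
  next
    fix k
    obtain B1 where B1: "\<And>f x. integrable lborel (f :: real^'n \<Rightarrow> real) \<Longrightarrow>
        norm (mollify (t k *\<^sub>R l) (t k *\<^sub>R u) f x) \<le> B1 * (LINT y|lborel. norm (f y))"
      by (rule mollify_bounded) blast
    obtain B2 where B2: "\<And>f x. integrable lborel (f :: real^'n \<Rightarrow> real^'n) \<Longrightarrow>
        norm (mollify (t k *\<^sub>R l) (t k *\<^sub>R u) f x) \<le> B2 * (LINT y|lborel. norm (f y))"
      by (rule mollify_bounded) blast
    note B = B1[OF f] B2[OF g]
    show "\<exists>B. \<forall>x. \<bar>?v k x\<bar> \<le> B \<and> norm (?G k x) \<le> B"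
      using B by (intro exI[of _ "max (B1 * (LINT y|lborel. norm (f y))) (B2 * (LINT y|lborel. norm (g y)))"])
        (auto simp: le_max_iff_disj)
  qed (use mollify_Lp[OF _ f] mollify_Lp[OF _ g] box' t in auto)
qed

text \<open>The directions are \<open>a + \<sigma> *\<^sub>R axis i 1\<close> for a point
  \<open>a\<close> of the open box. The map is a rank-one perturbation of a multiple of the
  identity; summing coordinates shows that it is injective once
  \<open>\<sigma> + s a \<noteq> 0\<close>.\<close>

lemma cone_directions:
  fixes l u :: "real^'n"
  assumes "box l u \<noteq> {}"
  obtains T :: "real^'n \<Rightarrow> real^'n" where "linear T" "inj T" "\<And>i. T (axis i 1) \<in> cbox l u"
proof -
  obtain a where a: "a \<in> box l u" using assms by auto
  then obtain \<rho> where \<rho>: "\<rho> > 0" "ball a \<rho> \<subseteq> box l u" using open_box open_contains_ball by blast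
  define s where "s x = (\<Sum>i\<in>UNIV. x $ i)" for x :: "real^'n"
  have s_lin: "s (x + y) = s x + s y" "s (c *\<^sub>R x) = c * s x" for x y c
    by (simp_all add: s_def sum.distrib sum_distrib_left)
  \<comment> \<open>Only one value of \<sigma> is forbidden, so one of \<open>\<rho> / 2\<close> and
    \<open>\<rho> / 3\<close> works.\<close>
  obtain \<sigma> where \<sigma>: "0 < \<sigma>" "\<sigma> < \<rho>" "\<sigma> + s a \<noteq> 0"
  proof (cases "\<rho> / 2 + s a = 0")
    case True
    then show ?thesis using \<rho> by (intro that[of "\<rho> / 3"]) auto
  next
    case False
    then show ?thesis using \<rho> by (intro that[of "\<rho> / 2"]) auto
  qed
  define T where "T x = \<sigma> *\<^sub>R x + s x *\<^sub>R a" for x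
  show ?thesis
  proof
    show lin: "linear T" by (rule linearI) (simp_all add: T_def s_lin algebra_simps)
    show "inj T"
    proof (subst linear_injective_0[OF lin], intro allI impI)
      fix x assume x: "T x = 0"
      then have "s (T x) = 0" by (simp add: s_def)
      then have "s x * (\<sigma> + s a) = 0" by (simp add: T_def s_lin algebra_simps)
      then have "s x = 0" using \<sigma> by simp
      then show "x = 0" using x \<sigma> by (simp add: T_def)
    qed
    fix i
    have "s (axis i 1) = 1" by (simp add: s_def axis_def)
    then have "dist a (T (axis i 1)) = \<sigma>" using \<sigma> by (simp add: T_def dist_norm)
    then have "T (axis i 1) \<in> ball a \<rho>" using \<sigma> by simp
    then show "T (axis i 1) \<in> cbox l u" using \<rho> box_subset_cbox by blast
  qed
qed

section \<open>The Sobolev inequality on uniform cone domains\<close>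

text \<open>Squaring the positive part makes the cutoff continuously differentiable; it is
  differentiated only once, and its gradient and all bounds stay explicit.\<close>

definition cutoff :: "'a::euclidean_space \<Rightarrow> real \<Rightarrow> 'a \<Rightarrow> real" where
  "cutoff x0 r x = (max 0 (r\<^sup>2 - (x - x0) \<bullet> (x - x0)))\<^sup>2"

definition cutoff_grad :: "'a::euclidean_space \<Rightarrow> real \<Rightarrow> 'a \<Rightarrow> 'a" where
  "cutoff_grad x0 r x = (- 4 * max 0 (r\<^sup>2 - (x - x0) \<bullet> (x - x0))) *\<^sub>R (x - x0)"

lemma continuous_on_cutoff: "continuous_on S (cutoff x0 r)" "continuous_on S (cutoff_grad x0 r)"
  unfolding cutoff_def cutoff_grad_def by (intro continuous_intros)+

lemma cutoff_has_derivative: "(cutoff x0 r has_derivative (\<lambda>h. h \<bullet> cutoff_grad x0 r x)) (at x)"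
proof -
  have m: "((\<lambda>s. (max 0 s)\<^sup>2) has_real_derivative 2 * max 0 s) (at s)" for s :: real
  proof -
    consider "s > 0" | "s < 0" | "s = 0" by linarith
    then show ?thesis
    proof cases
      case 1
      have "((\<lambda>s. s\<^sup>2) has_real_derivative 2 * s) (at s)" by (auto intro!: derivative_eq_intros)
      then show ?thesis using 1
        by (subst has_field_derivative_cong_eventually[of _ "\<lambda>s. s\<^sup>2"])
          (auto intro: eventually_mono[OF order_tendstoD(1)[OF tendsto_ident_at 1]])
    next
      case 2
      then show ?thesis
        by (subst has_field_derivative_cong_eventually[of _ "\<lambda>s. 0"])
          (auto intro: eventually_mono[OF order_tendstoD(2)[OF tendsto_ident_at 2]])
    next
      case 3
      have "((\<lambda>h. max 0 h) \<longlongrightarrow> max 0 0) (at (0::real))" by (intro tendsto_intros)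
      moreover have "(max 0 h)\<^sup>2 / h = max 0 h" if "h \<noteq> 0" for h :: real
        using that by (cases "h > 0") (auto simp: power2_eq_square)
      ultimately have "((\<lambda>h. (max 0 h)\<^sup>2 / h) \<longlongrightarrow> 0) (at (0::real))"
        by (subst tendsto_cong[where g = "\<lambda>h. max 0 h"]) (auto simp: eventually_at_filter)
      then show ?thesis using 3 by (simp add: DERIV_def)
    qed
  qed
  have "((\<lambda>x. r\<^sup>2 - (x - x0) \<bullet> (x - x0)) has_derivative (\<lambda>h. - 2 * (h \<bullet> (x - x0)))) (at x)"
    by (auto intro!: derivative_eq_intros simp: inner_commute)
  from has_derivative_compose[OF this m[unfolded has_field_derivative_def]]
  show ?thesis
    unfolding cutoff_def by (rule has_derivative_eq_rhs) (auto simp: cutoff_grad_def fun_eq_iff)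
qed

lemma inner_ge_square: "0 \<le> r \<Longrightarrow> x \<notin> ball x0 r \<Longrightarrow> r\<^sup>2 \<le> (x - x0) \<bullet> (x - x0)"
  by (auto simp: dist_norm norm_minus_commute power2_norm_eq_inner[symmetric] intro!: power_mono)

lemma cutoff_outside:
  assumes "0 \<le> r" "x \<notin> ball x0 r"
  shows "cutoff x0 r x = 0" "cutoff_grad x0 r x = 0"
  using inner_ge_square[OF assms] by (auto simp: cutoff_def cutoff_grad_def)

lemma cutoff_nonneg: "0 \<le> cutoff x0 r x"
  by (simp add: cutoff_def)

lemma cutoff_le: "cutoff x0 r x \<le> r ^ 4"
proof -
  have "(max 0 (r\<^sup>2 - (x - x0) \<bullet> (x - x0)))\<^sup>2 \<le> (r\<^sup>2)\<^sup>2"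
    by (intro power_mono) auto
  then show ?thesis by (simp add: cutoff_def flip: power_mult)
qed

lemma cutoff_grad_le:
  assumes "0 \<le> r"
  shows "norm (cutoff_grad x0 r x) \<le> 4 * r ^ 3"
proof (cases "x \<in> ball x0 r")
  case True
  have "norm (cutoff_grad x0 r x) = 4 * max 0 (r\<^sup>2 - (x - x0) \<bullet> (x - x0)) * norm (x - x0)"
    by (simp add: cutoff_grad_def)
  also have "\<dots> \<le> 4 * r\<^sup>2 * r"
    using True by (intro mult_mono) (auto simp: dist_norm norm_minus_commute)
  finally show ?thesis by (simp add: power3_eq_cube power2_eq_square)
next
  case False
  then show ?thesis using cutoff_outside(2)[OF assms False] assms by simp
qed

lemma cutoff_lower:
  assumes "0 < r" "x \<in> ball x0 (r / 2)"
  shows "(3/4 * r\<^sup>2)\<^sup>2 \<le> cutoff x0 r x"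
proof -
  have "norm (x - x0) \<le> r / 2" using assms by (auto simp: dist_norm norm_minus_commute)
  then have "(norm (x - x0))\<^sup>2 \<le> (r / 2)\<^sup>2" by (intro power_mono) auto
  then have "3/4 * r\<^sup>2 \<le> r\<^sup>2 - (x - x0) \<bullet> (x - x0)"
    by (simp add: power2_norm_eq_inner power_divide)
  then have "3/4 * r\<^sup>2 \<le> max 0 (r\<^sup>2 - (x - x0) \<bullet> (x - x0))" by linarith
  then show ?thesis unfolding cutoff_def by (intro power_mono) auto
qed

section \<open>Gagliardo's argument in one patch\<close>

lemma integrable_continuous_indicator:
  fixes H :: "'a::euclidean_space \<Rightarrow> real"
  assumes H: "continuous_on UNIV H" "\<And>x. x \<notin> cball x0 r \<Longrightarrow> H x = 0" and S: "S \<in> sets borel"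
  shows "integrable lborel (\<lambda>x. indicator S x * H x)"
proof -
  have m: "H \<in> borel_measurable borel" using H(1) by (rule borel_measurable_continuous_onI)
  have "integrable lborel (\<lambda>x. indicator (cball x0 r) x *\<^sub>R H x)"
    by (rule borel_integrable_compact) (use H in \<open>auto intro: continuous_on_subset\<close>)
  also have "(\<lambda>x. indicator (cball x0 r) x *\<^sub>R H x) = H" using H(2) by (fastforce simp: indicator_def)
  finally have "integrable lborel H" .
  then show ?thesis
    by (rule Bochner_Integration.integrable_bound) (use m S in \<open>auto simp: indicator_def\<close>)
qed

text \<open>
  With \<open>\<Phi> s = \<bar>s\<bar> powr \<gamma>\<close> this yields the case \<open>p > 1\<close> of the Sobolev inequality.
\<close>

lemma Gagliardo_patch:
  fixes x0 :: "real^'n"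
  assumes \<Omega>: "open \<Omega>" and K: "cone_patch \<Omega> (ball x0 R) l u" and R: "0 < R" and n: "CARD('n) \<ge> 2"
  defines "m \<equiv> real CARD('n) / (real CARD('n) - 1)"
  obtains r C :: real where "0 < r" "0 \<le> C"
    "\<And>v G \<Phi> \<Phi>'. (\<And>x. x \<in> ball x0 R \<inter> \<Omega> \<Longrightarrow> (v has_derivative (\<lambda>h. h \<bullet> G x)) (at x)) \<Longrightarrow>
      continuous_on UNIV v \<Longrightarrow> continuous_on UNIV G \<Longrightarrow>
      (\<And>s. (\<Phi> has_real_derivative \<Phi>' s) (at s)) \<Longrightarrow> continuous_on UNIV \<Phi>' \<Longrightarrow> \<Phi> 0 = (0::real) \<Longrightarrow>
      integrable lborel (\<lambda>x. (indicator \<Omega> x * \<bar>\<Phi> (cutoff x0 r x * v x)\<bar>) powr m) \<and>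
      (LINT x|lborel. (indicator \<Omega> x * \<bar>\<Phi> (cutoff x0 r x * v x)\<bar>) powr m) \<le>
      C * (LINT x|lborel. indicator \<Omega> x * (\<bar>\<Phi>' (cutoff x0 r x * v x)\<bar> * norm (cutoff x0 r x *\<^sub>R G x + v x *\<^sub>R cutoff_grad x0 r x))) powr m"
proof -
  have box: "box l u \<noteq> {}" using K by (simp add: cone_patch_def)
  obtain T :: "real^'n \<Rightarrow> real^'n" where T: "linear T" "inj T" "\<And>i. T (axis i 1) \<in> cbox l u"
    by (rule cone_directions[OF box]) blast
  define e where "e i = T (axis i 1)" for i
  have e0: "norm (e i) > 0" for i
  proof -
    have "T (axis i 1) \<noteq> T 0" using T(2) by (metis axis_eq_0_iff injD zero_neq_one)
    then show ?thesis using T(1) by (simp add: e_def linear_0)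
  qed
  define \<delta> where "\<delta> = Min (range (\<lambda>i. norm (e i)))"
  have \<delta>: "0 < \<delta>" "\<And>i. \<delta> \<le> norm (e i)" unfolding \<delta>_def using e0 by auto
  \<comment> \<open>Every direction has length at least \<open>2 * r\<close>, so the step from a
    point of the ball to \<open>x + e i\<close> leaves the ball, and the cutoff vanishes at its end.
    Moreover \<open>r < R\<close>, so the support of the cutoff lies in the patch.\<close>
  define r where "r = min (R / 2) (\<delta> / 2)"
  have r: "0 < r" "r < R" "2 * r \<le> \<delta>" using R \<delta> by (auto simp: r_def)
  define M where "M = (\<Sum>i\<in>UNIV. norm (e i))"
  have M: "norm (e i) \<le> M" for i unfolding M_def by (rule member_le_sum) auto
  have M0: "0 \<le> M" by (auto simp: M_def intro: sum_nonneg)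
  obtain C0 where C0: "0 \<le> C0" "\<And>f F. f \<in> borel_measurable borel \<Longrightarrow> integrable lborel F \<Longrightarrow> F \<in> borel_measurable borel \<Longrightarrow>
       (\<And>x. 0 \<le> f x) \<Longrightarrow> (\<And>x. 0 \<le> F x) \<Longrightarrow>
       (\<And>i x. ennreal (f x) \<le> dir_integral (e i) (\<lambda>x. ennreal (F x)) x) \<Longrightarrow>
       integrable lborel (\<lambda>x. f x powr m) \<and> (LINT x|lborel. f x powr m) \<le> C0 * (LINT x|lborel. F x) powr m"
    unfolding e_def m_def by (rule Gagliardo_bound[OF T(1,2) n]) blast
  have [measurable]: "\<Omega> \<in> sets borel" using \<Omega> by auto
  show ?thesis
  proof (rule that[of r "C0 * M powr m"])
    show "0 < r" by (fact r)
    show "0 \<le> C0 * M powr m" using C0 by simp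
    fix v :: "real^'n \<Rightarrow> real" and G :: "real^'n \<Rightarrow> real^'n" and \<Phi> \<Phi>' :: "real \<Rightarrow> real"
    assume v: "\<And>x. x \<in> ball x0 R \<inter> \<Omega> \<Longrightarrow> (v has_derivative (\<lambda>h. h \<bullet> G x)) (at x)"
      and cv: "continuous_on UNIV v" and cG: "continuous_on UNIV G"
      and \<Phi>: "\<And>s. (\<Phi> has_real_derivative \<Phi>' s) (at s)" and c\<Phi>': "continuous_on UNIV \<Phi>'" and \<Phi>0: "\<Phi> 0 = 0"
    define V where "V x = cutoff x0 r x * v x" for x
    define W where "W x = cutoff x0 r x *\<^sub>R G x + v x *\<^sub>R cutoff_grad x0 r x" for x
    have cV: "continuous_on UNIV V" unfolding V_def by (intro continuous_intros continuous_on_cutoff cv)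
    have cW: "continuous_on UNIV W" unfolding W_def by (intro continuous_intros continuous_on_cutoff cv cG)
    have c\<Phi>: "continuous_on UNIV \<Phi>" using \<Phi> by (meson DERIV_continuous continuous_at_imp_continuous_on)
    have V0: "V x = 0" "W x = 0" if "x \<notin> ball x0 r" for x
      using cutoff_outside[OF _ that] r by (auto simp: V_def W_def)
    \<comment> \<open>Nothing is known about the derivative of \<open>v\<close> outside the patch,
      but there \<open>V\<close> vanishes identically near \<open>x\<close>.\<close>
    have dV: "(V has_derivative (\<lambda>h. h \<bullet> W x)) (at x)" if x: "x \<in> \<Omega>" for x
    proof (cases "x \<in> ball x0 R")
      case True
      have "(V has_derivative (\<lambda>h. cutoff x0 r x * (h \<bullet> G x) + (h \<bullet> cutoff_grad x0 r x) * v x)) (at x)"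
        unfolding V_def using True x by (intro has_derivative_mult cutoff_has_derivative v) auto
      then show ?thesis by (simp add: W_def inner_add_right mult.commute)
    next
      case False
      then have "x \<in> - cball x0 r" using r by auto
      have "((\<lambda>_. 0) has_derivative (\<lambda>_. 0)) (at x)" by simp
      then have "(V has_derivative (\<lambda>_. 0)) (at x)"
        by (rule has_derivative_transform_within_open[of _ _ _ _ "- cball x0 r"])
          (use V0 \<open>x \<in> - cball x0 r\<close> in \<open>auto simp: open_Compl\<close>)
      then show ?thesis using V0(2)[of x] \<open>x \<in> - cball x0 r\<close> by auto
    qed
    define H where "H x = \<bar>\<Phi>' (V x)\<bar> * norm (W x)" for x
    define f where "f x = indicator \<Omega> x * \<bar>\<Phi> (V x)\<bar>" for x
    define F where "F x = M * (indicator \<Omega> x * H x)" for x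
    have cH: "continuous_on UNIV H" unfolding H_def
      by (intro continuous_intros cW continuous_on_compose2[OF c\<Phi>' cV]) auto
    have iH: "integrable lborel (\<lambda>x. indicator \<Omega> x * H x)"
      by (rule integrable_continuous_indicator[of _ x0 r])
        (use cH V0 in \<open>auto simp: H_def\<close>)
    have iF: "integrable lborel F" unfolding F_def using iH by simp
    have mf: "f \<in> borel_measurable borel"
    proof -
      have "continuous_on UNIV (\<lambda>x. \<bar>\<Phi> (V x)\<bar>)"
        by (intro continuous_intros continuous_on_compose2[OF c\<Phi> cV]) auto
      then have [measurable]: "(\<lambda>x. \<bar>\<Phi> (V x)\<bar>) \<in> borel_measurable borel" by (rule borel_measurable_continuous_onI)
      show ?thesis unfolding f_def by measurable
    qed
    have H0: "0 \<le> H x" for x by (simp add: H_def)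
    \<comment> \<open>\<open>V\<close> vanishes at \<open>x + e i\<close>, and the cone condition
      keeps the segment towards this point in \<Omega>. So \<open>f x\<close> is at most an integral
      over the segment, hence over the whole line.\<close>
    have le: "ennreal (f x) \<le> dir_integral (e i) (\<lambda>x. ennreal (F x)) x" for i x
    proof (cases "x \<in> \<Omega> \<inter> ball x0 r")
      case False
      then have "f x = 0" using V0(1)[of x] \<Phi>0 by (auto simp: f_def)
      then show ?thesis by simp
    next
      case True
      have in\<Omega>: "x + t *\<^sub>R e i \<in> \<Omega>" if "t \<in> {0..1}" for t
      proof (cases "t = 0")
        case False
        then show ?thesis using K True T(3)[of i] that r by (auto simp: cone_patch_def e_def)
      qed (use True in auto)
      have "x + 1 *\<^sub>R e i \<notin> ball x0 r"
      proof
        assume *: "x + 1 *\<^sub>R e i \<in> ball x0 r"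
        have "norm (e i) \<le> norm (x + 1 *\<^sub>R e i - x0) + norm (x - x0)"
          using norm_triangle_ineq4[of "x + 1 *\<^sub>R e i - x0" "x - x0"] by simp
        also have "\<dots> < 2 * r" using * True by (simp add: dist_norm norm_minus_commute)
        finally show False using r(3) \<delta>(2)[of i] by simp
      qed
      then have V1: "V (x + 1 *\<^sub>R e i) = 0" by (rule V0)
      let ?\<phi> = "\<lambda>t. \<Phi> (V (x + t *\<^sub>R e i))" and ?\<phi>' = "\<lambda>t. \<Phi>' (V (x + t *\<^sub>R e i)) * (e i \<bullet> W (x + t *\<^sub>R e i))"
      have "ennreal \<bar>?\<phi> 1 - ?\<phi> 0\<bar> \<le> (\<integral>\<^sup>+t. ennreal (F (x + t *\<^sub>R e i)) * indicator {0..1} t \<partial>lborel)"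
      proof (rule abs_le_nn_integral_derivative[where \<phi>' = ?\<phi>'])
        fix t :: real assume t: "t \<in> {0..1}"
        have "((\<lambda>t. x + t *\<^sub>R e i) has_derivative (\<lambda>s. s *\<^sub>R e i)) (at t)"
          by (auto intro!: derivative_eq_intros)
        from has_derivative_compose[OF this dV[OF in\<Omega>[OF t]]]
        have "((\<lambda>t. V (x + t *\<^sub>R e i)) has_real_derivative (e i \<bullet> W (x + t *\<^sub>R e i))) (at t)"
          by (simp add: has_field_derivative_def mult.commute[of "e i \<bullet> _"] mult_commute_abs)
        from DERIV_chain2[OF \<Phi> this]
        show "(?\<phi> has_real_derivative ?\<phi>' t) (at t within {0..1})"
          by (rule has_field_derivative_at_within)
        have "\<bar>e i \<bullet> W (x + t *\<^sub>R e i)\<bar> \<le> M * norm (W (x + t *\<^sub>R e i))"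
          by (rule order_trans[OF Cauchy_Schwarz_ineq2 mult_right_mono[OF M norm_ge_zero]])
        then have "\<bar>\<Phi>' (V (x + t *\<^sub>R e i))\<bar> * \<bar>e i \<bullet> W (x + t *\<^sub>R e i)\<bar>
            \<le> \<bar>\<Phi>' (V (x + t *\<^sub>R e i))\<bar> * (M * norm (W (x + t *\<^sub>R e i)))"
          by (rule mult_left_mono) simp
        then show "\<bar>?\<phi>' t\<bar> \<le> F (x + t *\<^sub>R e i)"
          using in\<Omega>[OF t] by (simp add: F_def H_def abs_mult mult_ac)
      next
        show "continuous_on {0..1} ?\<phi>'"
          by (intro continuous_intros continuous_on_compose2[OF cW] continuous_on_compose2[OF c\<Phi>']
              continuous_on_compose2[OF cV]) auto
      qed
      also have "\<dots> \<le> (\<integral>\<^sup>+t. ennreal (F (x + t *\<^sub>R e i)) \<partial>lborel)"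
        by (intro nn_integral_mono) (auto simp: indicator_def)
      finally show ?thesis using V1 \<Phi>0 True by (simp add: f_def dir_integral_def)
    qed
    have "integrable lborel (\<lambda>x. f x powr m) \<and> (LINT x|lborel. f x powr m) \<le> C0 * (LINT x|lborel. F x) powr m"
    proof (rule C0(2)[OF mf iF _ _ _ le])
      show "0 \<le> f x" "0 \<le> F x" for x using H0 M0 by (simp_all add: f_def F_def)
    qed (use iF in auto)
    moreover have "(LINT x|lborel. F x) powr m = M powr m * (LINT x|lborel. indicator \<Omega> x * H x) powr m"
      unfolding F_def using M0 H0 by (simp add: powr_mult)
    ultimately show "integrable lborel (\<lambda>x. (indicator \<Omega> x * \<bar>\<Phi> (cutoff x0 r x * v x)\<bar>) powr m) \<and>
      (LINT x|lborel. (indicator \<Omega> x * \<bar>\<Phi> (cutoff x0 r x * v x)\<bar>) powr m) \<le>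
      C0 * M powr m * (LINT x|lborel. indicator \<Omega> x * (\<bar>\<Phi>' (cutoff x0 r x * v x)\<bar> * norm (cutoff x0 r x *\<^sub>R G x + v x *\<^sub>R cutoff_grad x0 r x))) powr m"
      by (simp add: f_def H_def V_def W_def mult.assoc)
  qed
qed

text \<open>Besides the bound, integrability of the limit is a conclusion; this is how limits are
  seen to lie in L^q.\<close>

lemma integrable_Fatou:
  fixes h :: "nat \<Rightarrow> 'a \<Rightarrow> real"
  assumes i: "\<And>k. integrable M (h k)" "\<And>k x. 0 \<le> h k x" "\<And>k. (LINT x|M. h k x) \<le> B"
    and lim: "AE x in M. (\<lambda>k. h k x) \<longlonglongrightarrow> g x" and g: "g \<in> borel_measurable M" "\<And>x. 0 \<le> g x"
  shows "integrable M g" "(LINT x|M. g x) \<le> B"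
proof -
  have B: "0 \<le> B" using i(3)[of 0] Bochner_Integration.integral_nonneg[of M "h 0"] i(2) by fastforce
  have "(\<integral>\<^sup>+x. ennreal (g x) \<partial>M) = (\<integral>\<^sup>+x. liminf (\<lambda>k. ennreal (h k x)) \<partial>M)"
    using lim by (intro nn_integral_cong_AE, eventually_elim) (auto intro!: lim_imp_Liminf[symmetric] tendsto_ennrealI)
  also have "\<dots> \<le> liminf (\<lambda>k. \<integral>\<^sup>+x. ennreal (h k x) \<partial>M)"
    using i by (intro nn_integral_liminf) auto
  also have "\<dots> \<le> ennreal B"
    using i by (intro Liminf_le always_eventually) (auto simp: nn_integral_eq_integral intro!: ennreal_leI)
  finally have *: "(\<integral>\<^sup>+x. ennreal (g x) \<partial>M) \<le> ennreal B" .
  then show "integrable M g"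
    using g by (intro integrableI_nonneg) (auto intro: le_less_trans[OF _ ennreal_less_top])
  then show "(LINT x|M. g x) \<le> B"
    using * g B by (subst (asm) nn_integral_eq_integral) auto
qed

text \<open>The crude factor \<open>2 powr p\<close> also covers exponents below 1;
  \<open>Lr_bounded_critical\<close> applies it with \<open>1 / p\<close>.\<close>

lemma powr_add_le:
  fixes a b p :: real
  assumes "0 \<le> a" "0 \<le> b" "0 \<le> p"
  shows "(a + b) powr p \<le> 2 powr p * (a powr p + b powr p)"
proof -
  have "(a + b) powr p \<le> (2 * max a b) powr p"
    using assms by (intro powr_mono2) auto
  also have "\<dots> = 2 powr p * max a b powr p"
    using assms by (simp add: powr_mult)
  also have "max a b powr p \<le> a powr p + b powr p"
    by (auto simp: max_def)
  finally show ?thesis by simp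
qed

lemma sgn_powr_eq:
  fixes s :: real
  shows "\<bar>s\<bar> powr a * sgn s = max 0 s powr a - max 0 (- s) powr a"
  by (auto simp: sgn_if max_def)

text \<open>The exponent \<gamma> makes both the power \<open>\<gamma> * m\<close> from Gagliardo's
  bound and the power \<open>(\<gamma> - 1) * p / (p - 1)\<close> left over by Hoelder equal to
  \<open>q\<close>. The last two identities are the bookkeeping of
  \<open>Sobolev_absorb\<close>.\<close>

lemma Sobolev_exponents:
  fixes N p :: real
  assumes "1 < p" "p < N"
  defines "\<gamma> \<equiv> p * (N - 1) / (N - p)" and "m \<equiv> N / (N - 1)" and "q \<equiv> N * p / (N - p)"
  shows "1 < \<gamma>" "\<gamma> * m = q" "q * (1 - 1 / p) = \<gamma> - 1" "1 - (1 - 1 / p) * m = 1 / \<gamma>" "m * \<gamma> / p = q / p"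
proof -
  have pos: "0 < N - p" "0 < N - 1" "0 < p" using assms(1,2) by auto
  have "N - p < p * (N - 1)"
  proof -
    have "0 < N * (p - 1)" using assms(1,2) by simp
    then show ?thesis by (simp add: algebra_simps)
  qed
  then show "1 < \<gamma>" using pos by (simp add: \<gamma>_def field_simps)
  have "p * M / D * (N / M) = N * p / D" if "M \<noteq> 0" for M D :: real using that by simp
  then show "\<gamma> * m = q" using pos by (simp add: \<gamma>_def m_def q_def)
  then show "m * \<gamma> / p = q / p" by (simp add: mult.commute)
  show "q * (1 - 1 / p) = \<gamma> - 1" using pos by (simp add: \<gamma>_def q_def field_simps)
  have "1 - (1 - 1 / p) * m = (N - p) / (p * (N - 1))" using pos by (simp add: m_def field_simps)
  then show "1 - (1 - 1 / p) * m = 1 / \<gamma>" by (simp add: \<gamma>_def)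
qed

text \<open>
  Here \<open>J powr (1 / p) * I powr (1 - 1 / p)\<close> comes from the Hoelder inequality applied to the
  derivative of \<open>\<bar>v\<bar> powr \<gamma>\<close>; the power of \<open>I\<close> on the right is less than 1 and can be absorbed.
\<close>

lemma Sobolev_absorb:
  fixes I J C \<gamma> m p q :: real
  assumes "0 \<le> I" "0 \<le> J" "0 \<le> C" and le: "I \<le> C * (\<gamma> * (J powr (1 / p) * I powr (1 - 1 / p))) powr m"
    and e: "1 < \<gamma>" "1 - (1 - 1 / p) * m = 1 / \<gamma>" "m * \<gamma> / p = q / p"
  shows "I \<le> (C * \<gamma> powr m) powr \<gamma> * J powr (q / p)"
proof (cases "I = 0")
  case False
  then have I: "0 < I" using assms by simp
  have "I \<le> (C * \<gamma> powr m * J powr (m / p)) * I powr ((1 - 1 / p) * m)"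
    using le assms by (simp add: powr_mult powr_powr mult_ac)
  then have "I * I powr (- ((1 - 1 / p) * m)) \<le> (C * \<gamma> powr m * J powr (m / p)) * I powr ((1 - 1 / p) * m) * I powr (- ((1 - 1 / p) * m))"
    by (rule mult_right_mono) simp
  also have "\<dots> = C * \<gamma> powr m * J powr (m / p)"
    using I by (simp add: mult.assoc flip: powr_add)
  also have "I * I powr (- ((1 - 1 / p) * m)) = I powr (1 - (1 - 1 / p) * m)"
    using I by (simp add: powr_diff powr_minus divide_inverse)
  finally have "I powr (1 / \<gamma>) \<le> C * \<gamma> powr m * J powr (m / p)" unfolding e(2) .
  then have "(I powr (1 / \<gamma>)) powr \<gamma> \<le> (C * \<gamma> powr m * J powr (m / p)) powr \<gamma>"
    using e by (intro powr_mono2) auto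
  then show ?thesis using e I assms(3) by (simp add: powr_powr powr_mult)
qed simp

text \<open>Gagliardo's bound for the power \<gamma> of the cut-off function, then Hoelder to
  separate the gradient, then absorption. For \<open>p = 1\<close> the exponent \<gamma> would be 1,
  and the absolute value is not differentiable at 0; there \<Phi> is the identity.\<close>

lemma Sobolev_patch_smooth:
  fixes x0 :: "real^'n"
  assumes \<Omega>: "open \<Omega>" and K: "cone_patch \<Omega> (ball x0 R) l u" and R: "0 < R" and n: "CARD('n) \<ge> 2"
    and p: "1 \<le> p" "p < real CARD('n)"
  defines "q \<equiv> real CARD('n) * p / (real CARD('n) - p)"
  obtains r C :: real where "0 < r" "0 \<le> C"
    "\<And>v G. (\<And>x. x \<in> ball x0 R \<inter> \<Omega> \<Longrightarrow> (v has_derivative (\<lambda>h. h \<bullet> G x)) (at x)) \<Longrightarrow>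
      continuous_on UNIV v \<Longrightarrow> continuous_on UNIV G \<Longrightarrow>
      integrable lborel (\<lambda>x. (indicator \<Omega> x * \<bar>cutoff x0 r x * v x\<bar>) powr q) \<and>
      (LINT x|lborel. (indicator \<Omega> x * \<bar>cutoff x0 r x * v x\<bar>) powr q) \<le>
      C * (LINT x|lborel. indicator \<Omega> x * norm (cutoff x0 r x *\<^sub>R G x + v x *\<^sub>R cutoff_grad x0 r x) powr p) powr (q / p)"
proof -
  define N where "N = real CARD('n)"
  define m where "m = N / (N - 1)"
  have N: "2 \<le> N" using n by (simp add: N_def)
  have m0: "0 < m" using N by (simp add: m_def)
  obtain r C where rC: "0 < r" "0 \<le> C"
    "\<And>v G \<Phi> \<Phi>'. (\<And>x. x \<in> ball x0 R \<inter> \<Omega> \<Longrightarrow> (v has_derivative (\<lambda>h. h \<bullet> G x)) (at x)) \<Longrightarrow>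
      continuous_on UNIV v \<Longrightarrow> continuous_on UNIV G \<Longrightarrow>
      (\<And>s. (\<Phi> has_real_derivative \<Phi>' s) (at s)) \<Longrightarrow> continuous_on UNIV \<Phi>' \<Longrightarrow> \<Phi> 0 = (0::real) \<Longrightarrow>
      integrable lborel (\<lambda>x. (indicator \<Omega> x * \<bar>\<Phi> (cutoff x0 r x * v x)\<bar>) powr m) \<and>
      (LINT x|lborel. (indicator \<Omega> x * \<bar>\<Phi> (cutoff x0 r x * v x)\<bar>) powr m) \<le>
      C * (LINT x|lborel. indicator \<Omega> x * (\<bar>\<Phi>' (cutoff x0 r x * v x)\<bar> * norm (cutoff x0 r x *\<^sub>R G x + v x *\<^sub>R cutoff_grad x0 r x))) powr m"
    unfolding m_def N_def by (rule Gagliardo_patch[OF \<Omega> K R n]) blast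
  show ?thesis
  proof (cases "p = 1")
    case True
    then have q: "q = m" by (simp add: q_def m_def N_def)
    show ?thesis
    proof (rule that[OF rC(1,2)])
      fix v :: "real^'n \<Rightarrow> real" and G :: "real^'n \<Rightarrow> real^'n"
      assume *: "\<And>x. x \<in> ball x0 R \<inter> \<Omega> \<Longrightarrow> (v has_derivative (\<lambda>h. h \<bullet> G x)) (at x)"
        "continuous_on UNIV v" "continuous_on UNIV G"
      show "integrable lborel (\<lambda>x. (indicator \<Omega> x * \<bar>cutoff x0 r x * v x\<bar>) powr q) \<and>
        (LINT x|lborel. (indicator \<Omega> x * \<bar>cutoff x0 r x * v x\<bar>) powr q) \<le>
        C * (LINT x|lborel. indicator \<Omega> x * norm (cutoff x0 r x *\<^sub>R G x + v x *\<^sub>R cutoff_grad x0 r x) powr p) powr (q / p)"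
        using rC(3)[of v G "\<lambda>s. s" "\<lambda>_. 1", OF *] True q by (simp add: DERIV_ident)
    qed
  next
    case False
    then have p1: "1 < p" "p < N" using p by (auto simp: N_def)
    define \<gamma> where "\<gamma> = p * (N - 1) / (N - p)"
    note e = Sobolev_exponents[OF p1, folded m_def \<gamma>_def, unfolded N_def, folded q_def]
    have q0: "0 < q" using e(2) e(1) m0 by (metis mult_pos_pos less_trans zero_less_one)
    define \<Phi>' where "\<Phi>' s = \<gamma> * \<bar>s\<bar> powr (\<gamma> - 1) * sgn s" for s
    have c: "continuous_on UNIV \<Phi>'"
    proof -
      \<comment> \<open>\<open>sgn\<close> is discontinuous at 0, so the derivative is rewritten as
        a difference of powers of the positive and the negative part.\<close>
      have "continuous_on UNIV (\<lambda>s::real. \<gamma> * (max 0 s powr (\<gamma> - 1) - max 0 (- s) powr (\<gamma> - 1)))"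
        using e(1) by (intro continuous_intros continuous_on_powr') auto
      then show ?thesis by (simp add: \<Phi>'_def[abs_def] mult.assoc sgn_powr_eq)
    qed
    have a\<Phi>': "\<bar>\<Phi>' s\<bar> = \<gamma> * \<bar>s\<bar> powr (\<gamma> - 1)" for s
      using e(1) by (auto simp: \<Phi>'_def abs_mult sgn_if)
    show ?thesis
    proof (rule that[of r "(C * \<gamma> powr m) powr \<gamma>"])
      show "0 < r" by (fact rC)
      show "0 \<le> (C * \<gamma> powr m) powr \<gamma>" by simp
      fix v :: "real^'n \<Rightarrow> real" and G :: "real^'n \<Rightarrow> real^'n"
      assume *: "\<And>x. x \<in> ball x0 R \<inter> \<Omega> \<Longrightarrow> (v has_derivative (\<lambda>h. h \<bullet> G x)) (at x)"
        "continuous_on UNIV v" "continuous_on UNIV G"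
      define V where "V x = cutoff x0 r x * v x" for x
      define W where "W x = cutoff x0 r x *\<^sub>R G x + v x *\<^sub>R cutoff_grad x0 r x" for x
      define I where "I = (LINT x|lborel. (indicator \<Omega> x * \<bar>V x\<bar>) powr q)"
      define J where "J = (LINT x|lborel. indicator \<Omega> x * norm (W x) powr p)"
      have IJ: "0 \<le> I" "0 \<le> J" by (auto simp: I_def J_def)
      have Vq: "(indicator \<Omega> x * \<bar>\<bar>V x\<bar> powr \<gamma>\<bar>) powr m = (indicator \<Omega> x * \<bar>V x\<bar>) powr q" for x
        using m0 q0 e(2) by (auto simp: indicator_def powr_powr)
      have 1: "integrable lborel (\<lambda>x. (indicator \<Omega> x * \<bar>V x\<bar>) powr q)"
        "I \<le> C * (LINT x|lborel. indicator \<Omega> x * (\<gamma> * \<bar>V x\<bar> powr (\<gamma> - 1) * norm (W x))) powr m"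
        using rC(3)[of v G "\<lambda>s. \<bar>s\<bar> powr \<gamma>" \<Phi>', OF * _ c] has_real_derivative_abs_powr[OF e(1)]
        unfolding V_def[symmetric] W_def[symmetric] Vq a\<Phi>' by (auto simp: \<Phi>'_def I_def)
      have iW: "integrable lborel (\<lambda>x. indicator \<Omega> x * norm (W x) powr p)"
      proof (rule integrable_continuous_indicator[of _ x0 r])
        show "continuous_on UNIV (\<lambda>x. norm (W x) powr p)"
          unfolding W_def using p by (intro continuous_intros continuous_on_powr' continuous_on_cutoff *) auto
        show "norm (W x) powr p = 0" if "x \<notin> cball x0 r" for x
          using that cutoff_outside[of r x x0] rC(1) by (simp add: W_def)
      qed (use \<Omega> in auto)
      \<comment> \<open>By the choice of \<gamma>,
        \<open>\<bar>V x\<bar> powr (\<gamma> - 1)\<close> is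
        \<open>(\<bar>V x\<bar> powr q) powr (1 - 1 / p)\<close>, so Hoelder reproduces the very
        integral \<open>I\<close> that is being estimated.\<close>
      have "(LINT x|lborel. indicator \<Omega> x * (\<gamma> * \<bar>V x\<bar> powr (\<gamma> - 1) * norm (W x)))
          = \<gamma> * (LINT x|lborel. (indicator \<Omega> x * norm (W x) powr p) powr (1 / p) * ((indicator \<Omega> x * \<bar>V x\<bar>) powr q) powr (1 - 1 / p))"
      proof -
        have "indicator \<Omega> x * (\<gamma> * \<bar>V x\<bar> powr (\<gamma> - 1) * norm (W x)) = \<gamma> * ((indicator \<Omega> x * norm (W x) powr p) powr (1 / p) * ((indicator \<Omega> x * \<bar>V x\<bar>) powr q) powr (1 - 1 / p))" for x
          using e(3) p1 by (auto simp: indicator_def powr_powr)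
        note eq = this
        show ?thesis unfolding eq by simp
      qed
      also have "\<dots> \<le> \<gamma> * (J powr (1 / p) * I powr (1 - 1 / p))"
        unfolding I_def J_def using 1(1) iW p1 e(1) by (intro mult_left_mono Holder_powr(2)) auto
      finally have 2: "(LINT x|lborel. indicator \<Omega> x * (\<gamma> * \<bar>V x\<bar> powr (\<gamma> - 1) * norm (W x))) \<le> \<gamma> * (J powr (1 / p) * I powr (1 - 1 / p))" .
      have "I \<le> C * (\<gamma> * (J powr (1 / p) * I powr (1 - 1 / p))) powr m"
        by (rule order_trans[OF 1(2)]) (use 2 rC(2) m0 e(1) in \<open>auto intro!: mult_left_mono powr_mono2\<close>)
      then have "I \<le> (C * \<gamma> powr m) powr \<gamma> * J powr (q / p)"
        by (intro Sobolev_absorb IJ rC e) 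
      with 1(1) show "integrable lborel (\<lambda>x. (indicator \<Omega> x * \<bar>cutoff x0 r x * v x\<bar>) powr q) \<and>
        (LINT x|lborel. (indicator \<Omega> x * \<bar>cutoff x0 r x * v x\<bar>) powr q) \<le>
        (C * \<gamma> powr m) powr \<gamma> * (LINT x|lborel. indicator \<Omega> x * norm (cutoff x0 r x *\<^sub>R G x + v x *\<^sub>R cutoff_grad x0 r x) powr p) powr (q / p)"
        by (simp add: I_def J_def V_def W_def)
    qed
  qed
qed

text \<open>The smooth estimate is uniform along the approximations, so Fatou's lemma carries it to
  \<open>f\<close>. Removing the cutoff costs half of the radius.\<close>

lemma Sobolev_patch:
  fixes x0 :: "real^'n"
  assumes \<Omega>: "open \<Omega>" and K: "cone_patch \<Omega> (ball x0 R) l u" and R: "0 < R" and n: "CARD('n) \<ge> 2"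
    and p: "1 \<le> p" "p < real CARD('n)"
  defines "q \<equiv> real CARD('n) * p / (real CARD('n) - p)"
  obtains r C :: real where "0 < r" "0 \<le> C"
    "\<And>f g. weak_pair \<Omega> f g \<Longrightarrow> integrable lborel (\<lambda>x. \<bar>f x\<bar> powr p) \<Longrightarrow> integrable lborel (\<lambda>x. norm (g x) powr p) \<Longrightarrow>
      integrable lborel (\<lambda>x. indicator (ball x0 r) x * \<bar>f x\<bar> powr q) \<and>
      (LINT x|lborel. indicator (ball x0 r) x * \<bar>f x\<bar> powr q)
        \<le> C * ((LINT x|lborel. \<bar>f x\<bar> powr p) + (LINT x|lborel. norm (g x) powr p)) powr (q / p)"
proof -
  have q: "0 < q" using p n by (auto simp: q_def)
  obtain r C where rC: "0 < r" "0 \<le> C"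
    "\<And>v G. (\<And>x. x \<in> ball x0 R \<inter> \<Omega> \<Longrightarrow> (v has_derivative (\<lambda>h. h \<bullet> G x)) (at x)) \<Longrightarrow>
      continuous_on UNIV v \<Longrightarrow> continuous_on UNIV G \<Longrightarrow>
      integrable lborel (\<lambda>x. (indicator \<Omega> x * \<bar>cutoff x0 r x * v x\<bar>) powr q) \<and>
      (LINT x|lborel. (indicator \<Omega> x * \<bar>cutoff x0 r x * v x\<bar>) powr q) \<le>
      C * (LINT x|lborel. indicator \<Omega> x * norm (cutoff x0 r x *\<^sub>R G x + v x *\<^sub>R cutoff_grad x0 r x) powr p) powr (q / p)"
    unfolding q_def by (rule Sobolev_patch_smooth[OF \<Omega> K R n p]) blast
  \<comment> \<open>\<open>r ^ 4\<close> and \<open>4 * r ^ 3\<close> bound the cutoff and its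
    gradient, and the 2 is that of \<open>powr_add_le\<close>; \<open>c\<close> bounds the cutoff
    from below on the half ball.\<close>
  define A where "A = (2 * (r ^ 4 + 4 * r ^ 3)) powr p"
  define c where "c = (3/4 * r\<^sup>2)\<^sup>2"
  have c: "0 < c" using rC by (simp add: c_def)
  have A: "0 \<le> A" by (simp add: A_def)
  have [measurable]: "\<Omega> \<in> sets borel" using \<Omega> by auto
  have [measurable]: "cutoff x0 r \<in> borel_measurable borel"
    by (intro borel_measurable_continuous_onI continuous_on_cutoff)
  show ?thesis
  proof (rule that[of "r / 2" "c powr (- q) * (C * A powr (q / p))"])
    show "0 < r / 2" "0 \<le> c powr (- q) * (C * A powr (q / p))" using rC by auto
    fix f :: "real^'n \<Rightarrow> real" and g :: "real^'n \<Rightarrow> real^'n"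
    assume w: "weak_pair \<Omega> f g" and i: "integrable lborel (\<lambda>x. \<bar>f x\<bar> powr p)" "integrable lborel (\<lambda>x. norm (g x) powr p)"
    define S where "S = (LINT x|lborel. \<bar>f x\<bar> powr p) + (LINT x|lborel. norm (g x) powr p)"
    have [measurable]: "f \<in> borel_measurable borel" using w by (auto simp: weak_pair_def)
    obtain v G where v: "\<And>k x. x \<in> ball x0 R \<inter> \<Omega> \<Longrightarrow> (v k has_derivative (\<lambda>h. h \<bullet> G k x)) (at x)"
      "\<And>k S. continuous_on S (v k)" "\<And>k S. continuous_on S (G k)"
      "\<And>k p. 1 \<le> p \<Longrightarrow> integrable lborel (\<lambda>x. \<bar>f x\<bar> powr p) \<Longrightarrow> integrable lborel (\<lambda>x. \<bar>v k x\<bar> powr p) \<and>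
         (LINT x|lborel. \<bar>v k x\<bar> powr p) \<le> (LINT x|lborel. \<bar>f x\<bar> powr p)"
      "\<And>k p. 1 \<le> p \<Longrightarrow> integrable lborel (\<lambda>x. norm (g x) powr p) \<Longrightarrow> integrable lborel (\<lambda>x. norm (G k x) powr p) \<and>
         (LINT x|lborel. norm (G k x) powr p) \<le> (LINT x|lborel. norm (g x) powr p)"
      "AE x in lborel. (\<lambda>k. v k x) \<longlonglongrightarrow> f x"
      by (rule patch_approximation[OF w K]) blast
    define h where "h k x = (indicator \<Omega> x * \<bar>cutoff x0 r x * v k x\<bar>) powr q" for k x
    have h: "integrable lborel (h k)" "(LINT x|lborel. h k x) \<le> C * (A * S) powr (q / p)" for k
    proof -
      note vk = v(4)[OF p(1) i(1), of k] and Gk = v(5)[OF p(1) i(2), of k]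
      let ?W = "\<lambda>x. cutoff x0 r x *\<^sub>R G k x + v k x *\<^sub>R cutoff_grad x0 r x"
      have W: "norm (?W x) powr p \<le> A * (norm (G k x) powr p + \<bar>v k x\<bar> powr p)" for x
      proof -
        have "norm (?W x) \<le> cutoff x0 r x * norm (G k x) + \<bar>v k x\<bar> * norm (cutoff_grad x0 r x)"
          using cutoff_nonneg[of x0 r x] by (intro norm_triangle_le) simp
        also have "\<dots> \<le> (r ^ 4 + 4 * r ^ 3) * norm (G k x) + \<bar>v k x\<bar> * (r ^ 4 + 4 * r ^ 3)"
          using cutoff_le[of x0 r x] cutoff_grad_le[of r x0 x] rC(1)
          by (intro add_mono mult_mono) (auto intro: add_increasing add_increasing2)
        finally have "norm (?W x) \<le> (r ^ 4 + 4 * r ^ 3) * (norm (G k x) + \<bar>v k x\<bar>)"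
          by (simp add: algebra_simps)
        then have "norm (?W x) powr p \<le> ((r ^ 4 + 4 * r ^ 3) * (norm (G k x) + \<bar>v k x\<bar>)) powr p"
          using p by (intro powr_mono2) auto
        also have "\<dots> = (r ^ 4 + 4 * r ^ 3) powr p * (norm (G k x) + \<bar>v k x\<bar>) powr p"
          using rC(1) by (simp add: powr_mult)
        also have "\<dots> \<le> (r ^ 4 + 4 * r ^ 3) powr p * (2 powr p * (norm (G k x) powr p + \<bar>v k x\<bar> powr p))"
          using p by (intro mult_left_mono powr_add_le) auto
        also have "\<dots> = A * (norm (G k x) powr p + \<bar>v k x\<bar> powr p)"
        proof -
          have "A = 2 powr p * (r ^ 4 + 4 * r ^ 3) powr p"
            unfolding A_def by (subst powr_mult) (use rC(1) in auto)
          then show ?thesis by simp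
        qed
        finally show ?thesis .
      qed
      have iW: "integrable lborel (\<lambda>x. A * (norm (G k x) powr p + \<bar>v k x\<bar> powr p))" using vk Gk by auto
      have "(LINT x|lborel. indicator \<Omega> x * norm (?W x) powr p) \<le> (LINT x|lborel. A * (norm (G k x) powr p + \<bar>v k x\<bar> powr p))"
      proof (rule integral_mono'[OF iW])
        show "indicator \<Omega> x * norm (?W x) powr p \<le> A * (norm (G k x) powr p + \<bar>v k x\<bar> powr p)" for x
          using W[of x] A by (auto simp: indicator_def)
      qed (use A in auto)
      also have "\<dots> \<le> A * S" using vk Gk A by (auto simp: S_def intro!: mult_left_mono)
      finally have J: "(LINT x|lborel. indicator \<Omega> x * norm (?W x) powr p) \<le> A * S" .
      have *: "integrable lborel (h k) \<and> (LINT x|lborel. h k x) \<le> C * (LINT x|lborel. indicator \<Omega> x * norm (?W x) powr p) powr (q / p)"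
        unfolding h_def by (rule rC(3)[OF v(1) v(2) v(3)])
      then show "integrable lborel (h k)" ..
      have "C * (LINT x|lborel. indicator \<Omega> x * norm (?W x) powr p) powr (q / p) \<le> C * (A * S) powr (q / p)"
        using J q p rC(2) by (intro mult_left_mono powr_mono2) auto
      then show "(LINT x|lborel. h k x) \<le> C * (A * S) powr (q / p)" using * by linarith
    qed
    let ?g = "\<lambda>x. (indicator \<Omega> x * \<bar>cutoff x0 r x * f x\<bar>) powr q"
    have lim: "AE x in lborel. (\<lambda>k. h k x) \<longlonglongrightarrow> ?g x"
      using v(6)
    proof eventually_elim
      case (elim x)
      then show ?case unfolding h_def using q
        by (intro tendsto_powr' tendsto_intros) auto
    qed
    have mg: "?g \<in> borel_measurable lborel" by measurable
    have h0: "0 \<le> h k x" "0 \<le> ?g x" for k x by (simp_all add: h_def)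
    note g = integrable_Fatou[OF h(1) h0(1) h(2) lim mg h0(2)]
    have le: "indicator (ball x0 (r / 2)) x * \<bar>f x\<bar> powr q \<le> c powr (- q) * ?g x" for x
    proof (cases "x \<in> ball x0 (r / 2) \<inter> \<Omega>")
      case True
      have "c * \<bar>f x\<bar> \<le> \<bar>cutoff x0 r x * f x\<bar>"
        using cutoff_lower[of r x x0] cutoff_nonneg[of x0 r x] True rC(1) by (auto simp: c_def abs_mult intro: mult_right_mono)
      then have "(c * \<bar>f x\<bar>) powr q \<le> \<bar>cutoff x0 r x * f x\<bar> powr q" using c q by (intro powr_mono2) auto
      then have "c powr (- q) * (c powr q * \<bar>f x\<bar> powr q) \<le> c powr (- q) * \<bar>cutoff x0 r x * f x\<bar> powr q"
        using c by (intro mult_left_mono) (auto simp: powr_mult)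
      also have "c powr (- q) * (c powr q * \<bar>f x\<bar> powr q) = \<bar>f x\<bar> powr q"
        using c by (simp add: mult.assoc[symmetric] flip: powr_add)
      finally show ?thesis using True by simp
    next
      case False
      then show ?thesis using w by (auto simp: weak_pair_def indicator_def)
    qed
    have ig: "integrable lborel (\<lambda>x. c powr (- q) * ?g x)" using g by simp
    show "integrable lborel (\<lambda>x. indicator (ball x0 (r / 2)) x * \<bar>f x\<bar> powr q) \<and>
      (LINT x|lborel. indicator (ball x0 (r / 2)) x * \<bar>f x\<bar> powr q)
        \<le> c powr (- q) * (C * A powr (q / p)) * ((LINT x|lborel. \<bar>f x\<bar> powr p) + (LINT x|lborel. norm (g x) powr p)) powr (q / p)"
    proof
      show "integrable lborel (\<lambda>x. indicator (ball x0 (r / 2)) x * \<bar>f x\<bar> powr q)"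
      proof (rule Bochner_Integration.integrable_bound[OF ig])
        show "(\<lambda>x. indicator (ball x0 (r / 2)) x * \<bar>f x\<bar> powr q) \<in> borel_measurable lborel"
          by (intro borel_measurable_times borel_measurable_indicator) (simp, measurable)
      qed (use le in \<open>auto simp: abs_mult\<close>)
      have "(LINT x|lborel. indicator (ball x0 (r / 2)) x * \<bar>f x\<bar> powr q) \<le> (LINT x|lborel. c powr (- q) * ?g x)"
        by (rule integral_mono'[OF ig le]) auto
      also have "\<dots> \<le> c powr (- q) * (C * (A * S) powr (q / p))" using g by (auto intro: mult_left_mono)
      also have "\<dots> = c powr (- q) * (C * A powr (q / p)) * S powr (q / p)"
        using A by (simp add: powr_mult S_def)
      finally show "(LINT x|lborel. indicator (ball x0 (r / 2)) x * \<bar>f x\<bar> powr q)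
        \<le> c powr (- q) * (C * A powr (q / p)) * ((LINT x|lborel. \<bar>f x\<bar> powr p) + (LINT x|lborel. norm (g x) powr p)) powr (q / p)"
        by (simp add: S_def)
    qed
  qed
qed

section \<open>From patches to the domain\<close>

text \<open>The condition is imposed at all points of the closure, interior ones included, so that
  compactness covers the whole domain by finitely many patches.\<close>

definition uniform_cone :: "(real^'n) set \<Rightarrow> bool" where
  "uniform_cone \<Omega> \<longleftrightarrow> open \<Omega> \<and> bounded \<Omega> \<and> (\<forall>x0\<in>closure \<Omega>. \<exists>R l u. 0 < R \<and> cone_patch \<Omega> (ball x0 R) l u)"

lemma uniform_cone_finite_cover:
  assumes "uniform_cone \<Omega>" "\<And>x. x \<in> closure \<Omega> \<Longrightarrow> 0 < r x"
  obtains X where "finite X" "X \<subseteq> closure \<Omega>" "closure \<Omega> \<subseteq> (\<Union>x\<in>X. ball x (r x))"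
proof -
  have "compact (closure \<Omega>)" using assms by (simp add: uniform_cone_def)
  moreover have "closure \<Omega> \<subseteq> (\<Union>x\<in>closure \<Omega>. ball x (r x))" using assms(2) by auto
  ultimately show ?thesis
    by (metis (no_types, lifting) compactE_image open_ball that)
qed

text \<open>The local constants do not depend on the function, so the estimates of a finite cover
  can be added.\<close>

lemma Sobolev_uniform_cone:
  fixes \<Omega> :: "(real^'n) set"
  assumes U: "uniform_cone \<Omega>" and n: "CARD('n) \<ge> 2" and p: "1 \<le> p" "p < real CARD('n)"
  defines "q \<equiv> real CARD('n) * p / (real CARD('n) - p)"
  obtains C :: real where "0 \<le> C"
    "\<And>f g. weak_pair \<Omega> f g \<Longrightarrow> integrable lborel (\<lambda>x. \<bar>f x\<bar> powr p) \<Longrightarrow> integrable lborel (\<lambda>x. norm (g x) powr p) \<Longrightarrow>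
      integrable lborel (\<lambda>x. \<bar>f x\<bar> powr q) \<and> (LINT x|lborel. \<bar>f x\<bar> powr q)
        \<le> C * ((LINT x|lborel. \<bar>f x\<bar> powr p) + (LINT x|lborel. norm (g x) powr p)) powr (q / p)"
proof -
  define P where "P x0 r C \<longleftrightarrow> 0 < r \<and> 0 \<le> C \<and> (\<forall>f g. weak_pair \<Omega> f g \<longrightarrow> integrable lborel (\<lambda>x. \<bar>f x\<bar> powr p) \<longrightarrow> integrable lborel (\<lambda>x. norm (g x) powr p) \<longrightarrow>
      integrable lborel (\<lambda>x. indicator (ball x0 r) x * \<bar>f x\<bar> powr q) \<and>
      (LINT x|lborel. indicator (ball x0 r) x * \<bar>f x\<bar> powr q)
        \<le> C * ((LINT x|lborel. \<bar>f x\<bar> powr p) + (LINT x|lborel. norm (g x) powr p)) powr (q / p))" for x0 r C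
  have "\<exists>r C. P x0 r C" if x0: "x0 \<in> closure \<Omega>" for x0
  proof -
    obtain R l u where R: "0 < R" "cone_patch \<Omega> (ball x0 R) l u" using U x0 unfolding uniform_cone_def by blast
    have o: "open \<Omega>" using U by (simp add: uniform_cone_def)
    show ?thesis unfolding P_def q_def
      by (rule Sobolev_patch[OF o R(2,1) n p]) blast
  qed
  then obtain r C where P: "\<And>x0. x0 \<in> closure \<Omega> \<Longrightarrow> P x0 (r x0) (C x0)" by metis
  obtain X where X: "finite X" "X \<subseteq> closure \<Omega>" "closure \<Omega> \<subseteq> (\<Union>x\<in>X. ball x (r x))"
    by (rule uniform_cone_finite_cover[OF U, of r]) (use P in \<open>auto simp: P_def\<close>)
  show ?thesis
  proof (rule that[of "\<Sum>x\<in>X. C x"])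
    show "0 \<le> (\<Sum>x\<in>X. C x)" using P X by (intro sum_nonneg) (auto simp: P_def)
    fix f :: "real^'n \<Rightarrow> real" and g :: "real^'n \<Rightarrow> real^'n"
    assume w: "weak_pair \<Omega> f g" and i: "integrable lborel (\<lambda>x. \<bar>f x\<bar> powr p)" "integrable lborel (\<lambda>x. norm (g x) powr p)"
    have [measurable]: "f \<in> borel_measurable borel" using w by (auto simp: weak_pair_def)
    let ?S = "((LINT x|lborel. \<bar>f x\<bar> powr p) + (LINT x|lborel. norm (g x) powr p)) powr (q / p)"
    let ?h = "\<lambda>y. \<Sum>x\<in>X. indicator (ball x (r x)) y * \<bar>f y\<bar> powr q"
    have *: "integrable lborel (\<lambda>y. indicator (ball x (r x)) y * \<bar>f y\<bar> powr q)"
      "(LINT y|lborel. indicator (ball x (r x)) y * \<bar>f y\<bar> powr q) \<le> C x * ?S" if "x \<in> X" for x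
      using P[of x] that X w i unfolding P_def by blast+
    have ih: "integrable lborel ?h" using * by (intro Bochner_Integration.integrable_sum)
    have le: "\<bar>f y\<bar> powr q \<le> ?h y" for y
    proof (cases "y \<in> \<Omega>")
      case True
      then obtain x where x: "x \<in> X" "y \<in> ball x (r x)" using X closure_subset by blast
      have "\<bar>f y\<bar> powr q = indicator (ball x (r x)) y * \<bar>f y\<bar> powr q" using x by simp
      also have "\<dots> \<le> ?h y" by (rule member_le_sum) (use x X in auto)
      finally show ?thesis .
    next
      case False
      then show ?thesis using w by (auto simp: weak_pair_def intro!: sum_nonneg)
    qed
    show "integrable lborel (\<lambda>x. \<bar>f x\<bar> powr q) \<and> (LINT x|lborel. \<bar>f x\<bar> powr q) \<le> (\<Sum>x\<in>X. C x) * ?S"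
    proof
      show "integrable lborel (\<lambda>x. \<bar>f x\<bar> powr q)"
        by (rule Bochner_Integration.integrable_bound[OF ih]) (use le in \<open>auto intro: order_trans[OF _ abs_ge_self]\<close>)
      have "(LINT x|lborel. \<bar>f x\<bar> powr q) \<le> (LINT y|lborel. ?h y)"
        by (rule integral_mono'[OF ih le]) (auto intro!: sum_nonneg)
      also have "\<dots> = (\<Sum>x\<in>X. LINT y|lborel. indicator (ball x (r x)) y * \<bar>f y\<bar> powr q)"
        using * by (intro Bochner_Integration.integral_sum)
      also have "\<dots> \<le> (\<Sum>x\<in>X. C x * ?S)" using * by (intro sum_mono)
      finally show "(LINT x|lborel. \<bar>f x\<bar> powr q) \<le> (\<Sum>x\<in>X. C x) * ?S" by (simp add: sum_distrib_right)
    qed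
  qed
qed

section \<open>Morrey's inequality on uniform cone domains\<close>

lemma lborel_affine_integral:
  fixes h :: "'a::euclidean_space \<Rightarrow> real"
  assumes h: "integrable lborel h" and c: "0 < c"
  shows "integrable lborel (\<lambda>z. h (x + c *\<^sub>R z))"
    and "(LINT z|lborel. h (x + c *\<^sub>R z)) = (LINT z|lborel. h z) / c ^ DIM('a)"
proof -
  let ?D = "distr lborel borel (\<lambda>z. x + c *\<^sub>R z)"
  have m [measurable]: "h \<in> borel_measurable borel" using h by auto
  have eq: "lborel = density ?D (\<lambda>_. ennreal (c ^ DIM('a)))"
    using lborel_affine[of c x] c by simp
  have "integrable (density ?D (\<lambda>_. ennreal (c ^ DIM('a)))) h" using h eq by simp
  then have "integrable ?D (\<lambda>z. c ^ DIM('a) *\<^sub>R h z)"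
    using c by (subst (asm) integrable_density) auto
  then show "integrable lborel (\<lambda>z. h (x + c *\<^sub>R z))"
    using c by (subst (asm) integrable_distr_eq) auto
  have "(LINT z|lborel. h z) = (LINT z|density ?D (\<lambda>_. ennreal (c ^ DIM('a))). h z)" using eq by simp
  also have "\<dots> = (LINT z|?D. c ^ DIM('a) *\<^sub>R h z)"
    using c by (subst integral_density) auto
  also have "\<dots> = c ^ DIM('a) * (LINT z|lborel. h (x + c *\<^sub>R z))"
    by (subst integral_distr) auto
  finally show "(LINT z|lborel. h (x + c *\<^sub>R z)) = (LINT z|lborel. h z) / c ^ DIM('a)"
    using c by simp
qed

lemma nn_integral_powr_unit:
  fixes \<alpha> :: real
  assumes "0 < \<alpha>"
  shows "(\<integral>\<^sup>+t. ennreal (t powr (\<alpha> - 1)) * indicator {0..1} t \<partial>lborel) = ennreal (1 / \<alpha>)"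
proof -
  have "((\<lambda>t. t powr (\<alpha> - 1)) has_integral (1 powr (\<alpha> - 1 + 1) / (\<alpha> - 1 + 1))) {0..1}"
    using assms by (intro has_integral_powr_from_0) auto
  then have "((\<lambda>t. if t \<in> {0..1} then t powr (\<alpha> - 1) else 0) has_integral (1 / \<alpha>)) UNIV"
    by (subst has_integral_restrict_UNIV) simp
  then have "(\<integral>\<^sup>+t. ennreal (if t \<in> {0..1} then t powr (\<alpha> - 1) else 0) \<partial>lborel) = ennreal (1 / \<alpha>)"
    by (intro nn_integral_has_integral_lborel) auto
  also have "(\<integral>\<^sup>+t. ennreal (if t \<in> {0..1} then t powr (\<alpha> - 1) else 0) \<partial>lborel)
      = (\<integral>\<^sup>+t. ennreal (t powr (\<alpha> - 1)) * indicator {0..1} t \<partial>lborel)"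
    by (intro nn_integral_cong) (auto simp: indicator_def)
  finally show ?thesis .
qed

text \<open>Rescaling by \<open>c\<close> has Jacobian \<open>c ^ DIM('a)\<close>; under the
  \<open>p\<close>-th root it leaves \<open>c powr (- (DIM('a) / p))\<close>, the singularity that
  Morrey's argument integrates.\<close>

lemma ball_average_Holder:
  fixes H :: "'a::euclidean_space \<Rightarrow> real" and p :: real
  assumes H: "\<And>x. 0 \<le> H x" "integrable lborel (\<lambda>x. H x powr p)" and p: "1 < p" and c: "0 < c"
    and [measurable]: "H \<in> borel_measurable borel"
  shows "(\<integral>\<^sup>+z. indicator (ball a s) z * ennreal (H (x + c *\<^sub>R z)) \<partial>lborel)
    \<le> ennreal (measure lborel (ball a s) powr (1 - 1 / p) * c powr (- (real DIM('a) / p)) * (LINT x|lborel. H x powr p) powr (1 / p))"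
proof -
  let ?F = "\<lambda>z. H (x + c *\<^sub>R z) powr p"
  note F = lborel_affine_integral[OF H(2) c, of x]
  have b: "integrable lborel (indicator (ball a s) :: 'a \<Rightarrow> real)"
    using emeasure_bounded_finite[OF bounded_ball[of a s]] by (intro integrable_real_indicator) auto
  have eq: "?F z powr (1 / p) * indicator (ball a s) z powr (1 - 1 / p) = indicator (ball a s) z * H (x + c *\<^sub>R z)" for z
    using p H(1) by (auto simp: indicator_def powr_powr)
  note ho = Holder_powr[OF F(1) _ b _, of "1 / p", unfolded eq]
  have i: "integrable lborel (\<lambda>z. indicator (ball a s) z * H (x + c *\<^sub>R z))"
    using p by (intro ho(1)) auto
  have "(\<integral>\<^sup>+z. indicator (ball a s) z * ennreal (H (x + c *\<^sub>R z)) \<partial>lborel)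
      = (\<integral>\<^sup>+z. ennreal (indicator (ball a s) z * H (x + c *\<^sub>R z)) \<partial>lborel)"
    by (intro nn_integral_cong) (auto simp: indicator_def)
  also have "\<dots> = ennreal (LINT z|lborel. indicator (ball a s) z * H (x + c *\<^sub>R z))"
    using H(1) by (intro nn_integral_eq_integral i) auto
  also have "\<dots> \<le> ennreal ((LINT z|lborel. ?F z) powr (1 / p) * (LINT z|lborel. indicator (ball a s) z) powr (1 - 1 / p))"
    using p by (intro ennreal_leI ho(2)) auto
  also have "(LINT z|lborel. ?F z) powr (1 / p) = (LINT x|lborel. H x powr p) powr (1 / p) * c powr (- (real DIM('a) / p))"
  proof -
    have "(Q / c ^ DIM('a)) powr (1 / p) = Q powr (1 / p) / (c powr DIM('a)) powr (1 / p)" if "0 \<le> Q" for Q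
      using c that by (simp add: powr_divide powr_realpow)
    then have "(Q / c ^ DIM('a)) powr (1 / p) = Q powr (1 / p) * c powr (- (real DIM('a) / p))" if "0 \<le> Q" for Q
      using that by (simp add: powr_powr powr_minus_divide)
    then show ?thesis unfolding F(2) by simp
  qed
  finally show ?thesis by (simp add: mult_ac)
qed

text \<open>The difference is an integral of the gradient along the segment from \<open>x\<close> to
  \<open>x + d *\<^sub>R z\<close>, averaged over \<open>z\<close>. Hoelder bounds the slice at time
  \<open>t\<close> by a multiple of \<open>(t * d) powr (- (DIM('a) / p))\<close>, which is
  integrable at \<open>t = 0\<close> because \<open>p\<close> exceeds the dimension; together with
  the factor \<open>d\<close> from the velocity it leaves \<open>d powr \<alpha>\<close>.\<close>

lemma Morrey_average:
  fixes v :: "'a::euclidean_space \<Rightarrow> real" and p :: real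
  assumes c: "continuous_on UNIV v" "continuous_on UNIV G"
    and d: "0 < d" and M: "\<And>z. z \<in> ball a s \<Longrightarrow> norm z \<le> M"
    and v: "\<And>z t. z \<in> ball a s \<Longrightarrow> t \<in> {0..1} \<Longrightarrow>
      (v has_derivative (\<lambda>h. h \<bullet> G (x + (t * d) *\<^sub>R z))) (at (x + (t * d) *\<^sub>R z))"
    and p: "DIM('a) < p" and G: "integrable lborel (\<lambda>x. norm (G x) powr p)"
  defines "\<alpha> \<equiv> 1 - DIM('a) / p"
  shows "(\<integral>\<^sup>+z. indicator (ball a s) z * ennreal \<bar>v (x + d *\<^sub>R z) - v x\<bar> \<partial>lborel)
    \<le> ennreal (M * measure lborel (ball a s) powr (1 - 1 / p) / \<alpha> * d powr \<alpha> * (LINT x|lborel. norm (G x) powr p) powr (1 / p))"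
proof (cases "ball a s = {}")
  case False
  define B where "B = ball a s"
  define Q where "Q = (LINT x|lborel. norm (G x) powr p) powr (1 / p)"
  define A where "A = measure lborel B powr (1 - 1 / p)"
  have [measurable]: "v \<in> borel_measurable borel" "G \<in> borel_measurable borel" "B \<in> sets borel"
    using c by (auto intro: borel_measurable_continuous_onI simp: B_def)
  have M0: "0 \<le> M" using M False by (meson all_not_in_conv norm_ge_zero order_trans)
  have p1: "1 < p" using p DIM_positive[where 'a='a] by linarith
  have \<alpha>: "0 < \<alpha>" using p p1 by (simp add: \<alpha>_def)
  have QA: "0 \<le> Q" "0 \<le> A" by (auto simp: Q_def A_def)
  have 1: "ennreal \<bar>v (x + d *\<^sub>R z) - v x\<bar> \<le> (\<integral>\<^sup>+t. ennreal (d * M) * (indicator {0..1} t * ennreal (norm (G (x + (t * d) *\<^sub>R z)))) \<partial>lborel)"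
    if z: "z \<in> B" for z
  proof -
    let ?\<phi> = "\<lambda>t. v (x + (t * d) *\<^sub>R z)" and ?\<phi>' = "\<lambda>t. (d *\<^sub>R z) \<bullet> G (x + (t * d) *\<^sub>R z)"
    have "ennreal \<bar>?\<phi> 1 - ?\<phi> 0\<bar> \<le> (\<integral>\<^sup>+t. ennreal (d * M * norm (G (x + (t * d) *\<^sub>R z))) * indicator {0..1} t \<partial>lborel)"
    proof (rule abs_le_nn_integral_derivative[where \<phi>' = ?\<phi>'])
      fix t :: real assume t: "t \<in> {0..1}"
      have "((\<lambda>t. x + (t * d) *\<^sub>R z) has_derivative (\<lambda>s. (s * d) *\<^sub>R z)) (at t)"
        by (auto intro!: derivative_eq_intros)
      from has_derivative_compose[OF this v[OF z[unfolded B_def] t]]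
      have "(?\<phi> has_real_derivative ?\<phi>' t) (at t)"
        by (simp add: has_field_derivative_def mult_commute_abs mult_ac)
      then show "(?\<phi> has_real_derivative ?\<phi>' t) (at t within {0..1})" by (rule has_field_derivative_at_within)
      have "\<bar>?\<phi>' t\<bar> \<le> norm (d *\<^sub>R z) * norm (G (x + (t * d) *\<^sub>R z))" by (rule Cauchy_Schwarz_ineq2)
      also have "\<dots> \<le> d * M * norm (G (x + (t * d) *\<^sub>R z))"
        using d M[of z] z by (intro mult_right_mono) (auto simp: B_def)
      finally show "\<bar>?\<phi>' t\<bar> \<le> d * M * norm (G (x + (t * d) *\<^sub>R z))" .
    next
      show "continuous_on {0..1} ?\<phi>'"
        by (intro continuous_intros continuous_on_compose2[OF c(2)]) auto
    qed
    also have "\<dots> = (\<integral>\<^sup>+t. ennreal (d * M) * (indicator {0..1} t * ennreal (norm (G (x + (t * d) *\<^sub>R z)))) \<partial>lborel)"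
      using d M0 by (intro nn_integral_cong) (auto simp: ennreal_mult' mult_ac)
    finally show ?thesis by simp
  qed
  have "(\<integral>\<^sup>+z. indicator B z * ennreal \<bar>v (x + d *\<^sub>R z) - v x\<bar> \<partial>lborel)
    \<le> (\<integral>\<^sup>+z. (\<integral>\<^sup>+t. indicator B z * (ennreal (d * M) * (indicator {0..1} t * ennreal (norm (G (x + (t * d) *\<^sub>R z))))) \<partial>lborel) \<partial>lborel)"
    using 1 by (intro nn_integral_mono) (auto simp: nn_integral_cmult indicator_def)
  also have "\<dots> = (\<integral>\<^sup>+t. (\<integral>\<^sup>+z. indicator B z * (ennreal (d * M) * (indicator {0..1} t * ennreal (norm (G (x + (t * d) *\<^sub>R z))))) \<partial>lborel) \<partial>lborel)"
    by (rule lborel_pair.Fubini') measurable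
  also have "\<dots> = (\<integral>\<^sup>+t. ennreal (d * M) * (indicator {0..1} t * (\<integral>\<^sup>+z. indicator B z * ennreal (norm (G (x + (t * d) *\<^sub>R z))) \<partial>lborel)) \<partial>lborel)"
    by (intro nn_integral_cong) (simp add: nn_integral_cmult[symmetric] mult_ac)
  also have "\<dots> \<le> (\<integral>\<^sup>+t. ennreal (M * A * d powr \<alpha> * Q) * (ennreal (t powr (\<alpha> - 1)) * indicator {0..1} t) \<partial>lborel)"
  proof (rule nn_integral_mono_AE)
    \<comment> \<open>\<open>ball_average_Holder\<close> applies to positive scales, so
      \<open>t = 0\<close> is left out.\<close>
    have "AE t in lborel. t \<noteq> (0::real)" by (rule AE_lborel_singleton)
    then show "AE t in lborel. ennreal (d * M) * (indicator {0..1} t * (\<integral>\<^sup>+z. indicator B z * ennreal (norm (G (x + (t * d) *\<^sub>R z))) \<partial>lborel))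
      \<le> ennreal (M * A * d powr \<alpha> * Q) * (ennreal (t powr (\<alpha> - 1)) * indicator {0..1} t)"
    proof eventually_elim
      case (elim t)
      show ?case
      proof (cases "t \<in> {0..1}")
        case True
        then have t: "0 < t" using elim by auto
        have "(\<integral>\<^sup>+z. indicator B z * ennreal (norm (G (x + (t * d) *\<^sub>R z))) \<partial>lborel) \<le> ennreal (A * (t * d) powr (- (real DIM('a) / p)) * Q)"
          unfolding A_def B_def Q_def by (rule ball_average_Holder[OF _ G p1]) (use t d in auto)
        then have "ennreal (d * M) * (\<integral>\<^sup>+z. indicator B z * ennreal (norm (G (x + (t * d) *\<^sub>R z))) \<partial>lborel)
            \<le> ennreal (d * M) * ennreal (A * (t * d) powr (- (real DIM('a) / p)) * Q)"
          by (intro mult_left_mono) auto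
        also have "\<dots> = ennreal (d * M * (A * (t * d) powr (- (real DIM('a) / p)) * Q))"
          using d M0 QA by (intro ennreal_mult[symmetric]) auto
        also have "d * M * (A * (t * d) powr (- (real DIM('a) / p)) * Q) = M * A * (d powr 1 * d powr (- (real DIM('a) / p))) * Q * t powr (- (real DIM('a) / p))"
          using t d by (simp add: powr_mult)
        also have "\<dots> = M * A * d powr \<alpha> * Q * t powr (\<alpha> - 1)"
          unfolding powr_add[symmetric] by (simp add: \<alpha>_def)
        also have "ennreal \<dots> = ennreal (M * A * d powr \<alpha> * Q) * ennreal (t powr (\<alpha> - 1))"
          using M0 QA by (intro ennreal_mult) auto
        finally show ?thesis using True by simp
      qed simp
    qed
  qed
  also have "\<dots> = ennreal (M * A * d powr \<alpha> * Q) * ennreal (1 / \<alpha>)"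
    by (subst nn_integral_cmult) (auto simp: nn_integral_powr_unit[OF \<alpha>])
  also have "\<dots> = ennreal (M * A * d powr \<alpha> * Q * (1 / \<alpha>))"
    using M0 QA \<alpha> by (intro ennreal_mult[symmetric]) auto
  also have "M * A * d powr \<alpha> * Q * (1 / \<alpha>) = M * A / \<alpha> * d powr \<alpha> * Q" by simp
  finally show ?thesis by (simp add: A_def B_def Q_def)
next
  case True
  show ?thesis unfolding True by simp
qed

text \<open>Two points at distance \<open>\<rho> * d\<close> have overlapping cone pieces:
  \<open>B\<close>, scaled by \<open>d\<close> and attached to \<open>x\<close> or to
  \<open>y\<close>, contains in both cases \<open>B1\<close>, scaled by \<open>d\<close> and
  attached to \<open>x\<close>. Comparing \<open>v x\<close> and \<open>v y\<close> with the values
  on the common part gives the Hoelder bound; comparing \<open>v x\<close> with the values on the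
  largest piece bounds \<open>v\<close> itself.\<close>

lemma Morrey_patch_smooth:
  fixes x0 :: "real^'n" and p :: real
  assumes K: "cone_patch \<Omega> (ball x0 R) l u" and R: "0 < R" and p: "CARD('n) < p"
  defines "\<alpha> \<equiv> 1 - CARD('n) / p"
  obtains r C :: real where "0 < r" "0 \<le> C"
    "\<And>v G x. (\<And>x. x \<in> ball x0 R \<inter> \<Omega> \<Longrightarrow> (v has_derivative (\<lambda>h. h \<bullet> G x)) (at x)) \<Longrightarrow>
      continuous_on UNIV v \<Longrightarrow> continuous_on UNIV G \<Longrightarrow>
      integrable lborel (\<lambda>x. \<bar>v x\<bar> powr p) \<Longrightarrow> integrable lborel (\<lambda>x. norm (G x) powr p) \<Longrightarrow> x \<in> \<Omega> \<inter> ball x0 r \<Longrightarrow>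
      \<bar>v x\<bar> \<le> C * ((LINT x|lborel. \<bar>v x\<bar> powr p) powr (1 / p) + (LINT x|lborel. norm (G x) powr p) powr (1 / p))"
    "\<And>v G x y. (\<And>x. x \<in> ball x0 R \<inter> \<Omega> \<Longrightarrow> (v has_derivative (\<lambda>h. h \<bullet> G x)) (at x)) \<Longrightarrow>
      continuous_on UNIV v \<Longrightarrow> continuous_on UNIV G \<Longrightarrow>
      integrable lborel (\<lambda>x. norm (G x) powr p) \<Longrightarrow> x \<in> \<Omega> \<inter> ball x0 r \<Longrightarrow> y \<in> \<Omega> \<inter> ball x0 r \<Longrightarrow>
      \<bar>v x - v y\<bar> \<le> C * norm (x - y) powr \<alpha> * (LINT x|lborel. norm (G x) powr p) powr (1 / p)"
proof -
  have "1 \<le> real CARD('n)" by (simp add: Suc_le_eq)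
  then have p1: "1 < p" using p by linarith
  have \<alpha>: "0 < \<alpha>" using p p1 by (simp add: \<alpha>_def)
  obtain a where "a \<in> box l u" using K by (auto simp: cone_patch_def)
  then obtain \<rho>' where \<rho>': "\<rho>' > 0" "ball a \<rho>' \<subseteq> box l u" using open_box open_contains_ball by blast
  define \<rho> where "\<rho> = \<rho>' / 2"
  have \<rho>: "0 < \<rho>" "ball a (2 * \<rho>) \<subseteq> cbox l u" using \<rho>' box_subset_cbox by (auto simp: \<rho>_def)
  obtain M where M: "0 < M" "\<And>z. z \<in> cbox l u \<Longrightarrow> norm z \<le> M"
    using bounded_cbox[of l u] by (auto simp: bounded_pos)
  \<comment> \<open>Points of \<open>ball x0 r\<close> are less than
    \<open>2 * r = \<rho> * d0\<close> apart, so \<open>d0\<close> is the largest scale that occurs.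
    The first entry of the minimum gives \<open>d0 \<le> 1\<close>, the second
    \<open>r + d0 * M \<le> R\<close>, which keeps all segments in the patch.\<close>
  define r where "r = min (\<rho> / 2) (R / (1 + 2 * M / \<rho>))"
  define d0 where "d0 = 2 * r / \<rho>"
  have pos: "0 < 1 + 2 * M / \<rho>" using M \<rho> by (simp add: add_pos_pos)
  have r: "0 < r" using \<rho> R pos by (simp add: r_def)
  have d0: "0 < d0" "d0 \<le> 1" using r \<rho> by (auto simp: d0_def r_def field_simps)
  have rR: "r + d0 * M \<le> R"
  proof -
    have "r * (1 + 2 * M / \<rho>) \<le> R" using pos by (simp add: r_def pos_le_divide_eq[symmetric])
    then show ?thesis by (simp add: d0_def algebra_simps)
  qed
  define B where "B = ball a (2 * \<rho>)"
  define B1 where "B1 = ball a \<rho>"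
  have [measurable]: "B \<in> sets borel" "B1 \<in> sets borel" by (auto simp: B_def B1_def)
  define b where "b = measure lborel B"
  define b1 where "b1 = measure lborel B1"
  have b: "0 < b" "0 < b1" using \<rho> content_ball_pos[of "2 * \<rho>" a] content_ball_pos[of \<rho> a]
    by (auto simp: b_def b1_def B_def B1_def)
  have eb: "emeasure lborel B = ennreal b" "emeasure lborel B1 = ennreal b1"
    using emeasure_bounded_finite[OF bounded_ball[of a "2 * \<rho>"]] emeasure_bounded_finite[OF bounded_ball[of a \<rho>]]
    by (auto simp: b_def b1_def B_def B1_def intro!: emeasure_eq_ennreal_measure)
  define C1 where "C1 = M * b powr (1 - 1 / p) / \<alpha>"
  have C1: "0 \<le> C1" using M \<alpha> by (simp add: C1_def)
  \<comment> \<open>The first entry belongs to the Hoelder bound; the other two are the coefficients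
    of the gradient and of the function in the bound for \<open>v\<close>.\<close>
  define C where "C = max (2 * C1 * \<rho> powr (- \<alpha>) / b1) (max (C1 * d0 powr \<alpha> / b) (b powr (1 - 1 / p) * d0 powr (- (CARD('n) / p)) / b))"
  have avg: "(\<integral>\<^sup>+z. indicator B z * ennreal \<bar>v (x + d *\<^sub>R z) - v x\<bar> \<partial>lborel)
      \<le> ennreal (C1 * d powr \<alpha> * (LINT x|lborel. norm (G x) powr p) powr (1 / p))"
    if v: "\<And>x. x \<in> ball x0 R \<inter> \<Omega> \<Longrightarrow> (v has_derivative (\<lambda>h. h \<bullet> G x)) (at x)"
      and c: "continuous_on UNIV v" "continuous_on UNIV G" "integrable lborel (\<lambda>x. norm (G x) powr p)"
      and x: "x \<in> \<Omega> \<inter> ball x0 r" and d: "0 < d" "d \<le> d0" for v G x d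
  proof -
    have in_K: "x + (t * d) *\<^sub>R z \<in> ball x0 R \<inter> \<Omega>" if z: "z \<in> B" and t: "t \<in> {0..1}" for z t
    proof
      have zc: "z \<in> cbox l u" using z \<rho> by (auto simp: B_def)
      have "t * d \<le> 1 * d0" using t d by (intro mult_mono) auto
      moreover have "0 \<le> t * d" using t d by simp
      ultimately have td: "0 \<le> t * d" "t * d \<le> d0" by auto
      have "norm (x + (t * d) *\<^sub>R z - x0) \<le> norm (x - x0) + norm ((t * d) *\<^sub>R z)"
        by (metis add_diff_eq add.commute add_diff_cancel_left' diff_add_eq norm_triangle_ineq)
      also have "\<dots> < r + d0 * M"
      proof (rule add_less_le_mono)
        show "norm (x - x0) < r" using x by (simp add: dist_norm norm_minus_commute)
        show "norm ((t * d) *\<^sub>R z) \<le> d0 * M"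
          using td M(2)[OF zc] d0 by (auto simp: abs_mult[symmetric] intro!: mult_mono)
      qed
      finally show "x + (t * d) *\<^sub>R z \<in> ball x0 R" using rR by (simp add: dist_norm norm_minus_commute)
      show "x + (t * d) *\<^sub>R z \<in> \<Omega>"
      proof (cases "t = 0")
        case False
        have "x \<in> ball x0 R" using x rR d0 M(1) by (auto intro: less_le_trans simp: mult_nonneg_nonneg)
           (smt (verit) mult_nonneg_nonneg)
        moreover have "0 < t * d" "t * d \<le> 1" using False t d d0 td by auto
        ultimately show ?thesis using K x zc by (auto simp: cone_patch_def)
      qed (use x in auto)
    qed
    show ?thesis
      using Morrey_average[of v G d a "2 * \<rho>" M x p] c d M(2) \<rho>(2) v[OF in_K] p
      unfolding B_def C1_def b_def \<alpha>_def by (auto simp: subset_iff)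
  qed
  show ?thesis
  proof (rule that[of r C])
    show "0 < r" by (fact r)
    show C0: "0 \<le> C" using C1 b \<rho> by (auto simp: C_def le_max_iff_disj)
    fix v :: "real^'n \<Rightarrow> real" and G :: "real^'n \<Rightarrow> real^'n" and x
    assume v: "\<And>x. x \<in> ball x0 R \<inter> \<Omega> \<Longrightarrow> (v has_derivative (\<lambda>h. h \<bullet> G x)) (at x)"
      and c: "continuous_on UNIV v" "continuous_on UNIV G" and iG: "integrable lborel (\<lambda>x. norm (G x) powr p)"
      and x: "x \<in> \<Omega> \<inter> ball x0 r"
    have [measurable]: "v \<in> borel_measurable borel" using c by (auto intro: borel_measurable_continuous_onI)
    define Q where "Q = (LINT x|lborel. norm (G x) powr p) powr (1 / p)"
    have Q: "0 \<le> Q" by (simp add: Q_def)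
    note avg' = avg[OF v c iG, folded Q_def]
    {
      assume iv: "integrable lborel (\<lambda>x. \<bar>v x\<bar> powr p)"
      define P where "P = (LINT x|lborel. \<bar>v x\<bar> powr p) powr (1 / p)"
      have P: "0 \<le> P" by (simp add: P_def)
      \<comment> \<open>At scale \<open>d0\<close>, \<open>\<bar>v x\<bar>\<close> is at most a mean
        of \<open>\<bar>v\<bar>\<close> plus the mean deviation from \<open>v x\<close>.\<close>
      have "ennreal (b * \<bar>v x\<bar>) = (\<integral>\<^sup>+z. indicator B z * ennreal \<bar>v x\<bar> \<partial>lborel)"
        using b by (simp add: nn_integral_multc eb ennreal_mult)
      also have "\<dots> \<le> (\<integral>\<^sup>+z. indicator B z * ennreal \<bar>v (x + d0 *\<^sub>R z) - v x\<bar> + indicator B z * ennreal \<bar>v (x + d0 *\<^sub>R z)\<bar> \<partial>lborel)"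
        by (intro nn_integral_mono) (auto simp: indicator_def ennreal_plus[symmetric] simp del: ennreal_plus intro!: ennreal_leI)
      also have "\<dots> = (\<integral>\<^sup>+z. indicator B z * ennreal \<bar>v (x + d0 *\<^sub>R z) - v x\<bar> \<partial>lborel) + (\<integral>\<^sup>+z. indicator B z * ennreal \<bar>v (x + d0 *\<^sub>R z)\<bar> \<partial>lborel)"
        by (intro nn_integral_add) auto
      also have "\<dots> \<le> ennreal (C1 * d0 powr \<alpha> * Q) + ennreal (b powr (1 - 1 / p) * d0 powr (- (CARD('n) / p)) * P)"
        using ball_average_Holder[of "\<lambda>x. \<bar>v x\<bar>" p d0 a "2 * \<rho>" x] iv p1 d0
        by (intro add_mono avg' x) (auto simp: B_def b_def P_def)
      also have "\<dots> = ennreal (C1 * d0 powr \<alpha> * Q + b powr (1 - 1 / p) * d0 powr (- (CARD('n) / p)) * P)"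
        using C1 Q P by (intro ennreal_plus[symmetric]) auto
      finally have "b * \<bar>v x\<bar> \<le> C1 * d0 powr \<alpha> * Q + b powr (1 - 1 / p) * d0 powr (- (CARD('n) / p)) * P"
        using C1 Q P by (subst (asm) ennreal_le_iff) auto
      then have "\<bar>v x\<bar> \<le> C1 * d0 powr \<alpha> / b * Q + b powr (1 - 1 / p) * d0 powr (- (CARD('n) / p)) / b * P"
        using b by (simp add: field_simps)
      also have "\<dots> \<le> C * Q + C * P"
        using P Q by (intro add_mono mult_right_mono) (auto simp: C_def)
      finally show "\<bar>v x\<bar> \<le> C * ((LINT x|lborel. \<bar>v x\<bar> powr p) powr (1 / p) + (LINT x|lborel. norm (G x) powr p) powr (1 / p))"
        by (simp add: P_def Q_def algebra_simps)
    }
    fix y assume y: "y \<in> \<Omega> \<inter> ball x0 r"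
    have "\<bar>v x - v y\<bar> \<le> C * norm (x - y) powr \<alpha> * Q"
    proof (cases "x = y")
      case False
      define d where "d = norm (x - y) / \<rho>"
      have d: "0 < d" using False \<rho> by (simp add: d_def)
      have "norm (x - y) \<le> norm (x - x0) + norm (y - x0)"
        using norm_triangle_ineq4[of "x - x0" "y - x0"] by simp
      also have "\<dots> < r + r" using x y by (intro add_strict_mono) (auto simp: dist_norm norm_minus_commute)
      finally have d': "d \<le> d0" using \<rho> by (simp add: d_def d0_def divide_right_mono)
      \<comment> \<open>\<open>w\<close> has length \<rho>, so for \<open>z\<close> in
        \<open>B1\<close> both \<open>z\<close> and \<open>w + z\<close> lie in \<open>B\<close>,
        whose radius is twice that of \<open>B1\<close>.\<close>
      define w where "w = (1 / d) *\<^sub>R (x - y)"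
      have w: "norm w = \<rho>" using False \<rho> by (simp add: w_def d_def)
      have xw: "x + d *\<^sub>R z = y + d *\<^sub>R (w + z)" for z using d by (simp add: w_def algebra_simps)
      have "ennreal (b1 * \<bar>v x - v y\<bar>) = (\<integral>\<^sup>+z. indicator B1 z * ennreal \<bar>v x - v y\<bar> \<partial>lborel)"
        using b by (simp add: nn_integral_multc eb ennreal_mult)
      also have "\<dots> \<le> (\<integral>\<^sup>+z. indicator B z * ennreal \<bar>v (x + d *\<^sub>R z) - v x\<bar> + indicator B (w + z) * ennreal \<bar>v (y + d *\<^sub>R (w + z)) - v y\<bar> \<partial>lborel)"
      proof (rule nn_integral_mono)
        fix z
        show "indicator B1 z * ennreal \<bar>v x - v y\<bar>
          \<le> indicator B z * ennreal \<bar>v (x + d *\<^sub>R z) - v x\<bar> + indicator B (w + z) * ennreal \<bar>v (y + d *\<^sub>R (w + z)) - v y\<bar>"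
        proof (cases "z \<in> B1")
          case True
          have "norm (a - (w + z)) \<le> norm (a - z) + norm w"
            using norm_triangle_ineq4[of "a - z" w] by (simp add: algebra_simps)
          then have "z \<in> B" "w + z \<in> B" using True w \<rho> by (auto simp: B_def B1_def dist_norm)
          then show ?thesis using True xw[of z]
            by (auto simp: ennreal_plus[symmetric] simp del: ennreal_plus intro!: ennreal_leI)
        qed simp
      qed
      also have "\<dots> = (\<integral>\<^sup>+z. indicator B z * ennreal \<bar>v (x + d *\<^sub>R z) - v x\<bar> \<partial>lborel)
          + (\<integral>\<^sup>+z. indicator B (w + z) * ennreal \<bar>v (y + d *\<^sub>R (w + z)) - v y\<bar> \<partial>lborel)"
        by (intro nn_integral_add) auto
      also have "(\<integral>\<^sup>+z. indicator B (w + z) * ennreal \<bar>v (y + d *\<^sub>R (w + z)) - v y\<bar> \<partial>lborel)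
          = (\<integral>\<^sup>+z. indicator B z * ennreal \<bar>v (y + d *\<^sub>R z) - v y\<bar> \<partial>lborel)"
        by (rule nn_integral_lborel_translate) measurable
      also have "(\<integral>\<^sup>+z. indicator B z * ennreal \<bar>v (x + d *\<^sub>R z) - v x\<bar> \<partial>lborel) + \<dots>
          \<le> ennreal (C1 * d powr \<alpha> * Q) + ennreal (C1 * d powr \<alpha> * Q)"
        by (intro add_mono avg' x y d d')
      also have "\<dots> = ennreal (2 * (C1 * d powr \<alpha> * Q))"
        using C1 Q by (subst ennreal_plus[symmetric]) auto
      finally have "b1 * \<bar>v x - v y\<bar> \<le> 2 * (C1 * d powr \<alpha> * Q)"
        using C1 Q by (subst (asm) ennreal_le_iff) auto
      also have "d powr \<alpha> = norm (x - y) powr \<alpha> * \<rho> powr (- \<alpha>)"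
        using \<rho> by (simp add: d_def powr_divide powr_minus_divide)
      finally have "\<bar>v x - v y\<bar> \<le> (2 * C1 * \<rho> powr (- \<alpha>) / b1) * (norm (x - y) powr \<alpha> * Q)"
        using b by (simp add: field_simps)
      also have "\<dots> \<le> C * (norm (x - y) powr \<alpha> * Q)"
        using Q by (intro mult_right_mono) (auto simp: C_def)
      finally show ?thesis by (simp add: mult.assoc)
    qed simp
    then show "\<bar>v x - v y\<bar> \<le> C * norm (x - y) powr \<alpha> * (LINT x|lborel. norm (G x) powr p) powr (1 / p)"
      by (simp add: Q_def)
  qed
qed

text \<open>The smooth bounds pass to the limit at every point where the approximations converge;
  the exceptional null set belongs to the approximation and serves both bounds.\<close>

lemma Morrey_patch:
  fixes x0 :: "real^'n" and p :: real
  assumes K: "cone_patch \<Omega> (ball x0 R) l u" and R: "0 < R" and p: "CARD('n) < p"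
  defines "\<alpha> \<equiv> 1 - CARD('n) / p"
  obtains r C :: real where "0 < r" "0 \<le> C"
    "\<And>f g. weak_pair \<Omega> f g \<Longrightarrow> integrable lborel (\<lambda>x. \<bar>f x\<bar> powr p) \<Longrightarrow> integrable lborel (\<lambda>x. norm (g x) powr p) \<Longrightarrow>
      \<exists>Z\<in>null_sets lborel. \<forall>x \<in> \<Omega> \<inter> ball x0 r - Z.
        \<bar>f x\<bar> \<le> C * ((LINT x|lborel. \<bar>f x\<bar> powr p) powr (1 / p) + (LINT x|lborel. norm (g x) powr p) powr (1 / p)) \<and>
        (\<forall>y \<in> \<Omega> \<inter> ball x0 r - Z. \<bar>f x - f y\<bar> \<le> C * norm (x - y) powr \<alpha> * (LINT x|lborel. norm (g x) powr p) powr (1 / p))"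
proof -
  have "1 \<le> real CARD('n)" by (simp add: Suc_le_eq)
  then have p1: "1 \<le> p" using p by linarith
  obtain r C where rC: "0 < r" "0 \<le> C"
    "\<And>v G x. (\<And>x. x \<in> ball x0 R \<inter> \<Omega> \<Longrightarrow> (v has_derivative (\<lambda>h. h \<bullet> G x)) (at x)) \<Longrightarrow>
      continuous_on UNIV v \<Longrightarrow> continuous_on UNIV G \<Longrightarrow>
      integrable lborel (\<lambda>x. \<bar>v x\<bar> powr p) \<Longrightarrow> integrable lborel (\<lambda>x. norm (G x) powr p) \<Longrightarrow> x \<in> \<Omega> \<inter> ball x0 r \<Longrightarrow>
      \<bar>v x\<bar> \<le> C * ((LINT x|lborel. \<bar>v x\<bar> powr p) powr (1 / p) + (LINT x|lborel. norm (G x) powr p) powr (1 / p))"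
    "\<And>v G x y. (\<And>x. x \<in> ball x0 R \<inter> \<Omega> \<Longrightarrow> (v has_derivative (\<lambda>h. h \<bullet> G x)) (at x)) \<Longrightarrow>
      continuous_on UNIV v \<Longrightarrow> continuous_on UNIV G \<Longrightarrow>
      integrable lborel (\<lambda>x. norm (G x) powr p) \<Longrightarrow> x \<in> \<Omega> \<inter> ball x0 r \<Longrightarrow> y \<in> \<Omega> \<inter> ball x0 r \<Longrightarrow>
      \<bar>v x - v y\<bar> \<le> C * norm (x - y) powr \<alpha> * (LINT x|lborel. norm (G x) powr p) powr (1 / p)"
    unfolding \<alpha>_def by (rule Morrey_patch_smooth[OF K R p]) blast
  show ?thesis
  proof (rule that[OF rC(1,2)])
    fix f :: "real^'n \<Rightarrow> real" and g :: "real^'n \<Rightarrow> real^'n"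
    assume w: "weak_pair \<Omega> f g" and i: "integrable lborel (\<lambda>x. \<bar>f x\<bar> powr p)" "integrable lborel (\<lambda>x. norm (g x) powr p)"
    obtain v G where v: "\<And>k x. x \<in> ball x0 R \<inter> \<Omega> \<Longrightarrow> (v k has_derivative (\<lambda>h. h \<bullet> G k x)) (at x)"
      "\<And>k S. continuous_on S (v k)" "\<And>k S. continuous_on S (G k)"
      "\<And>k p. 1 \<le> p \<Longrightarrow> integrable lborel (\<lambda>x. \<bar>f x\<bar> powr p) \<Longrightarrow> integrable lborel (\<lambda>x. \<bar>v k x\<bar> powr p) \<and>
         (LINT x|lborel. \<bar>v k x\<bar> powr p) \<le> (LINT x|lborel. \<bar>f x\<bar> powr p)"
      "\<And>k p. 1 \<le> p \<Longrightarrow> integrable lborel (\<lambda>x. norm (g x) powr p) \<Longrightarrow> integrable lborel (\<lambda>x. norm (G k x) powr p) \<and>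
         (LINT x|lborel. norm (G k x) powr p) \<le> (LINT x|lborel. norm (g x) powr p)"
      "AE x in lborel. (\<lambda>k. v k x) \<longlonglongrightarrow> f x"
      by (rule patch_approximation[OF w K]) blast
    obtain Z where Z: "{x \<in> space lborel. \<not> (\<lambda>k. v k x) \<longlonglongrightarrow> f x} \<subseteq> Z" "Z \<in> null_sets lborel"
      using v(6) by (auto elim!: AE_E simp: null_sets_def)
    have lim: "(\<lambda>k. v k x) \<longlonglongrightarrow> f x" if "x \<notin> Z" for x using Z that by auto
    define P where "P = (LINT x|lborel. \<bar>f x\<bar> powr p) powr (1 / p)"
    define Q where "Q = (LINT x|lborel. norm (g x) powr p) powr (1 / p)"
    have PQ: "(LINT x|lborel. \<bar>v k x\<bar> powr p) powr (1 / p) \<le> P" "(LINT x|lborel. norm (G k x) powr p) powr (1 / p) \<le> Q" for k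
      using v(4)[OF p1 i(1), of k] v(5)[OF p1 i(2), of k] p1 by (auto simp: P_def Q_def intro!: powr_mono2)
    note iv = v(4)[OF p1 i(1), THEN conjunct1] and iG = v(5)[OF p1 i(2), THEN conjunct1]
    have "\<bar>f x\<bar> \<le> C * (P + Q)" if "x \<in> \<Omega> \<inter> ball x0 r - Z" for x
    proof (rule LIMSEQ_le_const2)
      show "(\<lambda>k. \<bar>v k x\<bar>) \<longlonglongrightarrow> \<bar>f x\<bar>" using that by (intro tendsto_rabs lim) auto
      have "\<bar>v k x\<bar> \<le> C * (P + Q)" for k
        by (rule order_trans[OF rC(3)[OF v(1) v(2) v(3) iv iG]]) (use that rC(2) PQ in \<open>auto intro!: mult_left_mono add_mono\<close>)
      then show "\<exists>N. \<forall>k\<ge>N. \<bar>v k x\<bar> \<le> C * (P + Q)" by blast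
    qed
    moreover have "\<bar>f x - f y\<bar> \<le> C * norm (x - y) powr \<alpha> * Q" if "x \<in> \<Omega> \<inter> ball x0 r - Z" "y \<in> \<Omega> \<inter> ball x0 r - Z" for x y
    proof (rule LIMSEQ_le_const2)
      show "(\<lambda>k. \<bar>v k x - v k y\<bar>) \<longlonglongrightarrow> \<bar>f x - f y\<bar>" using that by (intro tendsto_rabs tendsto_diff lim) auto
      have "\<bar>v k x - v k y\<bar> \<le> C * norm (x - y) powr \<alpha> * Q" for k
        by (rule order_trans[OF rC(4)[OF v(1) v(2) v(3) iG]]) (use that rC(2) PQ in \<open>auto intro!: mult_left_mono\<close>)
      then show "\<exists>N. \<forall>k\<ge>N. \<bar>v k x - v k y\<bar> \<le> C * norm (x - y) powr \<alpha> * Q" by blast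
    qed
    ultimately show "\<exists>Z\<in>null_sets lborel. \<forall>x \<in> \<Omega> \<inter> ball x0 r - Z.
        \<bar>f x\<bar> \<le> C * ((LINT x|lborel. \<bar>f x\<bar> powr p) powr (1 / p) + (LINT x|lborel. norm (g x) powr p) powr (1 / p)) \<and>
        (\<forall>y \<in> \<Omega> \<inter> ball x0 r - Z. \<bar>f x - f y\<bar> \<le> C * norm (x - y) powr \<alpha> * (LINT x|lborel. norm (g x) powr p) powr (1 / p))"
      unfolding P_def[symmetric] Q_def[symmetric] using Z(2) by (intro bexI[of _ Z]) auto
  qed
qed

lemma Morrey_uniform_cone:
  fixes \<Omega> :: "(real^'n) set" and p :: real
  assumes U: "uniform_cone \<Omega>" and p: "CARD('n) < p"
  defines "\<alpha> \<equiv> 1 - CARD('n) / p"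
  obtains C d :: real where "0 \<le> C" "0 < d"
    "\<And>f g. weak_pair \<Omega> f g \<Longrightarrow> integrable lborel (\<lambda>x. \<bar>f x\<bar> powr p) \<Longrightarrow> integrable lborel (\<lambda>x. norm (g x) powr p) \<Longrightarrow>
      \<exists>Z\<in>null_sets lborel. \<forall>x \<in> \<Omega> - Z.
        \<bar>f x\<bar> \<le> C * ((LINT x|lborel. \<bar>f x\<bar> powr p) powr (1 / p) + (LINT x|lborel. norm (g x) powr p) powr (1 / p)) \<and>
        (\<forall>y \<in> \<Omega> - Z. norm (x - y) < d \<longrightarrow> \<bar>f x - f y\<bar> \<le> C * norm (x - y) powr \<alpha> *
          ((LINT x|lborel. \<bar>f x\<bar> powr p) powr (1 / p) + (LINT x|lborel. norm (g x) powr p) powr (1 / p)))"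
proof -
  define P where "P x0 r C \<longleftrightarrow> 0 < r \<and> 0 \<le> C \<and> (\<forall>f g. weak_pair \<Omega> f g \<longrightarrow> integrable lborel (\<lambda>x. \<bar>f x\<bar> powr p) \<longrightarrow> integrable lborel (\<lambda>x. norm (g x) powr p) \<longrightarrow>
     (\<exists>Z\<in>null_sets lborel. \<forall>x \<in> \<Omega> \<inter> ball x0 r - Z.
        \<bar>f x\<bar> \<le> C * ((LINT x|lborel. \<bar>f x\<bar> powr p) powr (1 / p) + (LINT x|lborel. norm (g x) powr p) powr (1 / p)) \<and>
        (\<forall>y \<in> \<Omega> \<inter> ball x0 r - Z. \<bar>f x - f y\<bar> \<le> C * norm (x - y) powr \<alpha> * (LINT x|lborel. norm (g x) powr p) powr (1 / p))))" for x0 r C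
  have "\<exists>r C. P x0 r C" if x0: "x0 \<in> closure \<Omega>" for x0
  proof -
    obtain R l u where R: "0 < R" "cone_patch \<Omega> (ball x0 R) l u" using U x0 unfolding uniform_cone_def by blast
    show ?thesis unfolding P_def \<alpha>_def
      by (rule Morrey_patch[OF R(2,1) p]) blast
  qed
  then obtain r C where P: "\<And>x0. x0 \<in> closure \<Omega> \<Longrightarrow> P x0 (r x0) (C x0)" by metis
  obtain X where X: "finite X" "X \<subseteq> closure \<Omega>" "closure \<Omega> \<subseteq> (\<Union>x\<in>X. ball x (r x / 2))"
    by (rule uniform_cone_finite_cover[OF U, of "\<lambda>x. r x / 2"]) (use P in \<open>auto simp: P_def\<close>)
  have PX: "0 < r x" "0 \<le> C x" if "x \<in> X" for x using P[of x] X that by (auto simp: P_def)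
  \<comment> \<open>A Lebesgue number of the cover by half balls: if \<open>x\<close> lies in the
    half ball of a patch and \<open>norm (x - y) < D\<close>, then \<open>y\<close> lies in the ball
    of the same patch. The 1 serves an empty \<open>X\<close>.\<close>
  define D where "D = Min (insert 1 ((\<lambda>x. r x / 2) ` X))"
  have D: "0 < D" "\<And>x. x \<in> X \<Longrightarrow> D \<le> r x / 2"
    using X PX by (simp add: D_def) (unfold D_def, rule Min_le, use X in auto)
  define CC where "CC = (\<Sum>x\<in>X. C x)"
  have CC: "C x \<le> CC" if "x \<in> X" for x unfolding CC_def using that X PX by (intro member_le_sum) auto
  have CC0: "0 \<le> CC" unfolding CC_def using PX by (intro sum_nonneg) auto
  show ?thesis
  proof (rule that[OF CC0 D(1)])
    fix f :: "real^'n \<Rightarrow> real" and g :: "real^'n \<Rightarrow> real^'n"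
    assume w: "weak_pair \<Omega> f g" and i: "integrable lborel (\<lambda>x. \<bar>f x\<bar> powr p)" "integrable lborel (\<lambda>x. norm (g x) powr p)"
    define F where "F = (LINT x|lborel. \<bar>f x\<bar> powr p) powr (1 / p)"
    define G where "G = (LINT x|lborel. norm (g x) powr p) powr (1 / p)"
    have FG: "0 \<le> F" "0 \<le> G" by (auto simp: F_def G_def)
    have "\<exists>Z\<in>null_sets lborel. \<forall>x \<in> \<Omega> \<inter> ball x0 (r x0) - Z. \<bar>f x\<bar> \<le> C x0 * (F + G) \<and>
        (\<forall>y \<in> \<Omega> \<inter> ball x0 (r x0) - Z. \<bar>f x - f y\<bar> \<le> C x0 * norm (x - y) powr \<alpha> * G)" if "x0 \<in> X" for x0
      using P[of x0] that X w i unfolding P_def F_def G_def by blast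
    then obtain Z where Z: "\<And>x0. x0 \<in> X \<Longrightarrow> Z x0 \<in> null_sets lborel"
      "\<And>x0 x. x0 \<in> X \<Longrightarrow> x \<in> \<Omega> \<inter> ball x0 (r x0) - Z x0 \<Longrightarrow> \<bar>f x\<bar> \<le> C x0 * (F + G)"
      "\<And>x0 x y. x0 \<in> X \<Longrightarrow> x \<in> \<Omega> \<inter> ball x0 (r x0) - Z x0 \<Longrightarrow> y \<in> \<Omega> \<inter> ball x0 (r x0) - Z x0 \<Longrightarrow>
        \<bar>f x - f y\<bar> \<le> C x0 * norm (x - y) powr \<alpha> * G" by metis
    define ZZ where "ZZ = (\<Union>x0\<in>X. Z x0)"
    have ZZ: "ZZ \<in> null_sets lborel" unfolding ZZ_def using X(1) Z(1) by (intro null_sets_UN') (auto intro: countable_finite)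
    have "\<bar>f x\<bar> \<le> CC * (F + G) \<and> (\<forall>y \<in> \<Omega> - ZZ. norm (x - y) < D \<longrightarrow> \<bar>f x - f y\<bar> \<le> CC * norm (x - y) powr \<alpha> * (F + G))"
      if x: "x \<in> \<Omega> - ZZ" for x
    proof -
      obtain x0 where x0: "x0 \<in> X" "x \<in> ball x0 (r x0 / 2)" using X x closure_subset by blast
      have xb: "x \<in> \<Omega> \<inter> ball x0 (r x0) - Z x0" using x x0 PX[OF x0(1)] by (auto simp: ZZ_def)
      have "\<bar>f x\<bar> \<le> C x0 * (F + G)" using Z(2)[OF x0(1) xb] .
      also have "\<dots> \<le> CC * (F + G)" using CC[OF x0(1)] FG by (intro mult_right_mono) auto
      finally have 1: "\<bar>f x\<bar> \<le> CC * (F + G)" .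
      have 2: "\<bar>f x - f y\<bar> \<le> CC * norm (x - y) powr \<alpha> * (F + G)" if y: "y \<in> \<Omega> - ZZ" "norm (x - y) < D" for y
      proof -
        have "dist x0 y \<le> dist x0 x + norm (x - y)" using dist_triangle[of x0 y x] by (simp add: dist_norm)
        also have "\<dots> < r x0 / 2 + r x0 / 2" using x0 y(2) D(2)[OF x0(1)] by auto
        finally have "y \<in> \<Omega> \<inter> ball x0 (r x0) - Z x0" using y x0 by (auto simp: ZZ_def)
        then have "\<bar>f x - f y\<bar> \<le> C x0 * norm (x - y) powr \<alpha> * G" using Z(3)[OF x0(1) xb] by blast
        also have "\<dots> \<le> CC * norm (x - y) powr \<alpha> * (F + G)"
          using CC[OF x0(1)] CC0 FG PX[OF x0(1)] by (intro mult_mono) auto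
        finally show ?thesis .
      qed
      from 1 2 show ?thesis by blast
    qed
    then show "\<exists>Z\<in>null_sets lborel. \<forall>x \<in> \<Omega> - Z.
        \<bar>f x\<bar> \<le> CC * ((LINT x|lborel. \<bar>f x\<bar> powr p) powr (1 / p) + (LINT x|lborel. norm (g x) powr p) powr (1 / p)) \<and>
        (\<forall>y \<in> \<Omega> - Z. norm (x - y) < D \<longrightarrow> \<bar>f x - f y\<bar> \<le> CC * norm (x - y) powr \<alpha> *
          ((LINT x|lborel. \<bar>f x\<bar> powr p) powr (1 / p) + (LINT x|lborel. norm (g x) powr p) powr (1 / p)))"
      unfolding F_def[symmetric] G_def[symmetric] using ZZ by blast
  qed
qed

section \<open>Compactness in mean\<close>

text \<open>The difference is an integral of the gradient over the segment; after exchanging the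
  integrals, every translate of \<open>G\<close> contributes the same amount.\<close>

lemma smooth_translation_L1:
  fixes v :: "real^'n \<Rightarrow> real"
  assumes c: "continuous_on UNIV v" "continuous_on UNIV G" and G: "integrable lborel G"
    and [measurable]: "S \<in> sets borel" and M: "norm z \<le> M"
    and v: "\<And>x s. x \<in> S \<Longrightarrow> s \<in> {0..1} \<Longrightarrow> (v has_derivative (\<lambda>h. h \<bullet> G (x + s *\<^sub>R z))) (at (x + s *\<^sub>R z))"
  shows "(\<integral>\<^sup>+x. indicator S x * ennreal \<bar>v (x + z) - v x\<bar> \<partial>lborel) \<le> ennreal (M * (LINT x|lborel. norm (G x)))"
proof -
  have M0: "0 \<le> M" using M norm_ge_zero order_trans by blast
  have [measurable]: "v \<in> borel_measurable borel" "G \<in> borel_measurable borel"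
    using c by (auto intro: borel_measurable_continuous_onI)
  have 1: "ennreal \<bar>v (x + z) - v x\<bar> \<le> (\<integral>\<^sup>+s. ennreal M * (indicator {0..1} s * ennreal (norm (G (x + s *\<^sub>R z)))) \<partial>lborel)"
    if x: "x \<in> S" for x
  proof -
    let ?\<phi> = "\<lambda>s. v (x + s *\<^sub>R z)" and ?\<phi>' = "\<lambda>s. z \<bullet> G (x + s *\<^sub>R z)"
    have "ennreal \<bar>?\<phi> 1 - ?\<phi> 0\<bar> \<le> (\<integral>\<^sup>+s. ennreal (M * norm (G (x + s *\<^sub>R z))) * indicator {0..1} s \<partial>lborel)"
    proof (rule abs_le_nn_integral_derivative[where \<phi>' = ?\<phi>'])
      fix s :: real assume s: "s \<in> {0..1}"
      have "((\<lambda>s. x + s *\<^sub>R z) has_derivative (\<lambda>h. h *\<^sub>R z)) (at s)"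
        by (auto intro!: derivative_eq_intros)
      from has_derivative_compose[OF this v[OF x s]]
      have "(?\<phi> has_real_derivative ?\<phi>' s) (at s)"
        by (simp add: has_field_derivative_def mult_commute_abs mult_ac)
      then show "(?\<phi> has_real_derivative ?\<phi>' s) (at s within {0..1})" by (rule has_field_derivative_at_within)
      show "\<bar>?\<phi>' s\<bar> \<le> M * norm (G (x + s *\<^sub>R z))"
        by (rule order_trans[OF Cauchy_Schwarz_ineq2 mult_right_mono[OF M norm_ge_zero]])
    next
      show "continuous_on {0..1} ?\<phi>'"
        by (intro continuous_intros continuous_on_compose2[OF c(2)]) auto
    qed
    also have "\<dots> = (\<integral>\<^sup>+s. ennreal M * (indicator {0..1} s * ennreal (norm (G (x + s *\<^sub>R z)))) \<partial>lborel)"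
      using M0 by (intro nn_integral_cong) (auto simp: ennreal_mult' mult_ac)
    finally show ?thesis by simp
  qed
  have "(\<integral>\<^sup>+x. indicator S x * ennreal \<bar>v (x + z) - v x\<bar> \<partial>lborel)
      \<le> (\<integral>\<^sup>+x. (\<integral>\<^sup>+s. ennreal M * (indicator {0..1} s * ennreal (norm (G (x + s *\<^sub>R z)))) \<partial>lborel) \<partial>lborel)"
    using 1 by (intro nn_integral_mono) (auto simp: indicator_def)
  also have "\<dots> = (\<integral>\<^sup>+s. (\<integral>\<^sup>+x. ennreal M * (indicator {0..1} s * ennreal (norm (G (x + s *\<^sub>R z)))) \<partial>lborel) \<partial>lborel)"
    by (rule lborel_pair.Fubini') measurable
  also have "\<dots> = (\<integral>\<^sup>+s. ennreal M * (indicator {0..1} s * (\<integral>\<^sup>+x. ennreal (norm (G (s *\<^sub>R z + x))) \<partial>lborel)) \<partial>lborel)"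
    by (intro nn_integral_cong) (simp add: nn_integral_cmult add.commute)
  also have "\<dots> = (\<integral>\<^sup>+(s::real). ennreal M * (indicator {0..1} s * (\<integral>\<^sup>+x. ennreal (norm (G x)) \<partial>lborel)) \<partial>lborel)"
    by (simp add: nn_integral_lborel_translate[of "\<lambda>x. ennreal (norm (G x))"])
  also have "\<dots> = ennreal M * (\<integral>\<^sup>+x. ennreal (norm (G x)) \<partial>lborel)"
    by (simp add: nn_integral_cmult nn_integral_multc)
  also have "(\<integral>\<^sup>+x. ennreal (norm (G x)) \<partial>lborel) = ennreal (LINT x|lborel. norm (G x))"
    using G by (intro nn_integral_eq_integral) auto
  also have "ennreal M * ennreal (LINT x|lborel. norm (G x)) = ennreal (M * (LINT x|lborel. norm (G x)))"
    using M0 by (intro ennreal_mult[symmetric]) auto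
  finally show ?thesis .
qed

text \<open>In contrast to \<open>integrable_translate_tendsto\<close>, the bound depends on
  \<open>f\<close> through its gradient only and is therefore uniform on bounded sets of Sobolev
  functions. \<open>r + t * M \<le> R\<close> keeps the segments in the patch.\<close>

lemma patch_translation_L1:
  fixes f :: "real^'n \<Rightarrow> real"
  assumes w: "weak_pair \<Omega> f g" and K: "cone_patch \<Omega> (ball x0 R) l u" and \<Omega>: "open \<Omega>"
    and t: "0 < t" "t \<le> 1" and M: "norm z \<le> M" and z: "z \<in> cbox l u" and R: "r + t * M \<le> R"
  shows "(LINT x|lborel. indicator (\<Omega> \<inter> ball x0 r) x * \<bar>f (x + t *\<^sub>R z) - f x\<bar>) \<le> t * M * (LINT x|lborel. norm (g x))"
proof -
  have f: "integrable lborel f" and g: "integrable lborel g" using w by (auto simp: weak_pair_def)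
  have [measurable]: "f \<in> borel_measurable borel" using f by auto
  define S where "S = \<Omega> \<inter> ball x0 r"
  have [measurable]: "S \<in> sets borel" using \<Omega> by (auto simp: S_def)
  have M0: "0 \<le> M" using M norm_ge_zero order_trans by blast
  obtain v G where v: "\<And>k x. x \<in> ball x0 R \<inter> \<Omega> \<Longrightarrow> (v k has_derivative (\<lambda>h. h \<bullet> G k x)) (at x)"
      "\<And>k S. continuous_on S (v k)" "\<And>k S. continuous_on S (G k)"
      "\<And>k p. 1 \<le> p \<Longrightarrow> integrable lborel (\<lambda>x. \<bar>f x\<bar> powr p) \<Longrightarrow> integrable lborel (\<lambda>x. \<bar>v k x\<bar> powr p) \<and>
         (LINT x|lborel. \<bar>v k x\<bar> powr p) \<le> (LINT x|lborel. \<bar>f x\<bar> powr p)"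
      "\<And>k p. 1 \<le> p \<Longrightarrow> integrable lborel (\<lambda>x. norm (g x) powr p) \<Longrightarrow> integrable lborel (\<lambda>x. norm (G k x) powr p) \<and>
         (LINT x|lborel. norm (G k x) powr p) \<le> (LINT x|lborel. norm (g x) powr p)"
      "AE x in lborel. (\<lambda>k. v k x) \<longlonglongrightarrow> f x"
    by (rule patch_approximation[OF w K]) blast
  have mv [measurable]: "v k \<in> borel_measurable borel" "G k \<in> borel_measurable borel" for k
    using v(2,3) by (auto intro: borel_measurable_continuous_onI)
  have iG: "integrable lborel (G k)" "(LINT x|lborel. norm (G k x)) \<le> (LINT x|lborel. norm (g x))" for k
  proof -
    have *: "integrable lborel (\<lambda>x. norm (G k x)) \<and> (LINT x|lborel. norm (G k x)) \<le> (LINT x|lborel. norm (g x))"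
      using v(5)[of 1 k] g by simp
    then show "integrable lborel (G k)" by (subst (asm) integrable_norm_iff) auto
    show "(LINT x|lborel. norm (G k x)) \<le> (LINT x|lborel. norm (g x))" using * ..
  qed
  obtain Z where Z: "{x \<in> space lborel. \<not> (\<lambda>k. v k x) \<longlonglongrightarrow> f x} \<subseteq> Z" "Z \<in> null_sets lborel"
    using v(6) by (auto elim!: AE_E simp: null_sets_def)
  \<comment> \<open>Both \<open>x\<close> and \<open>x + t *\<^sub>R z\<close> have to avoid the set
    of divergence, so its translate must be null as well.\<close>
  have "{x. x - (- t *\<^sub>R z) \<in> Z} \<in> null_sets lborel" using Z(2) by (rule null_sets_translation)
  then have AE2: "AE x in lborel. x + t *\<^sub>R z \<notin> Z"
    by (rule AE_I') auto
  define h where "h k x = indicator S x * \<bar>v k (x + t *\<^sub>R z) - v k x\<bar>" for k x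
  have hb: "integrable lborel (h k) \<and> (LINT x|lborel. h k x) \<le> t * M * (LINT x|lborel. norm (g x))" for k
  proof -
    have "(\<integral>\<^sup>+x. ennreal (h k x) \<partial>lborel) = (\<integral>\<^sup>+x. indicator S x * ennreal \<bar>v k (x + t *\<^sub>R z) - v k x\<bar> \<partial>lborel)"
      by (intro nn_integral_cong) (auto simp: h_def indicator_def)
    also have "\<dots> \<le> ennreal (t * M * (LINT x|lborel. norm (G k x)))"
    proof (rule smooth_translation_L1[OF v(2) v(3) iG(1)])
      show "norm (t *\<^sub>R z) \<le> t * M" using M t by simp
      fix x and s :: real assume x: "x \<in> S" and s: "s \<in> {0..1}"
      have "x + s *\<^sub>R t *\<^sub>R z \<in> ball x0 R \<inter> \<Omega>"
      proof
        have "norm (x + s *\<^sub>R t *\<^sub>R z - x0) \<le> norm (x - x0) + norm (s *\<^sub>R t *\<^sub>R z)"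
          by (metis add_diff_eq add.commute add_diff_cancel_left' diff_add_eq norm_triangle_ineq)
        also have "\<dots> < r + t * M"
        proof (rule add_less_le_mono)
          show "norm (x - x0) < r" using x by (simp add: S_def dist_norm norm_minus_commute)
          have "norm (s *\<^sub>R t *\<^sub>R z) = s * (t * norm z)" using s t by simp
          also have "\<dots> \<le> 1 * (t * M)" using s t M by (intro mult_mono) auto
          finally show "norm (s *\<^sub>R t *\<^sub>R z) \<le> t * M" by simp
        qed
        finally show "x + s *\<^sub>R t *\<^sub>R z \<in> ball x0 R" using R by (simp add: dist_norm norm_minus_commute)
        show "x + s *\<^sub>R t *\<^sub>R z \<in> \<Omega>"
        proof (cases "s = 0")
          case False
          have "r \<le> R" using R t M0 by (smt (verit) mult_nonneg_nonneg)
          then have "x \<in> ball x0 R" using x by (auto simp: S_def)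
          moreover have "0 < s * t" "s * t \<le> 1" using False s t by (auto intro: mult_le_one)
          ultimately have "x + (s * t) *\<^sub>R z \<in> \<Omega>" using K x z by (auto simp: cone_patch_def S_def)
          then show ?thesis by simp
        qed (use x in \<open>auto simp: S_def\<close>)
      qed
      then show "(v k has_derivative (\<lambda>h. h \<bullet> G k (x + s *\<^sub>R t *\<^sub>R z))) (at (x + s *\<^sub>R t *\<^sub>R z))" by (rule v(1))
    qed simp
    also have "\<dots> \<le> ennreal (t * M * (LINT x|lborel. norm (g x)))"
      using iG(2)[of k] t M0 by (intro ennreal_leI mult_left_mono) auto
    finally have *: "(\<integral>\<^sup>+x. ennreal (h k x) \<partial>lborel) \<le> ennreal (t * M * (LINT x|lborel. norm (g x)))" .
    have mh: "h k \<in> borel_measurable lborel" unfolding h_def by measurable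
    have ih: "integrable lborel (h k)"
      using * mh by (intro integrableI_nonneg) (auto simp: h_def intro: le_less_trans[OF _ ennreal_less_top])
    have "(\<integral>\<^sup>+x. ennreal (h k x) \<partial>lborel) = ennreal (LINT x|lborel. h k x)"
      by (rule nn_integral_eq_integral[OF ih]) (auto simp: h_def)
    then have "ennreal (LINT x|lborel. h k x) \<le> ennreal (t * M * (LINT x|lborel. norm (g x)))"
      using * by simp
    then show ?thesis using ih t M0 by (subst (asm) ennreal_le_iff) auto
  qed
  have lim: "AE x in lborel. (\<lambda>k. h k x) \<longlonglongrightarrow> indicator S x * \<bar>f (x + t *\<^sub>R z) - f x\<bar>"
    using v(6) AE2
  proof eventually_elim
    case (elim x)
    then have "(\<lambda>k. v k (x + t *\<^sub>R z)) \<longlonglongrightarrow> f (x + t *\<^sub>R z)" using Z(1) by auto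
    then show ?case unfolding h_def using elim(1) by (intro tendsto_intros)
  qed
  have mf: "(\<lambda>x. indicator S x * \<bar>f (x + t *\<^sub>R z) - f x\<bar>) \<in> borel_measurable lborel" by measurable
  have "(LINT x|lborel. indicator S x * \<bar>f (x + t *\<^sub>R z) - f x\<bar>) \<le> t * M * (LINT x|lborel. norm (g x))"
    by (rule integrable_Fatou(2)[OF hb[THEN conjunct1] _ hb[THEN conjunct2] lim mf]) (auto simp: h_def)
  then show ?thesis by (simp add: S_def)
qed

section \<open>Extraction of a subsequence\<close>

text \<open>The scales in \<open>mollify_AE_limit\<close> depend on the function; here one countable
  family has to serve all members of a sequence.\<close>

definition scale_seq :: "nat \<Rightarrow> real" where
  "scale_seq k = 1 / real (Suc k)"

lemma scale_seq: "0 < scale_seq k" "scale_seq k \<le> 1"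
  by (auto simp: scale_seq_def divide_le_eq)

lemma scale_seq_tendsto: "scale_seq \<longlonglongrightarrow> 0"
  unfolding scale_seq_def[abs_def] by (rule LIMSEQ_Suc[OF lim_1_over_n])

text \<open>By \<open>mollify_Lipschitz\<close> and the common bound \<open>A\<close>, passing from
  \<open>x\<close> to a nearby point of \<open>D\<close> changes all mollifications by less than
  \<open>e / 3\<close>, uniformly in \<open>n\<close>.\<close>

lemma mollify_pointwise_Cauchy:
  fixes F :: "nat \<Rightarrow> real^'n \<Rightarrow> real"
  assumes F: "\<And>n. integrable lborel (F n)" "\<And>n. (LINT x|lborel. \<bar>F n x\<bar>) \<le> A"
    and D: "\<And>X::(real^'n) set. open X \<Longrightarrow> X \<noteq> {} \<Longrightarrow> \<exists>d\<in>D. d \<in> X"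
    and conv: "\<And>y. y \<in> D \<Longrightarrow> convergent (\<lambda>n. mollify l u (F n) y)"
  shows "convergent (\<lambda>n. mollify l u (F n) x)"
proof (rule Cauchy_convergent, rule metric_CauchyI)
  fix e :: real assume e: "0 < e"
  have A: "0 \<le> A" by (rule order_trans[OF Bochner_Integration.integral_nonneg F(2)[of 0]]) simp
  obtain L where L: "0 \<le> L" "\<And>f x y. integrable lborel (f :: real^'n \<Rightarrow> real)
      \<Longrightarrow> norm (mollify l u f x - mollify l u f y) \<le> L * norm (x - y) * (LINT y|lborel. norm (f y))"
    by (rule mollify_Lipschitz) blast
  have LA: "0 < L * A + 1" using L A by (simp add: add_nonneg_pos)
  obtain y where y: "y \<in> D" "y \<in> ball x (e / (3 * (L * A + 1)))"
  proof -
    have "0 < e / (3 * (L * A + 1))" using e LA by simp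
    then show ?thesis using D[of "ball x (e / (3 * (L * A + 1)))"] that
      by (metis centre_in_ball empty_iff open_ball)
  qed
  have close: "\<bar>mollify l u (F n) x - mollify l u (F n) y\<bar> < e / 3" for n
  proof -
    have "\<bar>mollify l u (F n) x - mollify l u (F n) y\<bar> \<le> L * norm (x - y) * (LINT y|lborel. norm (F n y))"
      using L(2)[OF F(1)[of n], of x y] by simp
    also have "\<dots> \<le> L * norm (x - y) * A" using F(2)[of n] L(1) by (intro mult_left_mono) auto
    also have "\<dots> \<le> (L * A + 1) * norm (x - y)" by (simp add: algebra_simps)
    also have "\<dots> < (L * A + 1) * (e / (3 * (L * A + 1)))"
      using y(2) LA by (intro mult_strict_left_mono) (auto simp: dist_norm)
    also have "\<dots> = e / 3" using LA by (simp add: divide_simps)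
    finally show ?thesis .
  qed
  have "Cauchy (\<lambda>n. mollify l u (F n) y)" using conv[OF y(1)] by (rule convergent_Cauchy)
  then obtain N where N: "\<And>m n. m \<ge> N \<Longrightarrow> n \<ge> N \<Longrightarrow> dist (mollify l u (F m) y) (mollify l u (F n) y) < e / 3"
    using e by (metis metric_CauchyD divide_pos_pos zero_less_numeral)
  show "\<exists>N. \<forall>m\<ge>N. \<forall>n\<ge>N. dist (mollify l u (F m) x) (mollify l u (F n) x) < e"
  proof (intro exI allI impI)
    fix m n assume "N \<le> m" "N \<le> n"
    then show "dist (mollify l u (F m) x) (mollify l u (F n) x) < e"
      using N[of m n] close[of m] close[of n] unfolding dist_real_def by linarith
  qed
qed

text \<open>At a fixed scale the mollifications converge in mean on the bounded set \<open>S\<close>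
  by dominated convergence, and replacing \<open>F n\<close> by its mollification costs a
  translation error that is uniform in \<open>n\<close>. Four errors of \<open>e / 4\<close> add
  up.\<close>

lemma L1_Cauchy_patch:
  fixes F :: "nat \<Rightarrow> real^'n \<Rightarrow> real"
  assumes K: "cone_patch \<Omega> (ball x0 R) l u" and R: "0 < R" and \<Omega>: "open \<Omega>" "bounded \<Omega>"
    and w: "\<And>n. weak_pair \<Omega> (F n) (G n)"
    and A: "\<And>n. (LINT x|lborel. \<bar>F n x\<bar>) \<le> A" "\<And>n. (LINT x|lborel. norm (G n x)) \<le> A"
    and conv: "\<And>k y. convergent (\<lambda>n. mollify (scale_seq k *\<^sub>R l) (scale_seq k *\<^sub>R u) (F n) y)"
    and e: "0 < e"
  shows "\<exists>N. \<forall>i\<ge>N. \<forall>j\<ge>N. (LINT x|lborel. indicator (ball x0 (R / 2)) x * \<bar>F i x - F j x\<bar>) < e"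
proof -
  have F: "integrable lborel (F n)" for n using w[of n] by (simp add: weak_pair_def)
  have box: "box l u \<noteq> {}" using K by (simp add: cone_patch_def)
  have A0: "0 \<le> A" by (rule order_trans[OF Bochner_Integration.integral_nonneg A(1)[of 0]]) simp
  obtain M where M: "0 < M" "\<And>z. z \<in> cbox l u \<Longrightarrow> norm z \<le> M"
    using bounded_cbox[of l u] by (auto simp: bounded_pos)
  have "(\<lambda>k. scale_seq k * (M * A)) \<longlonglongrightarrow> 0 * (M * A)" "(\<lambda>k. scale_seq k * M) \<longlonglongrightarrow> 0 * M"
    by (intro tendsto_intros scale_seq_tendsto)+
  then have "eventually (\<lambda>k. scale_seq k * (M * A) < e / 4) sequentially" "eventually (\<lambda>k. scale_seq k * M < R / 2) sequentially"
    using e R by (auto intro!: order_tendstoD(2))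
  then have "eventually (\<lambda>k. scale_seq k * (M * A) < e / 4 \<and> scale_seq k * M < R / 2) sequentially"
    by (rule eventually_conj)
  \<comment> \<open>The scale makes the uniform error small and keeps shifts that start in the ball
    of radius \<open>R / 2\<close> inside the patch.\<close>
  then obtain k where k: "scale_seq k * (M * A) < e / 4" "scale_seq k * M < R / 2"
    by (auto simp: eventually_sequentially)
  define t where "t = scale_seq k"
  have t: "0 < t" "t \<le> 1" using scale_seq by (auto simp: t_def)
  define S where "S = \<Omega> \<inter> ball x0 (R / 2)"
  have S [measurable]: "S \<in> sets borel" using \<Omega> by (auto simp: S_def)
  have "emeasure lborel S < \<infinity>" using \<Omega> by (intro emeasure_bounded_finite) (auto simp: S_def)
  then have fS: "integrable lborel (indicator S :: _ \<Rightarrow> real)" by (intro integrable_real_indicator) auto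
  let ?m = "\<lambda>n. mollify (t *\<^sub>R l) (t *\<^sub>R u) (F n)"
  have box': "box (t *\<^sub>R l) (t *\<^sub>R u) \<noteq> {}" using t(1) box by (rule box_scaleR_nonempty)
  have im: "integrable lborel (?m n)" for n using F box' by (rule integrable_mollify)
  have near: "(LINT x|lborel. indicator S x * \<bar>?m n x - F n x\<bar>) \<le> t * (M * A)" for n
  proof (rule mollify_diff_L1_le[OF F box' S])
    fix z assume "z \<in> cbox (t *\<^sub>R l) (t *\<^sub>R u)"
    then obtain z' where z': "z' \<in> cbox l u" "z = t *\<^sub>R z'" using t cbox_scaleR_subset by metis
    have "(LINT x|lborel. indicator S x * \<bar>F n (x + z) - F n x\<bar>) \<le> t * M * (LINT x|lborel. norm (G n x))"
      unfolding S_def z'(2) using k(2) t by (intro patch_translation_L1[OF w K \<Omega>(1)] z' M(2)) (auto simp: t_def)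
    also have "\<dots> \<le> t * M * A" using t M A(2)[of n] by (intro mult_left_mono) auto
    finally show "(LINT x|lborel. indicator S x * \<bar>F n (x + z) - F n x\<bar>) \<le> t * (M * A)" by (simp add: mult.assoc)
  qed (use t M A0 in auto)
  have "\<exists>m. \<forall>y. (\<lambda>n. ?m n y) \<longlonglongrightarrow> m y"
    using conv[of k] unfolding convergent_def t_def by metis
  then obtain m where m: "\<And>y. (\<lambda>n. ?m n y) \<longlonglongrightarrow> m y" by blast
  have [measurable]: "?m n \<in> borel_measurable borel" for n using F by (rule measurable_mollify)
  have [measurable]: "m \<in> borel_measurable borel"
    by (rule borel_measurable_LIMSEQ_real[OF m]) auto
  obtain B where B: "0 \<le> B" "\<And>f x. integrable lborel (f :: real^'n \<Rightarrow> real)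
      \<Longrightarrow> norm (mollify (t *\<^sub>R l) (t *\<^sub>R u) f x) \<le> B * (LINT y|lborel. norm (f y))"
    by (rule mollify_bounded) blast
  have mB: "\<bar>?m n y\<bar> \<le> B * A" for n y
  proof -
    have "\<bar>?m n y\<bar> \<le> B * (LINT y|lborel. norm (F n y))" using B(2)[OF F[of n], of y] by simp
    also have "\<dots> \<le> B * A" using A(1)[of n] B(1) by (intro mult_left_mono) auto
    finally show ?thesis .
  qed
  have mB': "\<bar>m y\<bar> \<le> B * A" for y
    by (rule LIMSEQ_le_const2[OF tendsto_rabs[OF m]]) (use mB in auto)
  have d: "(\<lambda>n. LINT y|lborel. indicator S y * \<bar>?m n y - m y\<bar>) \<longlonglongrightarrow> (LINT y::real^'n|lborel. 0)"
    and im2: "\<And>n. integrable lborel (\<lambda>y. indicator S y * \<bar>?m n y - m y\<bar>)"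
  proof -
    have b: "norm (indicator S y * \<bar>?m n y - m y\<bar>) \<le> 2 * (B * A) * indicator S y" for n y
      using mB[of n y] mB'[of y] by (auto simp: indicator_def)
    show im2: "integrable lborel (\<lambda>y. indicator S y * \<bar>?m n y - m y\<bar>)" for n
      by (rule Bochner_Integration.integrable_bound[of _ "\<lambda>y. 2 * (B * A) * indicator S y"])
        (use fS b[of _ n] in \<open>auto intro!: AE_I2 intro: order_trans[OF _ abs_ge_self]\<close>)
    show "(\<lambda>n. LINT y|lborel. indicator S y * \<bar>?m n y - m y\<bar>) \<longlonglongrightarrow> (LINT y::real^'n|lborel. 0)"
    proof (rule integral_dominated_convergence[where w = "\<lambda>y. 2 * (B * A) * indicator S y"])
      show "AE y in lborel. (\<lambda>n. indicator S y * \<bar>?m n y - m y\<bar>) \<longlonglongrightarrow> 0"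
      proof (rule AE_I2)
        fix y
        have "(\<lambda>n. indicator S y * \<bar>?m n y - m y\<bar>) \<longlonglongrightarrow> indicator S y * \<bar>m y - m y\<bar>"
          by (intro tendsto_intros m)
        then show "(\<lambda>n. indicator S y * \<bar>?m n y - m y\<bar>) \<longlonglongrightarrow> 0" by simp
      qed
    qed (use fS b in auto)
  qed
  then have "eventually (\<lambda>n. (LINT y|lborel. indicator S y * \<bar>?m n y - m y\<bar>) < e / 4) sequentially"
    using e by (intro order_tendstoD(2)) auto
  then obtain N where N: "\<And>n. n \<ge> N \<Longrightarrow> (LINT y|lborel. indicator S y * \<bar>?m n y - m y\<bar>) < e / 4"
    by (auto simp: eventually_sequentially)
  have i1: "integrable lborel (\<lambda>x. indicator S x * \<bar>?m n x - F n x\<bar>)" for n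
    by (rule Bochner_Integration.integrable_bound[of _ "\<lambda>x. \<bar>?m n x - F n x\<bar>"])
      (use im[of n] F[of n] in \<open>auto simp: indicator_def\<close>)
  show ?thesis
  proof (intro exI[of _ N] allI impI)
    fix i j assume ij: "N \<le> i" "N \<le> j"
    let ?H = "\<lambda>x. indicator S x * \<bar>?m i x - F i x\<bar> + indicator S x * \<bar>?m i x - m x\<bar>
         + indicator S x * \<bar>?m j x - m x\<bar> + indicator S x * \<bar>?m j x - F j x\<bar>"
    have "(LINT x|lborel. indicator (ball x0 (R / 2)) x * \<bar>F i x - F j x\<bar>) \<le> (LINT x|lborel. ?H x)"
    proof (rule integral_mono')
      show "integrable lborel ?H" using i1 im2 by auto
      fix x
      show "indicator (ball x0 (R / 2)) x * \<bar>F i x - F j x\<bar> \<le> ?H x"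
        using w[of i] w[of j] by (cases "x \<in> \<Omega>") (auto simp: weak_pair_def S_def indicator_def)
    qed auto
    also have "\<dots> = (LINT x|lborel. indicator S x * \<bar>?m i x - F i x\<bar>) + (LINT x|lborel. indicator S x * \<bar>?m i x - m x\<bar>)
         + (LINT x|lborel. indicator S x * \<bar>?m j x - m x\<bar>) + (LINT x|lborel. indicator S x * \<bar>?m j x - F j x\<bar>)"
      using i1 im2 by simp
    also have "\<dots> < e" using near[of i] near[of j] N[OF ij(1)] N[OF ij(2)] k(1) unfolding t_def[symmetric] by linarith
    finally show "(LINT x|lborel. indicator (ball x0 (R / 2)) x * \<bar>F i x - F j x\<bar>) < e" .
  qed
qed

text \<open>A single subsequence makes the mollifications converge for the finitely many patches,
  all scales and a countable dense set of points. The sequence is then Cauchy in mean on each patch,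
  and the patches cover \<Omega>.\<close>

lemma L1_compact:
  fixes F :: "nat \<Rightarrow> real^'n \<Rightarrow> real"
  assumes U: "uniform_cone \<Omega>" and w: "\<And>n. weak_pair \<Omega> (F n) (G n)"
    and A: "\<And>n. (LINT x|lborel. \<bar>F n x\<bar>) \<le> A" "\<And>n. (LINT x|lborel. norm (G n x)) \<le> A"
  obtains r :: "nat \<Rightarrow> nat" where "strict_mono r"
    "\<And>e. 0 < e \<Longrightarrow> \<exists>N. \<forall>i\<ge>N. \<forall>j\<ge>N. (LINT x|lborel. \<bar>F (r i) x - F (r j) x\<bar>) < e"
proof -
  have \<Omega>: "open \<Omega>" "bounded \<Omega>" using U by (auto simp: uniform_cone_def)
  have F: "integrable lborel (F n)" for n using w[of n] by (simp add: weak_pair_def)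
  obtain R l u where P: "\<And>x0. x0 \<in> closure \<Omega> \<Longrightarrow> 0 < R x0" "\<And>x0. x0 \<in> closure \<Omega> \<Longrightarrow> cone_patch \<Omega> (ball x0 (R x0)) (l x0) (u x0)"
    using U unfolding uniform_cone_def by metis
  obtain X where X: "finite X" "X \<subseteq> closure \<Omega>" "closure \<Omega> \<subseteq> (\<Union>x\<in>X. ball x (R x / 2))"
    by (rule uniform_cone_finite_cover[OF U, of "\<lambda>x. R x / 2"]) (use P in auto)
  obtain D :: "(real^'n) set" where D: "countable D" "\<And>Y. open Y \<Longrightarrow> Y \<noteq> {} \<Longrightarrow> \<exists>d\<in>D. d \<in> Y"
    using countable_dense_exists by blast
  let ?m = "\<lambda>n x0 k. mollify (scale_seq k *\<^sub>R l x0) (scale_seq k *\<^sub>R u x0) (F n)"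
  have exB: "\<exists>B. \<forall>n y. \<bar>?m n x0 k y\<bar> \<le> B" for x0 k
  proof -
    obtain B where B: "0 \<le> B" "\<And>f x. integrable lborel (f :: real^'n \<Rightarrow> real)
        \<Longrightarrow> norm (mollify (scale_seq k *\<^sub>R l x0) (scale_seq k *\<^sub>R u x0) f x) \<le> B * (LINT y|lborel. norm (f y))"
      by (rule mollify_bounded) blast
    have "\<bar>?m n x0 k y\<bar> \<le> B * A" for n y
    proof -
      have "\<bar>?m n x0 k y\<bar> \<le> B * (LINT y|lborel. norm (F n y))" using B(2)[OF F[of n], of y] by simp
      also have "\<dots> \<le> B * A" using A(1)[of n] B(1) by (intro mult_left_mono) auto
      finally show ?thesis .
    qed
    then show ?thesis by blast
  qed
  define B where "B x0 k = (SOME B. \<forall>n y. \<bar>?m n x0 k y\<bar> \<le> B)" for x0 k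
  have B: "\<bar>?m n x0 k y\<bar> \<le> B x0 k" for x0 k n y
    using someI_ex[OF exB[where k = k]] unfolding B_def by blast
  \<comment> \<open>\<open>function_convergent_subsequence\<close> asks for one bound for all
    indices, whereas \<open>B x0 k\<close> depends on patch and scale. Dividing by
    \<open>\<bar>B x0 k\<bar> + 1\<close> normalises and can be undone.\<close>
  define h where "h n q = (case q of (x0, k, y) \<Rightarrow> ?m n x0 k y / (\<bar>B x0 k\<bar> + 1))" for n and q :: "(real^'n) \<times> nat \<times> (real^'n)"
  have "norm (h n q) \<le> 1" for n q
  proof (cases q)
    case (fields x0 k y)
    define c where "c = \<bar>B x0 k\<bar> + 1"
    have "\<bar>?m n x0 k y\<bar> \<le> B x0 k" by (rule B)
    then have c: "0 < c" "\<bar>?m n x0 k y\<bar> \<le> c" unfolding c_def by linarith+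
    have "h n q = ?m n x0 k y / c" by (simp add: h_def fields c_def)
    then show ?thesis using c by (simp add: abs_divide divide_le_eq)
  qed
  moreover have "countable (X \<times> (UNIV :: nat set) \<times> D)" using X(1) D(1) by (intro countable_SIGMA) (auto intro: countable_finite)
  ultimately obtain r where r: "strict_mono (r :: nat \<Rightarrow> nat)" "\<And>q. q \<in> X \<times> (UNIV :: nat set) \<times> D \<Longrightarrow> \<exists>L. (\<lambda>n. h (r n) q) \<longlonglongrightarrow> L"
    using function_convergent_subsequence[of "X \<times> (UNIV :: nat set) \<times> D" h 1] by metis
  have conv: "convergent (\<lambda>n. ?m (r n) x0 k y)" if x0: "x0 \<in> X" for x0 k y
  proof (rule mollify_pointwise_Cauchy[where F = "\<lambda>n. F (r n)" and D = D])
    show "integrable lborel (F (r n))" "(LINT x|lborel. \<bar>F (r n) x\<bar>) \<le> A" for n by (fact F, fact A(1))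
    show "\<exists>d\<in>D. d \<in> Y" if "open Y" "Y \<noteq> {}" for Y using D(2) that by blast
    fix y assume "y \<in> D"
    then obtain L where "(\<lambda>n. h (r n) (x0, k, y)) \<longlonglongrightarrow> L" using r(2)[of "(x0, k, y)"] x0 by auto
    then have "(\<lambda>n. (\<bar>B x0 k\<bar> + 1) * h (r n) (x0, k, y)) \<longlonglongrightarrow> (\<bar>B x0 k\<bar> + 1) * L" by (intro tendsto_intros)
    moreover have "(\<bar>B x0 k\<bar> + 1) * h n (x0, k, y) = ?m n x0 k y" for n
    proof -
      have "\<bar>B x0 k\<bar> + 1 \<noteq> 0" by (metis abs_add_one_gt_zero less_irrefl add.commute)
      then show ?thesis by (simp add: h_def)
    qed
    ultimately show "convergent (\<lambda>n. ?m (r n) x0 k y)" by (auto simp: convergent_def)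
  qed
  show ?thesis
  proof (rule that[OF r(1)])
    fix e :: real assume e: "0 < e"
    define e' where "e' = e / (real (card X) + 1)"
    have e': "0 < e'" using e by (simp add: e'_def)
    have "\<exists>N. \<forall>i\<ge>N. \<forall>j\<ge>N. (LINT x|lborel. indicator (ball x0 (R x0 / 2)) x * \<bar>F (r i) x - F (r j) x\<bar>) < e'" if x0: "x0 \<in> X" for x0
    proof -
      have c: "x0 \<in> closure \<Omega>" using x0 X by auto
      show ?thesis
        by (rule L1_Cauchy_patch[OF P(2)[OF c] P(1)[OF c] \<Omega> w A(1) A(2) conv[OF x0] e'])
    qed
    then obtain N where N: "\<And>x0 i j. x0 \<in> X \<Longrightarrow> N x0 \<le> i \<Longrightarrow> N x0 \<le> j \<Longrightarrow>
        (LINT x|lborel. indicator (ball x0 (R x0 / 2)) x * \<bar>F (r i) x - F (r j) x\<bar>) < e'" by metis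
    show "\<exists>N. \<forall>i\<ge>N. \<forall>j\<ge>N. (LINT x|lborel. \<bar>F (r i) x - F (r j) x\<bar>) < e"
    \<comment> \<open>A sum of natural numbers bounds each of its terms, so it serves as a common
      threshold.\<close>
    proof (intro exI[of _ "\<Sum>x0\<in>X. N x0"] allI impI)
      fix i j assume ij: "(\<Sum>x0\<in>X. N x0) \<le> i" "(\<Sum>x0\<in>X. N x0) \<le> j"
      have NN: "N x0 \<le> (\<Sum>x0\<in>X. N x0)" if "x0 \<in> X" for x0 using X(1) that by (intro member_le_sum) auto
      have ii: "integrable lborel (\<lambda>x. indicator (ball x0 (R x0 / 2)) x * \<bar>F (r i) x - F (r j) x\<bar>)" for x0
        by (rule Bochner_Integration.integrable_bound[of _ "\<lambda>x. \<bar>F (r i) x - F (r j) x\<bar>"])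
          (use F[of "r i"] F[of "r j"] in \<open>auto simp: indicator_def\<close>)
      have "(LINT x|lborel. \<bar>F (r i) x - F (r j) x\<bar>) \<le> (LINT x|lborel. (\<Sum>x0\<in>X. indicator (ball x0 (R x0 / 2)) x * \<bar>F (r i) x - F (r j) x\<bar>))"
      proof (rule integral_mono')
        show "integrable lborel (\<lambda>x. \<Sum>x0\<in>X. indicator (ball x0 (R x0 / 2)) x * \<bar>F (r i) x - F (r j) x\<bar>)"
          using ii by (intro Bochner_Integration.integrable_sum)
        fix x
        show "0 \<le> (\<Sum>x0\<in>X. indicator (ball x0 (R x0 / 2)) x * \<bar>F (r i) x - F (r j) x\<bar>)"
          by (auto intro!: sum_nonneg)
        show "\<bar>F (r i) x - F (r j) x\<bar> \<le> (\<Sum>x0\<in>X. indicator (ball x0 (R x0 / 2)) x * \<bar>F (r i) x - F (r j) x\<bar>)"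
        proof (cases "x \<in> \<Omega>")
          case True
          then obtain x0 where x0: "x0 \<in> X" "x \<in> ball x0 (R x0 / 2)" using X(3) closure_subset by blast
          have "\<bar>F (r i) x - F (r j) x\<bar> = indicator (ball x0 (R x0 / 2)) x * \<bar>F (r i) x - F (r j) x\<bar>" using x0 by simp
          also have "\<dots> \<le> (\<Sum>x0\<in>X. indicator (ball x0 (R x0 / 2)) x * \<bar>F (r i) x - F (r j) x\<bar>)"
            by (rule member_le_sum) (use x0 X in auto)
          finally show ?thesis .
        next
          case False
          then have "F (r i) x = 0" "F (r j) x = 0" using w by (auto simp: weak_pair_def)
          then show ?thesis by simp
        qed
      qed
      also have "\<dots> = (\<Sum>x0\<in>X. LINT x|lborel. indicator (ball x0 (R x0 / 2)) x * \<bar>F (r i) x - F (r j) x\<bar>)"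
        using ii by (intro Bochner_Integration.integral_sum)
      also have "\<dots> \<le> (\<Sum>x0\<in>X. e')"
        by (intro sum_mono less_imp_le[OF N] order_trans[OF NN ij(1)] order_trans[OF NN ij(2)])
      also have "\<dots> < e"
        using e by (simp add: e'_def divide_less_eq algebra_simps)
      finally show "(LINT x|lborel. \<bar>F (r i) x - F (r j) x\<bar>) < e" .
    qed
  qed
qed

section \<open>Borel representatives of Sobolev functions\<close>

text \<open>The estimates concern Borel functions on the whole space, where Tonelli's theorem and
  translations act. This is the bridge from \<open>lebesgue_on \<Omega>\<close>, whose functions are
  merely Lebesgue measurable and arbitrary outside \<Omega>.\<close>

lemma lebesgue_on_transfer:
  fixes h h' :: "real^'n \<Rightarrow> 'b::{banach, second_countable_topology}"
  assumes \<Omega>: "open \<Omega>" and h: "h \<in> borel_measurable (lebesgue_on \<Omega>)" and h' [measurable]: "h' \<in> borel_measurable borel"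
    and z: "\<And>x. x \<notin> \<Omega> \<Longrightarrow> h' x = 0" and ae: "AE x in lborel. x \<in> \<Omega> \<longrightarrow> h x = h' x"
  shows "integrable (lebesgue_on \<Omega>) h \<longleftrightarrow> integrable lborel h'"
    and "(LINT x|lebesgue_on \<Omega>. h x) = (LINT x|lborel. h' x)"
proof -
  have S: "\<Omega> \<inter> space lebesgue \<in> sets lebesgue" using \<Omega> by auto
  have mh: "(\<lambda>x. indicator \<Omega> x *\<^sub>R h x) \<in> borel_measurable lebesgue"
    using h borel_measurable_restrict_space_iff[OF S, of h] by simp
  have mh': "h' \<in> borel_measurable lebesgue" using h' by (simp add: measurable_completion)
  have "AE x in lborel. indicator \<Omega> x *\<^sub>R h x = h' x"
    using ae by eventually_elim (auto simp: indicator_def z)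
  then have ae': "AE x in lebesgue. indicator \<Omega> x *\<^sub>R h x = h' x"
    by (simp add: AE_completion_iff)
  have "integrable (lebesgue_on \<Omega>) h \<longleftrightarrow> integrable lebesgue (\<lambda>x. indicator \<Omega> x *\<^sub>R h x)"
    using S by (rule integrable_restrict_space)
  also have "\<dots> \<longleftrightarrow> integrable lebesgue h'" by (rule integrable_cong_AE[OF mh mh' ae'])
  also have "\<dots> \<longleftrightarrow> integrable lborel h'" using h' by (intro integrable_completion) simp
  finally show "integrable (lebesgue_on \<Omega>) h \<longleftrightarrow> integrable lborel h'" .
  have "(LINT x|lebesgue_on \<Omega>. h x) = (LINT x|lebesgue. indicator \<Omega> x *\<^sub>R h x)"
    using S by (rule integral_restrict_space)
  also have "\<dots> = (LINT x|lebesgue. h' x)" by (rule integral_cong_AE[OF mh mh' ae'])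
  also have "\<dots> = (LINT x|lborel. h' x)" using h' by (intro integral_completion) simp
  finally show "(LINT x|lebesgue_on \<Omega>. h x) = (LINT x|lborel. h' x)" .
qed

lemma borel_representative:
  fixes h :: "real^'n \<Rightarrow> real"
  assumes \<Omega>: "open \<Omega>" and h: "h \<in> borel_measurable (lebesgue_on \<Omega>)"
  obtains h' where "h' \<in> borel_measurable borel" "\<And>x. x \<notin> \<Omega> \<Longrightarrow> h' x = 0" "AE x in lborel. x \<in> \<Omega> \<longrightarrow> h x = h' x"
proof -
  have S: "\<Omega> \<inter> space lebesgue \<in> sets lebesgue" using \<Omega> by auto
  have "(\<lambda>x. indicator \<Omega> x *\<^sub>R h x) \<in> borel_measurable lebesgue"
    using h borel_measurable_restrict_space_iff[OF S, of h] by simp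
  then obtain h0 where h0: "h0 \<in> borel_measurable lborel" "AE x in lborel. indicator \<Omega> x *\<^sub>R h x = h0 x"
    using completion_ex_borel_measurable_real by blast
  have [measurable]: "h0 \<in> borel_measurable borel" "\<Omega> \<in> sets borel" using h0 \<Omega> by auto
  show ?thesis
  proof (rule that[of "\<lambda>x. indicator \<Omega> x * h0 x"])
    show "AE x in lborel. x \<in> \<Omega> \<longrightarrow> h x = indicator \<Omega> x * h0 x"
      using h0(2) by eventually_elim auto
  qed auto
qed

lemma borel_measurable_vec_nth: "(\<lambda>x::real^'n. x $ i) \<in> borel_measurable borel"
  by (intro borel_measurable_continuous_onI continuous_intros)

lemma borel_representative_vec:
  fixes h :: "real^'n \<Rightarrow> real^'m"
  assumes \<Omega>: "open \<Omega>" and h: "h \<in> borel_measurable (lebesgue_on \<Omega>)"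
  obtains h' where "h' \<in> borel_measurable borel" "\<And>x. x \<notin> \<Omega> \<Longrightarrow> h' x = 0" "AE x in lborel. x \<in> \<Omega> \<longrightarrow> h x = h' x"
proof -
  have c: "(\<lambda>x. h x $ i) \<in> borel_measurable (lebesgue_on \<Omega>)" for i
    using h by (rule measurable_compose[OF _ borel_measurable_vec_nth])
  have "\<exists>h'. h' \<in> borel_measurable borel \<and> (\<forall>x. x \<notin> \<Omega> \<longrightarrow> h' x = 0) \<and> (AE x in lborel. x \<in> \<Omega> \<longrightarrow> h x $ i = h' x)" for i
    by (rule borel_representative[OF \<Omega> c[of i]]) blast
  then have "\<exists>H. \<forall>i. H i \<in> borel_measurable borel \<and> (\<forall>x. x \<notin> \<Omega> \<longrightarrow> H i x = 0) \<and> (AE x in lborel. x \<in> \<Omega> \<longrightarrow> h x $ i = H i x)"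
    by (intro choice allI)
  then obtain H where H: "\<And>i. H i \<in> borel_measurable borel" "\<And>i x. x \<notin> \<Omega> \<Longrightarrow> H i x = 0"
    "\<And>i. AE x in lborel. x \<in> \<Omega> \<longrightarrow> h x $ i = H i x" by blast
  have [measurable]: "H i \<in> borel_measurable borel" for i by (rule H)
  show ?thesis
  proof (rule that[of "\<lambda>x. \<chi> i. H i x"])
    have "(\<lambda>x. \<Sum>i\<in>UNIV. H i x *\<^sub>R axis i (1::real)) \<in> borel_measurable borel" by measurable
    also have "(\<lambda>x. \<Sum>i\<in>UNIV. H i x *\<^sub>R axis i (1::real)) = (\<lambda>x. \<chi> i. H i x)"
    proof
      fix x show "(\<Sum>i\<in>UNIV. H i x *\<^sub>R axis i (1::real)) = (\<chi> i. H i x)"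
        using basis_expansion[of "\<chi> i. H i x"] by (simp add: scalar_mult_eq_scaleR)
    qed
    finally show "(\<lambda>x. \<chi> i. H i x) \<in> borel_measurable borel" .
    show "(\<chi> i. H i x) = 0" if "x \<notin> \<Omega>" for x using H(2)[OF that] by (simp add: vec_eq_iff)
    have "AE x in lborel. \<forall>i\<in>UNIV. x \<in> \<Omega> \<longrightarrow> h x $ i = H i x"
      using H(3) by (intro AE_finite_allI) auto
    then show "AE x in lborel. x \<in> \<Omega> \<longrightarrow> h x = (\<chi> i. H i x)"
      by eventually_elim (auto simp: vec_eq_iff)
  qed
qed

text \<open>An exhaustion of \<Omega> by compact sets turns measurability on compact subsets into
  measurability on \<Omega>. It is meant for the weak gradient, of which only local integrability is
  given.\<close>

lemma locally_integrable_measurable: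
  fixes g :: "real^'n \<Rightarrow> 'b::{banach, second_countable_topology}"
  assumes \<Omega>: "open \<Omega>" and g: "g locally_integrable_on \<Omega>"
  shows "g \<in> borel_measurable (lebesgue_on \<Omega>)"
proof -
  obtain C where C: "\<And>n. compact (C n)" "\<And>n. C n \<subseteq> \<Omega>" "\<And>n. C n \<subseteq> interior (C (Suc n))" "(\<Union>n. C n) = \<Omega>"
    "\<And>K. compact K \<Longrightarrow> K \<subseteq> \<Omega> \<Longrightarrow> \<exists>N. \<forall>n\<ge>N. K \<subseteq> C n"
    by (rule open_Union_compact_subsets[OF \<Omega>]) blast
  have S: "\<Omega> \<inter> space lebesgue \<in> sets lebesgue" using \<Omega> by auto
  have "(\<lambda>x. indicator \<Omega> x *\<^sub>R g x) \<in> borel_measurable lebesgue"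
  proof (rule borel_measurable_LIMSEQ_metric)
    fix n
    have "integrable (lebesgue_on (C n)) g" using g C by (auto simp: locally_integrable_on_def)
    then have m: "g \<in> borel_measurable (lebesgue_on (C n))" by auto
    have "C n \<inter> space lebesgue \<in> sets lebesgue" using C(1)[of n] by (simp add: lmeasurable_compact fmeasurableD)
    then show "(\<lambda>x. indicator (C n) x *\<^sub>R g x) \<in> borel_measurable lebesgue"
      using m borel_measurable_restrict_space_iff by blast
  next
    fix x
    show "(\<lambda>n. indicator (C n) x *\<^sub>R g x) \<longlonglongrightarrow> indicator \<Omega> x *\<^sub>R g x"
    proof (cases "x \<in> \<Omega>")
      case True
      then obtain N where "\<And>n. n \<ge> N \<Longrightarrow> {x} \<subseteq> C n" using C(5)[of "{x}"] by auto
      then have "eventually (\<lambda>n. indicator (C n) x *\<^sub>R g x = indicator \<Omega> x *\<^sub>R g x) sequentially"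
        using True by (intro eventually_sequentiallyI[of N]) auto
      then show ?thesis by (rule tendsto_eventually)
    next
      case False
      then have "x \<notin> C n" for n using C(2) by blast
      then show ?thesis using False by simp
    qed
  qed
  then show ?thesis using borel_measurable_restrict_space_iff[OF S] by blast
qed

text \<open>On a finite measure space the integrable function \<open>1 + norm (h x) powr q\<close>
  dominates.\<close>

lemma integrable_powr_imp_integrable:
  fixes h :: "'a \<Rightarrow> 'b::{banach, second_countable_topology}"
  assumes "finite_measure M" "h \<in> borel_measurable M" "integrable M (\<lambda>x. norm (h x) powr q)" "1 \<le> q"
  shows "integrable M h"
proof -
  interpret finite_measure M by fact
  have le: "norm (h x) \<le> 1 + norm (h x) powr q" for x
  proof (cases "norm (h x) \<le> 1")
    case True
    then show ?thesis using powr_ge_zero[of "norm (h x)" q] by linarith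
  next
    case False
    then have "norm (h x) powr 1 \<le> norm (h x) powr q" using assms(4) by (intro powr_mono) auto
    then show ?thesis using False by simp
  qed
  show ?thesis
  proof (rule Bochner_Integration.integrable_bound)
    show "integrable M (\<lambda>x. 1 + norm (h x) powr q)" using assms(3) by simp
    show "AE x in M. norm (h x) \<le> norm (1 + norm (h x) powr q)"
      by (intro AE_I2 order_trans[OF le]) simp
  qed fact
qed

lemma finite_measure_lebesgue_on:
  fixes \<Omega> :: "(real^'n) set"
  assumes "open \<Omega>" "bounded \<Omega>"
  shows "finite_measure (lebesgue_on \<Omega>)"
proof (rule finite_measureI)
  have "\<Omega> \<in> sets lborel" using assms by auto
  then show "emeasure (lebesgue_on \<Omega>) (space (lebesgue_on \<Omega>)) \<noteq> \<infinity>"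
    using emeasure_bounded_finite[OF assms(2)] by (subst emeasure_restrict_space) auto
qed

definition weak_norm :: "real \<Rightarrow> (real^'n \<Rightarrow> real) \<Rightarrow> (real^'n \<Rightarrow> real^'n) \<Rightarrow> real" where
  "weak_norm q f g = (LINT x|lborel. \<bar>f x\<bar> powr q) powr (1 / q) + (LINT x|lborel. norm (g x) powr q) powr (1 / q)"

text \<open>The pair represents \<open>u\<close> and the very gradient selected by
  \<open>weak_gradient\<close>, so that \<open>weak_norm\<close> equals the Sobolev norm exactly.
  Boundedness of \<Omega> puts both into L^1, as \<open>weak_pair\<close> demands.\<close>

lemma sobolev_representative:
  fixes \<Omega> :: "(real^'n) set"
  assumes \<Omega>: "open \<Omega>" "bounded \<Omega>" and q: "1 \<le> q" and u: "u \<in> fst (sobolev_space \<Omega> q (\<lambda>_. 1))"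
  obtains f g where "weak_pair \<Omega> f g" "AE x in lborel. x \<in> \<Omega> \<longrightarrow> u x = f x"
    "integrable lborel (\<lambda>x. \<bar>f x\<bar> powr q)" "integrable lborel (\<lambda>x. norm (g x) powr q)"
    "weak_norm q f g = snd (sobolev_space \<Omega> q (\<lambda>_. 1)) u"
proof -
  define G where "G = weak_gradient \<Omega> u"
  have u: "u \<in> borel_measurable (lebesgue_on \<Omega>)" "weakly_differentiable \<Omega> u"
    "integrable (lebesgue_on \<Omega>) (\<lambda>x. \<bar>u x\<bar> powr q)" "integrable (lebesgue_on \<Omega>) (\<lambda>x. norm (G x) powr q)"
    using u by (auto simp: sobolev_space_def G_def)
  have G: "is_weak_gradient \<Omega> u G"
    unfolding G_def weak_gradient_def using u(2) unfolding weakly_differentiable_def by (rule someI_ex)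
  have mG: "G \<in> borel_measurable (lebesgue_on \<Omega>)"
    using G by (intro locally_integrable_measurable \<Omega>) (auto simp: is_weak_gradient_def)
  obtain f where f: "f \<in> borel_measurable borel" "\<And>x. x \<notin> \<Omega> \<Longrightarrow> f x = 0" "AE x in lborel. x \<in> \<Omega> \<longrightarrow> u x = f x"
    by (rule borel_representative[OF \<Omega>(1) u(1)]) blast
  obtain g where g: "g \<in> borel_measurable borel" "\<And>x. x \<notin> \<Omega> \<Longrightarrow> g x = 0" "AE x in lborel. x \<in> \<Omega> \<longrightarrow> G x = g x"
    by (rule borel_representative_vec[OF \<Omega>(1) mG]) blast
  note [measurable] = f(1) g(1) u(1) mG
  interpret finite_measure "lebesgue_on \<Omega>" using \<Omega> by (rule finite_measure_lebesgue_on)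
  have iu: "integrable (lebesgue_on \<Omega>) u" "integrable (lebesgue_on \<Omega>) G"
    using integrable_powr_imp_integrable[of "lebesgue_on \<Omega>" u q] integrable_powr_imp_integrable[of "lebesgue_on \<Omega>" G q]
      finite_measure_axioms u mG q by auto
  have tf: "integrable (lebesgue_on \<Omega>) u \<longleftrightarrow> integrable lborel f"
    by (rule lebesgue_on_transfer(1)[OF \<Omega>(1) u(1) f])
  have tg: "integrable (lebesgue_on \<Omega>) G \<longleftrightarrow> integrable lborel g"
    by (rule lebesgue_on_transfer(1)[OF \<Omega>(1) mG g])
  have uq: "integrable (lebesgue_on \<Omega>) (\<lambda>x. \<bar>u x\<bar> powr q) \<longleftrightarrow> integrable lborel (\<lambda>x. \<bar>f x\<bar> powr q)"
    "(LINT x|lebesgue_on \<Omega>. \<bar>u x\<bar> powr q) = (LINT x|lborel. \<bar>f x\<bar> powr q)"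
  proof -
    have 1: "(\<lambda>x. \<bar>u x\<bar> powr q) \<in> borel_measurable (lebesgue_on \<Omega>)" by measurable
    have 2: "(\<lambda>x. \<bar>f x\<bar> powr q) \<in> borel_measurable borel" by measurable
    have 3: "AE x in lborel. x \<in> \<Omega> \<longrightarrow> \<bar>u x\<bar> powr q = \<bar>f x\<bar> powr q" using f(3) by eventually_elim auto
    show "integrable (lebesgue_on \<Omega>) (\<lambda>x. \<bar>u x\<bar> powr q) \<longleftrightarrow> integrable lborel (\<lambda>x. \<bar>f x\<bar> powr q)"
      "(LINT x|lebesgue_on \<Omega>. \<bar>u x\<bar> powr q) = (LINT x|lborel. \<bar>f x\<bar> powr q)"
      by (rule lebesgue_on_transfer[OF \<Omega>(1) 1 2 _ 3], simp add: f)+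
  qed
  have gq: "integrable (lebesgue_on \<Omega>) (\<lambda>x. norm (G x) powr q) \<longleftrightarrow> integrable lborel (\<lambda>x. norm (g x) powr q)"
    "(LINT x|lebesgue_on \<Omega>. norm (G x) powr q) = (LINT x|lborel. norm (g x) powr q)"
  proof -
    have 1: "(\<lambda>x. norm (G x) powr q) \<in> borel_measurable (lebesgue_on \<Omega>)" by measurable
    have 2: "(\<lambda>x. norm (g x) powr q) \<in> borel_measurable borel" by measurable
    have 3: "AE x in lborel. x \<in> \<Omega> \<longrightarrow> norm (G x) powr q = norm (g x) powr q" using g(3) by eventually_elim auto
    show "integrable (lebesgue_on \<Omega>) (\<lambda>x. norm (G x) powr q) \<longleftrightarrow> integrable lborel (\<lambda>x. norm (g x) powr q)"
      "(LINT x|lebesgue_on \<Omega>. norm (G x) powr q) = (LINT x|lborel. norm (g x) powr q)"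
      by (rule lebesgue_on_transfer[OF \<Omega>(1) 1 2 _ 3], simp add: g)+
  qed
  have "(LINT x|lborel. f x * partial_deriv i \<phi> x) = - (LINT x|lborel. g x $ i * \<phi> x)"
    if \<phi>: "\<phi> \<in> test_functions \<Omega>" for \<phi> i
  proof -
    have s: "smooth \<phi>" using \<phi> by (simp add: test_functions_def)
    have [measurable]: "\<phi> \<in> borel_measurable borel" "partial_deriv i \<phi> \<in> borel_measurable borel"
      using s by (auto intro!: borel_measurable_continuous_onI smooth_continuous smooth_partial_deriv)
    have [measurable]: "\<phi> \<in> borel_measurable (lebesgue_on \<Omega>)" "partial_deriv i \<phi> \<in> borel_measurable (lebesgue_on \<Omega>)"
      by (auto intro!: measurable_restrict_space1 measurable_completion)
    have [measurable]: "(\<lambda>x. G x $ i) \<in> borel_measurable (lebesgue_on \<Omega>)" "(\<lambda>x. g x $ i) \<in> borel_measurable borel"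
      by (rule measurable_compose[OF mG borel_measurable_vec_nth], rule measurable_compose[OF g(1) borel_measurable_vec_nth])
    have 1: "(LINT x|lebesgue_on \<Omega>. u x * partial_deriv i \<phi> x) = (LINT x|lborel. f x * partial_deriv i \<phi> x)"
    proof (rule lebesgue_on_transfer(2)[OF \<Omega>(1)])
      show "AE x in lborel. x \<in> \<Omega> \<longrightarrow> u x * partial_deriv i \<phi> x = f x * partial_deriv i \<phi> x"
        using f(3) by eventually_elim auto
    qed (auto simp: f)
    have 2: "(LINT x|lebesgue_on \<Omega>. G x $ i * \<phi> x) = (LINT x|lborel. g x $ i * \<phi> x)"
    proof (rule lebesgue_on_transfer(2)[OF \<Omega>(1)])
      show "AE x in lborel. x \<in> \<Omega> \<longrightarrow> G x $ i * \<phi> x = g x $ i * \<phi> x"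
        using g(3) by eventually_elim auto
    qed (auto simp: g)
    show ?thesis using G \<phi> 1 2 by (simp add: is_weak_gradient_def)
  qed
  then have "weak_pair \<Omega> f g" using iu tf tg f(2) g(2) by (simp add: weak_pair_def)
  moreover have "weak_norm q f g = snd (sobolev_space \<Omega> q (\<lambda>_. 1)) u"
    using uq(2) gq(2) by (simp add: weak_norm_def sobolev_space_def sobolev_norm_def G_def)
  ultimately show ?thesis using that f(3) uq(1) gq(1) u by blast
qed

section \<open>Smooth domains satisfy a uniform cone condition\<close>

lemma smooth_Lipschitz_on_cball:
  fixes f :: "real^'n \<Rightarrow> real"
  assumes f: "smooth f"
  obtains L where "0 \<le> L" "\<And>x y. x \<in> cball c r \<Longrightarrow> y \<in> cball c r \<Longrightarrow> \<bar>f x - f y\<bar> \<le> L * norm (x - y)"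
proof -
  have "\<exists>B. 0 \<le> B \<and> (\<forall>x\<in>cball c r. \<bar>partial_deriv i f x\<bar> \<le> B)" for i
  proof -
    have "bounded (partial_deriv i f ` cball c r)"
      by (intro compact_imp_bounded compact_continuous_image smooth_continuous smooth_partial_deriv f compact_cball)
    then obtain B where "\<forall>x\<in>cball c r. \<bar>partial_deriv i f x\<bar> \<le> B"
      by (auto simp: bounded_iff simp del: mem_cball)
    then show ?thesis by (intro exI[of _ "max B 0"]) (auto simp: le_max_iff_disj simp del: mem_cball)
  qed
  then obtain B where B: "\<And>i. 0 \<le> B i" "\<And>i x. x \<in> cball c r \<Longrightarrow> \<bar>partial_deriv i f x\<bar> \<le> B i" by metis
  show ?thesis
    by (rule that[of "\<Sum>i\<in>UNIV. B i"])
      (use B in \<open>auto intro!: sum_nonneg smooth_Lipschitz_on_convex[OF f convex_cball[of c r]] simp del: mem_cball\<close>)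
qed

text \<open>Near a boundary point \<Omega> lies above the graph of a function with Lipschitz
  constant \<open>L\<close> there, so a small displacement that rises more than \<open>L\<close>
  times its horizontal length leads from \<Omega> into \<Omega>. Such displacements form a cone
  around \<open>e\<close>.\<close>

lemma smooth_domain_uniform_cone:
  fixes \<Omega> :: "(real^'n) set"
  assumes "bounded_smooth_domain \<Omega>"
  shows "uniform_cone \<Omega>"
proof -
  have \<Omega>: "open \<Omega>" "bounded \<Omega>" "smooth_boundary \<Omega>" using assms by (auto simp: bounded_smooth_domain_def)
  have "\<exists>R l u. 0 < R \<and> cone_patch \<Omega> (ball x0 R) l u" if x0: "x0 \<in> closure \<Omega>" for x0
  proof (cases "x0 \<in> \<Omega>")
    case True
    then obtain d where d: "0 < d" "ball x0 d \<subseteq> \<Omega>" using \<Omega>(1) open_contains_ball by blast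
    \<comment> \<open>Near an interior point any box of sufficiently short displacements will
      do.\<close>
    obtain l u where lu: "cbox l u \<subseteq> ball (0::real^'n) (d / 2)" "box l u \<noteq> {}"
    proof -
      have "(0::real^'n) \<in> ball 0 (d / 2)" using d by simp
      from this obtain l u where "0 \<in> box l u" "cbox l u \<subseteq> ball (0::real^'n) (d / 2)"
        by (rule open_contains_cbox[OF open_ball]) blast
      then show ?thesis using that by blast
    qed
    have "cone_patch \<Omega> (ball x0 (d / 2)) l u"
      unfolding cone_patch_def
    proof (intro conjI ballI allI impI)
      fix x z and t :: real assume x: "x \<in> ball x0 (d / 2) \<inter> \<Omega>" and z: "z \<in> cbox l u" and t: "0 < t \<and> t \<le> 1"
      have "norm (t *\<^sub>R z) \<le> norm z" using t by (simp add: mult_left_le_one_le)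
      also have "\<dots> < d / 2" using z lu by auto
      finally have "dist x (x + t *\<^sub>R z) < d / 2" by (simp add: dist_norm)
      moreover have "dist x0 x < d / 2" using x by simp
      ultimately have "dist x0 (x + t *\<^sub>R z) < d" using dist_triangle[of x0 "x + t *\<^sub>R z" x] by linarith
      then show "x + t *\<^sub>R z \<in> \<Omega>" using d(2) by auto
    qed (use lu in auto)
    then show ?thesis using d(1) by (metis half_gt_zero)
  next
    case False
    then have "x0 \<in> frontier \<Omega>" using x0 \<Omega>(1) by (simp add: frontier_def interior_open)
    then obtain r e \<gamma> where r: "0 < r" "norm e = 1" "smooth \<gamma>"
        "\<Omega> \<inter> ball x0 r = {x \<in> ball x0 r. \<gamma> (x - (x \<bullet> e) *\<^sub>R e) < x \<bullet> e}"
      using \<Omega>(3) unfolding smooth_boundary_def by blast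
    define P where "P x = x - (x \<bullet> e) *\<^sub>R e" for x
    have P_add: "P (x + y) = P x + P y" and P_scale: "P (c *\<^sub>R x) = c *\<^sub>R P x" for x y c
      by (simp_all add: P_def algebra_simps inner_add_left scaleR_add_left)
    have ee: "e \<bullet> e = 1" using r(2) by (simp add: norm_eq_1)
    have P_e: "P (c *\<^sub>R e) = 0" for c using ee by (simp add: P_def)
    have P_norm: "norm (P x) \<le> norm x" for x
    proof -
      have "(norm (P x))\<^sup>2 = (norm x)\<^sup>2 - (x \<bullet> e)\<^sup>2"
        unfolding power2_norm_eq_inner P_def
        by (simp add: ee inner_diff_left inner_diff_right inner_commute power2_eq_square)
      then have "(norm (P x))\<^sup>2 \<le> (norm x)\<^sup>2" by simp
      then show ?thesis by (rule power2_le_imp_le) simp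
    qed
    have P_diff: "P x - P y = P (x - y)" for x y by (simp add: P_def inner_diff_left algebra_simps)
    obtain L where L: "0 \<le> L" "\<And>x y. x \<in> cball (P x0) r \<Longrightarrow> y \<in> cball (P x0) r \<Longrightarrow> \<bar>\<gamma> x - \<gamma> y\<bar> \<le> L * norm (x - y)"
      by (rule smooth_Lipschitz_on_cball[OF r(3), of "P x0" r]) blast
    \<comment> \<open>If \<open>z\<close> is closer than \<rho> to \<open>a\<close>, its horizontal
      part has length at most \<rho> and its rise exceeds \<open>L * \<rho>\<close>. The denominator
      in \<rho> gives \<open>norm z < (L + 2) * \<rho> < r / 2\<close>, so the displaced points stay
      in the chart.\<close>
    define \<rho> where "\<rho> = r / (2 * (L + 3))"
    have \<rho>: "0 < \<rho>" "(L + 2) * \<rho> < r / 2" using r(1) L(1) by (auto simp: \<rho>_def field_simps)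
    define a where "a = ((L + 1) * \<rho>) *\<^sub>R e"
    obtain l u where lu: "cbox l u \<subseteq> ball a \<rho>" "box l u \<noteq> {}"
    proof -
      have "a \<in> ball a \<rho>" using \<rho> by simp
      then obtain l u where "a \<in> box l u" "cbox l u \<subseteq> ball a \<rho>"
        by (rule open_contains_cbox[OF open_ball]) blast
      then show ?thesis using that by blast
    qed
    have "cone_patch \<Omega> (ball x0 (r / 2)) l u"
      unfolding cone_patch_def
    proof (intro conjI ballI allI impI)
      fix x z and t :: real assume x: "x \<in> ball x0 (r / 2) \<inter> \<Omega>" and z: "z \<in> cbox l u" and t: "0 < t \<and> t \<le> 1"
      have za: "norm (z - a) < \<rho>" using z lu by (auto simp: dist_norm norm_minus_commute)
      have "norm a = (L + 1) * \<rho>" using r(2) L(1) \<rho>(1) by (simp add: a_def)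
      then have "norm z < (L + 2) * \<rho>" using norm_triangle_sub[of z a] za by (simp add: algebra_simps)
      then have zr: "norm z < r / 2" using \<rho>(2) by linarith
      have "norm (t *\<^sub>R z) \<le> norm z" using t by (simp add: mult_left_le_one_le)
      then have "dist x (x + t *\<^sub>R z) < r / 2" using zr by (simp add: dist_norm)
      moreover have xr: "dist x0 x < r / 2" using x by simp
      ultimately have in_ball: "x + t *\<^sub>R z \<in> ball x0 r" using dist_triangle[of x0 "x + t *\<^sub>R z" x] by simp
      have Pz: "norm (P z) \<le> \<rho>"
      proof -
        have "P z = P (z - a)" using P_e[of "(L + 1) * \<rho>"] P_diff[of z a] by (simp add: a_def)
        then show ?thesis using P_norm[of "z - a"] za by simp
      qed
      have "\<bar>(z - a) \<bullet> e\<bar> \<le> norm (z - a)" using Cauchy_Schwarz_ineq2[of "z - a" e] r(2) by simp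
      moreover have "a \<bullet> e = (L + 1) * \<rho>" using ee by (simp add: a_def)
      ultimately have ze: "L * \<rho> < z \<bullet> e" using za by (simp add: inner_diff_left algebra_simps) 
      have "\<bar>\<gamma> (P (x + t *\<^sub>R z)) - \<gamma> (P x)\<bar> \<le> L * norm (P (x + t *\<^sub>R z) - P x)"
      proof (rule L(2))
        show "P (x + t *\<^sub>R z) \<in> cball (P x0) r" "P x \<in> cball (P x0) r"
          using in_ball xr r(1) P_norm[of "x + t *\<^sub>R z - x0"] P_norm[of "x - x0"]
          by (auto simp: dist_norm norm_minus_commute simp flip: P_diff)
      qed
      also have "\<dots> \<le> L * (t * \<rho>)"
        using L(1) t Pz by (auto simp: P_add P_scale intro!: mult_left_mono)
      also have "\<dots> = t * (L * \<rho>)" by simp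
      also have "\<dots> < t * (z \<bullet> e)" using t ze by (intro mult_strict_left_mono) auto
      finally have "\<gamma> (P (x + t *\<^sub>R z)) < \<gamma> (P x) + t * (z \<bullet> e)" by linarith
      moreover have "\<gamma> (P x) < x \<bullet> e"
      proof -
        have "dist x0 x < r" using xr r(1) by linarith
        then have "x \<in> \<Omega> \<inter> ball x0 r" using x by auto
        then show ?thesis unfolding r(4) P_def by simp
      qed
      ultimately have "\<gamma> (P (x + t *\<^sub>R z)) < (x + t *\<^sub>R z) \<bullet> e" by (simp add: inner_add_left)
      then have "x + t *\<^sub>R z \<in> \<Omega> \<inter> ball x0 r" unfolding r(4) using in_ball by (simp add: P_def)
      then show "x + t *\<^sub>R z \<in> \<Omega>" by simp
    qed (use lu in auto)
    then show ?thesis using r(1) by (metis half_gt_zero)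
  qed
  then show ?thesis using \<Omega> by (auto simp: uniform_cone_def)
qed

section \<open>Embeddings\<close>

text \<open>Hoelder against the indicator of \<Omega>. The case \<open>q = r\<close> is separate
  because \<open>Holder_powr\<close> asks for exponents strictly between 0 and 1.\<close>

lemma Lq_le_Lr:
  fixes \<Omega> :: "(real^'n) set"
  assumes \<Omega>: "open \<Omega>" "bounded \<Omega>" and q: "0 < q" "q \<le> r"
  obtains C :: real where "0 \<le> C"
    "\<And>f. f \<in> borel_measurable borel \<Longrightarrow> (\<And>x. x \<notin> \<Omega> \<Longrightarrow> f x = 0) \<Longrightarrow> integrable lborel (\<lambda>x. \<bar>f x\<bar> powr r) \<Longrightarrow>
      integrable lborel (\<lambda>x. \<bar>f x\<bar> powr q) \<and>
      (LINT x|lborel. \<bar>f x\<bar> powr q) powr (1 / q) \<le> C * (LINT x|lborel. \<bar>f x\<bar> powr r) powr (1 / r)"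
proof (cases "q = r")
  case True
  then show ?thesis by (intro that[of 1]) auto
next
  case False
  then have qr: "q < r" using q by simp
  have "emeasure lborel \<Omega> < \<infinity>" using \<Omega>(2) by (rule emeasure_bounded_finite)
  then have i\<Omega>: "integrable lborel (indicator \<Omega> :: _ \<Rightarrow> real)" using \<Omega> by (intro integrable_real_indicator) auto
  let ?C = "((LINT x|lborel. indicator \<Omega> x) powr (1 - q / r)) powr (1 / q)"
  show ?thesis
  proof (rule that[of ?C])
    show "0 \<le> ?C" by simp
    fix f :: "real^'n \<Rightarrow> real"
    assume f: "f \<in> borel_measurable borel" "\<And>x. x \<notin> \<Omega> \<Longrightarrow> f x = 0" "integrable lborel (\<lambda>x. \<bar>f x\<bar> powr r)"
    have eq: "(\<bar>f x\<bar> powr r) powr (q / r) * indicator \<Omega> x powr (1 - q / r) = \<bar>f x\<bar> powr q" for x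
      using f(2)[of x] q qr by (auto simp: powr_powr indicator_def)
    have h: "integrable lborel (\<lambda>x. \<bar>f x\<bar> powr q)"
      "(LINT x|lborel. \<bar>f x\<bar> powr q) \<le> (LINT x|lborel. \<bar>f x\<bar> powr r) powr (q / r) * (LINT x|lborel. indicator \<Omega> x) powr (1 - q / r)"
      using Holder_powr[OF f(3) _ i\<Omega>, of "q / r"] q qr unfolding eq by auto
    have "(LINT x|lborel. \<bar>f x\<bar> powr q) powr (1 / q)
        \<le> ((LINT x|lborel. \<bar>f x\<bar> powr r) powr (q / r) * (LINT x|lborel. indicator \<Omega> x) powr (1 - q / r)) powr (1 / q)"
      using h(2) q by (intro powr_mono2) auto
    also have "\<dots> = ?C * (LINT x|lborel. \<bar>f x\<bar> powr r) powr (1 / r)"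
      using q qr by (simp add: powr_mult powr_powr)
    finally show "integrable lborel (\<lambda>x. \<bar>f x\<bar> powr q) \<and>
      (LINT x|lborel. \<bar>f x\<bar> powr q) powr (1 / q) \<le> ?C * (LINT x|lborel. \<bar>f x\<bar> powr r) powr (1 / r)"
      using h(1) by simp
  qed
qed

lemma weak_norm_mono_exponent:
  fixes \<Omega> :: "(real^'n) set"
  assumes \<Omega>: "open \<Omega>" "bounded \<Omega>" and q: "0 < q" "q \<le> r"
  obtains C :: real where "0 \<le> C"
    "\<And>f g. weak_pair \<Omega> f g \<Longrightarrow> integrable lborel (\<lambda>x. \<bar>f x\<bar> powr r) \<Longrightarrow> integrable lborel (\<lambda>x. norm (g x) powr r) \<Longrightarrow>
      integrable lborel (\<lambda>x. \<bar>f x\<bar> powr q) \<and> integrable lborel (\<lambda>x. norm (g x) powr q) \<and> weak_norm q f g \<le> C * weak_norm r f g"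
proof -
  obtain C where C: "0 \<le> C"
    "\<And>f. f \<in> borel_measurable borel \<Longrightarrow> (\<And>x. x \<notin> \<Omega> \<Longrightarrow> f x = 0) \<Longrightarrow> integrable lborel (\<lambda>x. \<bar>f x\<bar> powr r) \<Longrightarrow>
      integrable lborel (\<lambda>x. \<bar>f x\<bar> powr q) \<and>
      (LINT x|lborel. \<bar>f x\<bar> powr q) powr (1 / q) \<le> C * (LINT x|lborel. \<bar>f x\<bar> powr r) powr (1 / r)"
    by (rule Lq_le_Lr[OF \<Omega> q]) blast
  show ?thesis
  proof (rule that[OF C(1)])
    fix f :: "real^'n \<Rightarrow> real" and g :: "real^'n \<Rightarrow> real^'n"
    assume w: "weak_pair \<Omega> f g" and i: "integrable lborel (\<lambda>x. \<bar>f x\<bar> powr r)" "integrable lborel (\<lambda>x. norm (g x) powr r)"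
    have [measurable]: "f \<in> borel_measurable borel" "g \<in> borel_measurable borel" using w by (auto simp: weak_pair_def)
    have 1: "integrable lborel (\<lambda>x. \<bar>f x\<bar> powr q) \<and>
      (LINT x|lborel. \<bar>f x\<bar> powr q) powr (1 / q) \<le> C * (LINT x|lborel. \<bar>f x\<bar> powr r) powr (1 / r)"
      by (rule C(2)) (use w i in \<open>auto simp: weak_pair_def\<close>)
    have 2: "integrable lborel (\<lambda>x. \<bar>norm (g x)\<bar> powr q) \<and>
      (LINT x|lborel. \<bar>norm (g x)\<bar> powr q) powr (1 / q) \<le> C * (LINT x|lborel. \<bar>norm (g x)\<bar> powr r) powr (1 / r)"
      by (rule C(2)) (use w i in \<open>auto simp: weak_pair_def\<close>)
    from 1 2 show "integrable lborel (\<lambda>x. \<bar>f x\<bar> powr q) \<and> integrable lborel (\<lambda>x. norm (g x) powr q) \<and> weak_norm q f g \<le> C * weak_norm r f g"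
      by (simp add: weak_norm_def distrib_left)
  qed
qed

text \<open>The Sobolev inequality for Borel pairs with its constant hidden: the form in which
  exponents are lowered and which both the continuous and the compact embedding consume.\<close>

definition Lr_bounded :: "(real^'n) set \<Rightarrow> real \<Rightarrow> real \<Rightarrow> bool" where
  "Lr_bounded \<Omega> p r \<longleftrightarrow> (\<exists>C\<ge>0. \<forall>f g. weak_pair \<Omega> f g \<longrightarrow> integrable lborel (\<lambda>x. \<bar>f x\<bar> powr p) \<longrightarrow>
      integrable lborel (\<lambda>x. norm (g x) powr p) \<longrightarrow>
      integrable lborel (\<lambda>x. \<bar>f x\<bar> powr r) \<and> (LINT x|lborel. \<bar>f x\<bar> powr r) powr (1 / r) \<le> C * weak_norm p f g)"

lemma Lr_bounded_mono:
  assumes \<Omega>: "open \<Omega>" "bounded \<Omega>" and "Lr_bounded \<Omega> p r" "0 < q" "q \<le> r"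
  shows "Lr_bounded \<Omega> p q"
proof -
  obtain C1 where C1: "0 \<le> C1" "\<And>f g. weak_pair \<Omega> f g \<Longrightarrow> integrable lborel (\<lambda>x. \<bar>f x\<bar> powr p) \<Longrightarrow>
      integrable lborel (\<lambda>x. norm (g x) powr p) \<Longrightarrow>
      integrable lborel (\<lambda>x. \<bar>f x\<bar> powr r) \<and> (LINT x|lborel. \<bar>f x\<bar> powr r) powr (1 / r) \<le> C1 * weak_norm p f g"
    using assms(3) unfolding Lr_bounded_def by blast
  obtain C where C: "0 \<le> C"
    "\<And>f. f \<in> borel_measurable borel \<Longrightarrow> (\<And>x. x \<notin> \<Omega> \<Longrightarrow> f x = 0) \<Longrightarrow> integrable lborel (\<lambda>x. \<bar>f x\<bar> powr r) \<Longrightarrow>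
      integrable lborel (\<lambda>x. \<bar>f x\<bar> powr q) \<and>
      (LINT x|lborel. \<bar>f x\<bar> powr q) powr (1 / q) \<le> C * (LINT x|lborel. \<bar>f x\<bar> powr r) powr (1 / r)"
    by (rule Lq_le_Lr[OF \<Omega> assms(4,5)]) blast
  show ?thesis
    unfolding Lr_bounded_def
  proof (intro exI[of _ "C * C1"] conjI allI impI)
    show "0 \<le> C * C1" using C(1) C1(1) by simp
    fix f :: "real^'a \<Rightarrow> real" and g :: "real^'a \<Rightarrow> real^'a"
    assume w: "weak_pair \<Omega> f g" "integrable lborel (\<lambda>x. \<bar>f x\<bar> powr p)" "integrable lborel (\<lambda>x. norm (g x) powr p)"
    note c1 = C1(2)[OF w]
    have c: "integrable lborel (\<lambda>x. \<bar>f x\<bar> powr q) \<and>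
      (LINT x|lborel. \<bar>f x\<bar> powr q) powr (1 / q) \<le> C * (LINT x|lborel. \<bar>f x\<bar> powr r) powr (1 / r)"
      by (rule C(2)) (use w(1) c1 in \<open>auto simp: weak_pair_def\<close>)
    then show "integrable lborel (\<lambda>x. \<bar>f x\<bar> powr q)" ..
    have "(LINT x|lborel. \<bar>f x\<bar> powr q) powr (1 / q) \<le> C * (C1 * weak_norm p f g)"
      using c c1 C(1) by (meson mult_left_mono order_trans)
    then show "(LINT x|lborel. \<bar>f x\<bar> powr q) powr (1 / q) \<le> C * C1 * weak_norm p f g" by (simp add: mult.assoc)
  qed
qed

lemma Lr_bounded_critical:
  fixes \<Omega> :: "(real^'n) set"
  assumes U: "uniform_cone \<Omega>" and n: "CARD('n) \<ge> 2" and p: "1 \<le> p" "p < real CARD('n)"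
  shows "Lr_bounded \<Omega> p (real CARD('n) * p / (real CARD('n) - p))"
proof -
  define q where "q = real CARD('n) * p / (real CARD('n) - p)"
  have q: "0 < q" using p n by (auto simp: q_def)
  obtain C where C: "0 \<le> C"
    "\<And>f g. weak_pair \<Omega> f g \<Longrightarrow> integrable lborel (\<lambda>x. \<bar>f x\<bar> powr p) \<Longrightarrow> integrable lborel (\<lambda>x. norm (g x) powr p) \<Longrightarrow>
      integrable lborel (\<lambda>x. \<bar>f x\<bar> powr q) \<and> (LINT x|lborel. \<bar>f x\<bar> powr q)
        \<le> C * ((LINT x|lborel. \<bar>f x\<bar> powr p) + (LINT x|lborel. norm (g x) powr p)) powr (q / p)"
    unfolding q_def by (rule Sobolev_uniform_cone[OF U n p]) blast
  have "Lr_bounded \<Omega> p q"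
    unfolding Lr_bounded_def
  proof (intro exI[of _ "C powr (1 / q) * 2 powr (1 / p)"] conjI allI impI)
    fix f :: "real^'n \<Rightarrow> real" and g :: "real^'n \<Rightarrow> real^'n"
    assume w: "weak_pair \<Omega> f g" "integrable lborel (\<lambda>x. \<bar>f x\<bar> powr p)" "integrable lborel (\<lambda>x. norm (g x) powr p)"
    note c = C(2)[OF w]
    show "integrable lborel (\<lambda>x. \<bar>f x\<bar> powr q)" using c ..
    let ?S = "(LINT x|lborel. \<bar>f x\<bar> powr p) + (LINT x|lborel. norm (g x) powr p)"
    have S: "0 \<le> ?S" by simp
    have "(LINT x|lborel. \<bar>f x\<bar> powr q) powr (1 / q) \<le> (C * ?S powr (q / p)) powr (1 / q)"
      using c q by (intro powr_mono2) auto
    also have "\<dots> = C powr (1 / q) * ?S powr (1 / p)"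
      using C(1) q by (simp add: powr_mult powr_powr)
    also have "\<dots> \<le> C powr (1 / q) * (2 powr (1 / p) * weak_norm p f g)"
      unfolding weak_norm_def using p by (intro mult_left_mono powr_add_le) auto
    finally show "(LINT x|lborel. \<bar>f x\<bar> powr q) powr (1 / q) \<le> C powr (1 / q) * 2 powr (1 / p) * weak_norm p f g"
      by (simp add: mult.assoc)
  qed simp
  then show ?thesis by (simp add: q_def)
qed

text \<open>The exponent N is lowered to some \<open>p < N\<close> whose critical exponent is at
  least \<open>r\<close>; on a bounded set the norm with exponent N dominates the one with exponent
  \<open>p\<close>.\<close>

lemma Lr_bounded_dimension:
  fixes \<Omega> :: "(real^'n) set"
  assumes U: "uniform_cone \<Omega>" and n: "CARD('n) \<ge> 2" and r: "1 \<le> r"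
  shows "Lr_bounded \<Omega> (real CARD('n)) r"
proof -
  define N where "N = real CARD('n)"
  have N: "2 \<le> N" using n by (simp add: N_def)
  have \<Omega>: "open \<Omega>" "bounded \<Omega>" using U by (auto simp: uniform_cone_def)
  \<comment> \<open>The exponent \<open>p\<close> defined next has critical exponent
    \<open>q\<close>; raising \<open>q\<close> to at least \<open>N / (N - 1)\<close> ensures
    \<open>p \<ge> 1\<close>.\<close>
  define q where "q = max r (N / (N - 1))"
  have q: "1 \<le> q" "r \<le> q" "N / (N - 1) \<le> q" using r by (auto simp: q_def)
  define p where "p = N * q / (N + q)"
  have Nq: "N \<le> q * (N - 1)" using q(3) N by (simp add: pos_divide_le_eq)
  have p: "1 \<le> p" "p < N" using N q Nq by (auto simp: p_def field_simps)
  have "N * p / (N - p) = q"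
  proof -
    have "N - p = N * N / (N + q)" using N q by (simp add: p_def field_simps)
    then show ?thesis using N q by (simp add: p_def)
  qed
  then have "Lr_bounded \<Omega> p q" using Lr_bounded_critical[OF U n p[unfolded N_def]] by (simp add: N_def)
  then have "Lr_bounded \<Omega> p r" using r q by (intro Lr_bounded_mono[OF \<Omega>, of p q r]) auto
  then obtain C1 where C1: "0 \<le> C1" "\<And>f g. weak_pair \<Omega> f g \<Longrightarrow> integrable lborel (\<lambda>x. \<bar>f x\<bar> powr p) \<Longrightarrow>
      integrable lborel (\<lambda>x. norm (g x) powr p) \<Longrightarrow>
      integrable lborel (\<lambda>x. \<bar>f x\<bar> powr r) \<and> (LINT x|lborel. \<bar>f x\<bar> powr r) powr (1 / r) \<le> C1 * weak_norm p f g"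
    unfolding Lr_bounded_def by blast
  have "0 < p" "p \<le> N" using p by auto
  then obtain C where C: "0 \<le> C"
    "\<And>f g. weak_pair \<Omega> f g \<Longrightarrow> integrable lborel (\<lambda>x. \<bar>f x\<bar> powr N) \<Longrightarrow> integrable lborel (\<lambda>x. norm (g x) powr N) \<Longrightarrow>
      integrable lborel (\<lambda>x. \<bar>f x\<bar> powr p) \<and> integrable lborel (\<lambda>x. norm (g x) powr p) \<and> weak_norm p f g \<le> C * weak_norm N f g"
    by (rule weak_norm_mono_exponent[OF \<Omega>]) blast
  have "Lr_bounded \<Omega> N r"
    unfolding Lr_bounded_def
  proof (intro exI[of _ "C1 * C"] conjI allI impI)
    show "0 \<le> C1 * C" using C(1) C1(1) by simp
    fix f :: "real^'n \<Rightarrow> real" and g :: "real^'n \<Rightarrow> real^'n"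
    assume w: "weak_pair \<Omega> f g" "integrable lborel (\<lambda>x. \<bar>f x\<bar> powr N)" "integrable lborel (\<lambda>x. norm (g x) powr N)"
    note c = C(2)[OF w]
    then have c1: "integrable lborel (\<lambda>x. \<bar>f x\<bar> powr r) \<and> (LINT x|lborel. \<bar>f x\<bar> powr r) powr (1 / r) \<le> C1 * weak_norm p f g"
      using C1(2)[OF w(1)] by blast
    then show "integrable lborel (\<lambda>x. \<bar>f x\<bar> powr r)" ..
    have "(LINT x|lborel. \<bar>f x\<bar> powr r) powr (1 / r) \<le> C1 * (C * weak_norm N f g)"
      using c c1 C1(1) by (meson mult_left_mono order_trans)
    then show "(LINT x|lborel. \<bar>f x\<bar> powr r) powr (1 / r) \<le> C1 * C * weak_norm N f g" by (simp add: mult.assoc)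
  qed
  then show ?thesis by (simp add: N_def)
qed

section \<open>Compactness in L^q\<close>

text \<open>Values below the level \<open>A\<close> are controlled by the first power, values above
  it by the power \<open>r\<close>. Since \<open>A\<close> is free, the contribution of the large
  values can be made small first.\<close>

lemma powr_interpolation:
  fixes a A :: real
  assumes "0 \<le> a" "0 < A" "1 \<le> q" "q < r"
  shows "a powr q \<le> A powr (q - 1) * a + A powr (q - r) * a powr r"
proof (cases "a = 0")
  case False
  then have a: "0 < a" using assms by simp
  show ?thesis
  proof (cases "a \<le> A")
    case True
    have "a powr q = a powr (q - 1) * a" using a by (simp add: powr_diff)
    also have "\<dots> \<le> A powr (q - 1) * a" using True a assms by (intro mult_right_mono powr_mono2) auto
    finally show ?thesis using assms by (simp add: add_increasing2)
  next
    case False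
    have "a powr q = a powr (q - r) * a powr r" using a by (simp flip: powr_add)
    also have "\<dots> \<le> A powr (q - r) * a powr r"
      using False a assms by (intro mult_right_mono powr_mono2') auto
    finally show ?thesis using a assms by (simp add: add_increasing)
  qed
qed simp

text \<open>A subsequence converges almost everywhere, and Fatou's lemma gives both the L^r bound of
  the limit and convergence in mean. Interpolation between the two yields convergence in
  L^q.\<close>

lemma L1_Cauchy_imp_Lq_convergent:
  fixes F :: "nat \<Rightarrow> 'a::euclidean_space \<Rightarrow> real"
  assumes F: "\<And>n. integrable lborel (F n)" and q: "1 \<le> q" "q < r"
    and B: "\<And>n. integrable lborel (\<lambda>x. \<bar>F n x\<bar> powr r)" "\<And>n. (LINT x|lborel. \<bar>F n x\<bar> powr r) \<le> B"
    and C: "\<And>e. 0 < e \<Longrightarrow> \<exists>N. \<forall>i\<ge>N. \<forall>j\<ge>N. (LINT x|lborel. \<bar>F i x - F j x\<bar>) < e"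
    and z: "\<And>n x. x \<notin> \<Omega> \<Longrightarrow> F n x = 0"
  obtains f s where "strict_mono (s :: nat \<Rightarrow> nat)" "f \<in> borel_measurable borel" "\<And>x. x \<notin> \<Omega> \<Longrightarrow> f x = 0"
    "integrable lborel f" "integrable lborel (\<lambda>x. \<bar>f x\<bar> powr r)"
    "(\<lambda>n. LINT x|lborel. \<bar>F (s n) x - f x\<bar> powr q) \<longlonglongrightarrow> 0"
proof -
  obtain s where s: "strict_mono (s :: nat \<Rightarrow> nat)" "AE x in lborel. Cauchy (\<lambda>i. F (s i) x)"
    by (rule cauchy_L1_AE_cauchy_subseq[of lborel F]) (use F C in auto)
  have [measurable]: "F n \<in> borel_measurable borel" for n using F[of n] by auto
  define f where "f x = lim (\<lambda>i. F (s i) x)" for x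
  have [measurable]: "f \<in> borel_measurable borel" unfolding f_def by measurable
  have lim: "AE x in lborel. (\<lambda>i. F (s i) x) \<longlonglongrightarrow> f x"
    using s(2) by eventually_elim (auto simp: f_def Cauchy_convergent_iff convergent_LIMSEQ_iff)
  have fz: "f x = 0" if "x \<notin> \<Omega>" for x using z[OF that] by (simp add: f_def)
  have fr: "integrable lborel (\<lambda>x. \<bar>f x\<bar> powr r)" "(LINT x|lborel. \<bar>f x\<bar> powr r) \<le> B"
  proof -
    have "AE x in lborel. (\<lambda>i. \<bar>F (s i) x\<bar> powr r) \<longlonglongrightarrow> \<bar>f x\<bar> powr r"
      using lim by eventually_elim (use q in \<open>auto intro!: tendsto_powr' tendsto_rabs\<close>)
    note * = integrable_Fatou[OF B(1) _ B(2) this]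
    show "integrable lborel (\<lambda>x. \<bar>f x\<bar> powr r)" by (rule *(1)) auto
    show "(LINT x|lborel. \<bar>f x\<bar> powr r) \<le> B" by (rule *(2)) auto
  qed
  have near: "\<exists>N. \<forall>n\<ge>N. integrable lborel (\<lambda>x. \<bar>F (s n) x - f x\<bar>) \<and> (LINT x|lborel. \<bar>F (s n) x - f x\<bar>) \<le> e" if e: "0 < e" for e
  proof -
    obtain N where N: "\<And>i j. i \<ge> N \<Longrightarrow> j \<ge> N \<Longrightarrow> (LINT x|lborel. \<bar>F i x - F j x\<bar>) < e" using C[OF e] by blast
    have "integrable lborel (\<lambda>x. \<bar>F (s n) x - f x\<bar>) \<and> (LINT x|lborel. \<bar>F (s n) x - f x\<bar>) \<le> e" if n: "n \<ge> N" for n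
    proof -
      have sn: "N \<le> s k" if "N \<le> k" for k using that seq_suble[OF s(1), of k] by linarith
      \<comment> \<open>Fatou's lemma in the second index: \<open>F (s n)\<close> is compared with
        later members of the subsequence.\<close>
      have "AE x in lborel. (\<lambda>i. \<bar>F (s n) x - F (s (i + N)) x\<bar>) \<longlonglongrightarrow> \<bar>F (s n) x - f x\<bar>"
        using lim by eventually_elim (intro tendsto_rabs tendsto_diff tendsto_const LIMSEQ_ignore_initial_segment)
      note * = integrable_Fatou[OF _ _ _ this, of e]
      have i: "integrable lborel (\<lambda>x. \<bar>F (s n) x - F (s (i + N)) x\<bar>)" for i using F by auto
      have le: "(LINT x|lborel. \<bar>F (s n) x - F (s (i + N)) x\<bar>) \<le> e" for i
        using N[OF sn[OF n] sn[of "i + N"]] by simp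
      show ?thesis using *[OF i _ le] by auto
    qed
    then show ?thesis by blast
  qed
  have "\<exists>N. \<forall>n\<ge>N. integrable lborel (\<lambda>x. \<bar>F (s n) x - f x\<bar>) \<and> (LINT x|lborel. \<bar>F (s n) x - f x\<bar>) \<le> 1"
    by (rule near) simp
  then obtain n where "integrable lborel (\<lambda>x. \<bar>F (s n) x - f x\<bar>)" by blast
  then have "integrable lborel (\<lambda>x. norm (F (s n) x - f x))" by simp
  then have "integrable lborel (\<lambda>x. F (s n) x - f x)" by (subst (asm) integrable_norm_iff) auto
  then have "integrable lborel (\<lambda>x. F (s n) x - (F (s n) x - f x))" by (rule Bochner_Integration.integrable_diff[OF F])
  then have if1: "integrable lborel f" by simp
  define D where "D = 2 powr r * (B + B)"
  have h: "integrable lborel (\<lambda>x. \<bar>F (s n) x - f x\<bar> powr r)" "(LINT x|lborel. \<bar>F (s n) x - f x\<bar> powr r) \<le> D" for n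
  proof -
    have le: "\<bar>F (s n) x - f x\<bar> powr r \<le> 2 powr r * (\<bar>F (s n) x\<bar> powr r + \<bar>f x\<bar> powr r)" for x
    proof -
      have "\<bar>F (s n) x - f x\<bar> powr r \<le> (\<bar>F (s n) x\<bar> + \<bar>f x\<bar>) powr r" using q by (intro powr_mono2) auto
      also have "\<dots> \<le> 2 powr r * (\<bar>F (s n) x\<bar> powr r + \<bar>f x\<bar> powr r)" using q by (intro powr_add_le) auto
      finally show ?thesis .
    qed
    have i: "integrable lborel (\<lambda>x. 2 powr r * (\<bar>F (s n) x\<bar> powr r + \<bar>f x\<bar> powr r))" using B fr by auto
    show "integrable lborel (\<lambda>x. \<bar>F (s n) x - f x\<bar> powr r)"
      by (rule Bochner_Integration.integrable_bound[OF i]) (use le in \<open>auto intro!: AE_I2 intro: order_trans[OF _ abs_ge_self]\<close>)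
    have "(LINT x|lborel. \<bar>F (s n) x - f x\<bar> powr r) \<le> (LINT x|lborel. 2 powr r * (\<bar>F (s n) x\<bar> powr r + \<bar>f x\<bar> powr r))"
      by (rule integral_mono'[OF i le]) auto
    also have "\<dots> = 2 powr r * ((LINT x|lborel. \<bar>F (s n) x\<bar> powr r) + (LINT x|lborel. \<bar>f x\<bar> powr r))" using B fr by simp
    also have "\<dots> \<le> D" unfolding D_def using B(2)[of "s n"] fr(2) by (intro mult_left_mono add_mono) auto
    finally show "(LINT x|lborel. \<bar>F (s n) x - f x\<bar> powr r) \<le> D" .
  qed
  have D0: "0 \<le> D" by (rule order_trans[OF Bochner_Integration.integral_nonneg h(2)[of 0]]) simp
  have "(\<lambda>n. LINT x|lborel. \<bar>F (s n) x - f x\<bar> powr q) \<longlonglongrightarrow> 0"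
  proof (rule LIMSEQ_I)
    fix e :: real assume e: "0 < e"
    \<comment> \<open>With the level \<open>A\<close> below, \<open>A powr (q - r) = 1 / c\<close>,
      so the large values contribute at most \<open>D / c < e / 2\<close>. The 1 covers
      \<open>D = 0\<close>.\<close>
    define c where "c = 2 * D / e + 1"
    have c: "1 \<le> c" using D0 e by (simp add: c_def)
    define A where "A = c powr (1 / (r - q))"
    have A: "0 < A" using c by (simp add: A_def)
    have "A powr (q - r) = 1 / c"
    proof -
      have "A powr (q - r) = c powr ((1 / (r - q)) * (q - r))" unfolding A_def by (rule powr_powr)
      also have "(1 / (r - q)) * (q - r) = -1" using q by (simp add: field_simps)
      finally show ?thesis using c by (simp add: powr_minus divide_inverse)
    qed
    moreover have "D / c < e / 2" using e D0 c by (simp add: c_def field_simps)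
    ultimately have AD: "A powr (q - r) * D < e / 2" by simp
    define e' where "e' = e / 2 / (A powr (q - 1) + 1)"
    have Ap: "0 < A powr (q - 1) + 1" by (simp add: add_nonneg_pos)
    have e': "0 < e'" using e Ap by (simp add: e'_def)
    obtain N where N: "\<And>n. n \<ge> N \<Longrightarrow> integrable lborel (\<lambda>x. \<bar>F (s n) x - f x\<bar>) \<and> (LINT x|lborel. \<bar>F (s n) x - f x\<bar>) \<le> e'"
      using near[OF e'] by blast
    have "norm ((LINT x|lborel. \<bar>F (s n) x - f x\<bar> powr q) - 0) < e" if n: "n \<ge> N" for n
    proof -
      have i: "integrable lborel (\<lambda>x. A powr (q - 1) * \<bar>F (s n) x - f x\<bar> + A powr (q - r) * \<bar>F (s n) x - f x\<bar> powr r)"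
        using N[OF n] h by auto
      have "(LINT x|lborel. \<bar>F (s n) x - f x\<bar> powr q) \<le> (LINT x|lborel. A powr (q - 1) * \<bar>F (s n) x - f x\<bar> + A powr (q - r) * \<bar>F (s n) x - f x\<bar> powr r)"
        by (rule integral_mono'[OF i]) (use powr_interpolation[OF _ A q] in auto)
      also have "\<dots> = A powr (q - 1) * (LINT x|lborel. \<bar>F (s n) x - f x\<bar>) + A powr (q - r) * (LINT x|lborel. \<bar>F (s n) x - f x\<bar> powr r)"
        using N[OF n] h[of n] by simp
      also have "\<dots> \<le> A powr (q - 1) * e' + A powr (q - r) * D"
        using N[OF n] h(2)[of n] by (intro add_mono mult_left_mono) auto
      also have "A powr (q - 1) * e' \<le> (A powr (q - 1) + 1) * e'" using e' by (intro mult_right_mono) auto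
      also have "(A powr (q - 1) + 1) * e' = e / 2"
      proof -
        have "c * (e / 2 / c) = e / 2" if "0 < c" for c :: real using that by simp
        from this[OF Ap] show ?thesis unfolding e'_def .
      qed
      finally have "(LINT x|lborel. \<bar>F (s n) x - f x\<bar> powr q) < e" using AD by simp
      then show ?thesis by simp
    qed
    then show "\<exists>N. \<forall>n\<ge>N. norm ((LINT x|lborel. \<bar>F (s n) x - f x\<bar> powr q) - 0) < e" by blast
  qed
  then show ?thesis using that[OF s(1) _ fz if1 fr(1)] by simp
qed

lemma Lp_space_representative:
  fixes \<Omega> :: "(real^'n) set"
  assumes \<Omega>: "open \<Omega>" and u: "u \<in> borel_measurable (lebesgue_on \<Omega>)"
    and f: "f \<in> borel_measurable borel" "\<And>x. x \<notin> \<Omega> \<Longrightarrow> f x = 0" "AE x in lborel. x \<in> \<Omega> \<longrightarrow> u x = f x"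
  shows "u \<in> fst (Lp_space \<Omega> q) \<longleftrightarrow> integrable lborel (\<lambda>x. \<bar>f x\<bar> powr q)"
    and "snd (Lp_space \<Omega> q) u = (LINT x|lborel. \<bar>f x\<bar> powr q) powr (1 / q)"
proof -
  note [measurable] = u f(1)
  have 1: "(\<lambda>x. \<bar>u x\<bar> powr q) \<in> borel_measurable (lebesgue_on \<Omega>)" by measurable
  have 2: "(\<lambda>x. \<bar>f x\<bar> powr q) \<in> borel_measurable borel" by measurable
  have 3: "AE x in lborel. x \<in> \<Omega> \<longrightarrow> \<bar>u x\<bar> powr q = \<bar>f x\<bar> powr q" using f(3) by eventually_elim auto
  have 4: "\<bar>f x\<bar> powr q = 0" if "x \<notin> \<Omega>" for x using f(2)[OF that] by simp
  note t = lebesgue_on_transfer[OF \<Omega> 1 2 4 3]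
  show "u \<in> fst (Lp_space \<Omega> q) \<longleftrightarrow> integrable lborel (\<lambda>x. \<bar>f x\<bar> powr q)"
    using t(1) u by (simp add: Lp_space_def)
  show "snd (Lp_space \<Omega> q) u = (LINT x|lborel. \<bar>f x\<bar> powr q) powr (1 / q)"
    using t(2) by (simp add: Lp_space_def)
qed

lemma sobolev_measurable: "u \<in> fst (sobolev_space \<Omega> p w) \<Longrightarrow> u \<in> borel_measurable (lebesgue_on \<Omega>)"
  by (simp add: sobolev_space_def)

lemma sobolev_norm_nonneg: "0 \<le> snd (sobolev_space \<Omega> p w) u"
  by (simp add: sobolev_space_def sobolev_norm_def)

lemma sobolev_embedded_Lp:
  fixes \<Omega> :: "(real^'n) set"
  assumes \<Omega>: "open \<Omega>" "bounded \<Omega>" and p: "1 \<le> p" and L: "Lr_bounded \<Omega> p q"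
  shows "sobolev_space \<Omega> p (\<lambda>_. 1) \<hookrightarrow> Lp_space \<Omega> q"
proof -
  obtain C where C: "0 \<le> C" "\<And>f g. weak_pair \<Omega> f g \<Longrightarrow> integrable lborel (\<lambda>x. \<bar>f x\<bar> powr p) \<Longrightarrow>
      integrable lborel (\<lambda>x. norm (g x) powr p) \<Longrightarrow>
      integrable lborel (\<lambda>x. \<bar>f x\<bar> powr q) \<and> (LINT x|lborel. \<bar>f x\<bar> powr q) powr (1 / q) \<le> C * weak_norm p f g"
    using L unfolding Lr_bounded_def by blast
  have *: "u \<in> fst (Lp_space \<Omega> q) \<and> snd (Lp_space \<Omega> q) u \<le> C * snd (sobolev_space \<Omega> p (\<lambda>_. 1)) u"
    if u: "u \<in> fst (sobolev_space \<Omega> p (\<lambda>_. 1))" for u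
  proof -
    obtain f g where fg: "weak_pair \<Omega> f g" "AE x in lborel. x \<in> \<Omega> \<longrightarrow> u x = f x"
      "integrable lborel (\<lambda>x. \<bar>f x\<bar> powr p)" "integrable lborel (\<lambda>x. norm (g x) powr p)"
      "weak_norm p f g = snd (sobolev_space \<Omega> p (\<lambda>_. 1)) u"
      by (rule sobolev_representative[OF \<Omega> p u]) blast
    have f: "f \<in> borel_measurable borel" "\<And>x. x \<notin> \<Omega> \<Longrightarrow> f x = 0" using fg(1) by (auto simp: weak_pair_def)
    show ?thesis
      using C(2)[OF fg(1,3,4)] fg(5) Lp_space_representative[OF \<Omega>(1) sobolev_measurable[OF u] f fg(2), of q] by simp
  qed
  show ?thesis unfolding continuously_embedded_def
  proof (intro conjI exI[of _ C] subsetI ballI)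
    fix u assume "u \<in> fst (sobolev_space \<Omega> p (\<lambda>_. 1))"
    from *[OF this] show "u \<in> fst (Lp_space \<Omega> q)" "snd (Lp_space \<Omega> q) u \<le> C * snd (sobolev_space \<Omega> p (\<lambda>_. 1)) u" by auto
  qed
qed

text \<open>Functions and gradients are bounded in L^1 because \<Omega> is bounded, so a subsequence
  is Cauchy in mean; the bound in L^r with \<open>r > q\<close> improves this to L^q.\<close>

lemma sobolev_compactly_embedded_Lp:
  fixes \<Omega> :: "(real^'n) set"
  assumes U: "uniform_cone \<Omega>" and p: "1 \<le> p" and q: "1 \<le> q" "q < r" and L: "Lr_bounded \<Omega> p r"
  shows "compactly_embedded (sobolev_space \<Omega> p (\<lambda>_. 1)) (Lp_space \<Omega> q)"
  unfolding compactly_embedded_def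
proof (intro conjI allI impI)
  have \<Omega>: "open \<Omega>" "bounded \<Omega>" using U by (auto simp: uniform_cone_def)
  show "sobolev_space \<Omega> p (\<lambda>_. 1) \<hookrightarrow> Lp_space \<Omega> q"
    using q by (intro sobolev_embedded_Lp \<Omega> p Lr_bounded_mono[OF \<Omega> L]) auto
  fix u :: "nat \<Rightarrow> real^'n \<Rightarrow> real"
  assume "(\<forall>n. u n \<in> fst (sobolev_space \<Omega> p (\<lambda>_. 1))) \<and> (\<exists>M. \<forall>n. snd (sobolev_space \<Omega> p (\<lambda>_. 1)) (u n) \<le> M)"
  then obtain M where u: "\<And>n. u n \<in> fst (sobolev_space \<Omega> p (\<lambda>_. 1))" and M: "\<And>n. snd (sobolev_space \<Omega> p (\<lambda>_. 1)) (u n) \<le> M"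
    by blast
  have M0: "0 \<le> M" using sobolev_norm_nonneg M order_trans by blast
  have "\<exists>f g. weak_pair \<Omega> f g \<and> (AE x in lborel. x \<in> \<Omega> \<longrightarrow> u n x = f x) \<and>
      integrable lborel (\<lambda>x. \<bar>f x\<bar> powr p) \<and> integrable lborel (\<lambda>x. norm (g x) powr p) \<and>
      weak_norm p f g = snd (sobolev_space \<Omega> p (\<lambda>_. 1)) (u n)" for n
    by (rule sobolev_representative[OF \<Omega> p u[of n]]) blast
  \<comment> \<open>Function and gradient are packed into a pair so that a single choice selects
    both.\<close>
  then have "\<forall>n. \<exists>fg. weak_pair \<Omega> (fst fg) (snd fg) \<and> (AE x in lborel. x \<in> \<Omega> \<longrightarrow> u n x = fst fg x) \<and>
      integrable lborel (\<lambda>x. \<bar>fst fg x\<bar> powr p) \<and> integrable lborel (\<lambda>x. norm (snd fg x) powr p) \<and>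
      weak_norm p (fst fg) (snd fg) = snd (sobolev_space \<Omega> p (\<lambda>_. 1)) (u n)" by simp
  from choice[OF this] obtain FG where FG: "\<And>n. weak_pair \<Omega> (fst (FG n)) (snd (FG n)) \<and> (AE x in lborel. x \<in> \<Omega> \<longrightarrow> u n x = fst (FG n) x) \<and>
      integrable lborel (\<lambda>x. \<bar>fst (FG n) x\<bar> powr p) \<and> integrable lborel (\<lambda>x. norm (snd (FG n) x) powr p) \<and>
      weak_norm p (fst (FG n)) (snd (FG n)) = snd (sobolev_space \<Omega> p (\<lambda>_. 1)) (u n)" by blast
  define F where "F n = fst (FG n)" for n
  define G where "G n = snd (FG n)" for n
  have w: "weak_pair \<Omega> (F n) (G n)" and ae: "AE x in lborel. x \<in> \<Omega> \<longrightarrow> u n x = F n x"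
    and i: "integrable lborel (\<lambda>x. \<bar>F n x\<bar> powr p)" "integrable lborel (\<lambda>x. norm (G n x) powr p)"
    and nM: "weak_norm p (F n) (G n) \<le> M" for n
    using FG[of n] M[of n] by (auto simp: F_def G_def)
  have Fm: "F n \<in> borel_measurable borel" "integrable lborel (F n)" "\<And>x. x \<notin> \<Omega> \<Longrightarrow> F n x = 0" for n
    using w[of n] by (auto simp: weak_pair_def)
  have "(0::real) < 1" by simp
  then obtain C where C: "0 \<le> C"
    "\<And>f g. weak_pair \<Omega> f g \<Longrightarrow> integrable lborel (\<lambda>x. \<bar>f x\<bar> powr p) \<Longrightarrow> integrable lborel (\<lambda>x. norm (g x) powr p) \<Longrightarrow>
      integrable lborel (\<lambda>x. \<bar>f x\<bar> powr 1) \<and> integrable lborel (\<lambda>x. norm (g x) powr 1) \<and> weak_norm 1 f g \<le> C * weak_norm p f g"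
    by (rule weak_norm_mono_exponent[OF \<Omega> _ p]) blast
  have A: "(LINT x|lborel. \<bar>F n x\<bar>) \<le> C * M" "(LINT x|lborel. norm (G n x)) \<le> C * M" for n
  proof -
    have "weak_norm 1 (F n) (G n) \<le> C * weak_norm p (F n) (G n)" using C(2)[OF w i] by blast
    also have "\<dots> \<le> C * M" using nM C(1) by (intro mult_left_mono)
    finally have "(LINT x|lborel. \<bar>F n x\<bar>) + (LINT x|lborel. norm (G n x)) \<le> C * M"
      by (simp add: weak_norm_def)
    moreover have "0 \<le> (LINT x|lborel. \<bar>F n x\<bar>)" "0 \<le> (LINT x|lborel. norm (G n x))" by simp_all
    ultimately show "(LINT x|lborel. \<bar>F n x\<bar>) \<le> C * M" "(LINT x|lborel. norm (G n x)) \<le> C * M" by linarith+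
  qed
  obtain r1 where r1: "strict_mono (r1 :: nat \<Rightarrow> nat)"
    "\<And>e. 0 < e \<Longrightarrow> \<exists>N. \<forall>i\<ge>N. \<forall>j\<ge>N. (LINT x|lborel. \<bar>F (r1 i) x - F (r1 j) x\<bar>) < e"
    by (rule L1_compact[where F = F and G = G, OF U w A]) blast
  obtain C2 where C2: "0 \<le> C2" "\<And>f g. weak_pair \<Omega> f g \<Longrightarrow> integrable lborel (\<lambda>x. \<bar>f x\<bar> powr p) \<Longrightarrow>
      integrable lborel (\<lambda>x. norm (g x) powr p) \<Longrightarrow>
      integrable lborel (\<lambda>x. \<bar>f x\<bar> powr r) \<and> (LINT x|lborel. \<bar>f x\<bar> powr r) powr (1 / r) \<le> C2 * weak_norm p f g"
    using L unfolding Lr_bounded_def by blast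
  have r0: "0 < r" using q by simp
  have B: "integrable lborel (\<lambda>x. \<bar>F n x\<bar> powr r)" "(LINT x|lborel. \<bar>F n x\<bar> powr r) \<le> (C2 * M) powr r" for n
  proof -
    note c = C2(2)[OF w i, of n]
    show "integrable lborel (\<lambda>x. \<bar>F n x\<bar> powr r)" using c ..
    have "(LINT x|lborel. \<bar>F n x\<bar> powr r) powr (1 / r) \<le> C2 * M"
      using c mult_left_mono[OF nM[of n] C2(1)] by linarith
    then have "((LINT x|lborel. \<bar>F n x\<bar> powr r) powr (1 / r)) powr r \<le> (C2 * M) powr r"
      using r0 by (intro powr_mono2) auto
    then show "(LINT x|lborel. \<bar>F n x\<bar> powr r) \<le> (C2 * M) powr r" using r0 by (simp add: powr_powr)
  qed
  obtain f s where s: "strict_mono (s :: nat \<Rightarrow> nat)" and f: "f \<in> borel_measurable borel" "\<And>x. x \<notin> \<Omega> \<Longrightarrow> f x = 0"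
    "integrable lborel f" "integrable lborel (\<lambda>x. \<bar>f x\<bar> powr r)"
    and lim: "(\<lambda>n. LINT x|lborel. \<bar>F (r1 (s n)) x - f x\<bar> powr q) \<longlonglongrightarrow> 0"
  proof (rule L1_Cauchy_imp_Lq_convergent[where F = "\<lambda>n. F (r1 n)" and \<Omega> = \<Omega>, OF Fm(2) q B])
    show "\<exists>N. \<forall>i\<ge>N. \<forall>j\<ge>N. (LINT x|lborel. \<bar>F (r1 i) x - F (r1 j) x\<bar>) < e" if "0 < e" for e
      using that by (rule r1(2))
    show "F (r1 n) x = 0" if "x \<notin> \<Omega>" for n x using that by (rule Fm(3))
    fix f s assume "strict_mono (s :: nat \<Rightarrow> nat)" "f \<in> borel_measurable borel" "\<And>x. x \<notin> \<Omega> \<Longrightarrow> f x = 0"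
      "integrable lborel f" "integrable lborel (\<lambda>x. \<bar>f x\<bar> powr r)"
      "(\<lambda>n. LINT x|lborel. \<bar>F (r1 (s n)) x - f x\<bar> powr q) \<longlonglongrightarrow> 0"
    then show thesis by (intro that) auto
  qed
  have mf: "f \<in> borel_measurable (lebesgue_on \<Omega>)"
    using f(1) by (auto intro!: measurable_restrict_space1 measurable_completion)
  show "\<exists>r v. strict_mono r \<and> v \<in> fst (Lp_space \<Omega> q) \<and> (\<lambda>n. snd (Lp_space \<Omega> q) (\<lambda>x. u (r n) x - v x)) \<longlonglongrightarrow> 0"
  proof (intro exI[of _ "r1 \<circ> s"] exI[of _ f] conjI)
    show "strict_mono (r1 \<circ> s)" using r1(1) s by (rule strict_mono_o)
    have "0 < q" "q \<le> r" using q by auto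
    then have "integrable lborel (\<lambda>x. \<bar>f x\<bar> powr q)"
      by (rule Lq_le_Lr[OF \<Omega>]) (use f in blast)
    then show "f \<in> fst (Lp_space \<Omega> q)"
      using Lp_space_representative(1)[OF \<Omega>(1) mf f(1,2), of q] by simp
    have "snd (Lp_space \<Omega> q) (\<lambda>x. u n x - f x) = (LINT x|lborel. \<bar>F n x - f x\<bar> powr q) powr (1 / q)" for n
    proof (rule Lp_space_representative(2)[OF \<Omega>(1)])
      show "(\<lambda>x. u n x - f x) \<in> borel_measurable (lebesgue_on \<Omega>)"
        using sobolev_measurable[OF u] mf by (intro borel_measurable_diff)
      show "(\<lambda>x. F n x - f x) \<in> borel_measurable borel" using Fm(1) f(1) by (intro borel_measurable_diff)
      show "AE x in lborel. x \<in> \<Omega> \<longrightarrow> u n x - f x = F n x - f x" using ae by eventually_elim auto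
    qed (use Fm(3) f(2) in auto)
    moreover have "(\<lambda>n. (LINT x|lborel. \<bar>F (r1 (s n)) x - f x\<bar> powr q) powr (1 / q)) \<longlonglongrightarrow> 0 powr (1 / q)"
      using q by (intro tendsto_powr' lim tendsto_const) auto
    ultimately show "(\<lambda>n. snd (Lp_space \<Omega> q) (\<lambda>x. u ((r1 \<circ> s) n) x - f x)) \<longlonglongrightarrow> 0" by simp
  qed
qed

section \<open>Removing the weight\<close>

text \<open>With \<open>\<theta> = s / (s + 1)\<close> the function \<open>h powr q\<close> is
  \<open>(h powr p * w) powr \<theta> * (w powr (- s)) powr (1 - \<theta>)\<close> where
  \<open>w\<close> is positive: the powers of \<open>w\<close> cancel because
  \<open>s * (1 - \<theta>) = \<theta>\<close>, and \<open>p * \<theta> = q\<close>.\<close>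

lemma weighted_Holder:
  fixes \<Omega> :: "(real^'n) set" and w h :: "real^'n \<Rightarrow> real" and s p :: real
  assumes s: "0 < s" and p: "0 < p" and w: "AE x in lebesgue_on \<Omega>. 0 < w x"
    and ws: "integrable (lebesgue_on \<Omega>) (\<lambda>x. w x powr (- s))"
    and h: "h \<in> borel_measurable (lebesgue_on \<Omega>)" "\<And>x. 0 \<le> h x" "integrable (lebesgue_on \<Omega>) (\<lambda>x. h x powr p * w x)"
  defines "q \<equiv> p * s / (s + 1)"
  shows "integrable (lebesgue_on \<Omega>) (\<lambda>x. h x powr q)"
    and "(LINT x|lebesgue_on \<Omega>. h x powr q) powr (1 / q)
      \<le> ((LINT x|lebesgue_on \<Omega>. w x powr (- s)) powr (1 / (s + 1))) powr (1 / q) * (LINT x|lebesgue_on \<Omega>. h x powr p * w x) powr (1 / p)"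
proof -
  define \<theta> where "\<theta> = s / (s + 1)"
  have \<theta>: "0 < \<theta>" "\<theta> < 1" "1 - \<theta> = 1 / (s + 1)" "p * \<theta> = q" 
  proof -
    have s1: "0 < s + 1" using s by linarith
    then show "0 < \<theta>" "\<theta> < 1" using s by (simp_all add: \<theta>_def)
    show "1 - \<theta> = 1 / (s + 1)" using s1 by (simp add: \<theta>_def field_simps)
    show "p * \<theta> = q" by (simp add: \<theta>_def q_def)
  qed
  have q: "0 < q" using p s by (simp add: q_def)
  \<comment> \<open>\<open>w\<close> is positive only almost everywhere, while
    \<open>Holder_powr\<close> asks for nonnegative functions everywhere; the absolute value repairs
    this and changes nothing almost everywhere.\<close>
  let ?f = "\<lambda>x. \<bar>h x powr p * w x\<bar>" and ?g = "\<lambda>x. w x powr (- s)"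
  note ho = Holder_powr[OF integrable_abs[OF h(3)] _ ws _ \<theta>(1,2)]
  have m: "(\<lambda>x. h x powr q) \<in> borel_measurable (lebesgue_on \<Omega>)" using h(1) by measurable
  have i: "integrable (lebesgue_on \<Omega>) (\<lambda>x. ?f x powr \<theta> * ?g x powr (1 - \<theta>))" by (rule ho(1)) auto
  have ae: "AE x in lebesgue_on \<Omega>. h x powr q = ?f x powr \<theta> * ?g x powr (1 - \<theta>)"
    using w
  proof eventually_elim
    case (elim x)
    have "?f x powr \<theta> * ?g x powr (1 - \<theta>) = h x powr (p * \<theta>) * (w x powr \<theta> * w x powr (- s * (1 - \<theta>)))"
      using elim h(2)[of x] by (simp add: abs_mult powr_mult powr_powr)
    also have "- s * (1 - \<theta>) = - \<theta>" unfolding \<theta>(3) by (simp add: \<theta>_def)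
    also have "w x powr \<theta> * w x powr (- \<theta>) = 1" using elim by (simp flip: powr_add)
    finally show ?case using \<theta>(4) by simp
  qed
  have ae2: "AE x in lebesgue_on \<Omega>. ?f x = h x powr p * w x"
    using w by eventually_elim (use h in \<open>auto simp: abs_mult\<close>)
  show "integrable (lebesgue_on \<Omega>) (\<lambda>x. h x powr q)"
    using integrable_cong_AE[OF m borel_measurable_integrable[OF i] ae] i by blast
  have "(LINT x|lebesgue_on \<Omega>. h x powr q) = (LINT x|lebesgue_on \<Omega>. ?f x powr \<theta> * ?g x powr (1 - \<theta>))"
    by (rule integral_cong_AE[OF m borel_measurable_integrable[OF i] ae])
  also have "\<dots> \<le> (LINT x|lebesgue_on \<Omega>. ?f x) powr \<theta> * (LINT x|lebesgue_on \<Omega>. ?g x) powr (1 - \<theta>)"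
    by (rule ho(2)) auto
  also have "(LINT x|lebesgue_on \<Omega>. ?f x) = (LINT x|lebesgue_on \<Omega>. h x powr p * w x)"
    using h(3) by (intro integral_cong_AE ae2) auto
  finally have "(LINT x|lebesgue_on \<Omega>. h x powr q) powr (1 / q)
      \<le> ((LINT x|lebesgue_on \<Omega>. h x powr p * w x) powr \<theta> * (LINT x|lebesgue_on \<Omega>. ?g x) powr (1 - \<theta>)) powr (1 / q)"
    using q by (intro powr_mono2) auto
  also have "\<dots> = ((LINT x|lebesgue_on \<Omega>. h x powr p * w x) powr \<theta>) powr (1 / q) * ((LINT x|lebesgue_on \<Omega>. ?g x) powr (1 - \<theta>)) powr (1 / q)"
    by (simp add: powr_mult)
  also have "((LINT x|lebesgue_on \<Omega>. h x powr p * w x) powr \<theta>) powr (1 / q) = (LINT x|lebesgue_on \<Omega>. h x powr p * w x) powr (1 / p)"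
    using \<theta>(1) p by (simp add: powr_powr \<theta>(4)[symmetric])
  finally show "(LINT x|lebesgue_on \<Omega>. h x powr q) powr (1 / q)
      \<le> ((LINT x|lebesgue_on \<Omega>. w x powr (- s)) powr (1 / (s + 1))) powr (1 / q) * (LINT x|lebesgue_on \<Omega>. h x powr p * w x) powr (1 / p)"
    unfolding \<theta>(3) by (simp add: mult.commute)
qed

text \<open>The weak gradient does not involve the weight, so the same
  \<open>weak_gradient \<Omega> u\<close> enters both norms; Hoelder is applied to
  \<open>\<bar>u x\<bar>\<close> and to the length of the gradient.\<close>

lemma weighted_sobolev_embedded:
  fixes \<Omega> :: "(real^'n) set"
  assumes \<Omega>: "open \<Omega>" and s: "0 < s" and p: "0 < p" and w: "w \<in> muckenhoupt_sub \<Omega> p s"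
  shows "sobolev_space \<Omega> p w \<hookrightarrow> sobolev_space \<Omega> (p * s / (s + 1)) (\<lambda>_. 1)"
proof -
  define q where "q = p * s / (s + 1)"
  define C where "C = ((LINT x|lebesgue_on \<Omega>. w x powr (- s)) powr (1 / (s + 1))) powr (1 / q)"
  have S: "\<Omega> \<inter> space lebesgue \<in> sets lebesgue" using \<Omega> by auto
  have "AE x in lebesgue. 0 < w x" using w by (simp add: muckenhoupt_sub_def muckenhoupt_def)
  then have wpos: "AE x in lebesgue_on \<Omega>. 0 < w x"
    by (subst AE_restrict_space_iff[OF S]) (auto elim: eventually_mono)
  have ws: "integrable (lebesgue_on \<Omega>) (\<lambda>x. w x powr (- s))" using w by (simp add: muckenhoupt_sub_def)
  have *: "u \<in> fst (sobolev_space \<Omega> q (\<lambda>_. 1)) \<and> snd (sobolev_space \<Omega> q (\<lambda>_. 1)) u \<le> C * snd (sobolev_space \<Omega> p w) u"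
    if u: "u \<in> fst (sobolev_space \<Omega> p w)" for u
  proof -
    define G where "G = weak_gradient \<Omega> u"
    have u: "u \<in> borel_measurable (lebesgue_on \<Omega>)" "weakly_differentiable \<Omega> u"
      "integrable (lebesgue_on \<Omega>) (\<lambda>x. \<bar>u x\<bar> powr p * w x)" "integrable (lebesgue_on \<Omega>) (\<lambda>x. norm (G x) powr p * w x)"
      using u by (auto simp: sobolev_space_def G_def)
    have "is_weak_gradient \<Omega> u G"
      unfolding G_def weak_gradient_def using u(2) unfolding weakly_differentiable_def by (rule someI_ex)
    then have mG: "G \<in> borel_measurable (lebesgue_on \<Omega>)"
      by (intro locally_integrable_measurable \<Omega>) (auto simp: is_weak_gradient_def)
    have mu: "(\<lambda>x. \<bar>u x\<bar>) \<in> borel_measurable (lebesgue_on \<Omega>)" "(\<lambda>x. norm (G x)) \<in> borel_measurable (lebesgue_on \<Omega>)"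
      using u(1) mG by measurable
    note 1 = weighted_Holder[OF s p wpos ws mu(1) _ u(3), folded q_def, folded C_def]
    note 2 = weighted_Holder[OF s p wpos ws mu(2) _ u(4), folded q_def, folded C_def]
    have a: "integrable (lebesgue_on \<Omega>) (\<lambda>x. \<bar>u x\<bar> powr q)" "integrable (lebesgue_on \<Omega>) (\<lambda>x. norm (G x) powr q)"
      by (rule 1(1), simp, rule 2(1), simp)
    have b: "(LINT x|lebesgue_on \<Omega>. \<bar>u x\<bar> powr q) powr (1 / q) \<le> C * (LINT x|lebesgue_on \<Omega>. \<bar>u x\<bar> powr p * w x) powr (1 / p)"
      "(LINT x|lebesgue_on \<Omega>. norm (G x) powr q) powr (1 / q) \<le> C * (LINT x|lebesgue_on \<Omega>. norm (G x) powr p * w x) powr (1 / p)"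
      by (rule 1(2), simp, rule 2(2), simp)
    show ?thesis
      using a add_mono[OF b] u(1,2) by (simp add: sobolev_space_def sobolev_norm_def G_def[symmetric] distrib_left)
  qed
  show ?thesis unfolding continuously_embedded_def q_def[symmetric]
  proof (intro conjI exI[of _ C] subsetI ballI)
    fix u assume "u \<in> fst (sobolev_space \<Omega> p w)"
    from *[OF this] show "u \<in> fst (sobolev_space \<Omega> q (\<lambda>_. 1))"
      "snd (sobolev_space \<Omega> q (\<lambda>_. 1)) u \<le> C * snd (sobolev_space \<Omega> p w) u" by auto
  qed
qed

section \<open>Composition of embeddings\<close>

text \<open>The constant of an embedding may be negative, so \<open>D\<close> is replaced by its
  absolute value before the estimates are chained; this is where the norm of \<open>Y\<close> has to
  be nonnegative.\<close>

lemma continuously_embedded_trans: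
  assumes XY: "X \<hookrightarrow> Y" and YZ: "Y \<hookrightarrow> Z" and Y: "\<And>u. 0 \<le> snd Y u"
  shows "X \<hookrightarrow> Z"
proof -
  obtain C where C: "\<And>u. u \<in> fst X \<Longrightarrow> snd Y u \<le> C * snd X u" using XY unfolding continuously_embedded_def by blast
  obtain D where D: "\<And>u. u \<in> fst Y \<Longrightarrow> snd Z u \<le> D * snd Y u" using YZ unfolding continuously_embedded_def by blast
  have "snd Z u \<le> (\<bar>D\<bar> * C) * snd X u" if "u \<in> fst X" for u
  proof -
    have "u \<in> fst Y" using XY that unfolding continuously_embedded_def by blast
    then have "snd Z u \<le> D * snd Y u" by (rule D)
    also have "\<dots> \<le> \<bar>D\<bar> * snd Y u" using Y by (intro mult_right_mono) auto
    also have "\<dots> \<le> \<bar>D\<bar> * (C * snd X u)" using C[OF that] by (intro mult_left_mono) auto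
    finally show ?thesis by (simp add: mult.assoc)
  qed
  then show ?thesis using XY YZ unfolding continuously_embedded_def by blast
qed

lemma compactly_embedded_compose:
  assumes XY: "X \<hookrightarrow> Y" and YZ: "compactly_embedded Y Z" and X: "\<And>u. 0 \<le> snd X u" and Y: "\<And>u. 0 \<le> snd Y u"
  shows "compactly_embedded X Z"
  unfolding compactly_embedded_def
proof (intro conjI allI impI)
  show "X \<hookrightarrow> Z" using XY YZ Y by (intro continuously_embedded_trans[of X Y Z]) (auto simp: compactly_embedded_def)
  obtain C where C: "\<And>u. u \<in> fst X \<Longrightarrow> snd Y u \<le> C * snd X u" using XY unfolding continuously_embedded_def by blast
  fix u :: "nat \<Rightarrow> 'a \<Rightarrow> real"
  assume "(\<forall>n. u n \<in> fst X) \<and> (\<exists>M. \<forall>n. snd X (u n) \<le> M)"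
  then obtain M where u: "\<And>n. u n \<in> fst X" "\<And>n. snd X (u n) \<le> M" by blast
  have uY: "u n \<in> fst Y" for n using XY u(1) unfolding continuously_embedded_def by blast
  have uM: "snd Y (u n) \<le> \<bar>C\<bar> * M" for n
  proof -
    have "snd Y (u n) \<le> C * snd X (u n)" using u(1) by (rule C)
    also have "\<dots> \<le> \<bar>C\<bar> * snd X (u n)" using X by (intro mult_right_mono) auto
    also have "\<dots> \<le> \<bar>C\<bar> * M" using u(2) by (intro mult_left_mono) auto
    finally show ?thesis .
  qed
  show "\<exists>r v. strict_mono r \<and> v \<in> fst Z \<and> (\<lambda>n. snd Z (\<lambda>x. u (r n) x - v x)) \<longlonglongrightarrow> 0"
    using YZ uY uM unfolding compactly_embedded_def by blast
qed

lemma sobolev_space0_embedded: "sobolev_space0 \<Omega> p w \<hookrightarrow> sobolev_space \<Omega> p w"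
  unfolding continuously_embedded_def
  by (intro conjI exI[of _ 1]) (auto simp: sobolev_space0_def sobolev_space_def)

lemma sobolev_norm0_nonneg: "0 \<le> snd (sobolev_space0 \<Omega> p w) u"
  by (simp add: sobolev_space0_def sobolev_norm_def)

section \<open>Embedding into continuous functions\<close>

text \<open>Inside \<Omega> the set where two versions differ is open and null, hence empty, and
  continuity extends equality to the closure. This makes the selection in the norm of
  \<open>C_closure_space\<close> immaterial.\<close>

lemma cont_version_unique:
  fixes \<Omega> :: "(real^'n) set"
  assumes \<Omega>: "open \<Omega>" and v: "is_cont_version \<Omega> u v" and v': "is_cont_version \<Omega> u v'" and x: "x \<in> closure \<Omega>"
  shows "v x = v' x"
proof -
  have c: "continuous_on (closure \<Omega>) (\<lambda>x. v x - v' x)"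
    using v v' by (auto simp: is_cont_version_def intro: continuous_on_diff)
  have S: "\<Omega> \<inter> space lebesgue \<in> sets lebesgue" using \<Omega> by auto
  have "AE x in lebesgue_on \<Omega>. v x = v' x"
    using v v' unfolding is_cont_version_def by (auto elim: eventually_elim2)
  then have ae: "AE x in lebesgue. x \<in> \<Omega> \<longrightarrow> v x = v' x" by (subst (asm) AE_restrict_space_iff[OF S])
  let ?A = "\<Omega> \<inter> (\<lambda>x. v x - v' x) -` (- {0})"
  have oA: "open ?A"
    using \<Omega> by (intro continuous_open_preimage continuous_on_subset[OF c closure_subset]) auto
  have "?A \<in> null_sets lebesgue"
  proof -
    have "AE x in lebesgue. x \<notin> ?A" using ae by eventually_elim auto
    then show ?thesis using oA by (subst (asm) AE_iff_null_sets[symmetric]) auto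
  qed
  then have "negligible ?A" by (simp add: negligible_iff_null_sets)
  then have "?A = {}" using oA open_not_negligible by blast
  then have z: "v x - v' x = 0" if "x \<in> \<Omega>" for x using that by auto
  have "v x - v' x = 0" by (rule continuous_constant_on_closure[OF c z x])
  then show ?thesis by simp
qed

lemma C_closure_norm:
  fixes \<Omega> :: "(real^'n) set"
  assumes \<Omega>: "open \<Omega>" and v: "is_cont_version \<Omega> u v"
  shows "snd (C_closure_space \<Omega>) u = (SUP x\<in>closure \<Omega>. \<bar>v x\<bar>)"
proof -
  have "is_cont_version \<Omega> u (SOME v. is_cont_version \<Omega> u v)" using someI[of "is_cont_version \<Omega> u" v] v by simp
  then have "(SOME v. is_cont_version \<Omega> u v) x = v x" if "x \<in> closure \<Omega>" for x
    using cont_version_unique[OF \<Omega> _ v that] by blast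
  then show ?thesis by (simp add: C_closure_space_def)
qed

text \<open>Off a null set \<open>f\<close> satisfies Morrey's bounds, so it is uniformly continuous
  on a dense part of \<Omega> and extends to the closure, where both bounds hold by passing to
  limits. The constants are common to all \<open>u\<close>, as the Arzela-Ascoli theorem will
  require.\<close>

lemma sobolev_Hoelder_version:
  fixes \<Omega> :: "(real^'n) set" and p :: real
  assumes U: "uniform_cone \<Omega>" and p: "CARD('n) < p"
  defines "\<alpha> \<equiv> 1 - CARD('n) / p"
  obtains C d :: real where "0 \<le> C" "0 < d"
    "\<And>u. u \<in> fst (sobolev_space \<Omega> p (\<lambda>_. 1)) \<Longrightarrow> \<exists>v. is_cont_version \<Omega> u v \<and>
      (\<forall>x\<in>closure \<Omega>. \<bar>v x\<bar> \<le> C * snd (sobolev_space \<Omega> p (\<lambda>_. 1)) u) \<and>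
      (\<forall>x\<in>closure \<Omega>. \<forall>y\<in>closure \<Omega>. norm (x - y) < d \<longrightarrow>
        \<bar>v x - v y\<bar> \<le> C * norm (x - y) powr \<alpha> * snd (sobolev_space \<Omega> p (\<lambda>_. 1)) u)"
proof -
  have \<Omega>: "open \<Omega>" "bounded \<Omega>" using U by (auto simp: uniform_cone_def)
  have "1 \<le> real CARD('n)" by (simp add: Suc_le_eq)
  then have p1: "1 \<le> p" using p by linarith
  have \<alpha>: "0 < \<alpha>" using p p1 by (simp add: \<alpha>_def)
  obtain C d where Cd: "0 \<le> C" "0 < d"
    "\<And>f g. weak_pair \<Omega> f g \<Longrightarrow> integrable lborel (\<lambda>x. \<bar>f x\<bar> powr p) \<Longrightarrow> integrable lborel (\<lambda>x. norm (g x) powr p) \<Longrightarrow>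
      \<exists>Z\<in>null_sets lborel. \<forall>x \<in> \<Omega> - Z.
        \<bar>f x\<bar> \<le> C * weak_norm p f g \<and>
        (\<forall>y \<in> \<Omega> - Z. norm (x - y) < d \<longrightarrow> \<bar>f x - f y\<bar> \<le> C * norm (x - y) powr \<alpha> * weak_norm p f g)"
    unfolding weak_norm_def \<alpha>_def by (rule Morrey_uniform_cone[OF U p]) blast
  show ?thesis
  proof (rule that[OF Cd(1,2)])
    fix u assume u: "u \<in> fst (sobolev_space \<Omega> p (\<lambda>_. 1))"
    define W where "W = snd (sobolev_space \<Omega> p (\<lambda>_. 1)) u"
    have W: "0 \<le> W" unfolding W_def by (rule sobolev_norm_nonneg)
    obtain f g where fg: "weak_pair \<Omega> f g" "AE x in lborel. x \<in> \<Omega> \<longrightarrow> u x = f x"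
      "integrable lborel (\<lambda>x. \<bar>f x\<bar> powr p)" "integrable lborel (\<lambda>x. norm (g x) powr p)" "weak_norm p f g = W"
      unfolding W_def by (rule sobolev_representative[OF \<Omega> p1 u]) blast
    obtain Z where Z: "Z \<in> null_sets lborel" "\<And>x. x \<in> \<Omega> - Z \<Longrightarrow> \<bar>f x\<bar> \<le> C * W"
      "\<And>x y. x \<in> \<Omega> - Z \<Longrightarrow> y \<in> \<Omega> - Z \<Longrightarrow> norm (x - y) < d \<Longrightarrow> \<bar>f x - f y\<bar> \<le> C * norm (x - y) powr \<alpha> * W"
      using Cd(3)[OF fg(1,3,4)] unfolding fg(5) by blast
    define E where "E = \<Omega> - Z"
    \<comment> \<open>A nonempty open set is not null, so every ball around a point of \<Omega>
      meets \<open>E\<close>.\<close>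
    have "\<Omega> \<subseteq> closure E"
    proof
      fix x assume x: "x \<in> \<Omega>"
      show "x \<in> closure E"
        unfolding closure_approachable
      proof (intro allI impI)
        fix e :: real assume e: "0 < e"
        have "open (\<Omega> \<inter> ball x e)" "\<Omega> \<inter> ball x e \<noteq> {}" using \<Omega> x e by auto
        then have "\<not> negligible (\<Omega> \<inter> ball x e)" by (rule open_not_negligible)
        moreover have "negligible Z" using Z(1) by (simp add: negligible_iff_null_sets null_sets_completionI)
        ultimately have "\<not> \<Omega> \<inter> ball x e \<subseteq> Z" using negligible_subset by blast
        then show "\<exists>y\<in>E. dist y x < e" by (auto simp: E_def dist_commute)
      qed
    qed
    then have cE: "closure E = closure \<Omega>"
      by (metis E_def Diff_subset closure_closure closure_mono subset_antisym)
    have "uniformly_continuous_on E f"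
      unfolding uniformly_continuous_on_def
    proof (intro allI impI)
      fix e :: real assume e: "0 < e"
      define K where "K = C * W + 1"
      have K: "0 < K" using Cd(1) W by (simp add: K_def add_nonneg_pos)
      \<comment> \<open>The modulus \<open>K * t powr \<alpha>\<close> reaches \<open>e\<close> at
        the second entry of the minimum; the 1 in \<open>K\<close> keeps the quotient
        meaningful.\<close>
      define \<delta> where "\<delta> = min d ((e / K) powr (1 / \<alpha>))"
      have \<delta>: "0 < \<delta>" using Cd(2) e K by (simp add: \<delta>_def)
      have "dist (f y) (f x) < e" if xy: "x \<in> E" "y \<in> E" "dist y x < \<delta>" for x y
      proof -
        have n: "norm (x - y) < \<delta>" using xy by (simp add: dist_norm norm_minus_commute)
        then have nd: "norm (x - y) < d" "norm (x - y) \<le> (e / K) powr (1 / \<alpha>)" by (auto simp: \<delta>_def)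
        have "norm (x - y) powr \<alpha> \<le> ((e / K) powr (1 / \<alpha>)) powr \<alpha>" using nd \<alpha> by (intro powr_mono2) auto
        also have "\<dots> = e / K" using \<alpha> e K by (simp add: powr_powr)
        finally have a: "norm (x - y) powr \<alpha> \<le> e / K" .
        have "\<bar>f x - f y\<bar> \<le> (C * W) * norm (x - y) powr \<alpha>" using Z(3)[of x y] xy nd by (simp add: E_def mult_ac)
        also have "\<dots> \<le> (C * W) * (e / K)" using a Cd(1) W by (intro mult_left_mono) auto
        also have "\<dots> < K * (e / K)" using e K by (intro mult_strict_right_mono) (auto simp: K_def)
        also have "\<dots> = e" using K by simp
        finally show ?thesis by (simp add: dist_real_def abs_minus_commute)
      qed
      then show "\<exists>\<delta>>0. \<forall>x\<in>E. \<forall>y\<in>E. dist y x < \<delta> \<longrightarrow> dist (f y) (f x) < e" using \<delta> by blast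
    qed
    then obtain v where v: "uniformly_continuous_on (closure E) v" "\<And>x. x \<in> E \<Longrightarrow> f x = v x"
      by (rule uniformly_continuous_on_extension_on_closure) blast
    then have cv: "continuous_on (closure \<Omega>) v" using cE uniformly_continuous_imp_continuous by metis
    have S: "\<Omega> \<inter> space lebesgue \<in> sets lebesgue" using \<Omega> by auto
    have "AE x in lborel. x \<in> \<Omega> \<longrightarrow> u x = v x"
      using fg(2) AE_not_in[OF Z(1)] by eventually_elim (use v(2) in \<open>auto simp: E_def\<close>)
    then have "AE x in lebesgue_on \<Omega>. u x = v x"
      by (subst AE_restrict_space_iff[OF S]) (simp add: AE_completion_iff)
    then have ver: "is_cont_version \<Omega> u v" using cv by (simp add: is_cont_version_def)
    have b: "\<bar>v x\<bar> \<le> C * W" if x: "x \<in> closure \<Omega>" for x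
    proof (rule continuous_le_on_closure[of E "\<lambda>x. \<bar>v x\<bar>"])
      show "continuous_on (closure E) (\<lambda>x. \<bar>v x\<bar>)" unfolding cE by (intro continuous_intros cv)
      show "\<bar>v x\<bar> \<le> C * W" if "x \<in> E" for x using Z(2)[of x] v(2)[OF that] that by (simp add: E_def)
    qed (use x cE in auto)
    have h: "\<bar>v x - v y\<bar> \<le> C * norm (x - y) powr \<alpha> * W" if x: "x \<in> closure \<Omega>" and y: "y \<in> closure \<Omega>" and xy: "norm (x - y) < d" for x y
    proof -
      obtain X where X: "\<And>n. X n \<in> E" "X \<longlonglongrightarrow> x" using x unfolding cE[symmetric] closure_sequential by blast
      obtain Y where Y: "\<And>n. Y n \<in> E" "Y \<longlonglongrightarrow> y" using y unfolding cE[symmetric] closure_sequential by blast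
      have Ecl: "E \<subseteq> closure \<Omega>" using closure_subset cE by blast
      have vX: "(\<lambda>n. v (X n)) \<longlonglongrightarrow> v x"
        by (rule continuous_on_tendsto_compose[OF cv X(2) x]) (use X(1) Ecl in \<open>auto intro!: always_eventually\<close>)
      have vY: "(\<lambda>n. v (Y n)) \<longlonglongrightarrow> v y"
        by (rule continuous_on_tendsto_compose[OF cv Y(2) y]) (use Y(1) Ecl in \<open>auto intro!: always_eventually\<close>)
      have nXY: "(\<lambda>n. norm (X n - Y n)) \<longlonglongrightarrow> norm (x - y)" by (intro tendsto_intros X Y)
      have "(\<lambda>n. C * norm (X n - Y n) powr \<alpha> * W) \<longlonglongrightarrow> C * norm (x - y) powr \<alpha> * W"
        using \<alpha> by (intro tendsto_mult tendsto_const tendsto_powr' nXY) auto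
      moreover have "(\<lambda>n. \<bar>v (X n) - v (Y n)\<bar>) \<longlonglongrightarrow> \<bar>v x - v y\<bar>" by (intro tendsto_intros vX vY)
      moreover have "eventually (\<lambda>n. \<bar>v (X n) - v (Y n)\<bar> \<le> C * norm (X n - Y n) powr \<alpha> * W) sequentially"
        using order_tendstoD(2)[OF nXY xy]
      proof eventually_elim
        case (elim n)
        then show ?case using Z(3)[of "X n" "Y n"] X(1)[of n] Y(1)[of n] v(2)[of "X n"] v(2)[of "Y n"] by (simp add: E_def)
      qed
      ultimately show ?thesis by (rule tendsto_le[OF sequentially_bot])
    qed
    show "\<exists>v. is_cont_version \<Omega> u v \<and>
      (\<forall>x\<in>closure \<Omega>. \<bar>v x\<bar> \<le> C * snd (sobolev_space \<Omega> p (\<lambda>_. 1)) u) \<and>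
      (\<forall>x\<in>closure \<Omega>. \<forall>y\<in>closure \<Omega>. norm (x - y) < d \<longrightarrow>
        \<bar>v x - v y\<bar> \<le> C * norm (x - y) powr \<alpha> * snd (sobolev_space \<Omega> p (\<lambda>_. 1)) u)"
      unfolding W_def[symmetric] using ver b h by blast
  qed
qed

text \<open>The continuous versions share a bound and a Hoelder modulus, which is what the
  Arzela-Ascoli theorem asks for on the compact closure. By \<open>C_closure_norm\<close>, uniform
  convergence of the versions is convergence in the space.\<close>

lemma sobolev_compactly_embedded_C:
  fixes \<Omega> :: "(real^'n) set" and p :: real
  assumes U: "uniform_cone \<Omega>" and ne: "\<Omega> \<noteq> {}" and p: "CARD('n) < p"
  shows "compactly_embedded (sobolev_space \<Omega> p (\<lambda>_. 1)) (C_closure_space \<Omega>)"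
proof -
  have \<Omega>: "open \<Omega>" "bounded \<Omega>" using U by (auto simp: uniform_cone_def)
  define \<alpha> where "\<alpha> = 1 - CARD('n) / p"
  have "0 < p" using p by (rule le_less_trans[rotated]) simp
  then have \<alpha>: "0 < \<alpha>" using p by (simp add: \<alpha>_def)
  have ne': "closure \<Omega> \<noteq> {}" using ne by simp
  let ?X = "sobolev_space \<Omega> p (\<lambda>_. 1)"
  obtain C d where Cd: "0 \<le> C" "0 < d"
    "\<And>u. u \<in> fst ?X \<Longrightarrow> \<exists>v. is_cont_version \<Omega> u v \<and>
      (\<forall>x\<in>closure \<Omega>. \<bar>v x\<bar> \<le> C * snd ?X u) \<and>
      (\<forall>x\<in>closure \<Omega>. \<forall>y\<in>closure \<Omega>. norm (x - y) < d \<longrightarrow> \<bar>v x - v y\<bar> \<le> C * norm (x - y) powr \<alpha> * snd ?X u)"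
    unfolding \<alpha>_def by (rule sobolev_Hoelder_version[OF U p]) blast
  show ?thesis
    unfolding compactly_embedded_def
  proof (intro conjI allI impI)
    show "?X \<hookrightarrow> C_closure_space \<Omega>"
      unfolding continuously_embedded_def
    proof (intro conjI exI[of _ C] subsetI ballI)
      fix u assume "u \<in> fst ?X"
      then obtain v where v: "is_cont_version \<Omega> u v" "\<And>x. x \<in> closure \<Omega> \<Longrightarrow> \<bar>v x\<bar> \<le> C * snd ?X u" using Cd(3) by blast
      show "u \<in> fst (C_closure_space \<Omega>)" using v(1) by (auto simp: C_closure_space_def)
      show "snd (C_closure_space \<Omega>) u \<le> C * snd ?X u"
        unfolding C_closure_norm[OF \<Omega>(1) v(1)] using ne' v(2) by (intro cSUP_least)
    qed
    fix u :: "nat \<Rightarrow> real^'n \<Rightarrow> real"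
    assume "(\<forall>n. u n \<in> fst ?X) \<and> (\<exists>M. \<forall>n. snd ?X (u n) \<le> M)"
    then obtain M where u: "\<And>n. u n \<in> fst ?X" and M: "\<And>n. snd ?X (u n) \<le> M" by blast
    have M0: "0 \<le> M" using sobolev_norm_nonneg M order_trans by blast
    have "\<forall>n. \<exists>v. is_cont_version \<Omega> (u n) v \<and>
      (\<forall>x\<in>closure \<Omega>. \<bar>v x\<bar> \<le> C * snd ?X (u n)) \<and>
      (\<forall>x\<in>closure \<Omega>. \<forall>y\<in>closure \<Omega>. norm (x - y) < d \<longrightarrow> \<bar>v x - v y\<bar> \<le> C * norm (x - y) powr \<alpha> * snd ?X (u n))"
      using Cd(3)[OF u] by blast
    from choice[OF this] obtain v where v: "\<And>n. is_cont_version \<Omega> (u n) (v n)"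
      "\<And>n x. x \<in> closure \<Omega> \<Longrightarrow> \<bar>v n x\<bar> \<le> C * snd ?X (u n)"
      "\<And>n x y. x \<in> closure \<Omega> \<Longrightarrow> y \<in> closure \<Omega> \<Longrightarrow> norm (x - y) < d \<Longrightarrow>
        \<bar>v n x - v n y\<bar> \<le> C * norm (x - y) powr \<alpha> * snd ?X (u n)" by blast
    have cpt: "compact (closure \<Omega>)" using \<Omega>(2) by simp
    have vb: "norm (v n x) \<le> C * M" if "x \<in> closure \<Omega>" for n x
      using order_trans[OF v(2)[OF that] mult_left_mono[OF M Cd(1)]] by simp
    have eq: "\<exists>\<delta>. 0 < \<delta> \<and> (\<forall>n y. y \<in> closure \<Omega> \<and> norm (x - y) < \<delta> \<longrightarrow> norm (v n x - v n y) < e)"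
      if x: "x \<in> closure \<Omega>" and e: "0 < e" for x e
    proof -
      define K where "K = C * M + 1"
      have K: "0 < K" using Cd(1) M0 by (simp add: K_def add_nonneg_pos)
      define \<delta> where "\<delta> = min d ((e / K) powr (1 / \<alpha>))"
      have \<delta>: "0 < \<delta>" using Cd(2) e K by (simp add: \<delta>_def)
      have "norm (v n x - v n y) < e" if y: "y \<in> closure \<Omega>" and n: "norm (x - y) < \<delta>" for n y
      proof -
        have nd: "norm (x - y) < d" "norm (x - y) \<le> (e / K) powr (1 / \<alpha>)" using n by (auto simp: \<delta>_def)
        have "norm (x - y) powr \<alpha> \<le> ((e / K) powr (1 / \<alpha>)) powr \<alpha>" using nd \<alpha> by (intro powr_mono2) auto
        also have "\<dots> = e / K" using \<alpha> e K by (simp add: powr_powr)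
        finally have a: "norm (x - y) powr \<alpha> \<le> e / K" .
        have "\<bar>v n x - v n y\<bar> \<le> C * norm (x - y) powr \<alpha> * snd ?X (u n)" by (rule v(3)[OF x y nd(1)])
        also have "\<dots> \<le> C * (e / K) * M"
          using a Cd(1) M M0 e K sobolev_norm_nonneg by (intro mult_mono) auto
        also have "\<dots> = (C * M) * (e / K)" by simp
        also have "\<dots> < K * (e / K)" using e K by (intro mult_strict_right_mono) (auto simp: K_def)
        also have "\<dots> = e" using K by simp
        finally show ?thesis by simp
      qed
      then show ?thesis using \<delta> by blast
    qed
    obtain g k where g: "continuous_on (closure \<Omega>) g" and k: "strict_mono (k :: nat \<Rightarrow> nat)"
      and lim: "\<And>e. 0 < e \<Longrightarrow> \<exists>N. \<forall>n x. n \<ge> N \<and> x \<in> closure \<Omega> \<longrightarrow> norm (v (k n) x - g x) < e"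
      by (rule Arzela_Ascoli[OF cpt vb eq]) blast+
    show "\<exists>r w. strict_mono r \<and> w \<in> fst (C_closure_space \<Omega>) \<and> (\<lambda>n. snd (C_closure_space \<Omega>) (\<lambda>x. u (r n) x - w x)) \<longlonglongrightarrow> 0"
    proof (intro exI[of _ k] exI[of _ g] conjI k)
      have "is_cont_version \<Omega> g g" using g by (simp add: is_cont_version_def)
      then show "g \<in> fst (C_closure_space \<Omega>)" by (auto simp: C_closure_space_def)
      have ver: "is_cont_version \<Omega> (\<lambda>x. u n x - g x) (\<lambda>x. v n x - g x)" for n
        using v(1)[of n] g by (auto simp: is_cont_version_def intro!: continuous_intros elim: eventually_mono)
      show "(\<lambda>n. snd (C_closure_space \<Omega>) (\<lambda>x. u (k n) x - g x)) \<longlonglongrightarrow> 0"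
        unfolding C_closure_norm[OF \<Omega>(1) ver]
      proof (rule LIMSEQ_I)
        fix e :: real assume e: "0 < e"
        then obtain N where N: "\<And>n x. n \<ge> N \<Longrightarrow> x \<in> closure \<Omega> \<Longrightarrow> norm (v (k n) x - g x) < e / 2"
          using lim[of "e / 2"] by auto
        have "norm ((SUP x\<in>closure \<Omega>. \<bar>v (k n) x - g x\<bar>) - 0) < e" if n: "n \<ge> N" for n
        proof -
          have le: "(SUP x\<in>closure \<Omega>. \<bar>v (k n) x - g x\<bar>) \<le> e / 2"
            using ne' N[OF n] by (intro cSUP_least) (auto intro: less_imp_le)
          obtain x where x: "x \<in> closure \<Omega>" using ne closure_subset by blast
          have "bdd_above ((\<lambda>x. \<bar>v (k n) x - g x\<bar>) ` closure \<Omega>)"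
            using N[OF n] by (intro bdd_aboveI[of _ "e / 2"]) (auto intro: less_imp_le)
          then have "\<bar>v (k n) x - g x\<bar> \<le> (SUP x\<in>closure \<Omega>. \<bar>v (k n) x - g x\<bar>)" using x by (intro cSUP_upper)
          then have "0 \<le> (SUP x\<in>closure \<Omega>. \<bar>v (k n) x - g x\<bar>)" by (rule order_trans[OF abs_ge_zero])
          then show ?thesis using le e by simp
        qed
        then show "\<exists>N. \<forall>n\<ge>N. norm ((SUP x\<in>closure \<Omega>. \<bar>v (k n) x - g x\<bar>) - 0) < e" by blast
      qed
    qed
  qed
qed

theorem theorem2p6:
  fixes \<Omega> :: "(real^'n) set" and w :: "real^'n \<Rightarrow> real" and N p s ps :: real
  assumes "N = real CARD('n)" and "N \<ge> 2"
    and "bounded_smooth_domain \<Omega>"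
    and "1 < p" and "1 / (p - 1) \<le> s" and "N / p < s"
    and "w \<in> muckenhoupt_sub \<Omega> p s"
    and "ps = p * s / (s + 1)" and "1 \<le> ps" and "ps < p"
  shows "\<forall>X \<in> {sobolev_space \<Omega> p w, sobolev_space0 \<Omega> p w}.
    X \<hookrightarrow> sobolev_space \<Omega> ps (\<lambda>_. 1) \<and>
    (ps < N \<longrightarrow> (\<forall>q. ps \<le> q \<and> q \<le> critical_exponent N ps \<longrightarrow>
        sobolev_space \<Omega> ps (\<lambda>_. 1) \<hookrightarrow> Lp_space \<Omega> q)) \<and>
    (ps = N \<longrightarrow> (\<forall>q\<ge>1. sobolev_space \<Omega> ps (\<lambda>_. 1) \<hookrightarrow> Lp_space \<Omega> q)) \<and>
    (ps > N \<longrightarrow> sobolev_space \<Omega> ps (\<lambda>_. 1) \<hookrightarrow> C_closure_space \<Omega>) \<and>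
    (ps < N \<longrightarrow> (\<forall>q. ps \<le> q \<and> q < critical_exponent N ps \<longrightarrow>
        compactly_embedded X (Lp_space \<Omega> q))) \<and>
    (ps = N \<longrightarrow> (\<forall>q\<ge>1. compactly_embedded X (Lp_space \<Omega> q))) \<and>
    (ps > N \<longrightarrow> compactly_embedded X (C_closure_space \<Omega>))"
proof -
  have U: "uniform_cone \<Omega>" using assms(3) by (rule smooth_domain_uniform_cone)
  have \<Omega>: "open \<Omega>" "bounded \<Omega>" "\<Omega> \<noteq> {}" using assms(3) by (auto simp: bounded_smooth_domain_def)
  have n: "CARD('n) \<ge> 2" using assms(1,2) by simp
  have s: "0 < s" using assms(4,5) by (smt (verit) divide_pos_pos)
  let ?W = "sobolev_space \<Omega> ps (\<lambda>_. 1)"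
  have crit: "Lr_bounded \<Omega> ps (critical_exponent N ps)" if "ps < N"
    using Lr_bounded_critical[OF U n assms(9)] that assms(1) by (simp add: critical_exponent_def)
  have dim: "Lr_bounded \<Omega> ps q" if "ps = N" "1 \<le> q" for q
    using Lr_bounded_dimension[OF U n that(2)] that(1) assms(1) by simp
  have W1: "?W \<hookrightarrow> Lp_space \<Omega> q" if "ps < N" "ps \<le> q" "q \<le> critical_exponent N ps" for q
    using that assms(9) by (intro sobolev_embedded_Lp[OF \<Omega>(1,2) assms(9)] Lr_bounded_mono[OF \<Omega>(1,2) crit]) auto
  have W2: "?W \<hookrightarrow> Lp_space \<Omega> q" if "ps = N" "1 \<le> q" for q
    using that by (intro sobolev_embedded_Lp[OF \<Omega>(1,2) assms(9)] dim)
  have K1: "compactly_embedded ?W (Lp_space \<Omega> q)" if "ps < N" "ps \<le> q" "q < critical_exponent N ps" for q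
    using that assms(9) by (intro sobolev_compactly_embedded_Lp[OF U assms(9) _ that(3)] crit) auto
  \<comment> \<open>Every exponent from 1 on is admissible here, so \<open>q + 1\<close> can serve
    as the larger exponent for the interpolation.\<close>
  have K2: "compactly_embedded ?W (Lp_space \<Omega> q)" if "ps = N" "1 \<le> q" for q
    using that by (intro sobolev_compactly_embedded_Lp[OF U assms(9), of q "q + 1"] dim) auto
  have K3: "compactly_embedded ?W (C_closure_space \<Omega>)" if "ps > N"
    using that assms(1) by (intro sobolev_compactly_embedded_C U \<Omega>) auto
  have W3: "?W \<hookrightarrow> C_closure_space \<Omega>" if "ps > N"
    using K3[OF that] by (simp add: compactly_embedded_def)
  have emb: "sobolev_space \<Omega> p w \<hookrightarrow> ?W"
    unfolding assms(8) using assms(4) by (intro weighted_sobolev_embedded \<Omega> s assms(7)) auto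
  have X: "X \<hookrightarrow> ?W" "\<And>u. 0 \<le> snd X u" if "X \<in> {sobolev_space \<Omega> p w, sobolev_space0 \<Omega> p w}" for X
    using that emb continuously_embedded_trans[OF sobolev_space0_embedded emb sobolev_norm_nonneg]
    by (auto simp: sobolev_norm_nonneg sobolev_norm0_nonneg)
  have comp: "compactly_embedded X Z" if "X \<in> {sobolev_space \<Omega> p w, sobolev_space0 \<Omega> p w}" "compactly_embedded ?W Z" for X Z
    using compactly_embedded_compose[OF X(1)[OF that(1)] that(2) X(2)[OF that(1)] sobolev_norm_nonneg] .
  \<comment> \<open>Each conjunct is one of the facts above; the compact embeddings of
    \<open>X\<close> are first reduced by \<open>comp\<close> to those of the unweighted
    space.\<close>
  show ?thesis
    by (intro ballI conjI allI impI; (elim conjE)?)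
      ((rule X(1) W1 W2 W3; assumption) | (rule comp, assumption, rule K1 K2 K3; assumption))+
qed

end
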